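(* Let $F$ be a global field, let $p$ be an odd prime with $p\neq\operatorname{char}F$, and assume $\mu_p\subset F$. Let $a,b,c,d\in F^\times$ be such that \[K=F(\sqrt[p]{a},\sqrt[p]{b},\sqrt[p]{c},\sqrt[p]{d})\] is a $C_p^4$-extension of $F$ (i.e. Galois with group $C_p^4$). There exists a Galois extension $L/F$ containing $K$ such that \[\operatorname{Gal}(L/F)\cong H_{p^3}*H_{p^3}\] and the natural (restriction) map $\operatorname{Gal}(L/F)\to\operatorname{Gal}(K/F)$ is, under this isomorphism, the quotient map of the central extension \[1\longrightarrow C_p\longrightarrow \mathcal E_p\longrightarrow C_p^4\longrightarrow 1,\qquad \mathcal E_p=H_{p^3}*H_{p^3},\] if and only if \[(a,b)_p=(c,d)_p \quad\text{in }\operatorname{Br}(F)[p].\]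
   Context: Fix a primitive $p$-th root of unity $\zeta\in F$. For $u,v\in F^\times$, $(u,v)_p$ denotes the class in $\operatorname{Br}(F)[p]$ of the degree-$p$ symbol algebra generated by $i,j$ with $i^p=u$, $j^p=v$, $ji=\zeta ij$. Commutators are $[g,h]=g^{-1}h^{-1}gh$. $H_{p^3}$ is the Heisenberg group of order $p^3$ and exponent $p$. $\mathcal E_p=H_{p^3}*H_{p^3}$ is the central product of two copies of $H_{p^3}$ obtained by identifying the centers with opposite orientation; equivalently it is the group of order $p^5$ with generators $s_a,s_b,s_c,s_d,\tau$ and relations: $s_a^p=s_b^p=s_c^p=s_d^p=\tau^p=1$; $\tau$ is central; $[s_a,s_b]=\tau$; $[s_c,s_d]=\tau^{-1}$; $[s_a,s_c]=[s_a,s_d]=[s_b,s_c]=[s_b,s_d]=1$. In the central extension the kernel $C_p$ is $\langle\tau\rangle$, and the quotient $C_p^4=\mathcal E_p/\langle\tau\rangle$ is identified with $\operatorname{Gal}(K/F)$ by sending the image of $s_u$ ($u\in\{a,b,c,d\}$) to the standard Kummer generator $\sigma_u$, which satisfies $\sigma_u(\sqrt[p]{u})=\zeta\sqrt[p]{u}$ and fixes the other three chosen radicals. *)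

theory Defs
  imports "HOL-Algebra.Algebra" "HOL-Algebra.Algebraic_Closure_Type"
begin

section \<open>Fields and Galois extensions\<close>

text \<open>
  A base field is a type \<open>'a :: field\<close>; its extensions are subfields of the algebraic closure
  \<open>'a alg_closure\<close>, with the base field embedded as \<open>range to_ac\<close>. The subfield, dimension and
  transcendence notions are those of HOL-Algebra, for the following ring structures on types.
\<close>

abbreviation fld :: "'b::field ring" where
  "fld \<equiv> ring_of_type_algebra"

abbreviation base_field :: "'a::field alg_closure set" where
  "base_field \<equiv> range to_ac"

text \<open>
  A global field is a finite extension of \<open>\<rat>\<close>, or a finite extension of the rational function
  field \<open>P(t)\<close> over a finite prime field \<open>P\<close>. The prime field is the subfield generated by
  the empty set.
\<close>

definition number_field :: "'a::field itself \<Rightarrow> bool" where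
  "number_field _ \<longleftrightarrow> CHAR('a) = 0 \<and>
     ring.finite_dimension fld (generate_field fld {}) (UNIV :: 'a set)"

definition global_function_field :: "'a::field itself \<Rightarrow> bool" where
  "global_function_field _ \<longleftrightarrow> CHAR('a) > 0 \<and>
     (\<exists>t::'a. ring.transcendental fld (generate_field fld {}) t \<and>
        ring.finite_dimension fld (generate_field fld {t}) (UNIV :: 'a set))"

definition global_field :: "'a::field itself \<Rightarrow> bool" where
  "global_field F \<longleftrightarrow> number_field F \<or> global_function_field F"

definition primitive_root_of_unity :: "nat \<Rightarrow> 'a::field \<Rightarrow> bool" where
  "primitive_root_of_unity n z \<longleftrightarrow> n > 0 \<and> z ^ n = 1 \<and> (\<forall>k\<in>{1..<n}. z ^ k \<noteq> 1)"

text \<open>\<open>Gal(E/k)\<close>, with \<open>(\<sigma> \<otimes> \<tau>) x = \<sigma> (\<tau> x)\<close>; automorphisms are extensional functions on \<open>E\<close>.\<close>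

definition Gal :: "'b::field set \<Rightarrow> 'b set \<Rightarrow> ('b \<Rightarrow> 'b) monoid" where
  "Gal E k = BijGroup E
     \<lparr>carrier := {\<sigma> \<in> Bij E. \<sigma> \<in> ring_hom (fld\<lparr>carrier := E\<rparr>) (fld\<lparr>carrier := E\<rparr>) \<and>
                   (\<forall>x\<in>k. \<sigma> x = x)}\<rparr>"

definition galois_extension :: "'b::field set \<Rightarrow> 'b set \<Rightarrow> bool" where
  "galois_extension E k \<longleftrightarrow> subfield k fld \<and> subfield E fld \<and> k \<subseteq> E \<and>
     (\<forall>x\<in>E. \<not> ring.transcendental fld k x) \<and>
     {x \<in> E. \<forall>\<sigma>\<in>carrier (Gal E k). \<sigma> x = x} = k"

definition kummer_generator ::
    "'a::field \<Rightarrow> 'a alg_closure \<Rightarrow> 'a alg_closure set \<Rightarrow> ('a alg_closure \<Rightarrow> 'a alg_closure) \<Rightarrow> bool" where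
  "kummer_generator \<zeta> \<rho> S \<sigma> \<longleftrightarrow> \<sigma> \<rho> = to_ac \<zeta> * \<rho> \<and> (\<forall>x\<in>S. \<sigma> x = x)"


section \<open>Central simple algebras and Brauer classes\<close>

text \<open>
  The library locale \<open>algebra\<close> is restricted to commutative algebras, so associative unital
  algebras are introduced here, on the same record type.
\<close>

definition assoc_algebra :: "'a ring \<Rightarrow> ('a, 'b) module \<Rightarrow> bool" where
  "assoc_algebra F A \<longleftrightarrow> module F A \<and> ring A \<and>
     (\<forall>k\<in>carrier F. \<forall>x\<in>carrier A. \<forall>y\<in>carrier A.
        (k \<odot>\<^bsub>A\<^esub> x) \<otimes>\<^bsub>A\<^esub> y = k \<odot>\<^bsub>A\<^esub> (x \<otimes>\<^bsub>A\<^esub> y) \<and>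
        x \<otimes>\<^bsub>A\<^esub> (k \<odot>\<^bsub>A\<^esub> y) = k \<odot>\<^bsub>A\<^esub> (x \<otimes>\<^bsub>A\<^esub> y))"

definition finitely_spanned :: "'a ring \<Rightarrow> ('a, 'b) module \<Rightarrow> bool" where
  "finitely_spanned F A \<longleftrightarrow>
     (\<exists>S. finite S \<and> S \<subseteq> carrier A \<and>
        (\<forall>x\<in>carrier A. \<exists>f\<in>S \<rightarrow> carrier F. x = (\<Oplus>\<^bsub>A\<^esub>s\<in>S. f s \<odot>\<^bsub>A\<^esub> s)))"

definition central_simple_algebra :: "'a ring \<Rightarrow> ('a, 'b) module \<Rightarrow> bool" where
  "central_simple_algebra F A \<longleftrightarrow> assoc_algebra F A \<and> finitely_spanned F A \<and>
     {z \<in> carrier A. \<forall>x\<in>carrier A. z \<otimes>\<^bsub>A\<^esub> x = x \<otimes>\<^bsub>A\<^esub> z} = {k \<odot>\<^bsub>A\<^esub> \<one>\<^bsub>A\<^esub> | k. k \<in> carrier F} \<and>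
     \<one>\<^bsub>A\<^esub> \<noteq> \<zero>\<^bsub>A\<^esub> \<and> (\<forall>I. ideal I A \<longrightarrow> I = {\<zero>\<^bsub>A\<^esub>} \<or> I = carrier A)"

definition algebra_iso :: "'a ring \<Rightarrow> ('a, 'b) module \<Rightarrow> ('a, 'c) module \<Rightarrow> ('b \<Rightarrow> 'c) set" where
  "algebra_iso F A B =
     {h \<in> ring_iso A B. \<forall>k\<in>carrier F. \<forall>x\<in>carrier A. h (k \<odot>\<^bsub>A\<^esub> x) = k \<odot>\<^bsub>B\<^esub> h x}"

definition matrix_algebra :: "nat \<Rightarrow> ('a, 'b) module \<Rightarrow> ('a, nat \<times> nat \<Rightarrow> 'b) module" where
  "matrix_algebra n A =
     \<lparr>carrier = ({..<n} \<times> {..<n}) \<rightarrow>\<^sub>E carrier A,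
      monoid.mult = (\<lambda>M N. \<lambda>(i, j)\<in>{..<n} \<times> {..<n}. \<Oplus>\<^bsub>A\<^esub>k\<in>{..<n}. M (i, k) \<otimes>\<^bsub>A\<^esub> N (k, j)),
      monoid.one = (\<lambda>(i, j)\<in>{..<n} \<times> {..<n}. if i = j then \<one>\<^bsub>A\<^esub> else \<zero>\<^bsub>A\<^esub>),
      ring.zero = (\<lambda>_\<in>{..<n} \<times> {..<n}. \<zero>\<^bsub>A\<^esub>),
      ring.add = (\<lambda>M N. \<lambda>e\<in>{..<n} \<times> {..<n}. M e \<oplus>\<^bsub>A\<^esub> N e),
      module.smult = (\<lambda>k M. \<lambda>e\<in>{..<n} \<times> {..<n}. k \<odot>\<^bsub>A\<^esub> M e)\<rparr>"

text \<open>
  \<open>A\<close> and \<open>B\<close> have the same class in \<open>Br(F)\<close> iff \<open>M\<^sub>m(A) \<cong> M\<^sub>n(B)\<close> for some \<open>m, n \<ge> 1\<close>. The classes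
  are taken among the central simple algebras whose carrier lies in one type \<open>'b\<close>. For the type
  \<open>nat \<times> nat \<Rightarrow> 'a\<close> used by symbol algebras this loses nothing: every finite-dimensional
  \<open>'a\<close>-algebra has an isomorphic copy there.
\<close>

definition brauer_rel :: "'a ring \<Rightarrow> (('a, 'b) module \<times> ('a, 'b) module) set" where
  "brauer_rel F = {(A, B). central_simple_algebra F A \<and> central_simple_algebra F B \<and>
     (\<exists>m\<ge>1. \<exists>n\<ge>1. algebra_iso F (matrix_algebra m A) (matrix_algebra n B) \<noteq> {})}"

definition brauer_class :: "'a ring \<Rightarrow> ('a, 'b) module \<Rightarrow> ('a, 'b) module set" where
  "brauer_class F A = brauer_rel F `` {A}"

text \<open>
  The symbol algebra on its basis \<open>i\<^sup>k j\<^sup>l\<close>, \<open>0 \<le> k, l < p\<close>; an element is its family of coefficients,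
  indexed by \<open>(k, l)\<close>. From \<open>i\<^sup>p = u\<close>, \<open>j\<^sup>p = v\<close>, \<open>j i = \<zeta> i j\<close> the product of two basis elements is
  \<open>i\<^sup>k j\<^sup>l i\<^sup>m j\<^sup>n = \<zeta>\<^bsup>l m\<^esup> i\<^bsup>k+m\<^esup> j\<^bsup>l+n\<^esup>\<close>, with \<open>i\<^bsup>k+m\<^esup> = u i\<^bsup>k+m-p\<^esup>\<close> if \<open>k + m \<ge> p\<close>, and likewise for \<open>j\<close>.
\<close>

definition symbol_algebra ::
    "nat \<Rightarrow> 'a::field \<Rightarrow> 'a \<Rightarrow> 'a \<Rightarrow> ('a, nat \<times> nat \<Rightarrow> 'a) module" where
  "symbol_algebra p \<zeta> u v =
     \<lparr>carrier = ({..<p} \<times> {..<p}) \<rightarrow>\<^sub>E UNIV,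
      monoid.mult = (\<lambda>x y. \<lambda>(r, s)\<in>{..<p} \<times> {..<p}.
                \<Sum>(k, l)\<in>{..<p} \<times> {..<p}. \<Sum>(m, n)\<in>{..<p} \<times> {..<p}.
                  if (k + m) mod p = r \<and> (l + n) mod p = s
                  then x (k, l) * y (m, n) * \<zeta> ^ (l * m) * u ^ ((k + m) div p) * v ^ ((l + n) div p)
                  else 0),
      monoid.one = (\<lambda>e\<in>{..<p} \<times> {..<p}. if e = (0, 0) then 1 else 0),
      ring.zero = (\<lambda>_\<in>{..<p} \<times> {..<p}. 0),
      ring.add = (\<lambda>x y. \<lambda>e\<in>{..<p} \<times> {..<p}. x e + y e),
      module.smult = (\<lambda>c x. \<lambda>e\<in>{..<p} \<times> {..<p}. c * x e)\<rparr>"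

definition symbol_class ::
    "nat \<Rightarrow> 'a::field \<Rightarrow> 'a \<Rightarrow> 'a \<Rightarrow> ('a, nat \<times> nat \<Rightarrow> 'a) module set" where
  "symbol_class p \<zeta> u v = brauer_class fld (symbol_algebra p \<zeta> u v)"


section \<open>The Heisenberg group and its central product\<close>

text \<open>\<open>(x, y, z)\<close> is the unitriangular matrix over \<open>\<int>/p\<close> with superdiagonal \<open>x, y\<close> and corner \<open>z\<close>.\<close>

definition heis :: "nat \<Rightarrow> (int \<times> int \<times> int) monoid" where
  "heis p =
     \<lparr>carrier = {0..<int p} \<times> {0..<int p} \<times> {0..<int p},
      monoid.mult = (\<lambda>(x, y, z) (x', y', z').
                ((x + x') mod int p, (y + y') mod int p, (z + z' + x * y') mod int p)),
      monoid.one = (0, 0, 0)\<rparr>"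

text \<open>
  The centre of \<open>heis p\<close> is generated by \<open>(0, 0, 1)\<close>, which is \<open>[(1,0,0), (0,1,0)]\<close> for
  \<open>[g,h] = g\<inverse>h\<inverse>gh\<close>. Killing the diagonal \<open>(z, z)\<close> identifies each central \<open>z\<close> of the second
  factor with \<open>z\<inverse>\<close> of the first, so that \<open>[s_a, s_b] = \<tau>\<close> and \<open>[s_c, s_d] = \<tau>\<inverse>\<close> below.
\<close>

definition central_diag :: "nat \<Rightarrow> ((int \<times> int \<times> int) \<times> (int \<times> int \<times> int)) set" where
  "central_diag p = {((0, 0, z), (0, 0, z)) | z. z \<in> {0..<int p}}"

type_synonym Ep_elem = "((int \<times> int \<times> int) \<times> (int \<times> int \<times> int)) set"

definition Ep :: "nat \<Rightarrow> Ep_elem monoid" where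
  "Ep p = (heis p \<times>\<times> heis p) Mod central_diag p"

definition Ep_mk :: "nat \<Rightarrow> int \<times> int \<times> int \<Rightarrow> int \<times> int \<times> int \<Rightarrow> Ep_elem" where
  "Ep_mk p g h = central_diag p #>\<^bsub>heis p \<times>\<times> heis p\<^esub> (g, h)"

definition s_a :: "nat \<Rightarrow> Ep_elem" where "s_a p = Ep_mk p (1, 0, 0) (0, 0, 0)"
definition s_b :: "nat \<Rightarrow> Ep_elem" where "s_b p = Ep_mk p (0, 1, 0) (0, 0, 0)"
definition s_c :: "nat \<Rightarrow> Ep_elem" where "s_c p = Ep_mk p (0, 0, 0) (1, 0, 0)"
definition s_d :: "nat \<Rightarrow> Ep_elem" where "s_d p = Ep_mk p (0, 0, 0) (0, 1, 0)"
definition Ep_tau :: "nat \<Rightarrow> Ep_elem" where "Ep_tau p = Ep_mk p (0, 0, 1) (0, 0, 0)"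

definition Ep_kernel :: "nat \<Rightarrow> Ep_elem set" where
  "Ep_kernel p = generate (Ep p) {Ep_tau p}"

definition Ep_proj :: "nat \<Rightarrow> Ep_elem \<Rightarrow> Ep_elem set" where
  "Ep_proj p x = Ep_kernel p #>\<^bsub>Ep p\<^esub> x"

text \<open>The isomorphism \<open>\<E>\<^sub>p/\<langle>\<tau>\<rangle> \<cong> Gal(K/F)\<close> that sends the image of each \<open>s_u\<close> to \<open>\<sigma>_u\<close>.\<close>

definition kummer_identification ::
    "nat \<Rightarrow> 'a::field \<Rightarrow> 'a alg_closure \<Rightarrow> 'a alg_closure \<Rightarrow> 'a alg_closure \<Rightarrow> 'a alg_closure \<Rightarrow>
     'a alg_closure set \<Rightarrow> (Ep_elem set \<Rightarrow> 'a alg_closure \<Rightarrow> 'a alg_closure) \<Rightarrow> bool" where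
  "kummer_identification p \<zeta> \<alpha> \<beta> \<gamma> \<delta> K \<iota> \<longleftrightarrow>
     \<iota> \<in> iso (Ep p Mod Ep_kernel p) (Gal K base_field) \<and>
     kummer_generator \<zeta> \<alpha> {\<beta>, \<gamma>, \<delta>} (\<iota> (Ep_proj p (s_a p))) \<and>
     kummer_generator \<zeta> \<beta> {\<alpha>, \<gamma>, \<delta>} (\<iota> (Ep_proj p (s_b p))) \<and>
     kummer_generator \<zeta> \<gamma> {\<alpha>, \<beta>, \<delta>} (\<iota> (Ep_proj p (s_c p))) \<and>
     kummer_generator \<zeta> \<delta> {\<alpha>, \<beta>, \<gamma>} (\<iota> (Ep_proj p (s_d p)))"

end

theory Submission
  imports Defs "HOL-Library.Function_Algebras"
begin

text \<open>
  Let \<open>F\<close> be the base field, \<open>M\<close> the fixed field of \<open>\<sigma>_a\<close> and \<open>\<sigma>_c\<close> in \<open>K\<close>, so that \<open>M = F(\<beta>, \<delta>)\<close>, and let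
  \<open>s = \<sigma>_b\<inverse>\<close> and \<open>t = \<sigma>_d\<close> be the two generators of its Galois group. Both sides of the theorem are
  equivalent to the solvability of a system of equations over \<open>M\<close>: there are \<open>x\<close> and \<open>y\<close> in \<open>M\<close> such
  that \<open>x\<close> has norm \<open>a\<close> under \<open>s\<close>, \<open>y\<close> has norm \<open>c\<close> under \<open>t\<close>, and \<open>x s(y) = y t(x)\<close>.

  The equations and the symbol algebras. Given a solution, let \<open>i m = x s(m)\<close>, \<open>j m = \<beta> m\<close>,
  \<open>I m = y t(m)\<close>, \<open>J m = \<delta> m\<close> for \<open>m\<close> in \<open>M\<close>. The equations say exactly that \<open>i, j\<close> define a left action of
  \<open>(a, b)_p\<close> and \<open>I, J\<close> a right action of \<open>(c, d)_p\<close>, and that the two commute. As \<open>M\<close> has the same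
  dimension \<open>p\<^sup>2\<close> as the algebras, it is a free module of rank one over each of them, so the algebras are
  isomorphic (\<open>symbol_algebras_isomorphic\<close>); the free generator comes from Maschke's averaging argument
  (\<open>cyclic_vector\<close>). Conversely, equal Brauer classes give an isomorphism of matrix algebras over
  \<open>(a, b)_p\<close> and \<open>(c, d)_p\<close>. A corner of that matrix algebra is a bimodule of dimension \<open>p\<^sup>2\<close> over the two
  symbol algebras. The commuting operators \<open>j\<close> and \<open>J\<close> turn it into a vector space over \<open>M\<close>, of dimension
  one, and \<open>i\<close> and \<open>I\<close> act on a basis vector by elements \<open>x\<close> and \<open>y\<close> of \<open>M\<close>, which solve the equations
  (\<open>solution_exists\<close>, \<open>solution_of_matrix_iso\<close>).

  The equations and the extension. If \<open>L\<close> exists, the central element \<open>\<tau>\<close> has an eigenvector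
  \<open>v\<close> with \<open>\<tau> v = \<zeta> v\<close>. Since \<open>\<alpha>\<close> and \<open>\<gamma>\<close> shift the eigenvalues of the lifts of \<open>\<sigma>_a\<close> and \<open>\<sigma>_c\<close>, the vector
  can be chosen fixed by these two commuting lifts. With lifts of \<open>s\<close> and \<open>t\<close>, the elements
  \<open>x = \<alpha> s(v) / v\<close> and \<open>y = \<gamma> t(v) / v\<close> lie in \<open>M\<close>: the commutator relations of \<open>\<E>_p\<close> are what cancels the
  action on \<open>\<alpha>\<close> and \<open>\<gamma>\<close>. They solve the equations (\<open>solution_from_lift\<close>, \<open>solution_of_extension\<close>).
  Conversely, for a solution a Hilbert 90 argument yields a nonzero \<open>\<omega>\<close> in \<open>M\<close> with
  \<open>s(\<omega>) = (x / \<alpha>)\<^sup>p \<omega>\<close> and \<open>t(\<omega>) = (y / \<gamma>)\<^sup>p \<omega>\<close>. Then \<open>L = K(\<xi>)\<close> with \<open>\<xi>\<^sup>p = \<omega>\<close> is the required extension: the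
  automorphisms of \<open>K\<close> lift to \<open>L\<close>, and the factors \<open>1\<close>, \<open>x / \<alpha>\<close>, \<open>1\<close>, \<open>y / \<gamma>\<close>, \<open>\<zeta>\<close> by which the five lifted
  generators multiply \<open>\<xi>\<close> reproduce the relations of \<open>\<E>_p\<close> (\<open>extension_exists\<close>).
\<close>

section \<open>Roots of unity and eigenvectors\<close>

lemma prim_root_pow_eq_1_iff:
  assumes "primitive_root_of_unity p z"
  shows "z ^ k = 1 \<longleftrightarrow> p dvd k"
proof -
  have p: "p > 0" "z ^ p = 1" and m: "\<And>k. k \<in> {1..<p} \<Longrightarrow> z ^ k \<noteq> 1"
    using assms by (auto simp: primitive_root_of_unity_def)
  have "z ^ k = z ^ (k mod p) * (z ^ p) ^ (k div p)"
    by (simp flip: power_mult power_add)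
  then have eq: "z ^ k = z ^ (k mod p)" by (simp add: p)
  show ?thesis
  proof (cases "k mod p = 0")
    case True then show ?thesis using eq by (auto simp: dvd_eq_mod_eq_0)
  next
    case False
    then have "k mod p \<in> {1..<p}" using p by auto
    then show ?thesis using eq m False by (auto simp: dvd_eq_mod_eq_0)
  qed
qed

lemma prim_root_nonzero: "primitive_root_of_unity p z \<Longrightarrow> z \<noteq> 0"
  by (auto simp: primitive_root_of_unity_def zero_power)

lemma prim_root_power: "primitive_root_of_unity p z \<Longrightarrow> z ^ p = 1"
  by (auto simp: primitive_root_of_unity_def)

lemma prim_root_inverse:
  "primitive_root_of_unity p z \<Longrightarrow> primitive_root_of_unity p (inverse z)"
  by (auto simp: primitive_root_of_unity_def power_inverse)

lemma prim_root_to_ac: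
  "primitive_root_of_unity p z \<Longrightarrow> primitive_root_of_unity p (to_ac z)"
  by (auto simp: primitive_root_of_unity_def simp flip: to_ac_power)

lemma prim_root_power_inj:
  assumes z: "primitive_root_of_unity p z" and "z ^ k = z ^ l" "k < p" "l < p"
  shows "k = l"
proof -
  have *: "k = l" if "k \<le> l" "z ^ k = z ^ l" "l < p" for k l
  proof -
    have "z ^ k * z ^ (l - k) = z ^ (k + (l - k))" by (simp only: power_add)
    then have "z ^ k * z ^ (l - k) = z ^ k * 1" using that by simp
    then have "z ^ (l - k) = 1" using prim_root_nonzero[OF z] by auto
    then have "p dvd l - k" using prim_root_pow_eq_1_iff[OF z] by blast
    then show ?thesis using that by (auto dest: dvd_imp_le)
  qed
  show ?thesis using *[of k l] *[of l k] assms by (cases "k \<le> l") auto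
qed

lemma sum_prim_root_powers:
  assumes "primitive_root_of_unity p z"
  shows "(\<Sum>r<p. z ^ (k * r)) = (if p dvd k then of_nat p else 0)"
proof (cases "p dvd k")
  case True
  then have "z ^ k = 1" using prim_root_pow_eq_1_iff[OF assms] by blast
  then show ?thesis using True by (simp add: power_mult)
next
  case False
  then have ne: "z ^ k \<noteq> 1" using prim_root_pow_eq_1_iff[OF assms] by blast
  have "(\<Sum>r<p. (z ^ k) ^ r) = ((z ^ k) ^ p - 1) / (z ^ k - 1)"
    using geometric_sum[OF ne] by blast
  also have "(z ^ k) ^ p = (z ^ p) ^ k" by (simp flip: power_mult add: mult.commute)
  finally show ?thesis using False by (simp add: prim_root_power[OF assms] power_mult)
qed

lemma sum_lessThan_cyclic_shift:
  fixes h :: "nat \<Rightarrow> 'b::ab_group_add"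
  assumes "h p = h 0"
  shows "(\<Sum>m<p. h (Suc m)) = (\<Sum>m<p. h m)"
  using sum.lessThan_Suc[of h p] sum.lessThan_Suc_shift[of h p] assms by simp

lemma roots_of_unity_are_powers:
  fixes y z :: "'b::field"
  assumes z: "primitive_root_of_unity p z" and y: "y ^ p = 1"
  obtains k where "k < p" "y = z ^ k"
proof -
  define P where "P = monom (1::'b) p - 1"
  have p: "p > 0" using z by (auto simp: primitive_root_of_unity_def)
  have "coeff P p = 1" using p by (simp add: P_def)
  then have "P \<noteq> 0" by auto
  have deg: "Polynomial.degree P \<le> p"
    unfolding P_def using degree_diff_le[of "monom (1::'b) p" p 1] by (simp add: degree_monom_le)
  have roots: "{x. poly P x = 0} = {x. x ^ p = 1}" by (auto simp: P_def poly_monom)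
  have fin: "finite {x::'b. x ^ p = 1}" using poly_roots_finite[OF \<open>P \<noteq> 0\<close>] roots by simp
  have "card {x::'b. x ^ p = 1} \<le> p"
    using card_poly_roots_bound[OF \<open>P \<noteq> 0\<close>] deg roots by simp
  moreover have "inj_on (\<lambda>k. z ^ k) {..<p}"
    using prim_root_power_inj[OF z] by (auto intro!: inj_onI)
  then have "card ((\<lambda>k. z ^ k) ` {..<p}) = p" by (simp add: card_image)
  moreover have "(\<lambda>k. z ^ k) ` {..<p} \<subseteq> {x. x ^ p = 1}"
    by (auto simp: prim_root_power[OF z] power_commutes
        simp flip: power_mult) (metis mult.commute power_mult power_one prim_root_power[OF z])
  ultimately have "(\<lambda>k. z ^ k) ` {..<p} = {x. x ^ p = 1}"
    using card_seteq[OF fin] by auto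
  then show ?thesis using that y by blast
qed

text \<open>
  More vectors than coordinates are linearly dependent. Vectors are families indexed by the
  coordinates, and the proof is Gaussian elimination of one coordinate at a time. All dimension counts
  below go back to this lemma.
\<close>

lemma linear_dependence:
  fixes v :: "'x \<Rightarrow> 'y \<Rightarrow> 'a::field"
  assumes "finite Y" "finite V" "card Y < card V"
  shows "\<exists>c. (\<exists>x\<in>V. c x \<noteq> 0) \<and> (\<forall>y\<in>Y. (\<Sum>x\<in>V. c x * v x y) = 0)"
  using assms
proof (induction Y arbitrary: V v rule: finite_induct)
  case empty
  then have "V \<noteq> {}" by auto
  then show ?case by (intro exI[of _ "\<lambda>_. 1"]) auto
next
  case (insert y0 Y)
  show ?case
  proof (cases "\<forall>x\<in>V. v x y0 = 0")
    case True
    have "card Y < card V" using insert.prems insert.hyps by simp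
    then obtain c where "\<exists>x\<in>V. c x \<noteq> 0" "\<forall>y\<in>Y. (\<Sum>x\<in>V. c x * v x y) = 0"
      using insert.IH[of V v] insert.prems(1) by blast
    then show ?thesis using True by (intro exI[of _ c]) simp
  next
    case False
    then obtain x0 where x0: "x0 \<in> V" "v x0 y0 \<noteq> 0" by blast
    define V' where "V' = V - {x0}"
    have V': "finite V'" "x0 \<notin> V'" "V = insert x0 V'" using x0 insert.prems by (auto simp: V'_def)
    have "card Y < card V'" using insert V' by auto
    from insert.IH[OF V'(1) this, of "\<lambda>x y. v x y - v x y0 / v x0 y0 * v x0 y"]
    obtain c where c: "\<exists>x\<in>V'. c x \<noteq> 0"
      "\<And>y. y \<in> Y \<Longrightarrow> (\<Sum>x\<in>V'. c x * (v x y - v x y0 / v x0 y0 * v x0 y)) = 0" by blast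
    define e where "e = c(x0 := - (\<Sum>x\<in>V'. c x * v x y0 / v x0 y0))"
    have e: "(\<Sum>x\<in>V. e x * v x y) = e x0 * v x0 y + (\<Sum>x\<in>V'. c x * v x y)" for y
    proof -
      have "(\<Sum>x\<in>V'. e x * v x y) = (\<Sum>x\<in>V'. c x * v x y)"
        using V'(2) by (intro sum.cong) (auto simp: e_def)
      then show ?thesis using V' by simp
    qed
    have "(\<Sum>x\<in>V. e x * v x y) = 0" if "y \<in> insert y0 Y" for y
    proof -
      have "(\<Sum>x\<in>V'. c x * (v x y - v x y0 / v x0 y0 * v x0 y)) = 0"
        using that c(2) x0 by (cases "y = y0") auto
      then show ?thesis unfolding e
        by (simp add: e_def right_diff_distrib sum_subtractf sum_distrib_right mult.assoc)
    qed
    moreover have "\<exists>x\<in>V. e x \<noteq> 0" using c(1) V' by (force simp: e_def)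
    ultimately show ?thesis by blast
  qed
qed

text \<open>
  Subspaces and linear operators over the base field. Scalars act through \<open>to_ac\<close>, so that subfields
  of the closure and eigenspaces of Galois automorphisms are treated alike.
\<close>

definition fspace :: "'a::field alg_closure set \<Rightarrow> bool" where
  "fspace V \<longleftrightarrow> 0 \<in> V \<and> (\<forall>x\<in>V. \<forall>y\<in>V. x + y \<in> V) \<and> (\<forall>c. \<forall>x\<in>V. to_ac c * x \<in> V)"

definition flinear :: "'a::field alg_closure set \<Rightarrow> ('a alg_closure \<Rightarrow> 'a alg_closure) \<Rightarrow> bool" where
  "flinear V G \<longleftrightarrow> (\<forall>x\<in>V. G x \<in> V) \<and> (\<forall>x\<in>V. \<forall>y\<in>V. G (x + y) = G x + G y) \<and>
     (\<forall>c. \<forall>x\<in>V. G (to_ac c * x) = to_ac c * G x)"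

lemma fspaceI:
  assumes "0 \<in> V" "\<And>x y. x \<in> V \<Longrightarrow> y \<in> V \<Longrightarrow> x + y \<in> V" "\<And>c x. x \<in> V \<Longrightarrow> to_ac c * x \<in> V"
  shows "fspace V"
  using assms by (auto simp: fspace_def)

lemma fspaceD:
  assumes "fspace V"
  shows "0 \<in> V" "x \<in> V \<Longrightarrow> y \<in> V \<Longrightarrow> x + y \<in> V" "x \<in> V \<Longrightarrow> to_ac c * x \<in> V"
    "(\<And>i. i \<in> I \<Longrightarrow> f i \<in> V) \<Longrightarrow> sum f I \<in> V"
proof -
  show 1: "0 \<in> V" and 2: "x \<in> V \<Longrightarrow> y \<in> V \<Longrightarrow> x + y \<in> V" and 3: "x \<in> V \<Longrightarrow> to_ac c * x \<in> V" for x y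
    using assms by (auto simp: fspace_def)
  show "(\<And>i. i \<in> I \<Longrightarrow> f i \<in> V) \<Longrightarrow> sum f I \<in> V"
    by (induction I rule: infinite_finite_induct) (auto intro: 1 2)
qed

lemma flinearI:
  assumes "\<And>x. x \<in> V \<Longrightarrow> G x \<in> V" "\<And>x y. x \<in> V \<Longrightarrow> y \<in> V \<Longrightarrow> G (x + y) = G x + G y"
    "\<And>c x. x \<in> V \<Longrightarrow> G (to_ac c * x) = to_ac c * G x"
  shows "flinear V G"
  using assms by (auto simp: flinear_def)

lemma flinearD:
  assumes "fspace V" "flinear V G"
  shows "x \<in> V \<Longrightarrow> G x \<in> V" "x \<in> V \<Longrightarrow> y \<in> V \<Longrightarrow> G (x + y) = G x + G y"
    "x \<in> V \<Longrightarrow> G (to_ac c * x) = to_ac c * G x" "G 0 = 0"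
    "(\<And>i. i \<in> I \<Longrightarrow> f i \<in> V) \<Longrightarrow> G (sum f I) = (\<Sum>i\<in>I. G (f i))"
proof -
  show "x \<in> V \<Longrightarrow> G x \<in> V" and 2: "x \<in> V \<Longrightarrow> y \<in> V \<Longrightarrow> G (x + y) = G x + G y"
   and 3: "x \<in> V \<Longrightarrow> G (to_ac c * x) = to_ac c * G x" for x y c
    using assms by (auto simp: flinear_def)
  show 0: "G 0 = 0" using 3[of 0 0] fspaceD(1)[OF assms(1)] by simp
  show "(\<And>i. i \<in> I \<Longrightarrow> f i \<in> V) \<Longrightarrow> G (sum f I) = (\<Sum>i\<in>I. G (f i))"
    by (induction I rule: infinite_finite_induct)
       (auto simp: 0 2 fspaceD[OF assms(1)])
qed

lemma flinear_funpow:
  assumes "fspace V" "flinear V G"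
  shows "flinear V (G ^^ m)"
proof (induction m)
  case 0
  show ?case by (rule flinearI) auto
next
  case (Suc m)
  show ?case
    by (rule flinearI) (simp_all add: flinearD[OF assms(1) Suc] flinearD[OF assms])
qed

text \<open>
  The component for \<open>z\<^sup>k\<close> is the Fourier coefficient, the average of the vectors \<open>z\<close> to the power \<open>- k m\<close>
  times \<open>G\<^sup>m y\<close> over all \<open>m < p\<close>; summing over \<open>k\<close> leaves only the term with \<open>m = 0\<close>.
\<close>

lemma eigen_decomp:
  fixes z :: "'a::field"
  assumes V: "fspace V" and G: "flinear V G" and Gp: "\<And>y. y \<in> V \<Longrightarrow> (G ^^ p) y = y"
    and z: "primitive_root_of_unity p z" and p: "of_nat p \<noteq> (0::'a)" and y: "y \<in> V"
  obtains Y where "\<And>k. Y k \<in> V" "\<And>k. G (Y k) = to_ac z ^ k * Y k" "y = (\<Sum>k<p. Y k)"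
proof -
  define w where "w = inverse z"
  have w: "primitive_root_of_unity p w" using prim_root_inverse[OF z] by (simp add: w_def)
  have zw: "z * w = 1" using prim_root_nonzero[OF z] by (simp add: w_def)
  define T where "T k m = to_ac (w ^ (k * m)) * (G ^^ m) y" for k m
  define Y where "Y k = to_ac (1 / of_nat p) * (\<Sum>m<p. T k m)" for k
  have GV: "(G ^^ m) y \<in> V" for m using flinearD(1)[OF V flinear_funpow[OF V G]] y by blast
  have T: "T k m \<in> V" for k m unfolding T_def by (rule fspaceD(3)[OF V GV])
  have S: "(\<Sum>m<p. T k m) \<in> V" for k by (rule fspaceD(4)[OF V T])
  have YV: "Y k \<in> V" for k unfolding Y_def by (rule fspaceD(3)[OF V S])
  have GT: "G (T k m) = to_ac (z ^ k) * T k (Suc m)" for k m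
  proof -
    have "z ^ k * w ^ (k * Suc m) = (z * w) ^ k * w ^ (k * m)"
      by (simp add: power_mult_distrib power_add mult_ac)
    then have "to_ac (z ^ k) * to_ac (w ^ (k * Suc m)) = to_ac (w ^ (k * m))"
      unfolding to_ac_mult[symmetric] zw by simp
    then have "to_ac (z ^ k) * T k (Suc m) = to_ac (w ^ (k * m)) * (G ^^ Suc m) y"
      unfolding T_def by (metis mult.assoc)
    moreover have "G (T k m) = to_ac (w ^ (k * m)) * G ((G ^^ m) y)"
      unfolding T_def by (rule flinearD(3)[OF V G GV])
    ultimately show ?thesis by simp
  qed
  have "G (Y k) = to_ac (1 / of_nat p) * (\<Sum>m<p. to_ac (z ^ k) * T k (Suc m))" for k
    unfolding Y_def flinearD(3)[OF V G S] flinearD(5)[OF V G T] GT ..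
  moreover have "(\<Sum>m<p. T k (Suc m)) = (\<Sum>m<p. T k m)" for k
  proof (rule sum_lessThan_cyclic_shift)
    have "w ^ (k * p) = 1" by (metis prim_root_power[OF w] mult.commute power_mult power_one)
    then show "T k p = T k 0" by (simp add: T_def Gp[OF y])
  qed
  ultimately have "G (Y k) = to_ac z ^ k * Y k" for k
    by (simp add: Y_def mult_ac flip: sum_distrib_left)
  moreover have "(\<Sum>k<p. Y k) = to_ac (1 / of_nat p) * (\<Sum>m<p. \<Sum>k<p. T k m)"
    unfolding Y_def by (subst sum.swap) (simp add: sum_distrib_left)
  moreover have "(\<Sum>k<p. T k m) = (if m = 0 then of_nat p * y else 0)" if "m < p" for m
  proof -
    have "(\<Sum>k<p. T k m) = to_ac (\<Sum>k<p. w ^ (m * k)) * (G ^^ m) y"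
      by (simp add: T_def to_ac_sum sum_distrib_right mult.commute[of m])
    moreover have "p dvd m \<longleftrightarrow> m = 0" using that by (auto dest: dvd_imp_le)
    ultimately show ?thesis by (simp add: sum_prim_root_powers[OF w])
  qed
  then have "(\<Sum>m<p. \<Sum>k<p. T k m) = (\<Sum>m<p. if m = 0 then of_nat p * y else 0)"
    by simp
  moreover have "p > 0" using z by (simp add: primitive_root_of_unity_def)
  moreover have "of_nat p \<noteq> (0 :: 'a alg_closure)"
    using p by (metis to_ac_eq_0_iff to_ac_of_nat)
  ultimately have "y = (\<Sum>k<p. Y k)" by (simp add: sum.delta)
  then show ?thesis using that YV \<open>\<And>k. G (Y k) = to_ac z ^ k * Y k\<close> by blast
qed

text \<open>
  Fourier inversion: the matrix of powers of \<open>z\<close> is invertible because \<open>p\<close> is nonzero in the field.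
\<close>

lemma dft_eq_0:
  fixes z :: "'a::field"
  assumes z: "primitive_root_of_unity p z" and p: "of_nat p \<noteq> (0::'a)"
    and 0: "\<And>m. m < p \<Longrightarrow> (\<Sum>k<p. to_ac (z ^ (k * m)) * Y k) = 0" and l: "l < p"
  shows "Y l = 0"
proof -
  define w where "w = inverse z"
  have w: "primitive_root_of_unity p w" using prim_root_inverse[OF z] by (simp add: w_def)
  have zw: "z * w = 1" using prim_root_nonzero[OF z] by (simp add: w_def)
  have "0 = (\<Sum>m<p. to_ac (w ^ (l * m)) * (\<Sum>k<p. to_ac (z ^ (k * m)) * Y k))"
    by (simp add: 0 del: to_ac_power)
  also have "\<dots> = (\<Sum>k<p. (\<Sum>m<p. to_ac (w ^ (l * m) * z ^ (k * m))) * Y k)"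
    unfolding sum_distrib_left sum_distrib_right by (subst sum.swap) (simp add: mult_ac)
  also have "\<dots> = (\<Sum>k<p. if k = l then of_nat p * Y k else 0)"
  proof (rule sum.cong[OF refl])
    fix k assume "k \<in> {..<p}"
    then have k: "k < p" by simp
    have "w ^ (l * m) * z ^ (k * m) = z ^ ((k + (p - l)) * m)" for m
    proof -
      have "w ^ l = z ^ (p - l)"
      proof -
        have "w ^ l = w ^ l * z ^ p" by (simp add: prim_root_power[OF z])
        also have "\<dots> = (z * w) ^ l * z ^ (p - l)"
          using l by (simp add: power_mult_distrib mult_ac flip: power_add)
        finally show ?thesis by (simp add: zw)
      qed
      then show ?thesis by (simp only: power_mult power_add power_mult_distrib mult.commute[of "(z ^ k) ^ m"])
    qed
    moreover have "p dvd k + (p - l) \<longleftrightarrow> k = l"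
    proof
      assume "p dvd k + (p - l)"
      then obtain q where q: "k + (p - l) = p * q" by (auto simp: dvd_def)
      have "q \<noteq> 0" using q k l by (auto intro!: gr0I)
      moreover have "p * q < p * 2" using q k l by linarith
      then have "q < 2" by simp
      ultimately show "k = l" using q l by (simp add: numeral_2_eq_2 less_Suc_eq)
    qed (use l in auto)
    ultimately show "(\<Sum>m<p. to_ac (w ^ (l * m) * z ^ (k * m))) * Y k = (if k = l then of_nat p * Y k else 0)"
      unfolding to_ac_sum[symmetric] using sum_prim_root_powers[OF z, of "k + (p - l)"] by simp
  qed
  also have "\<dots> = of_nat p * Y l" using l by (simp add: sum.delta)
  finally show ?thesis using p by (metis mult_eq_0_iff to_ac_eq_0_iff to_ac_of_nat)
qed

lemma eigen_indep:
  fixes z :: "'a::field"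
  assumes V: "fspace V" and G: "flinear V G"
    and z: "primitive_root_of_unity p z" and p: "of_nat p \<noteq> (0::'a)"
    and Y: "\<And>k. k < p \<Longrightarrow> Y k \<in> V" "\<And>k. k < p \<Longrightarrow> G (Y k) = to_ac z ^ k * Y k"
    and sum: "(\<Sum>k<p. Y k) = 0" and l: "l < p"
  shows "Y l = 0"
proof (rule dft_eq_0[OF z p _ l])
  have GY: "(G ^^ m) (Y k) = to_ac (z ^ (k * m)) * Y k" if "k < p" for k m
  proof (induction m)
    case (Suc m)
    have "G (to_ac (z ^ (k * m)) * Y k) = to_ac (z ^ (k * m)) * G (Y k)"
      using flinearD(3)[OF V G Y(1)[OF that]] by blast
    then show ?case by (simp add: Suc Y(2)[OF that] power_add mult_ac)
  qed auto
  fix m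
  have "(G ^^ m) (\<Sum>k<p. Y k) = (\<Sum>k<p. (G ^^ m) (Y k))"
    using Y(1) flinearD(5)[OF V flinear_funpow[OF V G], of "{..<p}" Y] by auto
  then show "(\<Sum>k<p. to_ac (z ^ (k * m)) * Y k) = 0"
    using flinearD(4)[OF V flinear_funpow[OF V G]] GY by (simp add: sum)
qed

text \<open>
  The rows \<open>v i\<close> form a square matrix. A dependence between them and the extra row \<open>m\<close>, which exists by
  counting, must involve \<open>m\<close>.
\<close>

lemma independent_imp_spanning:
  fixes v :: "'x \<Rightarrow> 'x \<Rightarrow> 'a::field"
  assumes "finite S" and indep: "\<And>f. (\<And>k. k \<in> S \<Longrightarrow> (\<Sum>i\<in>S. f i * v i k) = 0) \<Longrightarrow> \<forall>i\<in>S. f i = 0"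
  obtains f where "\<And>k. k \<in> S \<Longrightarrow> (\<Sum>i\<in>S. f i * v i k) = m k"
proof -
  define v' where "v' = case_option m v"
  obtain c where c: "\<exists>i\<in>insert None (Some ` S). c i \<noteq> 0"
    "\<And>k. k \<in> S \<Longrightarrow> (\<Sum>i\<in>insert None (Some ` S). c i * v' i k) = 0"
    using linear_dependence[OF assms(1), of "insert None (Some ` S)" v'] assms(1)
    by (auto simp: card_image card_insert_if)
  have sum: "c None * m k + (\<Sum>i\<in>S. c (Some i) * v i k) = 0" if "k \<in> S" for k
    using c(2)[OF that] assms(1) by (simp add: sum.reindex v'_def)
  have "c None \<noteq> 0"
  proof
    assume 0: "c None = 0"
    then have "\<forall>i\<in>S. c (Some i) = 0" using sum by (intro indep[of "\<lambda>i. c (Some i)"]) simp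
    then show False using 0 c(1) by auto
  qed
  show ?thesis
  proof (rule that[of "\<lambda>i. - c (Some i) / c None"])
    fix k assume "k \<in> S"
    then have "(\<Sum>i\<in>S. c (Some i) * v i k) = - (c None * m k)"
      using sum by (simp add: eq_neg_iff_add_eq_0 add.commute)
    moreover have "(\<Sum>i\<in>S. - c (Some i) / c None * v i k) = - (\<Sum>i\<in>S. c (Some i) * v i k) / c None"
      by (simp add: sum_divide_distrib sum_negf)
    ultimately show "(\<Sum>i\<in>S. - c (Some i) / c None * v i k) = m k"
      using \<open>c None \<noteq> 0\<close> by simp
  qed
qed

text \<open>
  If row \<open>i0\<close> occurred in a relation it could be eliminated, and then fewer than \<open>card S\<close> rows would
  still span all unit vectors.
\<close>

lemma spanning_imp_independent:
  fixes v :: "'x \<Rightarrow> 'x \<Rightarrow> 'a::field"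
  assumes S: "finite S" and f: "\<And>k. k \<in> S \<Longrightarrow> (\<Sum>i\<in>S. f i * v i k) = 0" and i0: "i0 \<in> S"
    and span: "\<And>j. j \<in> S \<Longrightarrow> \<exists>c. \<forall>k\<in>S. (\<Sum>i\<in>S. c i * v i k) = (if k = j then 1 else 0)"
  shows "f i0 = 0"
proof (rule ccontr)
  assume nz: "f i0 \<noteq> 0"
  obtain C where C: "\<And>j k. j \<in> S \<Longrightarrow> k \<in> S \<Longrightarrow> (\<Sum>i\<in>S. C j i * v i k) = (if k = j then 1 else 0)"
    using span by metis
  define D where "D j i = C j i - C j i0 / f i0 * f i" for j i
  have D: "(\<Sum>i\<in>S. D j i * v i k) = (if k = j then 1 else 0)" if "j \<in> S" "k \<in> S" for j k
  proof -
    have "(\<Sum>i\<in>S. D j i * v i k) = (\<Sum>i\<in>S. C j i * v i k) - C j i0 / f i0 * (\<Sum>i\<in>S. f i * v i k)"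
      by (simp add: D_def left_diff_distrib sum_subtractf sum_distrib_left mult.assoc)
    then show ?thesis using C[OF that] f[OF that(2)] by simp
  qed
  have D0: "D j i0 = 0" for j using nz by (simp add: D_def)
  have "card (S - {i0}) < card S" using S i0 by (meson card_Diff1_less)
  then obtain c where c: "\<exists>j\<in>S. c j \<noteq> 0" "\<And>i. i \<in> S - {i0} \<Longrightarrow> (\<Sum>j\<in>S. c j * D j i) = 0"
    using linear_dependence[of "S - {i0}" S D] S by auto
  have ci: "(\<Sum>j\<in>S. c j * D j i) = 0" if "i \<in> S" for i
    using c(2)[of i] D0 that by (cases "i = i0") auto
  have "c k = 0" if "k \<in> S" for k
  proof -
    have "c k = (\<Sum>j\<in>S. if j = k then c j else 0)" using that S by (simp add: sum.delta)
    also have "\<dots> = (\<Sum>j\<in>S. c j * (\<Sum>i\<in>S. D j i * v i k))"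
      using D that by (intro sum.cong) auto
    also have "\<dots> = (\<Sum>i\<in>S. (\<Sum>j\<in>S. c j * D j i) * v i k)"
      unfolding sum_distrib_left sum_distrib_right mult.assoc by (rule sum.swap)
    finally show ?thesis using ci by simp
  qed
  then show False using c(1) by auto
qed

text \<open>
  A version of Hilbert's Theorem 90. Multiplication by \<open>e\<close> permutes the eigenspaces of \<open>G\<close> cyclically,
  so a nonzero eigenvector can be moved into the eigenspace of the eigenvalue \<open>1\<close>.
\<close>

lemma fixed_vector:
  fixes z :: "'a::field"
  assumes V: "fspace V" and G: "flinear V G" and Gp: "\<And>y. y \<in> V \<Longrightarrow> (G ^^ p) y = y"
    and z: "primitive_root_of_unity p z" and p: "of_nat p \<noteq> (0::'a)"
    and e: "e \<noteq> 0" "\<And>y. y \<in> V \<Longrightarrow> e * y \<in> V" "\<And>y. y \<in> V \<Longrightarrow> to_ac z * G (e * y) = e * G y"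
    and y: "y \<in> V" "y \<noteq> 0"
  obtains y' where "y' \<in> V" "y' \<noteq> 0" "G y' = y'"
proof -
  obtain Y where Y: "\<And>k. Y k \<in> V" "\<And>k. G (Y k) = to_ac z ^ k * Y k" "y = (\<Sum>k<p. Y k)"
    using eigen_decomp[OF V G Gp z p y(1)] by blast
  obtain k where k: "Y k \<noteq> 0" using Y(3) y(2) by (metis sum.neutral)
  have eV: "e ^ m * x \<in> V" if "x \<in> V" for m x
    by (induction m) (auto simp: that mult.assoc e(2))
  have "to_ac z ^ m * G (e ^ m * x) = e ^ m * G x" if "x \<in> V" for m x
  proof (induction m)
    case (Suc m)
    have "to_ac z ^ Suc m * G (e ^ Suc m * x) = to_ac z ^ m * (to_ac z * G (e * (e ^ m * x)))"
      by (simp add: mult_ac)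
    also have "\<dots> = to_ac z ^ m * (e * G (e ^ m * x))" by (simp only: e(3)[OF eV[OF that]])
    also have "\<dots> = e * (to_ac z ^ m * G (e ^ m * x))" by (simp only: mult.left_commute)
    also have "\<dots> = e ^ Suc m * G x" by (simp only: Suc power_Suc mult.assoc)
    finally show ?case .
  qed auto
  from this[OF Y(1), of k k] have "to_ac z ^ k * G (e ^ k * Y k) = to_ac z ^ k * (e ^ k * Y k)"
    by (simp add: Y(2) mult_ac)
  then have "G (e ^ k * Y k) = e ^ k * Y k" using prim_root_nonzero[OF z] by simp
  then show ?thesis using that[OF eV[OF Y(1)], of k k] k e(1) by simp
qed

section \<open>Symbol algebras are central simple\<close>

lemma fld_simps [simp]:
  "carrier (fld :: 'b::field ring) = UNIV" "x \<otimes>\<^bsub>fld\<^esub> y = x * y" "x \<oplus>\<^bsub>fld\<^esub> y = x + y"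
  "\<one>\<^bsub>fld\<^esub> = 1" "\<zero>\<^bsub>fld\<^esub> = 0"
  by (simp_all add: ring_of_type_algebra_def)

text \<open>
  The product of the symbol algebra before restriction to the index range. On arbitrary coefficient
  functions it is bilinear for the pointwise operations.
\<close>

definition symbol_mult ::
    "nat \<Rightarrow> 'a::field \<Rightarrow> 'a \<Rightarrow> 'a \<Rightarrow> (nat \<times> nat \<Rightarrow> 'a) \<Rightarrow> (nat \<times> nat \<Rightarrow> 'a) \<Rightarrow> nat \<times> nat \<Rightarrow> 'a" where
  "symbol_mult p \<zeta> u v f g = (\<lambda>(r, s).
     \<Sum>(k, l)\<in>{..<p} \<times> {..<p}. \<Sum>(m, n)\<in>{..<p} \<times> {..<p}.
       if (k + m) mod p = r \<and> (l + n) mod p = s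
       then f (k, l) * g (m, n) * \<zeta> ^ (l * m) * u ^ ((k + m) div p) * v ^ ((l + n) div p) else 0)"

lemma (in vector_space) periodic_reduce:
  assumes "p > 0" and "\<And>k l. \<Phi> (k + p) l = u *s \<Phi> k l" and "\<And>k l. \<Phi> k (l + p) = v *s \<Phi> k l"
  shows "\<Phi> k l = (u ^ (k div p) * v ^ (l div p)) *s \<Phi> (k mod p) (l mod p)"
proof -
  have 1: "\<Phi> (p * q + k) l = u ^ q *s \<Phi> k l" for q k l
  proof (induction q)
    case (Suc q)
    have eq: "p * Suc q + k = (p * q + k) + p" by simp
    show ?case unfolding eq assms(2) Suc by simp
  qed simp
  have 2: "\<Phi> k (p * q + l) = v ^ q *s \<Phi> k l" for q k l
  proof (induction q)
    case (Suc q)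
    have eq: "p * Suc q + l = (p * q + l) + p" by simp
    show ?case unfolding eq assms(3) Suc by simp
  qed simp
  show ?thesis using 1[of "k div p" "k mod p" l] 2[of "k mod p" "l div p" "l mod p"] by simp
qed

text \<open>
  The family \<open>\<Phi> k l\<close> plays the role of \<open>i\<^sup>k j\<^sup>l\<close> applied to a vector; the two periodicity assumptions
  state \<open>i\<^sup>p = u\<close> and \<open>j\<^sup>p = v\<close>. They absorb the reduction of exponents modulo \<open>p\<close> in the definition of the
  product, and what remains is the naive expansion. Associativity and the verification of every
  module structure over a symbol algebra rest on this identity.
\<close>

lemma (in vector_space) symbol_product_sum:
  assumes p: "p > 0" and u: "\<And>k l. \<Phi> (k + p) l = u *s \<Phi> k l" and v: "\<And>k l. \<Phi> k (l + p) = v *s \<Phi> k l"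
  shows "(\<Sum>(r, s)\<in>{..<p} \<times> {..<p}. symbol_mult p \<zeta> u v f g (r, s) *s \<Phi> r s)
    = (\<Sum>(k, l)\<in>{..<p} \<times> {..<p}. \<Sum>(m, n)\<in>{..<p} \<times> {..<p}.
        (f (k, l) * g (m, n) * \<zeta> ^ (l * m)) *s \<Phi> (k + m) (l + n))"
proof -
  let ?P = "{..<p} \<times> {..<p}"
  define c where "c k l m n = f (k, l) * g (m, n) * \<zeta> ^ (l * m) * u ^ ((k + m) div p) * v ^ ((l + n) div p)"
    for k l m n
  have "(\<Sum>(r, s)\<in>?P. symbol_mult p \<zeta> u v f g (r, s) *s \<Phi> r s)
    = (\<Sum>e\<in>?P. \<Sum>(k, l)\<in>?P. \<Sum>(m, n)\<in>?P. (if ((k + m) mod p, (l + n) mod p) = e then c k l m n else 0) *s \<Phi> (fst e) (snd e))"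
    unfolding symbol_mult_def c_def by (auto simp: scale_sum_left intro!: sum.cong)
  also have "\<dots> = (\<Sum>(k, l)\<in>?P. \<Sum>e\<in>?P. \<Sum>(m, n)\<in>?P. (if ((k + m) mod p, (l + n) mod p) = e then c k l m n else 0) *s \<Phi> (fst e) (snd e))"
    unfolding case_prod_unfold by (rule sum.swap)
  also have "\<dots> = (\<Sum>(k, l)\<in>?P. \<Sum>(m, n)\<in>?P. \<Sum>e\<in>?P. (if ((k + m) mod p, (l + n) mod p) = e then c k l m n else 0) *s \<Phi> (fst e) (snd e))"
    unfolding case_prod_unfold by (rule sum.cong[OF refl]) (rule sum.swap)
  also have "\<dots> = (\<Sum>(k, l)\<in>?P. \<Sum>(m, n)\<in>?P. (f (k, l) * g (m, n) * \<zeta> ^ (l * m)) *s \<Phi> (k + m) (l + n))"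
  proof (intro sum.cong[OF refl], clarify, intro sum.cong[OF refl], clarify)
    fix k l m n
    have "(\<Sum>e\<in>?P. (if ((k + m) mod p, (l + n) mod p) = e then c k l m n else 0) *s \<Phi> (fst e) (snd e))
       = (\<Sum>e\<in>?P. if ((k + m) mod p, (l + n) mod p) = e then c k l m n *s \<Phi> (fst e) (snd e) else 0)"
      by (intro sum.cong) auto
    also have "\<dots> = c k l m n *s \<Phi> ((k + m) mod p) ((l + n) mod p)" using p by (simp add: sum.delta)
    also have "\<dots> = (f (k, l) * g (m, n) * \<zeta> ^ (l * m)) *s
        ((u ^ ((k + m) div p) * v ^ ((l + n) div p)) *s \<Phi> ((k + m) mod p) ((l + n) mod p))"
      by (simp add: c_def mult.assoc)
    also have "\<dots> = (f (k, l) * g (m, n) * \<zeta> ^ (l * m)) *s \<Phi> (k + m) (l + n)"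
      using periodic_reduce[where \<Phi> = \<Phi>, OF p u v, of "k + m" "l + n"] by simp
    finally show "(\<Sum>e\<in>?P. (if ((k + m) mod p, (l + n) mod p) = e then c k l m n else 0) *s \<Phi> (fst e) (snd e))
       = (f (k, l) * g (m, n) * \<zeta> ^ (l * m)) *s \<Phi> (k + m) (l + n)" .
  qed
  finally show ?thesis .
qed

lemma vector_space_self: "vector_space ((*) :: 'a::field \<Rightarrow> 'a \<Rightarrow> 'a)"
  by unfold_locales (auto simp: algebra_simps)

lemma vector_space_to_ac: "vector_space (\<lambda>(c::'a::field) y. to_ac c * y)"
  by unfold_locales (auto simp: algebra_simps)

lemma symbol_mult_cong:
  assumes "\<And>e. e \<in> {..<p} \<times> {..<p} \<Longrightarrow> f e = f' e" "\<And>e. e \<in> {..<p} \<times> {..<p} \<Longrightarrow> g e = g' e"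
  shows "symbol_mult p \<zeta> u v f g = symbol_mult p \<zeta> u v f' g'"
  unfolding symbol_mult_def using assms by (intro ext) (auto intro!: sum.cong)

lemma symbol_mult_add:
  "symbol_mult p \<zeta> u v (\<lambda>e. f e + f' e) g e = symbol_mult p \<zeta> u v f g e + symbol_mult p \<zeta> u v f' g e"
  "symbol_mult p \<zeta> u v g (\<lambda>e. f e + f' e) e = symbol_mult p \<zeta> u v g f e + symbol_mult p \<zeta> u v g f' e"
  unfolding symbol_mult_def
  by (auto simp: sum.distrib[symmetric] case_prod_unfold algebra_simps intro!: sum.cong)

lemma symbol_mult_scale:
  "symbol_mult p \<zeta> u v (\<lambda>e. c * f e) g e = c * symbol_mult p \<zeta> u v f g e"
  "symbol_mult p \<zeta> u v f (\<lambda>e. c * g e) e = c * symbol_mult p \<zeta> u v f g e"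
  unfolding symbol_mult_def
  by (auto simp: sum_distrib_left case_prod_unfold mult_ac intro!: sum.cong)

lemma symbol_mult_assoc:
  assumes p: "p > 0" and z: "\<zeta> ^ p = (1::'a::field)"
  shows "symbol_mult p \<zeta> u v (symbol_mult p \<zeta> u v f g) h = symbol_mult p \<zeta> u v f (symbol_mult p \<zeta> u v g h)"
proof
  fix e0 :: "nat \<times> nat"
  let ?P = "{..<p} \<times> {..<p}"
  note symbol_product_sum = vector_space.symbol_product_sum[OF vector_space_self]
  define \<Psi> where "\<Psi> K L = (if (K mod p, L mod p) = e0 then u ^ (K div p) * v ^ (L div p) else 0)" for K L
  have \<Psi>: "\<Psi> (K + p) L = u * \<Psi> K L" "\<Psi> K (L + p) = v * \<Psi> K L" for K L
  proof -
    have 1: "(J + p) mod p = J mod p" "(J + p) div p = Suc (J div p)" for J using p by simp_all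
    show "\<Psi> (K + p) L = u * \<Psi> K L" "\<Psi> K (L + p) = v * \<Psi> K L"
      unfolding \<Psi>_def 1 by simp_all
  qed
  have \<Psi>': "\<Psi> (K + (p + K')) L = u * \<Psi> (K + K') L" "\<Psi> K (L + (p + L')) = v * \<Psi> K (L + L')" for K L K' L'
    using \<Psi>(1)[of "K + K'"] \<Psi>(2)[of _ "L + L'"] by (simp_all add: ac_simps)
  have mult: "symbol_mult p \<zeta> u v f g e0
     = (\<Sum>(k, l)\<in>?P. \<Sum>(m, n)\<in>?P. (f (k, l) * g (m, n) * \<zeta> ^ (l * m)) * \<Psi> (k + m) (l + n))" for f g
    unfolding symbol_mult_def \<Psi>_def by (cases e0) (auto intro!: sum.cong)
  have zp: "\<zeta> ^ ((k + p) * m) = \<zeta> ^ (k * m)" "\<zeta> ^ (m * (k + p)) = \<zeta> ^ (m * k)" for k m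
    using z by (simp_all add: distrib_left distrib_right power_add power_mult mult.commute[of m p])
  define \<Phi> where "\<Phi> r s = (\<Sum>(a, b)\<in>?P. (h (a, b) * \<zeta> ^ (s * a)) * \<Psi> (r + a) (s + b))" for r s
  have "symbol_mult p \<zeta> u v (symbol_mult p \<zeta> u v f g) h e0
      = (\<Sum>(r, s)\<in>?P. symbol_mult p \<zeta> u v f g (r, s) * \<Phi> r s)"
    unfolding mult[of "symbol_mult p \<zeta> u v f g"] \<Phi>_def
    by (auto simp: sum_distrib_left mult.assoc case_prod_unfold intro!: sum.cong)
  also have "\<dots> = (\<Sum>(k, l)\<in>?P. \<Sum>(m, n)\<in>?P. (f (k, l) * g (m, n) * \<zeta> ^ (l * m)) * \<Phi> (k + m) (l + n))"
  proof (rule symbol_product_sum[OF p])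
    show "\<Phi> (k + p) l = u * \<Phi> k l" for k l
      unfolding \<Phi>_def sum_distrib_left case_prod_unfold
      by (intro sum.cong) (auto simp: \<Psi>' add.assoc)
    show "\<Phi> k (l + p) = v * \<Phi> k l" for k l
      unfolding \<Phi>_def sum_distrib_left case_prod_unfold
      by (intro sum.cong) (auto simp: \<Psi>' add.assoc zp)
  qed
  finally have 1: "symbol_mult p \<zeta> u v (symbol_mult p \<zeta> u v f g) h e0
    = (\<Sum>(k, l)\<in>?P. \<Sum>(m, n)\<in>?P. \<Sum>(a, b)\<in>?P.
        f (k, l) * g (m, n) * h (a, b) * \<zeta> ^ (l * m + l * a + n * a) * \<Psi> (k + m + a) (l + n + b))"
    unfolding \<Phi>_def by (simp add: sum_distrib_left case_prod_unfold power_add distrib_left distrib_right mult_ac)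
  have "symbol_mult p \<zeta> u v f (symbol_mult p \<zeta> u v g h) e0
      = (\<Sum>(k, l)\<in>?P. f (k, l) * (\<Sum>(r, s)\<in>?P. symbol_mult p \<zeta> u v g h (r, s) * (\<zeta> ^ (l * r) * \<Psi> (k + r) (l + s))))"
    unfolding mult[of f] by (auto simp: sum_distrib_left mult.assoc case_prod_unfold intro!: sum.cong)
  also have "\<dots> = (\<Sum>(k, l)\<in>?P. f (k, l) * (\<Sum>(m, n)\<in>?P. \<Sum>(a, b)\<in>?P. (g (m, n) * h (a, b) * \<zeta> ^ (n * a)) *
        (\<zeta> ^ (l * (m + a)) * \<Psi> (k + (m + a)) (l + (n + b)))))"
  proof (intro sum.cong[OF refl], clarify)
    fix k l
    show "f (k, l) * (\<Sum>(r, s)\<in>?P. symbol_mult p \<zeta> u v g h (r, s) * (\<zeta> ^ (l * r) * \<Psi> (k + r) (l + s)))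
      = f (k, l) * (\<Sum>(m, n)\<in>?P. \<Sum>(a, b)\<in>?P. (g (m, n) * h (a, b) * \<zeta> ^ (n * a)) *
        (\<zeta> ^ (l * (m + a)) * \<Psi> (k + (m + a)) (l + (n + b))))"
      by (subst symbol_product_sum[where \<Phi> = "\<lambda>r s. \<zeta> ^ (l * r) * \<Psi> (k + r) (l + s)", OF p])
         (simp_all add: zp \<Psi>(1)[of "k + _", unfolded add.assoc] \<Psi>(2)[of _ "l + _", unfolded add.assoc])
  qed
  also have "\<dots> = (\<Sum>(k, l)\<in>?P. \<Sum>(m, n)\<in>?P. \<Sum>(a, b)\<in>?P.
        f (k, l) * g (m, n) * h (a, b) * \<zeta> ^ (l * m + l * a + n * a) * \<Psi> (k + m + a) (l + n + b))"
    by (simp add: sum_distrib_left case_prod_unfold power_add distrib_left mult_ac add.assoc)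
  finally show "symbol_mult p \<zeta> u v (symbol_mult p \<zeta> u v f g) h e0
      = symbol_mult p \<zeta> u v f (symbol_mult p \<zeta> u v g h) e0"
    using 1 by simp
qed

lemma mod_add_left_cancel:
  assumes "(k + m) mod p = (k' + m) mod p" "k < p" "k' < (p::nat)"
  shows "k = k'"
proof -
  have "int k mod int p = int k' mod int p"
    using assms(1) by (metis add_diff_cancel_right' mod_diff_left_eq of_nat_add zmod_int)
  then show ?thesis using assms by (simp flip: zmod_int)
qed

definition symbol_basis :: "nat \<Rightarrow> nat \<times> nat \<Rightarrow> nat \<times> nat \<Rightarrow> 'a::field" where
  "symbol_basis p e = (\<lambda>e'\<in>{..<p} \<times> {..<p}. if e' = e then 1 else 0)"

lemma symbol_mult_basis:
  assumes "k < p" "l < p" "m < p" "n < p"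
  shows "symbol_mult p \<zeta> u v f (symbol_basis p (m, n)) ((k + m) mod p, (l + n) mod p)
      = f (k, l) * \<zeta> ^ (l * m) * u ^ ((k + m) div p) * v ^ ((l + n) div p)"
    and "symbol_mult p \<zeta> u v (symbol_basis p (m, n)) f ((k + m) mod p, (l + n) mod p)
      = f (k, l) * \<zeta> ^ (n * k) * u ^ ((k + m) div p) * v ^ ((l + n) div p)"
proof -
  let ?P = "{..<p} \<times> {..<p}"
  have "symbol_mult p \<zeta> u v f (symbol_basis p (m, n)) ((k + m) mod p, (l + n) mod p)
    = (\<Sum>e\<in>?P. \<Sum>e'\<in>?P. if e' = (m, n) then if e = (k, l) then
       f (k, l) * \<zeta> ^ (l * m) * u ^ ((k + m) div p) * v ^ ((l + n) div p) else 0 else 0)"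
    unfolding symbol_mult_def case_prod_conv case_prod_unfold
    by (intro sum.cong refl)
       (use assms in \<open>auto simp: symbol_basis_def dest: mod_add_left_cancel\<close>)
  then show "symbol_mult p \<zeta> u v f (symbol_basis p (m, n)) ((k + m) mod p, (l + n) mod p)
      = f (k, l) * \<zeta> ^ (l * m) * u ^ ((k + m) div p) * v ^ ((l + n) div p)"
    using assms by (simp add: sum.delta)
  have "symbol_mult p \<zeta> u v (symbol_basis p (m, n)) f ((k + m) mod p, (l + n) mod p)
    = (\<Sum>e\<in>?P. \<Sum>e'\<in>?P. if e' = (k, l) then if e = (m, n) then
       f (k, l) * \<zeta> ^ (n * k) * u ^ ((k + m) div p) * v ^ ((l + n) div p) else 0 else 0)"
    unfolding symbol_mult_def case_prod_conv case_prod_unfold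
    by (intro sum.cong refl)
       (use assms in \<open>auto simp: symbol_basis_def add.commute dest: mod_add_left_cancel\<close>)
  then show "symbol_mult p \<zeta> u v (symbol_basis p (m, n)) f ((k + m) mod p, (l + n) mod p)
      = f (k, l) * \<zeta> ^ (n * k) * u ^ ((k + m) div p) * v ^ ((l + n) div p)"
    using assms by (simp add: sum.delta)
qed

lemma shift_index_cases:
  assumes "e \<in> {..<p} \<times> {..<p}" "m < p" "n < (p::nat)"
  obtains k l where "k < p" "l < p" "e = ((k + m) mod p, (l + n) mod p)"
proof -
  obtain r s where e: "e = (r, s)" "r < p" "s < p" using assms by auto
  have *: "((r + (p - m)) mod p + m) mod p = r" if "r < p" "m < p" for r m
    using that by (simp add: mod_add_left_eq)
  show ?thesis
    by (rule that[of "(r + (p - m)) mod p" "(s + (p - n)) mod p"]) (use e assms * in auto)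
qed

lemma symbol_mult_one:
  assumes "p > 0" "e \<in> {..<p} \<times> {..<p}"
  shows "symbol_mult p \<zeta> u v f (symbol_basis p (0, 0)) e = f e"
    and "symbol_mult p \<zeta> u v (symbol_basis p (0, 0)) f e = f e"
  using assms symbol_mult_basis[of "fst e" p "snd e" 0 0] by (auto simp: mem_Times_iff)

lemma symbol_algebra_simps [simp]:
  "carrier (symbol_algebra p \<zeta> u v) = ({..<p} \<times> {..<p}) \<rightarrow>\<^sub>E UNIV"
  "f \<otimes>\<^bsub>symbol_algebra p \<zeta> u v\<^esub> g = restrict (symbol_mult p \<zeta> u v f g) ({..<p} \<times> {..<p})"
  "\<one>\<^bsub>symbol_algebra p \<zeta> u v\<^esub> = symbol_basis p (0, 0)"
  "\<zero>\<^bsub>symbol_algebra p \<zeta> u v\<^esub> = (\<lambda>_\<in>{..<p} \<times> {..<p}. 0)"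
  "f \<oplus>\<^bsub>symbol_algebra p \<zeta> u v\<^esub> g = (\<lambda>e\<in>{..<p} \<times> {..<p}. f e + g e)"
  "c \<odot>\<^bsub>symbol_algebra p \<zeta> u v\<^esub> f = (\<lambda>e\<in>{..<p} \<times> {..<p}. c * f e)"
  by (simp_all add: symbol_algebra_def symbol_mult_def symbol_basis_def)

lemma symbol_basis_carrier [simp]: "symbol_basis p e \<in> ({..<p} \<times> {..<p}) \<rightarrow>\<^sub>E UNIV"
  by (simp add: symbol_basis_def)

lemma symbol_mult_restrict:
  "symbol_mult p \<zeta> u v (restrict f ({..<p} \<times> {..<p})) g = symbol_mult p \<zeta> u v f g"
  "symbol_mult p \<zeta> u v f (restrict g ({..<p} \<times> {..<p})) = symbol_mult p \<zeta> u v f g"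
  by (auto intro!: symbol_mult_cong)

lemma PiE_UNIV_eqI:
  assumes "f \<in> S \<rightarrow>\<^sub>E UNIV" "g \<in> S \<rightarrow>\<^sub>E UNIV" "\<And>e. e \<in> S \<Longrightarrow> f e = g e"
  shows "f = g"
  using assms by (intro PiE_ext[OF assms(1,2)]) auto

lemma assoc_algebra_symbol:
  fixes u v \<zeta> :: "'a::field"
  assumes p: "p > 0" and z: "\<zeta> ^ p = 1"
  shows "assoc_algebra fld (symbol_algebra p \<zeta> u v)"
proof -
  let ?A = "symbol_algebra p \<zeta> u v" and ?P = "{..<p} \<times> {..<p}"
  note eqI = PiE_UNIV_eqI[where S = ?P]
  have ab: "abelian_group ?A"
  proof (rule abelian_groupI)
    fix f assume f: "f \<in> carrier ?A"
    show "\<exists>g\<in>carrier ?A. g \<oplus>\<^bsub>?A\<^esub> f = \<zero>\<^bsub>?A\<^esub>"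
      by (intro bexI[of _ "\<lambda>e\<in>?P. - f e"], rule eqI) simp_all
    show "\<zero>\<^bsub>?A\<^esub> \<oplus>\<^bsub>?A\<^esub> f = f" by (rule eqI) (use f in simp_all)
    fix g
    show "f \<oplus>\<^bsub>?A\<^esub> g = g \<oplus>\<^bsub>?A\<^esub> f" by (rule eqI) (simp_all add: add.commute)
    show "f \<oplus>\<^bsub>?A\<^esub> g \<in> carrier ?A" by simp
    fix h
    show "f \<oplus>\<^bsub>?A\<^esub> g \<oplus>\<^bsub>?A\<^esub> h = f \<oplus>\<^bsub>?A\<^esub> (g \<oplus>\<^bsub>?A\<^esub> h)" by (rule eqI) (simp_all add: add.assoc)
  qed simp
  have mon: "monoid ?A"
  proof (rule monoidI)
    fix f g h assume f: "f \<in> carrier ?A"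
    show "f \<otimes>\<^bsub>?A\<^esub> g \<in> carrier ?A" by simp
    show "f \<otimes>\<^bsub>?A\<^esub> g \<otimes>\<^bsub>?A\<^esub> h = f \<otimes>\<^bsub>?A\<^esub> (g \<otimes>\<^bsub>?A\<^esub> h)"
      by (rule eqI) (simp_all add: symbol_mult_restrict symbol_mult_assoc[OF p z])
    show "\<one>\<^bsub>?A\<^esub> \<otimes>\<^bsub>?A\<^esub> f = f" "f \<otimes>\<^bsub>?A\<^esub> \<one>\<^bsub>?A\<^esub> = f"
      by (rule eqI; use f in \<open>simp add: symbol_mult_one[OF p]\<close>)+
  qed simp
  have ring: "ring ?A"
    by (rule ringI[OF ab mon]; rule eqI) (simp_all add: symbol_mult_restrict symbol_mult_add)
  have cring: "cring (fld :: 'a ring)" by (rule cring_from_type_algebra)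
  have "module fld ?A"
    by (rule moduleI[OF cring ab])
       (simp, (rule eqI; simp add: distrib_left distrib_right mult.assoc)+)
  moreover have "(k \<odot>\<^bsub>?A\<^esub> x) \<otimes>\<^bsub>?A\<^esub> y = k \<odot>\<^bsub>?A\<^esub> (x \<otimes>\<^bsub>?A\<^esub> y)"
     "x \<otimes>\<^bsub>?A\<^esub> (k \<odot>\<^bsub>?A\<^esub> y) = k \<odot>\<^bsub>?A\<^esub> (x \<otimes>\<^bsub>?A\<^esub> y)" for k x y
    by (rule eqI; simp add: symbol_mult_restrict symbol_mult_scale)+
  ultimately show ?thesis unfolding assoc_algebra_def using ring by blast
qed

lemma symbol_finsum:
  assumes p: "p > 0" and z: "\<zeta> ^ p = 1" and "finite S" "h \<in> S \<rightarrow> carrier (symbol_algebra p \<zeta> u v)"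
    and e: "e \<in> {..<p} \<times> {..<p}"
  shows "finsum (symbol_algebra p \<zeta> u v) h S e = (\<Sum>s\<in>S. h s e)"
proof -
  let ?A = "symbol_algebra p \<zeta> u v"
  interpret ring ?A using assoc_algebra_symbol[OF p z] by (simp add: assoc_algebra_def)
  show ?thesis using assms(3,4)
  proof (induction S rule: finite_induct)
    case empty
    show ?case using e by (simp only: finsum_empty) simp
  next
    case (insert x S)
    have "finsum ?A h (insert x S) = h x \<oplus>\<^bsub>?A\<^esub> finsum ?A h S"
      by (rule finsum_insert) (use insert in auto)
    then show ?case using insert e by simp
  qed
qed

text \<open>
  An element of the ideal with the fewest nonzero coefficients is a multiple of one basis element:
  moving a basis element from its left to its right multiplies the coefficients by powers of \<open>\<zeta>\<close>, and
  if two of these powers differed, a suitable difference would have smaller nonempty support. Basis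
  elements are units.
\<close>

lemma symbol_algebra_ideal:
  fixes u v \<zeta> :: "'a::field"
  assumes p: "Factorial_Ring.prime p" and z: "primitive_root_of_unity p \<zeta>" and uv: "u \<noteq> 0" "v \<noteq> 0"
    and I: "ideal I (symbol_algebra p \<zeta> u v)" and f: "f \<in> I" "f \<noteq> (\<lambda>_\<in>{..<p} \<times> {..<p}. 0)"
  shows "symbol_basis p (0, 0) \<in> I"
proof -
  let ?A = "symbol_algebra p \<zeta> u v" and ?P = "{..<p} \<times> {..<p}"
  have p1: "p > 1" and p0: "p > 0" using prime_gt_1_nat[OF p] by auto
  interpret ideal I ?A by (rule I)
  have sub: "g \<in> carrier ?A" if "g \<in> I" for g using that by (rule Icarr)
  have mulR: "restrict (symbol_mult p \<zeta> u v g h) ?P \<in> I" if "g \<in> I" "h \<in> carrier ?A" for g h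
    using I_r_closed[OF that] by simp
  have mulL: "restrict (symbol_mult p \<zeta> u v h g) ?P \<in> I" if "g \<in> I" "h \<in> carrier ?A" for g h
    using I_l_closed[OF that] by simp
  have add: "(\<lambda>e\<in>?P. g e + h e) \<in> I" if "g \<in> I" "h \<in> I" for g h
    using additive_subgroup.a_closed[OF additive_subgroup_axioms that] by simp
  have scale: "(\<lambda>e\<in>?P. c * g e) \<in> I" if "g \<in> I" for g c
  proof -
    have "restrict (symbol_mult p \<zeta> u v (\<lambda>e\<in>?P. c * symbol_basis p (0, 0) e) g) ?P \<in> I"
      by (rule mulL[OF that]) simp
    also have "restrict (symbol_mult p \<zeta> u v (\<lambda>e\<in>?P. c * symbol_basis p (0, 0) e) g) ?P = (\<lambda>e\<in>?P. c * g e)"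
      by (rule PiE_UNIV_eqI[where S = ?P]) (simp_all add: symbol_mult_restrict symbol_mult_scale symbol_mult_one[OF p0])
    finally show ?thesis .
  qed
  define supp where "supp g = {e \<in> ?P. g e \<noteq> (0::'a)}" for g
  have fin: "finite (supp g)" for g by (simp add: supp_def)
  have nz: "g = (\<lambda>_\<in>?P. 0) \<longleftrightarrow> supp g = {}" if "g \<in> I" for g
  proof
    assume "supp g = {}"
    then show "g = (\<lambda>_\<in>?P. 0)" using sub[OF that]
      by (intro PiE_UNIV_eqI[where S = ?P]) (auto simp: supp_def)
  qed (auto simp: supp_def)
  obtain g where g: "g \<in> I" "supp g \<noteq> {}"
    and min: "\<And>h. h \<in> I \<Longrightarrow> supp h \<noteq> {} \<Longrightarrow> card (supp g) \<le> card (supp h)"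
    using arg_min_nat_lemma[of "\<lambda>g. g \<in> I \<and> supp g \<noteq> {}" f "\<lambda>g. card (supp g)"] f nz[OF f(1)]
    by (metis (no_types, lifting))
  obtain k0 l0 where kl0: "(k0, l0) \<in> supp g" using g(2) by auto
  have zinj: "k = l" if "\<zeta> ^ k = \<zeta> ^ l" "k < p" "l < p" for k l
    using prim_root_power_inj[OF z] that by blast
  have single: "e = (k0, l0)" if "e \<in> supp g" for e
  proof (rule ccontr)
    assume ne: "e \<noteq> (k0, l0)"
    obtain k1 l1 where e: "e = (k1, l1)" by (cases e)
    have lt: "k0 < p" "l0 < p" "k1 < p" "l1 < p" using kl0 that e by (auto simp: supp_def)
    obtain m n where mn: "m < p" "n < p" and
      *: "\<zeta> ^ (n * k1) * \<zeta> ^ (l0 * m) \<noteq> \<zeta> ^ (n * k0) * \<zeta> ^ (l1 * m)"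
    proof (cases "k0 = k1")
      case True
      then have "\<zeta> ^ l0 \<noteq> \<zeta> ^ l1" using zinj lt ne e by auto
      then show ?thesis using that[of 1 0] p1 by simp
    next
      case False
      then have "\<zeta> ^ k1 \<noteq> \<zeta> ^ k0" using zinj lt by auto
      then show ?thesis using that[of 0 1] p1 by simp
    qed
    define E where "E = (symbol_basis p (m, n) :: nat \<times> nat \<Rightarrow> 'a)"
    define h where "h = (\<lambda>e\<in>?P. (\<lambda>e\<in>?P. \<zeta> ^ (l0 * m) * restrict (symbol_mult p \<zeta> u v E g) ?P e) e
        + (\<lambda>e\<in>?P. (- (\<zeta> ^ (n * k0))) * restrict (symbol_mult p \<zeta> u v g E) ?P e) e)"
    have "h \<in> I" unfolding h_def by (intro add scale mulL mulR g(1)) (simp_all add: E_def)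
    have h: "h ((k + m) mod p, (l + n) mod p) = (\<zeta> ^ (n * k) * \<zeta> ^ (l0 * m) - \<zeta> ^ (n * k0) * \<zeta> ^ (l * m))
          * (u ^ ((k + m) div p) * v ^ ((l + n) div p)) * g (k, l)" if "k < p" "l < p" for k l
      using p0 by (simp add: h_def E_def symbol_mult_basis[OF that mn]) (simp add: algebra_simps)
    define \<sigma> where "\<sigma> = (\<lambda>(k, l). ((k + m) mod p, (l + n) mod p))"
    have "supp h \<subseteq> \<sigma> ` (supp g - {(k0, l0)})"
    proof
      fix e' assume e': "e' \<in> supp h"
      then have "e' \<in> ?P" by (simp add: supp_def)
      from shift_index_cases[OF this mn] obtain k l
        where kl: "k < p" "l < p" "e' = ((k + m) mod p, (l + n) mod p)" .
      then have "h ((k + m) mod p, (l + n) mod p) \<noteq> 0" using e' by (simp add: supp_def)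
      then have "(k, l) \<in> supp g - {(k0, l0)}" unfolding h[OF kl(1,2)] using kl(1,2)
        by (auto simp: supp_def)
      then show "e' \<in> \<sigma> ` (supp g - {(k0, l0)})" using kl(3) by (force simp: \<sigma>_def)
    qed
    then have "card (supp h) \<le> card (supp g - {(k0, l0)})"
      using fin by (meson finite_Diff finite_imageI card_mono card_image_le order_trans)
    also have "\<dots> < card (supp g)" by (rule card_Diff1_less[OF fin kl0])
    finally have "supp h = {}" using min[OF \<open>h \<in> I\<close>] by fastforce
    moreover have "((k1 + m) mod p, (l1 + n) mod p) \<in> supp h"
      using * uv that e p0 lt h[of k1 l1] by (simp add: supp_def)
    ultimately show False by blast
  qed
  have lt: "k0 < p" "l0 < p" and g0: "g (k0, l0) \<noteq> 0" using kl0 by (auto simp: supp_def)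
  define m n where "m = (p - k0) mod p" and "n = (p - l0) mod p"
  have mn: "m < p" "n < p" "(k0 + m) mod p = 0" "(l0 + n) mod p = 0"
    using lt p0 by (simp_all add: m_def n_def mod_add_right_eq)
  define c where "c = g (k0, l0) * \<zeta> ^ (l0 * m) * u ^ ((k0 + m) div p) * v ^ ((l0 + n) div p)"
  have c: "c \<noteq> 0" using g0 uv prim_root_nonzero[OF z] by (simp add: c_def)
  have "(\<lambda>e\<in>?P. inverse c * restrict (symbol_mult p \<zeta> u v g (symbol_basis p (m, n))) ?P e) \<in> I"
    by (intro scale mulR g(1)) simp
  also have "(\<lambda>e\<in>?P. inverse c * restrict (symbol_mult p \<zeta> u v g (symbol_basis p (m, n))) ?P e) = symbol_basis p (0, 0)"
  proof (rule PiE_UNIV_eqI[where S = ?P])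
    fix e assume e: "e \<in> ?P"
    from shift_index_cases[OF this mn(1,2)] obtain k l
      where kl: "k < p" "l < p" "e = ((k + m) mod p, (l + n) mod p)" .
    have eq: "symbol_mult p \<zeta> u v g (symbol_basis p (m, n)) e = g (k, l) * \<zeta> ^ (l * m) * u ^ ((k + m) div p) * v ^ ((l + n) div p)"
      using symbol_mult_basis(1)[OF kl(1,2) mn(1,2)] kl(3) by simp
    show "(\<lambda>e\<in>?P. inverse c * restrict (symbol_mult p \<zeta> u v g (symbol_basis p (m, n))) ?P e) e = symbol_basis p (0, 0) e"
    proof (cases "(k, l) = (k0, l0)")
      case True
      then have "e = (0, 0)" using kl mn by simp
      then have "(symbol_basis p (0, 0) :: nat \<times> nat \<Rightarrow> 'a) e = 1" using p0 by (simp add: symbol_basis_def)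
      moreover have "symbol_mult p \<zeta> u v g (symbol_basis p (m, n)) e = c" using eq True by (simp add: c_def)
      ultimately show ?thesis using e c by simp
    next
      case False
      then have "g (k, l) = 0" using single[of "(k, l)"] kl by (auto simp: supp_def)
      moreover have "e \<noteq> (0, 0)"
      proof
        assume "e = (0, 0)"
        then have "(k + m) mod p = (k0 + m) mod p" "(l + n) mod p = (l0 + n) mod p" using kl mn by auto
        then have "k = k0" "l = l0"
          using mod_add_left_cancel[OF _ kl(1) lt(1)] mod_add_left_cancel[OF _ kl(2) lt(2)] by blast+
        then show False using False by blast
      qed
      ultimately show ?thesis using e eq by (simp add: symbol_basis_def)
    qed
  qed simp_all
  finally show ?thesis .
qed

lemma central_simple_symbol_algebra:
  fixes u v \<zeta> :: "'a::field"
  assumes p: "Factorial_Ring.prime p" and z: "primitive_root_of_unity p \<zeta>" and uv: "u \<noteq> 0" "v \<noteq> 0"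
  shows "central_simple_algebra fld (symbol_algebra p \<zeta> u v)"
proof -
  let ?A = "symbol_algebra p \<zeta> u v" and ?P = "{..<p} \<times> {..<p}"
  have p1: "p > 1" and p0: "p > 0" using prime_gt_1_nat[OF p] by auto
  note zp = prim_root_power[OF z]
  have A: "assoc_algebra fld ?A" by (rule assoc_algebra_symbol[OF p0 zp])
  have span: "finitely_spanned fld ?A"
    unfolding finitely_spanned_def
  proof (intro exI[of _ "symbol_basis p ` ?P"] conjI ballI)
    fix x assume x: "x \<in> carrier ?A"
    define f where "f s = (\<Sum>e\<in>?P. x e * s e)" for s
    have inj: "inj_on (symbol_basis p :: _ \<Rightarrow> nat \<times> nat \<Rightarrow> 'a) ?P"
    proof (rule inj_onI)
      fix e e' assume *: "e \<in> ?P" "e' \<in> ?P" "(symbol_basis p e :: nat \<times> nat \<Rightarrow> 'a) = symbol_basis p e'"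
      then have "(symbol_basis p e :: nat \<times> nat \<Rightarrow> 'a) e = symbol_basis p e' e" by simp
      then show "e = e'" using * by (simp add: symbol_basis_def split: if_splits)
    qed
    have f: "f (symbol_basis p e) = x e" if "e \<in> ?P" for e
    proof -
      have "f (symbol_basis p e) = (\<Sum>e'\<in>?P. if e' = e then x e' else 0)"
        unfolding f_def by (intro sum.cong) (auto simp: symbol_basis_def)
      then show ?thesis using that by (simp add: sum.delta)
    qed
    have "x = (\<Oplus>\<^bsub>?A\<^esub>s\<in>symbol_basis p ` ?P. f s \<odot>\<^bsub>?A\<^esub> s)"
    proof (rule PiE_UNIV_eqI[where S = ?P])
      show "x \<in> ?P \<rightarrow>\<^sub>E UNIV" using x by simp
      interpret ring ?A using A by (simp add: assoc_algebra_def)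
      have "(\<Oplus>\<^bsub>?A\<^esub>s\<in>symbol_basis p ` ?P. f s \<odot>\<^bsub>?A\<^esub> s) \<in> carrier ?A" by (rule finsum_closed) simp
      then show "(\<Oplus>\<^bsub>?A\<^esub>s\<in>symbol_basis p ` ?P. f s \<odot>\<^bsub>?A\<^esub> s) \<in> ?P \<rightarrow>\<^sub>E UNIV" by simp
      fix e assume e: "e \<in> ?P"
      have "(\<Oplus>\<^bsub>?A\<^esub>s\<in>symbol_basis p ` ?P. f s \<odot>\<^bsub>?A\<^esub> s) e = (\<Sum>s\<in>symbol_basis p ` ?P. (f s \<odot>\<^bsub>?A\<^esub> s) e)"
        by (rule symbol_finsum[OF p0 zp _ _ e]) simp_all
      also have "\<dots> = (\<Sum>e'\<in>?P. x e' * symbol_basis p e' e)"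
        using e f by (simp add: sum.reindex[OF inj])
      also have "\<dots> = (\<Sum>e'\<in>?P. if e' = e then x e' else 0)"
        using e by (intro sum.cong) (auto simp: symbol_basis_def)
      finally show "x e = (\<Oplus>\<^bsub>?A\<^esub>s\<in>symbol_basis p ` ?P. f s \<odot>\<^bsub>?A\<^esub> s) e"
        using e by (simp add: sum.delta)
    qed
    then show "\<exists>f\<in>symbol_basis p ` ?P \<rightarrow> carrier fld. x = (\<Oplus>\<^bsub>?A\<^esub>s\<in>symbol_basis p ` ?P. f s \<odot>\<^bsub>?A\<^esub> s)"
      by (intro bexI[of _ f]) simp_all
  qed (simp_all add: image_subset_iff)
  have center: "{w \<in> carrier ?A. \<forall>x\<in>carrier ?A. w \<otimes>\<^bsub>?A\<^esub> x = x \<otimes>\<^bsub>?A\<^esub> w} = {k \<odot>\<^bsub>?A\<^esub> \<one>\<^bsub>?A\<^esub> | k. k \<in> carrier fld}"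
  proof (intro equalityI subsetI)
    fix w assume "w \<in> {w \<in> carrier ?A. \<forall>x\<in>carrier ?A. w \<otimes>\<^bsub>?A\<^esub> x = x \<otimes>\<^bsub>?A\<^esub> w}"
    then have w: "w \<in> carrier ?A"
      and "\<forall>x\<in>carrier ?A. w \<otimes>\<^bsub>?A\<^esub> x = x \<otimes>\<^bsub>?A\<^esub> w" by blast+
    then have comm: "w \<otimes>\<^bsub>?A\<^esub> x = x \<otimes>\<^bsub>?A\<^esub> w" if "x \<in> carrier ?A" for x
      using that by blast
    have eq: "w (k, l) * \<zeta> ^ (l * m) = w (k, l) * \<zeta> ^ (n * k)" if "k < p" "l < p" "m < p" "n < p" for k l m n
    proof -
      have "(w \<otimes>\<^bsub>?A\<^esub> symbol_basis p (m, n)) ((k + m) mod p, (l + n) mod p)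
          = (symbol_basis p (m, n) \<otimes>\<^bsub>?A\<^esub> w) ((k + m) mod p, (l + n) mod p)"
        by (subst comm) simp_all
      then show ?thesis using uv p0 by (simp add: symbol_mult_basis[OF that])
    qed
    have w0: "w (k, l) = 0" if "k < p" "l < p" "(k, l) \<noteq> (0, 0)" for k l
    proof (rule ccontr)
      assume "w (k, l) \<noteq> 0"
      then have "\<zeta> ^ l = \<zeta> ^ 0" "\<zeta> ^ k = \<zeta> ^ 0"
        using eq[OF that(1,2), of 1 0] eq[OF that(1,2), of 0 1] p1 by simp_all
      then show False using prim_root_power_inj[OF z, of _ 0] that p0 by blast
    qed
    have "w = w (0, 0) \<odot>\<^bsub>?A\<^esub> \<one>\<^bsub>?A\<^esub>"
    proof (rule PiE_UNIV_eqI[where S = ?P])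
      show "w \<in> ?P \<rightarrow>\<^sub>E UNIV" using w by simp
      fix e assume "e \<in> ?P"
      then show "w e = (w (0, 0) \<odot>\<^bsub>?A\<^esub> \<one>\<^bsub>?A\<^esub>) e"
        using w0[of "fst e" "snd e"] by (cases "e = (0, 0)") (auto simp: symbol_basis_def)
    qed simp
    then show "w \<in> {k \<odot>\<^bsub>?A\<^esub> \<one>\<^bsub>?A\<^esub> | k. k \<in> carrier fld}" by auto
  next
    fix w assume "w \<in> {k \<odot>\<^bsub>?A\<^esub> \<one>\<^bsub>?A\<^esub> | k. k \<in> carrier fld}"
    then obtain k where w: "w = k \<odot>\<^bsub>?A\<^esub> \<one>\<^bsub>?A\<^esub>" by auto
    have "w \<otimes>\<^bsub>?A\<^esub> x = x \<otimes>\<^bsub>?A\<^esub> w" for x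
      by (rule PiE_UNIV_eqI[where S = ?P])
         (simp_all add: w symbol_mult_restrict symbol_mult_scale symbol_mult_one[OF p0])
    then show "w \<in> {w \<in> carrier ?A. \<forall>x\<in>carrier ?A. w \<otimes>\<^bsub>?A\<^esub> x = x \<otimes>\<^bsub>?A\<^esub> w}" by (simp add: w)
  qed
  have "\<one>\<^bsub>?A\<^esub> \<noteq> \<zero>\<^bsub>?A\<^esub>"
  proof
    assume "\<one>\<^bsub>?A\<^esub> = \<zero>\<^bsub>?A\<^esub>"
    then have "\<one>\<^bsub>?A\<^esub> (0, 0) = \<zero>\<^bsub>?A\<^esub> (0, 0)" by simp
    then show False using p0 by (simp add: symbol_basis_def)
  qed
  moreover have "I = {\<zero>\<^bsub>?A\<^esub>} \<or> I = carrier ?A" if I: "ideal I ?A" for I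
  proof (cases "\<exists>f\<in>I. f \<noteq> \<zero>\<^bsub>?A\<^esub>")
    case True
    then have "\<one>\<^bsub>?A\<^esub> \<in> I" using symbol_algebra_ideal[OF p z uv I] by auto
    then show ?thesis using ideal.one_imp_carrier[OF I] by blast
  next
    case False
    moreover have "\<zero>\<^bsub>?A\<^esub> \<in> I" by (rule additive_subgroup.zero_closed[OF ideal.axioms(1)[OF I]])
    ultimately show ?thesis by blast
  qed
  ultimately show ?thesis unfolding central_simple_algebra_def using A span center by blast
qed

section \<open>A bicyclic Kummer extension and its monomial basis\<close>

text \<open>
  Here \<open>M\<close> is an abstract copy of \<open>F(\<beta>, \<delta>)\<close>. The automorphism \<open>s\<close> is the inverse of the Kummer
  generator at \<open>\<beta>\<close>: with this orientation \<open>j m = \<beta> m\<close> and \<open>i m = x s(m)\<close> satisfy \<open>j i = \<zeta> i j\<close>.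
\<close>

locale bicyclic =
  fixes p :: nat and \<zeta> b d :: "'a::field" and \<beta> \<delta> :: "'a alg_closure"
    and M :: "'a alg_closure set" and s t :: "'a alg_closure \<Rightarrow> 'a alg_closure"
  assumes prime_p: "Factorial_Ring.prime p"
    and root: "primitive_root_of_unity p \<zeta>" and p_nz: "of_nat p \<noteq> (0 :: 'a)"
    and b_nz: "b \<noteq> 0" and d_nz: "d \<noteq> 0"
    and \<beta>_pow: "\<beta> ^ p = to_ac b" and \<delta>_pow: "\<delta> ^ p = to_ac d"
    and base_M: "to_ac k \<in> M"
    and add_M: "m \<in> M \<Longrightarrow> m' \<in> M \<Longrightarrow> m + m' \<in> M"
    and mult_M: "m \<in> M \<Longrightarrow> m' \<in> M \<Longrightarrow> m * m' \<in> M"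
    and inverse_M: "m \<in> M \<Longrightarrow> inverse m \<in> M"
    and \<beta>_M: "\<beta> \<in> M" and \<delta>_M: "\<delta> \<in> M"
    and s_M: "m \<in> M \<Longrightarrow> s m \<in> M" and t_M: "m \<in> M \<Longrightarrow> t m \<in> M"
    and s_add: "m \<in> M \<Longrightarrow> m' \<in> M \<Longrightarrow> s (m + m') = s m + s m'"
    and t_add: "m \<in> M \<Longrightarrow> m' \<in> M \<Longrightarrow> t (m + m') = t m + t m'"
    and s_mult: "m \<in> M \<Longrightarrow> m' \<in> M \<Longrightarrow> s (m * m') = s m * s m'"
    and t_mult: "m \<in> M \<Longrightarrow> m' \<in> M \<Longrightarrow> t (m * m') = t m * t m'"
    and s_base: "s (to_ac k) = to_ac k" and t_base: "t (to_ac k) = to_ac k"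
    and st_commute: "m \<in> M \<Longrightarrow> s (t m) = t (s m)"
    and s_order: "m \<in> M \<Longrightarrow> (s ^^ p) m = m" and t_order: "m \<in> M \<Longrightarrow> (t ^^ p) m = m"
    and s_\<beta>: "s \<beta> = to_ac (inverse \<zeta>) * \<beta>" and s_\<delta>: "s \<delta> = \<delta>"
    and t_\<delta>: "t \<delta> = to_ac \<zeta> * \<delta>" and t_\<beta>: "t \<beta> = \<beta>"
    and fixed_base: "m \<in> M \<Longrightarrow> s m = m \<Longrightarrow> t m = m \<Longrightarrow> m \<in> base_field"
begin

lemma p_gt_1: "p > 1" and p_pos: "p > 0"
  using prime_gt_1_nat[OF prime_p] by auto

lemma \<zeta>_nz: "\<zeta> \<noteq> 0" and \<zeta>_pow: "\<zeta> ^ p = 1"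
  using prim_root_nonzero[OF root] prim_root_power[OF root] by auto

lemma \<beta>_nz: "\<beta> \<noteq> 0" and \<delta>_nz: "\<delta> \<noteq> 0"
  using \<beta>_pow b_nz \<delta>_pow d_nz p_pos by (auto simp: zero_power)

lemma zero_M: "0 \<in> M" and one_M: "1 \<in> M" and power_M: "m \<in> M \<Longrightarrow> m ^ k \<in> M"
proof -
  show "0 \<in> M" and 1: "1 \<in> M" using base_M[of 0] base_M[of 1] by auto
  show "m \<in> M \<Longrightarrow> m ^ k \<in> M" by (induction k) (auto simp: 1 mult_M)
qed

lemma fspace_M: "fspace M"
  by (intro fspaceI zero_M add_M mult_M base_M)

lemma flinear_s: "flinear M s" and flinear_t: "flinear M t"
  by (intro flinearI; simp add: s_M t_M s_add t_add s_mult t_mult base_M s_base t_base)+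

lemma s_power: "m \<in> M \<Longrightarrow> s (m ^ k) = s m ^ k" and t_power: "m \<in> M \<Longrightarrow> t (m ^ k) = t m ^ k"
proof -
  show "m \<in> M \<Longrightarrow> s (m ^ k) = s m ^ k"
    using s_base[of 1] by (induction k) (auto simp: s_mult power_M)
  show "m \<in> M \<Longrightarrow> t (m ^ k) = t m ^ k"
    using t_base[of 1] by (induction k) (auto simp: t_mult power_M)
qed

definition mono :: "nat \<times> nat \<Rightarrow> 'a alg_closure" where
  "mono e = \<beta> ^ fst e * \<delta> ^ snd e"

lemma mono_M: "mono e \<in> M"
  by (simp add: mono_def mult_M power_M \<beta>_M \<delta>_M)

lemma mono_nz: "mono e \<noteq> 0"
  by (simp add: mono_def \<beta>_nz \<delta>_nz)

lemma s_mono: "s (mono e) = to_ac (inverse \<zeta>) ^ fst e * mono e"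
  and t_mono: "t (mono e) = to_ac \<zeta> ^ snd e * mono e"
  by (simp_all add: mono_def s_mult t_mult power_M \<beta>_M \<delta>_M s_power t_power s_\<beta> s_\<delta> t_\<beta> t_\<delta>
      power_mult_distrib mult_ac)

text \<open>
  Decompose into eigenvectors of \<open>s\<close> and then of \<open>t\<close>. A common eigenvector, divided by the monomial with
  the same eigenvalues, is fixed by both automorphisms and hence a scalar.
\<close>

lemma coordinates_exist:
  assumes "m \<in> M"
  shows "\<exists>c. m = (\<Sum>e\<in>{..<p} \<times> {..<p}. to_ac (c e) * mono e)"
proof -
  obtain Y where Y: "\<And>k. Y k \<in> M" "\<And>k. s (Y k) = to_ac (inverse \<zeta>) ^ k * Y k" "m = (\<Sum>k<p. Y k)"
    using eigen_decomp[OF fspace_M flinear_s s_order prim_root_inverse[OF root] p_nz assms] by blast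
  have "\<exists>c. Y k = (\<Sum>l<p. to_ac (c l) * mono (k, l))" for k
  proof -
    define V where "V = {y \<in> M. s y = to_ac (inverse \<zeta> ^ k) * y}"
    have V: "fspace V"
      unfolding V_def
      by (intro fspaceI) (auto simp: zero_M add_M mult_M base_M s_add s_mult s_base distrib_left distrib_right mult_ac
          s_base[of 0, simplified] simp del: to_ac_power to_ac_inverse)
    have tV: "t y \<in> V" if "y \<in> V" for y
    proof -
      have y: "y \<in> M" "s y = to_ac (inverse \<zeta> ^ k) * y" using that by (auto simp: V_def)
      have "s (t y) = t (to_ac (inverse \<zeta> ^ k) * y)" using st_commute[OF y(1)] y(2) by simp
      also have "\<dots> = to_ac (inverse \<zeta> ^ k) * t y" using t_mult[OF base_M y(1)] t_base by metis
      finally show ?thesis using t_M[OF y(1)] by (simp add: V_def)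
    qed
    have t: "flinear V t"
      using flinear_t tV unfolding flinear_def V_def by auto
    have YV: "Y k \<in> V" using Y by (simp add: V_def)
    have ord: "(t ^^ p) y = y" if "y \<in> V" for y using t_order that by (simp add: V_def)
    obtain Z where Z: "\<And>l. Z l \<in> V" "\<And>l. t (Z l) = to_ac \<zeta> ^ l * Z l" "Y k = sum Z {..<p}"
      using eigen_decomp[OF V t ord root p_nz YV] by blast
    have "\<exists>c. Z l = to_ac c * mono (k, l)" for l
    proof -
      have zM: "Z l \<in> M" "s (Z l) = to_ac (inverse \<zeta> ^ k) * Z l" using Z(1)[of l] by (auto simp: V_def)
      define q where "q = Z l * inverse (mono (k, l))"
      have qM: "q \<in> M" by (simp add: q_def zM mult_M inverse_M mono_M)
      have qm: "q * mono (k, l) = Z l" using mono_nz by (simp add: q_def)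
      have "s q * s (mono (k, l)) = s (Z l)" using s_mult[OF qM mono_M[of "(k, l)"]] qm by simp
      then have "s q * mono (k, l) = q * mono (k, l)" 
        using \<zeta>_nz by (simp add: zM(2) qm s_mono field_simps)
      then have "s q = q" using mono_nz by simp
      have "t q * t (mono (k, l)) = t (Z l)" using t_mult[OF qM mono_M[of "(k, l)"]] qm by simp
      then have "t q * mono (k, l) = q * mono (k, l)"
        using \<zeta>_nz by (simp add: Z qm t_mono)
      then have "t q = q" using mono_nz by simp
      from fixed_base[OF qM \<open>s q = q\<close> this] obtain c where "q = to_ac c" by auto
      then show ?thesis using qm by metis
    qed
    then obtain c where c: "\<And>l. Z l = to_ac (c l) * mono (k, l)" by metis
    show ?thesis by (intro exI[of _ c]) (simp add: Z(3) c)
  qed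
  then obtain c where c: "\<And>k. Y k = (\<Sum>l<p. to_ac (c k l) * mono (k, l))" by metis
  have "m = (\<Sum>(k, l)\<in>{..<p} \<times> {..<p}. to_ac (c k l) * mono (k, l))"
    unfolding Y(3) c by (simp add: sum.cartesian_product)
  then show ?thesis by (intro exI[of _ "\<lambda>(k, l). c k l"]) (simp add: case_prod_unfold)
qed

lemma mono_independent:
  assumes "(\<Sum>e\<in>{..<p} \<times> {..<p}. to_ac (c e) * mono e) = 0" and "e \<in> {..<p} \<times> {..<p}"
  shows "c e = 0"
proof -
  obtain k l where e: "e = (k, l)" "k < p" "l < p" using assms(2) by auto
  define Y where "Y k = (\<Sum>l<p. to_ac (c (k, l)) * mono (k, l))" for k
  have cm: "to_ac (c e) * mono e \<in> M" for e by (intro mult_M base_M mono_M)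
  have YM: "Y k \<in> M" for k unfolding Y_def by (rule fspaceD(4)[OF fspace_M cm])
  have "s (Y k) = to_ac (inverse \<zeta>) ^ k * Y k" for k
    unfolding Y_def flinearD(5)[OF fspace_M flinear_s cm] flinearD(3)[OF fspace_M flinear_s mono_M] s_mono
    by (simp add: sum_distrib_left mult_ac)
  moreover have "(\<Sum>k<p. Y k) = 0"
    using assms(1) unfolding Y_def by (simp add: sum.cartesian_product case_prod_unfold)
  ultimately have "Y k = 0"
    using eigen_indep[where Y = Y, OF fspace_M flinear_s prim_root_inverse[OF root] p_nz YM _ _ e(2)] by blast
  then have sum0: "(\<Sum>l<p. to_ac (c (k, l)) * mono (k, l)) = 0" by (simp add: Y_def)
  have "t (to_ac (c (k, l)) * mono (k, l)) = to_ac \<zeta> ^ l * (to_ac (c (k, l)) * mono (k, l))" for l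
    unfolding flinearD(3)[OF fspace_M flinear_t mono_M] t_mono by (simp add: mult_ac)
  then have "to_ac (c (k, l)) * mono (k, l) = 0"
    using eigen_indep[OF fspace_M flinear_t root p_nz cm _ sum0 e(3)] by blast
  then show ?thesis using mono_nz e(1) by simp
qed

definition coord :: "'a alg_closure \<Rightarrow> nat \<times> nat \<Rightarrow> 'a" where
  "coord m = (SOME c. m = (\<Sum>e\<in>{..<p} \<times> {..<p}. to_ac (c e) * mono e))"

lemma coord_sum: "m \<in> M \<Longrightarrow> m = (\<Sum>e\<in>{..<p} \<times> {..<p}. to_ac (coord m e) * mono e)"
  unfolding coord_def using someI_ex[OF coordinates_exist] .

lemma mono_comb_M: "(\<Sum>e\<in>S. to_ac (c e) * mono e) \<in> M"
  by (rule fspaceD(4)[OF fspace_M]) (intro mult_M base_M mono_M)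

lemma coord_unique:
  assumes "m = (\<Sum>e\<in>{..<p} \<times> {..<p}. to_ac (c e) * mono e)" "e \<in> {..<p} \<times> {..<p}"
  shows "coord m e = c e"
proof -
  have "m \<in> M" using assms(1) mono_comb_M by simp
  then have "(\<Sum>e\<in>{..<p} \<times> {..<p}. to_ac (coord m e - c e) * mono e) = 0"
    using coord_sum assms(1) by (simp add: left_diff_distrib sum_subtractf)
  from mono_independent[OF this assms(2)] show ?thesis by simp
qed

lemma coord_lincomb:
  assumes "\<And>i. i \<in> S \<Longrightarrow> v i \<in> M" "e \<in> {..<p} \<times> {..<p}"
  shows "coord (\<Sum>i\<in>S. to_ac (c i) * v i) e = (\<Sum>i\<in>S. c i * coord (v i) e)"
proof (rule coord_unique[OF _ assms(2)])
  have "(\<Sum>i\<in>S. to_ac (c i) * v i)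
      = (\<Sum>i\<in>S. to_ac (c i) * (\<Sum>e\<in>{..<p} \<times> {..<p}. to_ac (coord (v i) e) * mono e))"
    using coord_sum[OF assms(1)] by (intro sum.cong) auto
  also have "\<dots> = (\<Sum>e\<in>{..<p} \<times> {..<p}. to_ac (\<Sum>i\<in>S. c i * coord (v i) e) * mono e)"
    unfolding sum_distrib_left to_ac_sum sum_distrib_right to_ac_mult mult.assoc by (rule sum.swap)
  finally show "(\<Sum>i\<in>S. to_ac (c i) * v i)
      = (\<Sum>e\<in>{..<p} \<times> {..<p}. to_ac (\<Sum>i\<in>S. c i * coord (v i) e) * mono e)" .
qed

lemma coord_eq_0_iff:
  assumes "m \<in> M"
  shows "m = 0 \<longleftrightarrow> (\<forall>e\<in>{..<p} \<times> {..<p}. coord m e = 0)"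
proof
  assume "m = 0"
  then show "\<forall>e\<in>{..<p} \<times> {..<p}. coord m e = 0" using coord_unique[of m "\<lambda>_. 0"] by simp
next
  assume "\<forall>e\<in>{..<p} \<times> {..<p}. coord m e = 0"
  then have "(\<Sum>e\<in>{..<p} \<times> {..<p}. to_ac (coord m e) * mono e) = 0" by (intro sum.neutral) auto
  then show "m = 0" using coord_sum[OF assms] by simp
qed

end

section \<open>A solution of the equations makes the symbol algebras isomorphic\<close>

lemma commute_funpow:
  fixes z :: "'a::field"
  assumes V: "fspace V" and P: "flinear V P" and Q: "flinear V Q"
    and QP: "\<And>w. w \<in> V \<Longrightarrow> Q (P w) = to_ac z * P (Q w)" and w: "w \<in> V"
  shows "(Q ^^ l) ((P ^^ m) w) = to_ac (z ^ (l * m)) * (P ^^ m) ((Q ^^ l) w)"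
proof -
  have PV: "(P ^^ m) w \<in> V" and QV: "(Q ^^ m) w \<in> V" if "w \<in> V" for m w
    using flinearD(1)[OF V flinear_funpow[OF V P]] flinearD(1)[OF V flinear_funpow[OF V Q]] that by auto
  have 1: "Q ((P ^^ m) w) = to_ac (z ^ m) * (P ^^ m) (Q w)" if "w \<in> V" for w
  proof (induction m)
    case (Suc m)
    have "Q ((P ^^ Suc m) w) = to_ac z * P (Q ((P ^^ m) w))" using QP[OF PV[OF that]] by simp
    also have "\<dots> = to_ac z * (to_ac (z ^ m) * P ((P ^^ m) (Q w)))"
      unfolding Suc flinearD(3)[OF V P PV[OF flinearD(1)[OF V Q that]]] ..
    finally show ?case by (simp add: mult.assoc)
  qed simp
  show ?thesis
  proof (induction l)
    case (Suc l)
    have "(Q ^^ Suc l) ((P ^^ m) w) = Q (to_ac (z ^ (l * m)) * (P ^^ m) ((Q ^^ l) w))" using Suc by simp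
    also have "\<dots> = to_ac (z ^ (l * m)) * (to_ac (z ^ m) * (P ^^ m) (Q ((Q ^^ l) w)))"
      unfolding flinearD(3)[OF V Q PV[OF QV[OF w]]] 1[OF QV[OF w]] ..
    finally show ?case by (simp add: power_add mult_ac)
  qed simp
qed

lemma funpow_scalar_period:
  assumes V: "fspace V" and P: "flinear V P" and "\<And>w. w \<in> V \<Longrightarrow> (P ^^ p) w = to_ac u * w" and w: "w \<in> V"
  shows "(P ^^ (k + p)) w = to_ac u * (P ^^ k) w"
  using flinearD(3)[OF V flinear_funpow[OF V P] w] assms(3)[OF w] by (simp add: funpow_add)

text \<open>
  Maschke's argument. The projection is replaced by the average of its conjugates by \<open>G\<^sup>k\<close>, where the
  inverse of \<open>G\<^sup>k\<close> is \<open>G\<close> to the power \<open>p - k\<close> divided by \<open>g\<close>. The last conclusion says that averaging preserves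
  equivariance under an operator that commutes with \<open>G\<close> up to a root of unity; it allows averaging
  over two such operators in turn.
\<close>

lemma average_over_cyclic:
  fixes g h :: "'a::field"
  assumes V: "fspace V" and G: "flinear V G" and g: "g \<noteq> 0" "\<And>w. w \<in> V \<Longrightarrow> (G ^^ p) w = to_ac g * w"
    and p: "of_nat p \<noteq> (0::'a)" "p > 0"
    and U: "fspace U" "U \<subseteq> V" "\<And>w. w \<in> U \<Longrightarrow> G w \<in> U"
    and \<pi>: "flinear V \<pi>" "\<And>w. w \<in> V \<Longrightarrow> \<pi> w \<in> U" "\<And>w. w \<in> U \<Longrightarrow> \<pi> w = w"
  obtains \<pi>' where "flinear V \<pi>'" "\<And>w. w \<in> V \<Longrightarrow> \<pi>' w \<in> U" "\<And>w. w \<in> U \<Longrightarrow> \<pi>' w = w"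
    "\<And>w. w \<in> V \<Longrightarrow> \<pi>' (G w) = G (\<pi>' w)"
    "\<And>H h w. flinear V H \<Longrightarrow> (\<And>w. w \<in> V \<Longrightarrow> \<pi> (H w) = H (\<pi> w)) \<Longrightarrow>
       (\<And>w. w \<in> V \<Longrightarrow> H (G w) = to_ac h * G (H w)) \<Longrightarrow> h ^ p = 1 \<Longrightarrow> w \<in> V \<Longrightarrow> \<pi>' (H w) = H (\<pi>' w)"
proof -
  define c where "c = 1 / (of_nat p * g)"
  define T where "T w k = (G ^^ k) (\<pi> ((G ^^ (p - k)) w))" for w k
  define \<pi>' where "\<pi>' w = to_ac c * (\<Sum>k<p. T w k)" for w
  have GV: "(G ^^ k) w \<in> V" if "w \<in> V" for k w
    using flinearD(1)[OF V flinear_funpow[OF V G] that] .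
  have GU: "(G ^^ k) w \<in> U" if "w \<in> U" for k w using that U(3) by (induction k) auto
  have \<pi>V: "\<pi> w \<in> V" if "w \<in> V" for w using \<pi>(2) U(2) that by auto
  have TU: "T w k \<in> U" if "w \<in> V" for w k unfolding T_def by (intro GU \<pi>(2) GV that)
  then have TV: "T w k \<in> V" if "w \<in> V" for w k using U(2) that by auto
  note GL = flinearD[OF V flinear_funpow[OF V G]] and PL = flinearD[OF V \<pi>(1)]
  have Tadd: "T (x + y) k = T x k + T y k" if "x \<in> V" "y \<in> V" for x y k
    unfolding T_def by (simp add: GL(2) PL(2) GV \<pi>V that)
  have Tscale: "T (to_ac e * x) k = to_ac e * T x k" if "x \<in> V" for x e k
    unfolding T_def by (simp add: GL(3) PL(3) GV \<pi>V that)
  have "flinear V \<pi>'"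
  proof (rule flinearI)
    fix x assume x: "x \<in> V"
    show "\<pi>' x \<in> V" unfolding \<pi>'_def by (intro fspaceD(3,4)[OF V] TV x)
    show "\<pi>' (to_ac e * x) = to_ac e * \<pi>' x" for e
      unfolding \<pi>'_def Tscale[OF x] sum_distrib_left by (simp only: mult.left_commute)
    fix y assume y: "y \<in> V"
    show "\<pi>' (x + y) = \<pi>' x + \<pi>' y"
      unfolding \<pi>'_def by (simp add: Tadd[OF x y] sum.distrib distrib_left)
  qed
  moreover have "\<pi>' w \<in> U" if "w \<in> V" for w
    unfolding \<pi>'_def by (intro fspaceD(3,4)[OF U(1)] TU that)
  moreover have "\<pi>' w = w" if w: "w \<in> U" for w
  proof -
    have "T w k = to_ac g * w" if "k < p" for k
    proof -
      have "T w k = (G ^^ k) ((G ^^ (p - k)) w)" unfolding T_def by (simp add: \<pi>(3) GU w)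
      also have "\<dots> = (G ^^ (k + (p - k))) w" by (simp only: funpow_add o_apply)
      finally show ?thesis using that g(2) w U(2) by auto
    qed
    then have "\<pi>' w = to_ac (c * (of_nat p * g)) * w" by (simp add: \<pi>'_def)
    also have "c * (of_nat p * g) = 1" using p(1) g(1) by (simp add: c_def)
    finally show ?thesis by simp
  qed
  moreover have "\<pi>' (G w) = G (\<pi>' w)" if w: "w \<in> V" for w
  proof -
    define S where "S k = (G ^^ k) (\<pi> ((G ^^ (p + 1 - k)) w))" for k
    have "T (G w) k = S k" if "k < p" for k
    proof -
      have "(G ^^ (p - k)) (G w) = (G ^^ (p + 1 - k)) w"
        using that by (simp add: Suc_diff_le less_imp_le funpow_swap1)
      then show ?thesis by (simp add: T_def S_def)
    qed
    moreover have "G (T w k) = S (Suc k)" if "k < p" for k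
      using that by (simp add: T_def S_def)
    moreover have "S p = S 0"
    proof -
      have "S p = to_ac g * \<pi> (G w)" unfolding S_def using g(2)[OF \<pi>V[OF GV[OF w, of 1]]] by simp
      moreover have "(G ^^ (p + 1)) w = to_ac g * G w"
        using g(2)[OF GV[OF w, of 1]] by (simp add: funpow_swap1)
      ultimately show ?thesis unfolding S_def using PL(3)[OF GV[OF w, of 1]] by simp
    qed
    ultimately have eq: "(\<Sum>k<p. T (G w) k) = (\<Sum>k<p. G (T w k))"
      using sum_lessThan_cyclic_shift[of S p] by simp
    have "G (\<pi>' w) = to_ac c * (\<Sum>k<p. G (T w k))"
      unfolding \<pi>'_def flinearD(3)[OF V G fspaceD(4)[OF V TV[OF w]]] flinearD(5)[OF V G TV[OF w]] ..
    then show ?thesis unfolding \<pi>'_def eq by simp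
  qed
  moreover have "\<pi>' (H w) = H (\<pi>' w)"
    if H: "flinear V H" and com: "\<And>w. w \<in> V \<Longrightarrow> \<pi> (H w) = H (\<pi> w)"
      and HG: "\<And>w. w \<in> V \<Longrightarrow> H (G w) = to_ac h * G (H w)" and h: "h ^ p = 1" and w: "w \<in> V" for H h w
  proof -
    have HGk: "H ((G ^^ k) w) = to_ac (h ^ k) * (G ^^ k) (H w)" if "w \<in> V" for k w
      using commute_funpow[OF V G H HG that, of 1 k] by simp
    have HV: "H w \<in> V" using flinearD(1)[OF V H w] .
    have "H (T w k) = T (H w) k" if "k < p" for k
    proof -
      have "H (T w k) = to_ac (h ^ k) * (G ^^ k) (\<pi> (H ((G ^^ (p - k)) w)))"
        unfolding T_def HGk[OF \<pi>V[OF GV[OF w]]] com[OF GV[OF w]] ..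
      also have "\<dots> = to_ac (h ^ k) * (to_ac (h ^ (p - k)) * T (H w) k)"
        unfolding HGk[OF w] T_def PL(3)[OF GV[OF HV]] GL(3)[OF \<pi>V[OF GV[OF HV]]] ..
      also have "\<dots> = to_ac (h ^ k * h ^ (p - k)) * T (H w) k" by (simp only: to_ac_mult mult.assoc)
      also have "h ^ k * h ^ (p - k) = 1" using that h by (simp flip: power_add)
      finally show ?thesis by simp
    qed
    then show ?thesis
      unfolding \<pi>'_def flinearD(3)[OF V H fspaceD(4)[OF V TV[OF w]]] flinearD(5)[OF V H TV[OF w]] by simp
  qed
  ultimately show ?thesis by (rule that)
qed

lemma subspace_projection:
  fixes U :: "'a::field alg_closure set"
  assumes U: "fspace U"
  obtains \<pi> where "flinear UNIV \<pi>" "\<And>w. \<pi> w \<in> U" "\<And>w. w \<in> U \<Longrightarrow> \<pi> w = w"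
proof -
  let ?sc = "\<lambda>(c::'a) y. to_ac c * y"
  interpret vector_space_pair ?sc ?sc
    by (intro vector_space_pair.intro vector_space_to_ac)
  have id: "Vector_Spaces.linear ?sc ?sc id"
    by (intro Vector_Spaces.linear.intro vector_space_pair_axioms vector_space_to_ac
        module_hom.intro module_hom_axioms.intro vs1.module_axioms) auto
  have "vs1.subspace U" using U by (auto simp: vs1.subspace_def fspace_def)
  from linear_exists_left_inverse_on[OF id this] obtain g where
    g: "range g \<subseteq> U" "Vector_Spaces.linear ?sc ?sc g" "\<And>v. v \<in> U \<Longrightarrow> g v = v" by auto
  have "flinear UNIV g"
    using Vector_Spaces.linear.axioms(3)[OF g(2)] unfolding flinear_def module_hom_def module_hom_axioms_def
    by auto
  then show ?thesis using that g by blast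
qed

text \<open>
  The system of equations to which both sides of the theorem are reduced.
\<close>

locale bicyclic_solution = bicyclic +
  fixes x y :: "'a alg_closure" and a c :: 'a
  assumes a_nz: "a \<noteq> 0" and c_nz: "c \<noteq> 0"
    and x_M: "x \<in> M" and y_M: "y \<in> M"
    and x_norm: "(\<Prod>k<p. (s ^^ k) x) = to_ac a" and y_norm: "(\<Prod>k<p. (t ^^ k) y) = to_ac c"
    and xy: "x * s y = y * t x"
begin

text \<open>
  The generators \<open>i, j\<close> of \<open>(a, b)_p\<close> as left operators on \<open>M\<close>, and the generators \<open>i, j\<close> of \<open>(c, d)_p\<close> as
  right operators. The norm equations give the \<open>p\<close>-th powers, and \<open>x s(y) = y t(x)\<close> says that \<open>li\<close> and
  \<open>ri\<close> commute.
\<close>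

definition li :: "'a alg_closure \<Rightarrow> 'a alg_closure" where "li m = x * s m"
definition lj :: "'a alg_closure \<Rightarrow> 'a alg_closure" where "lj m = \<beta> * m"
definition ri :: "'a alg_closure \<Rightarrow> 'a alg_closure" where "ri m = y * t m"
definition rj :: "'a alg_closure \<Rightarrow> 'a alg_closure" where "rj m = \<delta> * m"

lemma flinear_ops: "flinear M li" "flinear M lj" "flinear M ri" "flinear M rj"
  by (intro flinearI; simp add: li_def lj_def ri_def rj_def s_M t_M mult_M x_M y_M \<beta>_M \<delta>_M
      s_add t_add s_mult t_mult base_M s_base t_base distrib_left mult.left_commute)+

lemma funpow_M: "m \<in> M \<Longrightarrow> (li ^^ k) m \<in> M" "m \<in> M \<Longrightarrow> (lj ^^ k) m \<in> M"
    "m \<in> M \<Longrightarrow> (ri ^^ k) m \<in> M" "m \<in> M \<Longrightarrow> (rj ^^ k) m \<in> M"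
  using flinear_funpow[OF fspace_M flinear_ops(1)] flinear_funpow[OF fspace_M flinear_ops(2)]
    flinear_funpow[OF fspace_M flinear_ops(3)] flinear_funpow[OF fspace_M flinear_ops(4)]
  by (auto simp: flinear_def)

lemma st_funpow_M: "m \<in> M \<Longrightarrow> (s ^^ k) m \<in> M" "m \<in> M \<Longrightarrow> (t ^^ k) m \<in> M"
  by (induction k) (auto simp: s_M t_M)

lemma prod_M: "(\<And>q. f q \<in> M) \<Longrightarrow> (\<Prod>q<(k::nat). f q) \<in> M"
  by (induction k) (auto simp: one_M mult_M)

lemma s_prod: "(\<And>q. f q \<in> M) \<Longrightarrow> s (\<Prod>q<(k::nat). f q) = (\<Prod>q<k. s (f q))"
  and t_prod: "(\<And>q. f q \<in> M) \<Longrightarrow> t (\<Prod>q<(k::nat). f q) = (\<Prod>q<k. t (f q))"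
proof -
  show "(\<And>q. f q \<in> M) \<Longrightarrow> s (\<Prod>q<(k::nat). f q) = (\<Prod>q<k. s (f q))"
    using s_base[of 1] by (induction k) (auto simp: s_mult prod_M)
  show "(\<And>q. f q \<in> M) \<Longrightarrow> t (\<Prod>q<(k::nat). f q) = (\<Prod>q<k. t (f q))"
    using t_base[of 1] by (induction k) (auto simp: t_mult prod_M)
qed

lemma li_funpow: "m \<in> M \<Longrightarrow> (li ^^ k) m = (\<Prod>q<k. (s ^^ q) x) * (s ^^ k) m"
proof (induction k)
  case (Suc k)
  have "(li ^^ Suc k) m = x * s ((\<Prod>q<k. (s ^^ q) x) * (s ^^ k) m)" using Suc by (simp only: funpow.simps o_apply li_def[of "_ * _"])
  also have "\<dots> = (x * (\<Prod>q<k. (s ^^ Suc q) x)) * (s ^^ Suc k) m"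
    using Suc.prems by (simp add: s_mult s_prod prod_M st_funpow_M x_M)
  also have "x * (\<Prod>q<k. (s ^^ Suc q) x) = (\<Prod>q<Suc k. (s ^^ q) x)"
    by (simp only: prod.lessThan_Suc_shift funpow_0)
  finally show ?case .
qed simp

lemma ri_funpow: "m \<in> M \<Longrightarrow> (ri ^^ k) m = (\<Prod>q<k. (t ^^ q) y) * (t ^^ k) m"
proof (induction k)
  case (Suc k)
  have "(ri ^^ Suc k) m = y * t ((\<Prod>q<k. (t ^^ q) y) * (t ^^ k) m)" using Suc by (simp only: funpow.simps o_apply ri_def[of "_ * _"])
  also have "\<dots> = (y * (\<Prod>q<k. (t ^^ Suc q) y)) * (t ^^ Suc k) m"
    using Suc.prems by (simp add: t_mult t_prod prod_M st_funpow_M y_M)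
  also have "y * (\<Prod>q<k. (t ^^ Suc q) y) = (\<Prod>q<Suc k. (t ^^ q) y)"
    by (simp only: prod.lessThan_Suc_shift funpow_0)
  finally show ?case .
qed simp

lemma lj_funpow: "(lj ^^ k) m = \<beta> ^ k * m" and rj_funpow: "(rj ^^ k) m = \<delta> ^ k * m"
  by (induction k) (simp_all add: lj_def rj_def mult.assoc)

lemma ops_order: "m \<in> M \<Longrightarrow> (li ^^ p) m = to_ac a * m" "m \<in> M \<Longrightarrow> (lj ^^ p) m = to_ac b * m"
   "m \<in> M \<Longrightarrow> (ri ^^ p) m = to_ac c * m" "m \<in> M \<Longrightarrow> (rj ^^ p) m = to_ac d * m"
  by (simp_all add: li_funpow ri_funpow lj_funpow rj_funpow x_norm y_norm s_order t_order \<beta>_pow \<delta>_pow)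

lemma ops_commute:
  assumes "m \<in> M"
  shows "lj (li m) = to_ac \<zeta> * li (lj m)" "ri (rj m) = to_ac \<zeta> * rj (ri m)"
    "li (ri m) = ri (li m)" "li (rj m) = rj (li m)" "lj (ri m) = ri (lj m)" "lj (rj m) = rj (lj m)"
proof -
  show "lj (li m) = to_ac \<zeta> * li (lj m)" "ri (rj m) = to_ac \<zeta> * rj (ri m)"
    using assms \<zeta>_nz by (simp_all add: li_def lj_def ri_def rj_def s_mult t_mult \<beta>_M \<delta>_M s_\<beta> t_\<delta>)
  have "li (ri m) = (x * s y) * s (t m)" by (simp add: li_def ri_def s_mult t_mult assms y_M t_M)
  also have "\<dots> = ri (li m)" using assms by (simp add: xy li_def ri_def t_mult x_M s_M st_commute)
  finally show "li (ri m) = ri (li m)" .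
  show "li (rj m) = rj (li m)" "lj (ri m) = ri (lj m)" "lj (rj m) = rj (lj m)"
    using assms by (simp_all add: li_def lj_def ri_def rj_def s_mult t_mult \<beta>_M \<delta>_M s_\<delta> t_\<beta>)
qed

lemma ops_inj: "m \<in> M \<Longrightarrow> (li ^^ k) m = 0 \<Longrightarrow> k \<le> p \<Longrightarrow> m = 0"
  "m \<in> M \<Longrightarrow> (ri ^^ k) m = 0 \<Longrightarrow> k \<le> p \<Longrightarrow> m = 0"
proof -
  assume m: "m \<in> M" and k: "k \<le> p"
  {
    assume "(li ^^ k) m = 0"
    then have "(li ^^ (p - k)) ((li ^^ k) m) = 0"
      using flinearD(4)[OF fspace_M flinear_funpow[OF fspace_M flinear_ops(1)]] by simp
    also have "(li ^^ (p - k)) ((li ^^ k) m) = (li ^^ ((p - k) + k)) m" by (simp only: funpow_add o_apply)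
    finally show "m = 0" using k m a_nz by (simp add: ops_order)
  next
    assume "(ri ^^ k) m = 0"
    then have "(ri ^^ (p - k)) ((ri ^^ k) m) = 0"
      using flinearD(4)[OF fspace_M flinear_funpow[OF fspace_M flinear_ops(3)]] by simp
    also have "(ri ^^ (p - k)) ((ri ^^ k) m) = (ri ^^ ((p - k) + k)) m" by (simp only: funpow_add o_apply)
    finally show "m = 0" using k m c_nz by (simp add: ops_order)
  }
qed

definition lact :: "(nat \<times> nat \<Rightarrow> 'a) \<Rightarrow> 'a alg_closure \<Rightarrow> 'a alg_closure" where
  "lact f m = (\<Sum>(k, l)\<in>{..<p} \<times> {..<p}. to_ac (f (k, l)) * (li ^^ k) ((lj ^^ l) m))"

text \<open>
  For a right action the product \<open>i\<^sup>k j\<^sup>l\<close> applies the powers of \<open>i\<close> first.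
\<close>

definition ract :: "(nat \<times> nat \<Rightarrow> 'a) \<Rightarrow> 'a alg_closure \<Rightarrow> 'a alg_closure" where
  "ract g m = (\<Sum>(k, l)\<in>{..<p} \<times> {..<p}. to_ac (g (k, l)) * (rj ^^ l) ((ri ^^ k) m))"

lemma lact_M: "m \<in> M \<Longrightarrow> lact f m \<in> M" and ract_M: "m \<in> M \<Longrightarrow> ract f m \<in> M"
  unfolding lact_def ract_def case_prod_unfold
  by (intro fspaceD(4)[OF fspace_M] mult_M base_M funpow_M; assumption)+

lemma flinear_lact: "flinear M (lact f)" and flinear_ract: "flinear M (ract f)"
proof -
  note L = flinearD[OF fspace_M flinear_funpow[OF fspace_M]]
  show "flinear M (lact f)"
  proof (rule flinearI)
    fix m m' k assume m: "m \<in> M"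
    show "lact f m \<in> M" by (rule lact_M[OF m])
    show "lact f (to_ac k * m) = to_ac k * lact f m"
      unfolding lact_def case_prod_unfold sum_distrib_left
      by (intro sum.cong refl) (simp add: L(3)[OF flinear_ops(2) m] L(3)[OF flinear_ops(1) funpow_M(2)[OF m]] mult.left_commute)
    assume m': "m' \<in> M"
    show "lact f (m + m') = lact f m + lact f m'"
      unfolding lact_def case_prod_unfold sum.distrib[symmetric]
      by (intro sum.cong refl) (simp add: L(2)[OF flinear_ops(2) m m'] 
          L(2)[OF flinear_ops(1) funpow_M(2)[OF m] funpow_M(2)[OF m']] distrib_left)
  qed
  show "flinear M (ract f)"
  proof (rule flinearI)
    fix m m' k assume m: "m \<in> M"
    show "ract f m \<in> M" by (rule ract_M[OF m])
    show "ract f (to_ac k * m) = to_ac k * ract f m"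
      unfolding ract_def case_prod_unfold sum_distrib_left
      by (intro sum.cong refl) (simp add: L(3)[OF flinear_ops(3) m] L(3)[OF flinear_ops(4) funpow_M(3)[OF m]] mult.left_commute)
    assume m': "m' \<in> M"
    show "ract f (m + m') = ract f m + ract f m'"
      unfolding ract_def case_prod_unfold sum.distrib[symmetric]
      by (intro sum.cong refl) (simp add: L(2)[OF flinear_ops(3) m m'] 
          L(2)[OF flinear_ops(4) funpow_M(3)[OF m] funpow_M(3)[OF m']] distrib_left)
  qed
qed

lemma lact_symbol_mult:
  assumes m: "m \<in> M"
  shows "lact (symbol_mult p \<zeta> a b f g) m = lact f (lact g m)"
proof -
  let ?P = "{..<p} \<times> {..<p}"
  define \<Phi> where "\<Phi> k l = (li ^^ k) ((lj ^^ l) m)" for k l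
  have u: "\<Phi> (k + p) l = to_ac a * \<Phi> k l" for k l
    unfolding \<Phi>_def by (rule funpow_scalar_period[OF fspace_M flinear_ops(1) ops_order(1) funpow_M(2)[OF m]])
  have v: "\<Phi> k (l + p) = to_ac b * \<Phi> k l" for k l
  proof -
    have 1: "(lj ^^ (l + p)) m = to_ac b * (lj ^^ l) m"
      by (rule funpow_scalar_period[OF fspace_M flinear_ops(2) ops_order(2) m])
    show ?thesis unfolding \<Phi>_def 1
      by (rule flinearD(3)[OF fspace_M flinear_funpow[OF fspace_M flinear_ops(1)] funpow_M(2)[OF m]])
  qed
  have word: "(li ^^ k) ((lj ^^ l) (\<Phi> k' l')) = to_ac (\<zeta> ^ (l * k')) * \<Phi> (k + k') (l + l')" for k l k' l'
  proof -
    have "(lj ^^ l) (\<Phi> k' l') = to_ac (\<zeta> ^ (l * k')) * (li ^^ k') ((lj ^^ l) ((lj ^^ l') m))"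
      unfolding \<Phi>_def
      by (rule commute_funpow[OF fspace_M flinear_ops(1,2) ops_commute(1) funpow_M(2)[OF m]])
    also have "(lj ^^ l) ((lj ^^ l') m) = (lj ^^ (l + l')) m" by (simp add: funpow_add)
    finally have eq: "(lj ^^ l) (\<Phi> k' l') = to_ac (\<zeta> ^ (l * k')) * (li ^^ k') ((lj ^^ (l + l')) m)" .
    show ?thesis
      unfolding eq flinearD(3)[OF fspace_M flinear_funpow[OF fspace_M flinear_ops(1)] funpow_M(1)[OF funpow_M(2)[OF m]]]
      by (simp add: \<Phi>_def funpow_add)
  qed
  have \<Phi>M: "\<Phi> k l \<in> M" for k l unfolding \<Phi>_def by (intro funpow_M m)
  have "lact f (lact g m) = (\<Sum>(k, l)\<in>?P. to_ac (f (k, l)) * (\<Sum>(k', l')\<in>?P. to_ac (g (k', l')) *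
      (li ^^ k) ((lj ^^ l) (\<Phi> k' l'))))"
    unfolding lact_def[of f]
  proof (intro sum.cong refl, clarify)
    fix k l
    note A = flinear_funpow[OF fspace_M flinear_ops(1), of k] and B = flinear_funpow[OF fspace_M flinear_ops(2), of l]
    have "(li ^^ k) ((lj ^^ l) (lact g m)) = (\<Sum>(k', l')\<in>?P. to_ac (g (k', l')) * (li ^^ k) ((lj ^^ l) (\<Phi> k' l')))"
      unfolding lact_def \<Phi>_def[symmetric] case_prod_unfold
      by (simp add: flinearD(5)[OF fspace_M B] flinearD(5)[OF fspace_M A] flinearD(3)[OF fspace_M B]
          flinearD(3)[OF fspace_M A] funpow_M mult_M base_M \<Phi>M)
    then show "to_ac (f (k, l)) * (li ^^ k) ((lj ^^ l) (lact g m)) = to_ac (f (k, l)) *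
      (\<Sum>(k', l')\<in>?P. to_ac (g (k', l')) * (li ^^ k) ((lj ^^ l) (\<Phi> k' l')))" by simp
  qed
  also have "\<dots> = (\<Sum>(k, l)\<in>?P. \<Sum>(k', l')\<in>?P. to_ac (f (k, l) * g (k', l') * \<zeta> ^ (l * k')) * \<Phi> (k + k') (l + l'))"
    unfolding word by (simp add: sum_distrib_left case_prod_unfold mult.assoc)
  also have "\<dots> = lact (symbol_mult p \<zeta> a b f g) m"
    unfolding lact_def \<Phi>_def[symmetric]
    using vector_space.symbol_product_sum[OF vector_space_to_ac, of p \<Phi> a b \<zeta> f g, OF p_pos u v] by simp
  finally show ?thesis by simp
qed

lemma ract_symbol_mult:
  assumes m: "m \<in> M"
  shows "ract (symbol_mult p \<zeta> c d f g) m = ract g (ract f m)"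
proof -
  let ?P = "{..<p} \<times> {..<p}"
  define \<Phi> where "\<Phi> k l = (rj ^^ l) ((ri ^^ k) m)" for k l
  have v: "\<Phi> k (l + p) = to_ac d * \<Phi> k l" for k l
    unfolding \<Phi>_def by (rule funpow_scalar_period[OF fspace_M flinear_ops(4) ops_order(4) funpow_M(3)[OF m]])
  have u: "\<Phi> (k + p) l = to_ac c * \<Phi> k l" for k l
  proof -
    have 1: "(ri ^^ (k + p)) m = to_ac c * (ri ^^ k) m"
      by (rule funpow_scalar_period[OF fspace_M flinear_ops(3) ops_order(3) m])
    show ?thesis unfolding \<Phi>_def 1
      by (rule flinearD(3)[OF fspace_M flinear_funpow[OF fspace_M flinear_ops(4)] funpow_M(3)[OF m]])
  qed
  have word: "(rj ^^ l) ((ri ^^ k) (\<Phi> k' l')) = to_ac (\<zeta> ^ (l' * k)) * \<Phi> (k' + k) (l' + l)" for k l k' l'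
  proof -
    have "(ri ^^ k) (\<Phi> k' l') = to_ac (\<zeta> ^ (k * l')) * (rj ^^ l') ((ri ^^ k) ((ri ^^ k') m))"
      unfolding \<Phi>_def
      by (rule commute_funpow[OF fspace_M flinear_ops(4,3) ops_commute(2) funpow_M(3)[OF m]])
    also have "(ri ^^ k) ((ri ^^ k') m) = (ri ^^ (k' + k)) m" by (simp add: funpow_add add.commute[of k'])
    finally have eq: "(ri ^^ k) (\<Phi> k' l') = to_ac (\<zeta> ^ (k * l')) * (rj ^^ l') ((ri ^^ (k' + k)) m)" .
    show ?thesis
      unfolding eq flinearD(3)[OF fspace_M flinear_funpow[OF fspace_M flinear_ops(4)] funpow_M(4)[OF funpow_M(3)[OF m]]]
      by (simp add: \<Phi>_def funpow_add add.commute[of l'] mult.commute[of k])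
  qed
  have \<Phi>M: "\<Phi> k l \<in> M" for k l unfolding \<Phi>_def by (intro funpow_M m)
  have "ract g (ract f m) = (\<Sum>(k, l)\<in>?P. to_ac (g (k, l)) * (\<Sum>(k', l')\<in>?P. to_ac (f (k', l')) *
      (rj ^^ l) ((ri ^^ k) (\<Phi> k' l'))))"
    unfolding ract_def[of g]
  proof (intro sum.cong refl, clarify)
    fix k l
    note A = flinear_funpow[OF fspace_M flinear_ops(4), of l] and B = flinear_funpow[OF fspace_M flinear_ops(3), of k]
    have "(rj ^^ l) ((ri ^^ k) (ract f m)) = (\<Sum>(k', l')\<in>?P. to_ac (f (k', l')) * (rj ^^ l) ((ri ^^ k) (\<Phi> k' l')))"
      unfolding ract_def \<Phi>_def[symmetric] case_prod_unfold
      by (simp add: flinearD(5)[OF fspace_M B] flinearD(5)[OF fspace_M A] flinearD(3)[OF fspace_M B]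
          flinearD(3)[OF fspace_M A] funpow_M mult_M base_M \<Phi>M)
    then show "to_ac (g (k, l)) * (rj ^^ l) ((ri ^^ k) (ract f m)) = to_ac (g (k, l)) *
      (\<Sum>(k', l')\<in>?P. to_ac (f (k', l')) * (rj ^^ l) ((ri ^^ k) (\<Phi> k' l')))" by simp
  qed
  also have "\<dots> = (\<Sum>(k, l)\<in>?P. \<Sum>(k', l')\<in>?P. to_ac (f (k', l') * g (k, l) * \<zeta> ^ (l' * k)) * \<Phi> (k' + k) (l' + l))"
    unfolding word by (simp add: sum_distrib_left case_prod_unfold mult_ac)
  also have "\<dots> = (\<Sum>(k', l')\<in>?P. \<Sum>(k, l)\<in>?P. to_ac (f (k', l') * g (k, l) * \<zeta> ^ (l' * k)) * \<Phi> (k' + k) (l' + l))"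
    unfolding case_prod_unfold by (rule sum.swap)
  also have "\<dots> = ract (symbol_mult p \<zeta> c d f g) m"
    unfolding ract_def \<Phi>_def[symmetric]
    using vector_space.symbol_product_sum[OF vector_space_to_ac, of p \<Phi> c d \<zeta> f g, OF p_pos u v] by simp
  finally show ?thesis by simp
qed

lemma lact_ract_commute:
  assumes m: "m \<in> M"
  shows "ract g (lact f m) = lact f (ract g m)"
proof -
  let ?P = "{..<p} \<times> {..<p}"
  have comm: "(Q ^^ l) ((R ^^ k) w) = (R ^^ k) ((Q ^^ l) w)"
    if "flinear M R" "flinear M Q" "\<And>w. w \<in> M \<Longrightarrow> Q (R w) = R (Q w)" "w \<in> M" for R Q k l w
    using commute_funpow[OF fspace_M that(1,2), of 1 w l k] that(3,4) by simp
  have li_ract: "li (ract g w) = ract g (li w)" and lj_ract: "lj (ract g w) = ract g (lj w)" if w: "w \<in> M" for w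
  proof -
    have 1: "R (ract g w) = ract g (R w)" if R: "flinear M R" "\<And>w. w \<in> M \<Longrightarrow> R (ri w) = ri (R w)"
      "\<And>w. w \<in> M \<Longrightarrow> R (rj w) = rj (R w)" for R
    proof -
      have "R ((rj ^^ l) ((ri ^^ k) w)) = (rj ^^ l) ((ri ^^ k) (R w))" for k l
        using comm[where l = 1, OF flinear_ops(4) R(1) R(3) funpow_M(3)[OF w]] comm[where l = 1, OF flinear_ops(3) R(1) R(2) w]
        by simp
      then show ?thesis unfolding ract_def case_prod_unfold
        by (simp add: flinearD(5)[OF fspace_M R(1)] flinearD(3)[OF fspace_M R(1)] mult_M base_M funpow_M w)
    qed
    show "li (ract g w) = ract g (li w)" "lj (ract g w) = ract g (lj w)"
      by (rule 1[OF flinear_ops(1) ops_commute(3,4)] 1[OF flinear_ops(2) ops_commute(5,6)]; assumption)+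
  qed
  have word: "ract g ((li ^^ k) ((lj ^^ l) m)) = (li ^^ k) ((lj ^^ l) (ract g m))" for k l
    using comm[where l = 1, OF flinear_ops(1) flinear_ract li_ract[symmetric] funpow_M(2)[OF m]]
      comm[where l = 1, OF flinear_ops(2) flinear_ract lj_ract[symmetric] m] by simp
  show ?thesis
    unfolding lact_def case_prod_unfold
    by (simp add: flinearD(5)[OF fspace_M flinear_ract] flinearD(3)[OF fspace_M flinear_ract]
         mult_M base_M funpow_M m word)
qed

end

context bicyclic_solution
begin

lemma lact_basis:
  assumes "k < p" "l < p"
  shows "lact (symbol_basis p (k, l)) m = (li ^^ k) ((lj ^^ l) m)"
proof -
  have "lact (symbol_basis p (k, l)) m
    = (\<Sum>e\<in>{..<p} \<times> {..<p}. if e = (k, l) then (li ^^ fst e) ((lj ^^ snd e) m) else 0)"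
    unfolding lact_def case_prod_unfold by (intro sum.cong) (auto simp: symbol_basis_def)
  then show ?thesis using assms by (simp add: sum.delta)
qed

lemma lact_cong: "(\<And>e. e \<in> {..<p} \<times> {..<p} \<Longrightarrow> f e = f' e) \<Longrightarrow> lact f m = lact f' m"
  and ract_cong: "(\<And>e. e \<in> {..<p} \<times> {..<p} \<Longrightarrow> f e = f' e) \<Longrightarrow> ract f m = ract f' m"
  unfolding lact_def ract_def by (auto intro!: sum.cong)

lemma lact_add: "lact (\<lambda>e. f e + f' e) m = lact f m + lact f' m"
  and ract_add: "ract (\<lambda>e. f e + f' e) m = ract f m + ract f' m"
  unfolding lact_def ract_def by (simp_all add: sum.distrib case_prod_unfold distrib_right)

lemma lact_scale: "lact (\<lambda>e. k * f e) m = to_ac k * lact f m"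
  and ract_scale: "ract (\<lambda>e. k * f e) m = to_ac k * ract f m"
  unfolding lact_def ract_def by (simp_all add: sum_distrib_left case_prod_unfold mult.assoc)

text \<open>
  Multiplying \<open>c0\<close> by \<open>\<beta>\<^sup>r\<close> multiplies the contribution of \<open>i\<^sup>k\<close> by \<open>\<zeta>\<close> to the power \<open>- k r\<close>, so Fourier inversion
  over \<open>r\<close> isolates each \<open>k\<close>. What remains is a polynomial in \<open>\<beta>\<close> of degree less than \<open>p\<close>.
\<close>

lemma lact_faithful:
  assumes c0: "c0 \<in> M" "c0 \<noteq> 0" and 0: "\<And>r. r < p \<Longrightarrow> lact f (\<beta> ^ r * c0) = 0"
    and e: "e \<in> {..<p} \<times> {..<p}"
  shows "f e = 0"
proof -
  note A = flinear_funpow[OF fspace_M flinear_ops(1)]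
  obtain k0 l0 where kl: "e = (k0, l0)" "k0 < p" "l0 < p" using e by auto
  define q where "q k = (\<Sum>l<p. to_ac (f (k, l)) * \<beta> ^ l)" for k
  have qM: "q k \<in> M" for k unfolding q_def by (intro fspaceD(4)[OF fspace_M] mult_M base_M power_M \<beta>_M)
  define Y where "Y k = (li ^^ k) (q k * c0)" for k
  have 1: "(li ^^ k) (\<beta> ^ r * w) = to_ac (inverse \<zeta> ^ (k * r)) * (\<beta> ^ r * (li ^^ k) w)" if "w \<in> M" for k r w
  proof -
    have "to_ac (inverse \<zeta> ^ (k * r)) * (\<beta> ^ r * (li ^^ k) w)
        = to_ac (inverse \<zeta> ^ (k * r) * \<zeta> ^ (r * k)) * (li ^^ k) (\<beta> ^ r * w)"
      using commute_funpow[OF fspace_M flinear_ops(1,2) ops_commute(1) that, of r k]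
      unfolding lj_funpow by (simp only: to_ac_mult mult.assoc)
    also have "inverse \<zeta> ^ (k * r) * \<zeta> ^ (r * k) = 1"
      using \<zeta>_nz by (simp add: mult.commute[of r] flip: power_mult_distrib)
    finally show ?thesis by simp
  qed
  have "(\<Sum>k<p. to_ac (inverse \<zeta> ^ (k * r)) * Y k) = 0" if r: "r < p" for r
  proof -
    have "(li ^^ k) (q k * (\<beta> ^ r * c0)) = (\<Sum>l<p. to_ac (f (k, l)) * (li ^^ k) ((lj ^^ l) (\<beta> ^ r * c0)))" for k
      unfolding q_def sum_distrib_right lj_funpow
      by (simp add: flinearD(5)[OF fspace_M A] flinearD(3)[OF fspace_M A] mult.assoc mult_M base_M power_M \<beta>_M c0)
    then have "lact f (\<beta> ^ r * c0) = (\<Sum>k<p. (li ^^ k) (q k * (\<beta> ^ r * c0)))"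
      unfolding lact_def by (simp add: sum.cartesian_product)
    also have "\<dots> = (\<Sum>k<p. to_ac (inverse \<zeta> ^ (k * r)) * (\<beta> ^ r * Y k))"
    proof (intro sum.cong refl)
      fix k
      have "(li ^^ k) (q k * (\<beta> ^ r * c0)) = (li ^^ k) (\<beta> ^ r * (q k * c0))" by (simp add: mult.left_commute)
      then show "(li ^^ k) (q k * (\<beta> ^ r * c0)) = to_ac (inverse \<zeta> ^ (k * r)) * (\<beta> ^ r * Y k)"
        unfolding Y_def using 1[OF mult_M[OF qM c0(1)]] by simp
    qed
    also have "\<dots> = \<beta> ^ r * (\<Sum>k<p. to_ac (inverse \<zeta> ^ (k * r)) * Y k)"
      unfolding sum_distrib_left by (simp only: mult.left_commute)
    finally show ?thesis using 0[OF r] \<beta>_nz by simp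
  qed
  then have "Y k0 = 0" by (rule dft_eq_0[OF prim_root_inverse[OF root] p_nz _ kl(2)])
  then have "q k0 * c0 = 0" unfolding Y_def using ops_inj(1)[OF mult_M[OF qM c0(1)]] kl(2) by simp
  then have q0: "q k0 = 0" using c0 by simp
  have "(\<Sum>e\<in>{..<p} \<times> {..<p}. to_ac (if snd e = 0 then f (k0, fst e) else 0) * mono e) = q k0"
  proof -
    have "(\<Sum>e\<in>{..<p} \<times> {..<p}. to_ac (if snd e = 0 then f (k0, fst e) else 0) * mono e)
      = (\<Sum>l<p. \<Sum>n<p. if n = 0 then to_ac (f (k0, l)) * \<beta> ^ l else 0)"
      unfolding sum.cartesian_product case_prod_unfold by (intro sum.cong) (auto simp: mono_def)
    then show ?thesis using p_pos by (simp add: q_def sum.delta)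
  qed
  from mono_independent[OF this[unfolded q0], of "(l0, 0)"] show ?thesis using kl p_pos by simp
qed

lemma ract_faithful:
  assumes 0: "\<And>m. m \<in> M \<Longrightarrow> ract g m = 0" and e: "e \<in> {..<p} \<times> {..<p}"
  shows "g e = 0"
proof -
  obtain k0 l0 where kl: "e = (k0, l0)" "k0 < p" "l0 < p" using e by auto
  define q where "q k = (\<Sum>l<p. to_ac (g (k, l)) * \<delta> ^ l)" for k
  define Y where "Y k = q k * (ri ^^ k) 1" for k
  have "(\<Sum>k<p. to_ac (\<zeta> ^ (k * r)) * Y k) = 0" if r: "r < p" for r
  proof -
    have 1: "(ri ^^ k) (\<delta> ^ r * 1) = to_ac (\<zeta> ^ (k * r)) * (\<delta> ^ r * (ri ^^ k) 1)" for k
      using commute_funpow[OF fspace_M flinear_ops(4,3) ops_commute(2) one_M, of k r]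
      unfolding rj_funpow .
    have "ract g (\<delta> ^ r * 1) = (\<Sum>k<p. q k * (ri ^^ k) (\<delta> ^ r * 1))"
      unfolding ract_def q_def rj_funpow by (simp add: sum.cartesian_product sum_distrib_right mult.assoc)
    also have "\<dots> = \<delta> ^ r * (\<Sum>k<p. to_ac (\<zeta> ^ (k * r)) * Y k)"
      unfolding 1 Y_def sum_distrib_left by (simp only: mult_ac)
    finally show ?thesis using 0[of "\<delta> ^ r * 1"] \<delta>_nz by (simp add: power_M \<delta>_M)
  qed
  then have "Y k0 = 0" by (rule dft_eq_0[OF root p_nz _ kl(2)])
  moreover have "(ri ^^ k0) 1 \<noteq> 0" using ops_inj(2)[OF one_M] kl(2) by fastforce
  ultimately have q0: "q k0 = 0" by (simp add: Y_def)
  have "(\<Sum>e\<in>{..<p} \<times> {..<p}. to_ac (if fst e = 0 then g (k0, snd e) else 0) * mono e) = q k0"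
  proof -
    have "(\<Sum>e\<in>{..<p} \<times> {..<p}. to_ac (if fst e = 0 then g (k0, snd e) else 0) * mono e)
      = (\<Sum>n<p. \<Sum>l<p. if n = 0 then to_ac (g (k0, l)) * \<delta> ^ l else 0)"
      unfolding sum.cartesian_product case_prod_unfold by (intro sum.cong) (auto simp: mono_def)
    also have "\<dots> = (\<Sum>l<p. \<Sum>n<p. if n = 0 then to_ac (g (k0, l)) * \<delta> ^ l else 0)" by (rule sum.swap)
    finally show ?thesis using p_pos by (simp add: q_def sum.delta)
  qed
  from mono_independent[OF this[unfolded q0], of "(0, l0)"] show ?thesis using kl p_pos by simp
qed

definition orbit :: "'a alg_closure \<Rightarrow> 'a alg_closure set" where "orbit w = range (\<lambda>f. lact f w)"

lemma orbit_fspace: "fspace (orbit w)"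
proof (rule fspaceI)
  have "lact (\<lambda>_. 0) w = 0" by (simp add: lact_def)
  then show "0 \<in> orbit w" unfolding orbit_def by (metis rangeI)
next
  fix u v assume "u \<in> orbit w" "v \<in> orbit w"
  then obtain f g where "u = lact f w" "v = lact g w" by (auto simp: orbit_def)
  then have "u + v = lact (\<lambda>e. f e + g e) w" by (simp add: lact_add)
  then show "u + v \<in> orbit w" by (simp add: orbit_def)
next
  fix k u assume "u \<in> orbit w"
  then obtain f where "u = lact f w" by (auto simp: orbit_def)
  then have "to_ac k * u = lact (\<lambda>e. k * f e) w" by (simp add: lact_scale)
  then show "to_ac k * u \<in> orbit w" by (simp add: orbit_def)
qed

lemma orbit_M: "w \<in> M \<Longrightarrow> orbit w \<subseteq> M"
  by (auto simp: orbit_def lact_M)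

lemma orbit_stable:
  assumes "w \<in> M" "u \<in> orbit w"
  shows "li u \<in> orbit w" "lj u \<in> orbit w"
proof -
  obtain f where u: "u = lact f w" using assms(2) by (auto simp: orbit_def)
  have "li u = lact (symbol_basis p (1, 0)) u" "lj u = lact (symbol_basis p (0, 1)) u"
    using p_gt_1 by (simp_all add: lact_basis)
  then show "li u \<in> orbit w" "lj u \<in> orbit w"
    unfolding u lact_symbol_mult[OF assms(1), symmetric] by (auto simp: orbit_def)
qed

text \<open>
  Average a linear projection first over \<open>j\<close> and then over \<open>i\<close>.
\<close>

lemma equivariant_projection:
  assumes w: "w \<in> M"
  obtains \<pi> where "flinear M \<pi>" "\<And>m. m \<in> M \<Longrightarrow> \<pi> m \<in> orbit w" "\<And>m. m \<in> orbit w \<Longrightarrow> \<pi> m = m"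
    "\<And>f m. m \<in> M \<Longrightarrow> \<pi> (lact f m) = lact f (\<pi> m)"
proof -
  obtain \<pi>0 where \<pi>0: "flinear UNIV \<pi>0" "\<And>w'. \<pi>0 w' \<in> orbit w" "\<And>w'. w' \<in> orbit w \<Longrightarrow> \<pi>0 w' = w'"
    using subspace_projection[OF orbit_fspace[of w]] by blast
  have "flinear M \<pi>0" using \<pi>0(1,2) orbit_M[OF w] by (auto simp: flinear_def)
  show ?thesis
  proof (rule average_over_cyclic[OF fspace_M flinear_ops(2) b_nz ops_order(2) p_nz p_pos orbit_fspace
      orbit_M[OF w] orbit_stable(2)[OF w] \<open>flinear M \<pi>0\<close> \<pi>0(2,3)])
    fix \<pi>1 assume \<pi>1: "flinear M \<pi>1" "\<And>m. m \<in> M \<Longrightarrow> \<pi>1 m \<in> orbit w" "\<And>m. m \<in> orbit w \<Longrightarrow> \<pi>1 m = m"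
      "\<And>m. m \<in> M \<Longrightarrow> \<pi>1 (lj m) = lj (\<pi>1 m)"
    show thesis
    proof (rule average_over_cyclic[OF fspace_M flinear_ops(1) a_nz ops_order(1) p_nz p_pos orbit_fspace
        orbit_M[OF w] orbit_stable(1)[OF w] \<pi>1(1,2,3)])
      fix \<pi> assume \<pi>: "flinear M \<pi>" "\<And>m. m \<in> M \<Longrightarrow> \<pi> m \<in> orbit w" "\<And>m. m \<in> orbit w \<Longrightarrow> \<pi> m = m"
        "\<And>m. m \<in> M \<Longrightarrow> \<pi> (li m) = li (\<pi> m)"
      assume H: "\<And>H h m. flinear M H \<Longrightarrow> (\<And>m. m \<in> M \<Longrightarrow> \<pi>1 (H m) = H (\<pi>1 m)) \<Longrightarrow>
         (\<And>m. m \<in> M \<Longrightarrow> H (li m) = to_ac h * li (H m)) \<Longrightarrow> h ^ p = 1 \<Longrightarrow> m \<in> M \<Longrightarrow> \<pi> (H m) = H (\<pi> m)"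
      have \<pi>lj: "\<pi> (lj m) = lj (\<pi> m)" if "m \<in> M" for m
        by (rule H[where H = lj and h = \<zeta>, OF flinear_ops(2) \<pi>1(4) ops_commute(1) \<zeta>_pow that])
      have 1: "\<pi> ((li ^^ k) m) = (li ^^ k) (\<pi> m)" if "m \<in> M" for m k
        by (induction k) (simp_all add: \<pi>(4) funpow_M that)
      have 2: "\<pi> ((lj ^^ k) m) = (lj ^^ k) (\<pi> m)" if "m \<in> M" for m k
        by (induction k) (simp_all add: \<pi>lj funpow_M that)
      have "\<pi> (lact f m) = lact f (\<pi> m)" if m: "m \<in> M" for f m
        unfolding lact_def case_prod_unfold
        by (simp add: flinearD(5)[OF fspace_M \<pi>(1)] flinearD(3)[OF fspace_M \<pi>(1)] mult_M base_M funpow_M m 1 2)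
      show thesis by (rule that[OF \<pi>(1,2,3) \<open>\<And>m f. m \<in> M \<Longrightarrow> \<pi> (lact f m) = lact f (\<pi> m)\<close>])
    qed
  qed
qed

text \<open>
  Take \<open>w\<close> with an orbit of largest dimension. If the orbit is not \<open>M\<close>, its dimension is less than
  \<open>p\<^sup>2\<close>, so some nonzero \<open>f\<close> annihilates \<open>w\<close>. By Maschke the orbit has an invariant complement, and by
  faithfulness \<open>f\<close> does not annihilate all of it. Adding to \<open>w\<close> a vector of the complement that \<open>f\<close> does not
  annihilate produces a larger orbit.
\<close>

lemma cyclic_vector:
  obtains w where "w \<in> M" "orbit w = M"
proof -
  let ?P = "{..<p} \<times> {..<p}"
  \<comment> \<open>\<open>good r\<close> says that some vector has an orbit of dimension at least \<open>r\<close>.\<close>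
  define good where "good r \<longleftrightarrow> (\<exists>w\<in>M. \<exists>g. \<forall>c. (\<Sum>q<r. to_ac (c q) * lact (g q) w) = 0 \<longrightarrow> (\<forall>q<r. c q = 0))"
    for r :: nat
  have "good 0" unfolding good_def using one_M by auto
  moreover have "r \<le> p * p" if good: "good r" for r
  proof (rule ccontr)
    assume "\<not> r \<le> p * p"
    obtain w g where w: "w \<in> M"
      and indep: "\<And>c. (\<Sum>q<r. to_ac (c q) * lact (g q) w) = 0 \<Longrightarrow> \<forall>q<r. c q = 0"
      using good unfolding good_def by blast
    have "card ?P < card {..<r}" using \<open>\<not> r \<le> p * p\<close> by (simp add: card_cartesian_product)
    from linear_dependence[OF _ _ this, of "\<lambda>q. coord (lact (g q) w)"]
    obtain c where c: "\<exists>q\<in>{..<r}. c q \<noteq> 0" "\<And>e. e \<in> ?P \<Longrightarrow> (\<Sum>q<r. c q * coord (lact (g q) w) e) = 0"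
      by blast
    have "(\<Sum>q<r. to_ac (c q) * lact (g q) w) \<in> M"
      by (intro fspaceD(4)[OF fspace_M] mult_M base_M lact_M w)
    then have "(\<Sum>q<r. to_ac (c q) * lact (g q) w) = 0"
      using c(2) by (simp add: coord_eq_0_iff coord_lincomb lact_M w)
    from indep[OF this] show False using c(1) by auto
  qed
  ultimately obtain r where r: "good r" and max: "\<And>r'. good r' \<Longrightarrow> r' \<le> r"
    using ex_has_greatest_nat[of good 0 "\<lambda>x. x" "Suc (p * p)"] by (auto simp: less_Suc_eq_le)
  obtain w g where w: "w \<in> M"
    and indep: "\<And>c. (\<Sum>q<r. to_ac (c q) * lact (g q) w) = 0 \<Longrightarrow> \<forall>q<r. c q = 0"
    using r unfolding good_def by blast
  have "orbit w = M"
  proof (rule ccontr)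
    assume "orbit w \<noteq> M"
    then obtain m where m: "m \<in> M" "m \<notin> orbit w" using orbit_M[OF w] by auto
    define v where "v i = (case i of None \<Rightarrow> m | Some e \<Rightarrow> lact (symbol_basis p e) w)" for i
    have vM: "v i \<in> M" for i by (simp add: v_def m lact_M w split: option.split)
    obtain f' where f': "\<exists>i\<in>insert None (Some ` ?P). f' i \<noteq> 0"
      "\<And>e. e \<in> ?P \<Longrightarrow> (\<Sum>i\<in>insert None (Some ` ?P). f' i * coord (v i) e) = 0"
    proof -
      have fin: "finite (insert None (Some ` ?P))" by simp
      have "card ?P < card (insert None (Some ` ?P))" by (subst card_insert_disjoint) (auto simp: card_image)
      from linear_dependence[OF _ fin this, of "\<lambda>i. coord (v i)"] show ?thesis using that by auto
    qed
    have "(\<Sum>i\<in>insert None (Some ` ?P). to_ac (f' i) * v i) \<in> M"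
      by (intro fspaceD(4)[OF fspace_M] mult_M base_M vM)
    moreover have "coord (\<Sum>i\<in>insert None (Some ` ?P). to_ac (f' i) * v i) e = 0" if "e \<in> ?P" for e
      using coord_lincomb[OF vM that] f'(2)[OF that] by (rule trans)
    ultimately have sum0: "(\<Sum>i\<in>insert None (Some ` ?P). to_ac (f' i) * v i) = 0"
      using coord_eq_0_iff by blast
    define f where "f e = f' (Some e)" for e
    have "(\<Sum>e\<in>?P. to_ac (f e) * lact (symbol_basis p e) w) = lact f w"
      unfolding lact_def[of f] case_prod_unfold by (intro sum.cong refl) (auto simp: lact_basis)
    then have "to_ac (f' None) * m + lact f w = 0"
      using sum0 by (simp add: sum.reindex v_def f_def)
    then have rel: "to_ac (f' None) * m = lact (\<lambda>e. - 1 * f e) w"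
      by (simp only: lact_scale) (simp add: eq_neg_iff_add_eq_0)
    have "f' None = 0"
    proof (rule ccontr)
      assume nz: "f' None \<noteq> 0"
      then have "m = to_ac (inverse (f' None)) * (to_ac (f' None) * m)" by simp
      also have "\<dots> \<in> orbit w" unfolding rel
        by (rule fspaceD(3)[OF orbit_fspace], unfold orbit_def, rule rangeI)
      finally show False using m by simp
    qed
    then have f0: "lact f w = 0" using \<open>to_ac (f' None) * m + lact f w = 0\<close> by simp
    obtain i where "i \<in> insert None (Some ` ?P)" "f' i \<noteq> 0" using f'(1) by blast
    then have "\<exists>e\<in>?P. f e \<noteq> 0" using \<open>f' None = 0\<close> unfolding f_def by (metis imageE insertE)
    obtain \<pi> where \<pi>: "flinear M \<pi>" "\<And>m. m \<in> M \<Longrightarrow> \<pi> m \<in> orbit w" "\<And>m. m \<in> orbit w \<Longrightarrow> \<pi> m = m"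
      "\<And>f m. m \<in> M \<Longrightarrow> \<pi> (lact f m) = lact f (\<pi> m)"
      by (rule equivariant_projection[OF w], rule that)
    note PL = flinearD[OF fspace_M \<pi>(1)]
    define c0 where "c0 = m + to_ac (- 1) * \<pi> m"
    have \<pi>m: "\<pi> m \<in> M" by (rule PL(1)[OF m(1)])
    have mM: "to_ac (- 1) * \<pi> m \<in> M" by (intro mult_M base_M \<pi>m)
    have c0M: "c0 \<in> M" unfolding c0_def by (rule add_M[OF m(1) mM])
    have "c0 = m - \<pi> m" by (simp add: c0_def)
    then have c0_nz: "c0 \<noteq> 0" using m(2) \<pi>(2)[OF m(1)] by auto
    note c0 = c0M c0_nz
    have "\<pi> c0 = \<pi> m + \<pi> (to_ac (- 1) * \<pi> m)" unfolding c0_def by (rule PL(2)[OF m(1) mM])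
    also have "\<pi> (to_ac (- 1) * \<pi> m) = to_ac (- 1) * \<pi> (\<pi> m)" by (rule PL(3)[OF \<pi>m])
    also have "\<pi> (\<pi> m) = \<pi> m" by (rule \<pi>(3)[OF \<pi>(2)[OF m(1)]])
    finally have \<pi>c0: "\<pi> c0 = 0" by simp
    obtain r' where r': "r' < p" "lact f (\<beta> ^ r' * c0) \<noteq> 0"
      using lact_faithful[OF c0] \<open>\<exists>e\<in>?P. f e \<noteq> 0\<close> by blast
    define w1 where "w1 = \<beta> ^ r' * c0"
    have w1: "w1 \<in> M" by (simp add: w1_def mult_M power_M \<beta>_M c0)
    have "w1 = lact (symbol_basis p (0, r')) c0" using r' p_pos by (simp add: lact_basis lj_funpow w1_def)
    then have \<pi>w1: "\<pi> w1 = 0" using \<pi>(4)[OF c0(1)] \<pi>c0 flinearD(4)[OF fspace_M flinear_lact] by simp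
    define w' where "w' = w + w1"
    have w': "w' \<in> M" by (simp add: w'_def add_M w w1)
    have "w \<in> orbit w"
      using lact_basis[of 0 0 w] p_pos unfolding orbit_def by (metis funpow_0 rangeI)
    then have "\<pi> w = w" by (rule \<pi>(3))
    then have \<pi>w': "\<pi> (lact h w') = lact h w" for h
      unfolding \<pi>(4)[OF w'] using PL(2)[OF w w1] \<pi>w1 by (simp add: w'_def)
    have fw': "lact f w' \<noteq> 0"
      using flinearD(2)[OF fspace_M flinear_lact w w1] f0 r' by (simp add: w'_def w1_def)
    have "good (Suc r)"
      unfolding good_def
    proof (intro bexI[OF _ w'] exI[of _ "g(r := f)"] allI impI)
      fix c q assume sum: "(\<Sum>q<Suc r. to_ac (c q) * lact ((g(r := f)) q) w') = 0" and q: "q < Suc r"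
      have split: "(\<Sum>q<r. to_ac (c q) * lact (g q) w') + to_ac (c r) * lact f w' = 0"
        using sum by simp
      have tM: "to_ac (c q) * lact (g q) w' \<in> M" for q by (intro mult_M base_M lact_M w')
      have "\<pi> ((\<Sum>q<r. to_ac (c q) * lact (g q) w') + to_ac (c r) * lact f w')
          = (\<Sum>q<r. to_ac (c q) * lact (g q) w) + to_ac (c r) * lact f w"
        unfolding PL(2)[OF fspaceD(4)[OF fspace_M tM] mult_M[OF base_M lact_M[OF w']]] PL(5)[OF tM]
          PL(3)[OF lact_M[OF w']] \<pi>w' ..
      then have "(\<Sum>q<r. to_ac (c q) * lact (g q) w) = 0" using split f0 PL(4) by simp
      from indep[OF this] have cr: "\<forall>q<r. c q = 0" .
      then have "to_ac (c r) * lact f w' = 0" using split by simp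
      then have "c r = 0" using fw' by simp
      then show "c q = 0" using cr q by (auto simp: less_Suc_eq)
    qed
    then show False using max by fastforce
  qed
  then show ?thesis using that w by blast
qed

text \<open>
  For a cyclic vector \<open>w\<close>, which is cyclic and separating for \<open>(a, b)_p\<close> by counting dimensions, each
  \<open>ract g w\<close> equals \<open>lact f w\<close> for exactly one \<open>f\<close>. The map from \<open>g\<close> to \<open>f\<close> is multiplicative because the two
  actions commute, and bijective because \<open>(c, d)_p\<close> acts faithfully and has the same dimension.
\<close>

lemma symbol_algebras_isomorphic:
  "algebra_iso fld (symbol_algebra p \<zeta> c d) (symbol_algebra p \<zeta> a b) \<noteq> {}"
proof -
  let ?P = "{..<p} \<times> {..<p}"
  let ?A = "symbol_algebra p \<zeta> a b" and ?B = "symbol_algebra p \<zeta> c d"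
  obtain w where w: "w \<in> M" "orbit w = M" by (rule cyclic_vector)
  have basis_sum: "(\<Sum>e\<in>?P. to_ac (f e) * lact (symbol_basis p e) w) = lact f w" for f
    unfolding lact_def[of f] case_prod_unfold by (intro sum.cong refl) (auto simp: lact_basis)
  have coordA: "coord (lact f w) k = (\<Sum>i\<in>?P. f i * coord (lact (symbol_basis p i) w) k)" if "k \<in> ?P" for f k
    by (subst basis_sum[of f, symmetric]) (rule coord_lincomb[OF lact_M[OF w(1)] that])
  have coord_mono: "coord (mono j) k = (if k = j then 1 else 0)" if "j \<in> ?P" "k \<in> ?P" for j k
  proof (rule coord_unique[OF _ that(2)])
    have "(\<Sum>e\<in>?P. to_ac (if e = j then 1 else 0) * mono e) = (\<Sum>e\<in>?P. if e = j then mono e else 0)"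
      by (intro sum.cong) auto
    then show "mono j = (\<Sum>e\<in>?P. to_ac (if e = j then 1 else 0) * mono e)" using that by (simp add: sum.delta)
  qed
  have injA: "f e = 0" if f: "lact f w = 0" and e: "e \<in> ?P" for f e
  proof (rule spanning_imp_independent[OF _ _ e])
    show "finite ?P" by simp
    show "(\<Sum>i\<in>?P. f i * coord (lact (symbol_basis p i) w) k) = 0" if "k \<in> ?P" for k
    proof -
      have "coord 0 k = 0" using coord_eq_0_iff[OF zero_M] that by blast
      then show ?thesis using coordA[OF that, of f] f by simp
    qed
    fix j assume j: "j \<in> ?P"
    have "mono j \<in> orbit w" using mono_M w(2) by simp
    then obtain c where c: "mono j = lact c w" by (auto simp: orbit_def)
    show "\<exists>c. \<forall>k\<in>?P. (\<Sum>i\<in>?P. c i * coord (lact (symbol_basis p i) w) k) = (if k = j then 1 else 0)"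
      using coordA[of _ c] coord_mono[OF j] unfolding c[symmetric] by (intro exI[of _ c]) simp
  qed
  have zero_on: "ract g m = 0" if 0: "ract g w = 0" and m: "m \<in> M" for g m
  proof -
    obtain f where "m = lact f w" using m w(2) by (auto simp: orbit_def)
    then show ?thesis using lact_ract_commute[OF w(1), of g f] 0
       flinearD(4)[OF fspace_M flinear_lact] by simp
  qed
  have injB: "g e = 0" if "ract g w = 0" "e \<in> ?P" for g e
    using ract_faithful[OF zero_on[OF that(1)] that(2)] .
  have ract_basis: "ract (symbol_basis p e) w = (rj ^^ snd e) ((ri ^^ fst e) w)" if "e \<in> ?P" for e
  proof -
    have "ract (symbol_basis p e) w
      = (\<Sum>e'\<in>?P. if e' = e then (rj ^^ snd e') ((ri ^^ fst e') w) else 0)"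
      unfolding ract_def case_prod_unfold by (intro sum.cong) (auto simp: symbol_basis_def)
    then show ?thesis using that by (simp add: sum.delta)
  qed
  have basis_sumB: "(\<Sum>e\<in>?P. to_ac (f e) * ract (symbol_basis p e) w) = ract f w" for f
    unfolding ract_def[of f] case_prod_unfold by (intro sum.cong refl) (auto simp: ract_basis)
  have coordB: "coord (ract f w) k = (\<Sum>i\<in>?P. f i * coord (ract (symbol_basis p i) w) k)" if "k \<in> ?P" for f k
    by (subst basis_sumB[of f, symmetric]) (rule coord_lincomb[OF ract_M[OF w(1)] that])
  have surjB: "\<exists>g. ract g w = m" if m: "m \<in> M" for m
  proof -
    have "\<forall>i\<in>?P. f i = 0" if z: "\<And>k. k \<in> ?P \<Longrightarrow> (\<Sum>i\<in>?P. f i * coord (ract (symbol_basis p i) w) k) = 0" for f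
    proof -
      have "coord (ract f w) k = 0" if "k \<in> ?P" for k using coordB[OF that, of f] z[OF that] by simp
      then have "ract f w = 0" using coord_eq_0_iff[OF ract_M[OF w(1)]] by blast
      then show ?thesis using injB by blast
    qed
    then obtain g where g: "\<And>k. k \<in> ?P \<Longrightarrow> (\<Sum>i\<in>?P. g i * coord (ract (symbol_basis p i) w) k) = coord m k"
      using independent_imp_spanning[of ?P "\<lambda>i. coord (ract (symbol_basis p i) w)" "coord m"] by blast
    have "ract g w = (\<Sum>e\<in>?P. to_ac (coord m e) * mono e)"
    proof -
      have "coord (ract g w) e = coord m e" if "e \<in> ?P" for e using coordB[OF that, of g] g[OF that] by simp
      then have "(\<Sum>e\<in>?P. to_ac (coord (ract g w) e) * mono e) = (\<Sum>e\<in>?P. to_ac (coord m e) * mono e)"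
        by (intro sum.cong) auto
      then show ?thesis using coord_sum[OF ract_M[OF w(1)], of g] by simp
    qed
    then show ?thesis using coord_sum[OF m] by metis
  qed
  have eqA: "f = f'" if "f \<in> carrier ?A" "f' \<in> carrier ?A" "lact f w = lact f' w" for f f'
  proof (rule PiE_UNIV_eqI[where S = ?P])
    fix e assume e: "e \<in> ?P"
    have "lact (\<lambda>e. f e + (- 1) * f' e) w = 0" using that(3) by (simp only: lact_add lact_scale) simp
    from injA[OF this e] show "f e = f' e" by simp
  qed (use that in simp_all)
  have eqB: "f = f'" if "f \<in> carrier ?B" "f' \<in> carrier ?B" "ract f w = ract f' w" for f f'
  proof (rule PiE_UNIV_eqI[where S = ?P])
    fix e assume e: "e \<in> ?P"
    have "ract (\<lambda>e. f e + (- 1) * f' e) w = 0" using that(3) by (simp only: ract_add ract_scale) simp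
    from injB[OF this e] show "f e = f' e" by simp
  qed (use that in simp_all)
  have ex: "\<exists>f\<in>carrier ?A. lact f w = m" if m: "m \<in> M" for m
  proof -
    obtain f where "lact f w = m" using m w(2) by (auto simp: orbit_def)
    then show ?thesis by (intro bexI[of _ "restrict f ?P"]) (auto simp: lact_cong[of "restrict f ?P" f])
  qed
  define \<theta> where "\<theta> g = (SOME f. f \<in> carrier ?A \<and> lact f w = ract g w)" for g
  have \<theta>: "\<theta> g \<in> carrier ?A" "lact (\<theta> g) w = ract g w" for g
    using someI_ex[of "\<lambda>f. f \<in> carrier ?A \<and> lact f w = ract g w"] ex[OF ract_M[OF w(1)]]
    unfolding \<theta>_def by blast+
  have \<theta>I: "\<theta> g = f" if "f \<in> carrier ?A" "lact f w = ract g w" for g f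
    using eqA[OF \<theta>(1) that(1)] \<theta>(2) that(2) by simp
  have lact_r: "lact (restrict f ?P) m = lact f m" and ract_r: "ract (restrict f ?P) m = ract f m" for f m
    by (auto intro!: lact_cong ract_cong)
  have hom: "\<theta> \<in> ring_hom ?B ?A"
  proof (rule ring_hom_memI)
    fix g h assume g: "g \<in> carrier ?B" and h: "h \<in> carrier ?B"
    show "\<theta> g \<in> carrier ?A" by (rule \<theta>(1))
    show "\<theta> (g \<otimes>\<^bsub>?B\<^esub> h) = \<theta> g \<otimes>\<^bsub>?A\<^esub> \<theta> h"
    proof (rule \<theta>I)
      have "ract (g \<otimes>\<^bsub>?B\<^esub> h) w = ract h (ract g w)"
        by (simp add: ract_r ract_symbol_mult[OF w(1)])
      also have "\<dots> = ract h (lact (\<theta> g) w)" by (simp only: \<theta>(2))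
      also have "\<dots> = lact (\<theta> g) (ract h w)" by (rule lact_ract_commute[OF w(1)])
      also have "\<dots> = lact (\<theta> g) (lact (\<theta> h) w)" by (simp only: \<theta>(2))
      finally show "lact (\<theta> g \<otimes>\<^bsub>?A\<^esub> \<theta> h) w = ract (g \<otimes>\<^bsub>?B\<^esub> h) w"
        by (simp add: lact_r lact_symbol_mult[OF w(1)])
    qed simp
    show "\<theta> (g \<oplus>\<^bsub>?B\<^esub> h) = \<theta> g \<oplus>\<^bsub>?A\<^esub> \<theta> h"
      by (rule \<theta>I) (simp_all add: lact_r ract_r lact_add ract_add \<theta>(2))
  next
    show "\<theta> \<one>\<^bsub>?B\<^esub> = \<one>\<^bsub>?A\<^esub>"
      by (rule \<theta>I) (use p_pos in \<open>simp_all add: lact_basis ract_basis\<close>)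
  qed
  have scal: "\<theta> (k \<odot>\<^bsub>?B\<^esub> g) = k \<odot>\<^bsub>?A\<^esub> \<theta> g" for k g
    by (rule \<theta>I) (simp_all add: lact_r ract_r lact_scale ract_scale \<theta>(2))
  have "bij_betw \<theta> (carrier ?B) (carrier ?A)"
    unfolding bij_betw_def
  proof (intro conjI inj_onI equalityI subsetI)
    fix g h assume "g \<in> carrier ?B" "h \<in> carrier ?B" "\<theta> g = \<theta> h"
    then show "g = h" using eqB[of g h] \<theta>(2) by metis
  next
    fix f assume f: "f \<in> carrier ?A"
    obtain g where g: "ract g w = lact f w" using surjB[OF lact_M[OF w(1)]] by blast
    have "\<theta> (restrict g ?P) = f" by (rule \<theta>I[OF f]) (simp add: ract_r g)
    then show "f \<in> \<theta> ` carrier ?B" by (intro image_eqI[of _ _ "restrict g ?P"]) simp_all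
  qed (use \<theta>(1) in auto)
  then have "\<theta> \<in> algebra_iso fld ?B ?A"
    unfolding algebra_iso_def ring_iso_def using hom scal by blast
  then show ?thesis by blast
qed

end

section \<open>A bimodule of rank one yields a solution\<close>

text \<open>
  The space \<open>W\<close> carries a left action of \<open>(a, b)_p\<close> through \<open>opi, opj\<close> and a right action of \<open>(c, d)_p\<close>
  through \<open>opI, opJ\<close>. Letting \<open>\<beta>\<close> act as \<open>opj\<close> and \<open>\<delta>\<close> as \<open>opJ\<close> makes \<open>W\<close> a vector space over \<open>M\<close>; the
  assumption \<open>rank_one\<close> says in coordinates that its dimension over \<open>M\<close> is one.
\<close>

locale bicyclic_bimodule = bicyclic p \<zeta> b d \<beta> \<delta> M s t + vector_space scale
  for p and \<zeta> b d :: "'a::field" and \<beta> \<delta> M s t and scale :: "'a \<Rightarrow> 'v::ab_group_add \<Rightarrow> 'v" (infixr \<open>*s\<close> 75) +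
  fixes W :: "'v set" and opi opj opI opJ :: "'v \<Rightarrow> 'v" and a c :: 'a and w0 :: 'v
  assumes subspace_W: "subspace W"
    and linear_ops: "module_hom (*s) (*s) opi" "module_hom (*s) (*s) opj" "module_hom (*s) (*s) opI" "module_hom (*s) (*s) opJ"
    and ops_W: "w \<in> W \<Longrightarrow> opi w \<in> W" "w \<in> W \<Longrightarrow> opj w \<in> W" "w \<in> W \<Longrightarrow> opI w \<in> W" "w \<in> W \<Longrightarrow> opJ w \<in> W"
    and opi_order: "w \<in> W \<Longrightarrow> (opi ^^ p) w = a *s w" and opj_order: "w \<in> W \<Longrightarrow> (opj ^^ p) w = b *s w"
    and opI_order: "w \<in> W \<Longrightarrow> (opI ^^ p) w = c *s w" and opJ_order: "w \<in> W \<Longrightarrow> (opJ ^^ p) w = d *s w"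
    and ji: "w \<in> W \<Longrightarrow> opj (opi w) = \<zeta> *s opi (opj w)" and IJ: "w \<in> W \<Longrightarrow> opI (opJ w) = \<zeta> *s opJ (opI w)"
    and iI: "w \<in> W \<Longrightarrow> opi (opI w) = opI (opi w)" and iJ: "w \<in> W \<Longrightarrow> opi (opJ w) = opJ (opi w)"
    and jI: "w \<in> W \<Longrightarrow> opj (opI w) = opI (opj w)" and jJ: "w \<in> W \<Longrightarrow> opj (opJ w) = opJ (opj w)"
    and w0: "w0 \<in> W" "w0 \<noteq> 0"
    and rank_one: "w \<in> W \<Longrightarrow> \<exists>f g. (\<exists>e\<in>{..<p} \<times> {..<p}. f e \<noteq> 0 \<or> g e \<noteq> 0) \<and>
       (\<Sum>e\<in>{..<p} \<times> {..<p}. f e *s (opj ^^ fst e) ((opJ ^^ snd e) w0))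
       + (\<Sum>e\<in>{..<p} \<times> {..<p}. g e *s (opj ^^ fst e) ((opJ ^^ snd e) w)) = 0"
begin

abbreviation (input) "P \<equiv> {..<p} \<times> {..<p}"

lemma ops_add: "opi (v + w) = opi v + opi w" "opj (v + w) = opj v + opj w"
    "opI (v + w) = opI v + opI w" "opJ (v + w) = opJ v + opJ w"
  and ops_scale: "opi (k *s w) = k *s opi w" "opj (k *s w) = k *s opj w" "opI (k *s w) = k *s opI w" "opJ (k *s w) = k *s opJ w"
  and ops_sum: "opi (\<Sum>e\<in>S. h e) = (\<Sum>e\<in>S. opi (h e))" "opj (\<Sum>e\<in>S. h e) = (\<Sum>e\<in>S. opj (h e))"
    "opI (\<Sum>e\<in>S. h e) = (\<Sum>e\<in>S. opI (h e))" "opJ (\<Sum>e\<in>S. h e) = (\<Sum>e\<in>S. opJ (h e))"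
  by (rule linear_ops[THEN module_hom.add] linear_ops[THEN module_hom.scale] linear_ops[THEN module_hom.sum])+

definition word :: "nat \<Rightarrow> nat \<Rightarrow> 'v \<Rightarrow> 'v" where
  "word k l w = (opj ^^ k) ((opJ ^^ l) w)"

lemma funpow_W: "w \<in> W \<Longrightarrow> (opi ^^ k) w \<in> W" "w \<in> W \<Longrightarrow> (opj ^^ k) w \<in> W"
    "w \<in> W \<Longrightarrow> (opI ^^ k) w \<in> W" "w \<in> W \<Longrightarrow> (opJ ^^ k) w \<in> W"
  by (induction k) (auto simp: ops_W)

lemma funpow_scale: "(opj ^^ k) (x *s w) = x *s (opj ^^ k) w" "(opJ ^^ k) (x *s w) = x *s (opJ ^^ k) w"
  and funpow_sum: "(opj ^^ k) (\<Sum>e\<in>S. h e) = (\<Sum>e\<in>S. (opj ^^ k) (h e))" "(opJ ^^ k) (\<Sum>e\<in>S. h e) = (\<Sum>e\<in>S. (opJ ^^ k) (h e))"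
  by (induction k) (simp_all add: ops_scale ops_sum)

lemma word_sum: "word k l (\<Sum>e\<in>S. h e *s v e) = (\<Sum>e\<in>S. h e *s word k l (v e))"
  by (simp add: word_def funpow_scale funpow_sum)

lemma opj_opJ_funpow: "w \<in> W \<Longrightarrow> (opJ ^^ l) ((opj ^^ k) w) = (opj ^^ k) ((opJ ^^ l) w)"
proof (induction l)
  case (Suc l)
  have "opJ ((opj ^^ k) w) = (opj ^^ k) (opJ w)" if "w \<in> W" for w
    by (induction k) (simp_all add: jJ[symmetric] funpow_W that)
  then show ?case using Suc by (simp add: funpow_W)
qed simp

lemma word_word: "w \<in> W \<Longrightarrow> word k l (word k' l' w) = word (k + k') (l + l') w"
  by (simp add: word_def opj_opJ_funpow funpow_W funpow_add)

lemma word_period: "w \<in> W \<Longrightarrow> word (k + p) l w = b *s word k l w" "w \<in> W \<Longrightarrow> word k (l + p) w = d *s word k l w"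
  by (simp_all add: word_def funpow_add opj_order opJ_order funpow_W funpow_scale)

lemma opi_word: "w \<in> W \<Longrightarrow> opi (word k l w) = inverse \<zeta> ^ k *s word k l (opi w)"
proof -
  assume w: "w \<in> W"
  have ij: "opi (opj v) = inverse \<zeta> *s opj (opi v)" if "v \<in> W" for v
    using ji[OF that] \<zeta>_nz by simp
  have "opi ((opj ^^ k) v) = inverse \<zeta> ^ k *s (opj ^^ k) (opi v)" if "v \<in> W" for v
    by (induction k) (simp_all add: ij funpow_W that ops_scale)
  moreover have "opi ((opJ ^^ l) v) = (opJ ^^ l) (opi v)" if "v \<in> W" for v
    by (induction l) (simp_all add: iJ funpow_W that)
  ultimately show ?thesis using w by (simp add: word_def funpow_W)
qed

lemma opI_word: "w \<in> W \<Longrightarrow> opI (word k l w) = \<zeta> ^ l *s word k l (opI w)"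
proof -
  assume w: "w \<in> W"
  have "opI ((opj ^^ k) v) = (opj ^^ k) (opI v)" if "v \<in> W" for v
    by (induction k) (simp_all add: jI[symmetric] funpow_W that ops_scale)
  moreover have "opI ((opJ ^^ l) v) = \<zeta> ^ l *s (opJ ^^ l) (opI v)" if "v \<in> W" for v
    by (induction l) (simp_all add: IJ funpow_W that ops_scale)
  ultimately show ?thesis using w by (simp add: word_def funpow_W funpow_scale)
qed

text \<open>
  Scalar multiplication of the vector space \<open>W\<close> over \<open>M\<close>.
\<close>

definition act :: "'a alg_closure \<Rightarrow> 'v \<Rightarrow> 'v" where
  "act m w = (\<Sum>e\<in>P. coord m e *s word (fst e) (snd e) w)"

lemma act_lincomb:
  assumes "\<And>i. i \<in> S \<Longrightarrow> v i \<in> M"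
  shows "act (\<Sum>i\<in>S. to_ac (k i) * v i) w = (\<Sum>i\<in>S. k i *s act (v i) w)"
proof -
  have "act (\<Sum>i\<in>S. to_ac (k i) * v i) w = (\<Sum>e\<in>P. (\<Sum>i\<in>S. k i * coord (v i) e) *s word (fst e) (snd e) w)"
    unfolding act_def by (intro sum.cong refl) (simp only: coord_lincomb[OF assms])
  also have "\<dots> = (\<Sum>i\<in>S. k i *s act (v i) w)"
    unfolding act_def scale_sum_left scale_sum_right scale_scale[symmetric] by (rule sum.swap)
  finally show ?thesis .
qed

lemma act_scale: "m \<in> M \<Longrightarrow> act (to_ac k * m) w = k *s act m w"
  using act_lincomb[of "{()}" "\<lambda>_. m" "\<lambda>_. k" w] by simp

lemma coord_mono: "j \<in> P \<Longrightarrow> k \<in> P \<Longrightarrow> coord (mono j) k = (if k = j then 1 else 0)"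
proof (rule coord_unique)
  assume j: "j \<in> P"
  have "(\<Sum>e\<in>P. to_ac (if e = j then 1 else 0) * mono e) = (\<Sum>e\<in>P. if e = j then mono e else 0)"
    by (intro sum.cong) auto
  then show "mono j = (\<Sum>e\<in>P. to_ac (if e = j then 1 else 0) * mono e)" using j by (simp add: sum.delta)
qed

lemma act_mono: "w \<in> W \<Longrightarrow> act (\<beta> ^ k * \<delta> ^ l) w = word k l w"
proof -
  assume w: "w \<in> W"
  have base: "act (\<beta> ^ k * \<delta> ^ l) w = word k l w" if "k < p" "l < p" for k l
  proof -
    have "act (mono (k, l)) w = (\<Sum>e\<in>P. if e = (k, l) then word (fst e) (snd e) w else 0)"
      unfolding act_def using that coord_mono[of "(k, l)"] by (intro sum.cong) auto
    then show ?thesis using that by (simp add: sum.delta mono_def)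
  qed
  have per: "act (\<beta> ^ (k + p) * \<delta> ^ l) w = b *s act (\<beta> ^ k * \<delta> ^ l) w"
     "act (\<beta> ^ k * \<delta> ^ (l + p)) w = d *s act (\<beta> ^ k * \<delta> ^ l) w" for k l
    using act_scale[OF mono_M[of "(k, l)"], of b w] act_scale[OF mono_M[of "(k, l)"], of d w]
    by (simp_all add: power_add \<beta>_pow \<delta>_pow mono_def mult_ac)
  show ?thesis
    using periodic_reduce[where \<Phi> = "\<lambda>k l. act (\<beta> ^ k * \<delta> ^ l) w", OF p_pos per, of k l]
      periodic_reduce[where \<Phi> = "\<lambda>k l. word k l w", OF p_pos word_period[OF w], of k l]
      base[of "k mod p" "l mod p"] p_pos by simp
qed

lemma act_one: "w \<in> W \<Longrightarrow> act 1 w = w"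
  using act_mono[of w 0 0] by (simp add: word_def)

lemma act_mult:
  assumes m: "m \<in> M" "m' \<in> M" and w: "w \<in> W"
  shows "act (m * m') w = act m (act m' w)"
proof -
  have 1: "act (mono e * m') w = word (fst e) (snd e) (act m' w)" for e
  proof -
    have "mono e * m' = (\<Sum>e'\<in>P. to_ac (coord m' e') * (mono e * mono e'))"
      by (subst coord_sum[OF m(2)]) (simp add: sum_distrib_left mult_ac)
    then have "act (mono e * m') w = (\<Sum>e'\<in>P. coord m' e' *s act (mono e * mono e') w)"
      by (simp only: act_lincomb[OF mult_M[OF mono_M mono_M]])
    moreover have "act (mono e * mono e') w = word (fst e) (snd e) (word (fst e') (snd e') w)" for e'
    proof -
      have "mono e * mono e' = \<beta> ^ (fst e + fst e') * \<delta> ^ (snd e + snd e')"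
        by (simp add: mono_def power_add mult_ac)
      then show ?thesis by (simp add: act_mono w word_word)
    qed
    ultimately show ?thesis by (simp add: act_def[of m'] word_sum)
  qed
  have "m * m' = (\<Sum>e\<in>P. to_ac (coord m e) * (mono e * m'))"
    by (subst coord_sum[OF m(1)]) (simp add: sum_distrib_right mult.assoc)
  then have "act (m * m') w = (\<Sum>e\<in>P. coord m e *s act (mono e * m') w)"
    by (simp only: act_lincomb[OF mult_M[OF mono_M m(2)]])
  then show ?thesis unfolding 1 act_def[of m] .
qed

lemma act_zero_right: "act m 0 = 0"
proof -
  have "word k l 0 = 0" for k l using word_sum[of k l "\<lambda>_. 0" "\<lambda>_. 0" "{}"] by simp
  then show ?thesis by (simp add: act_def)
qed

lemma act_zero_left: "act 0 w = 0"
proof -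
  have "coord 0 e = 0" if "e \<in> P" for e using coord_eq_0_iff[OF zero_M] that by blast
  then show ?thesis unfolding act_def by (intro sum.neutral) auto
qed

lemma act_inj:
  assumes "m \<in> M" "w \<in> W" "w \<noteq> 0" "act m w = 0"
  shows "m = 0"
proof (rule ccontr)
  assume "m \<noteq> 0"
  then have "w = act (inverse m * m) w" using act_one[OF assms(2)] by simp
  also have "\<dots> = act (inverse m) (act m w)" by (rule act_mult[OF inverse_M[OF assms(1)] assms(1,2)])
  finally show False using assms(3,4) act_zero_right by simp
qed

lemma act_inj_eq:
  assumes "m \<in> M" "m' \<in> M" "w \<in> W" "w \<noteq> 0" "act m w = act m' w"
  shows "m = m'"
proof -
  have eq: "(\<Sum>i\<in>{False, True}. to_ac (if i then 1 else - 1) * (if i then m else m')) = m - m'"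
    by simp
  have "m - m' \<in> M" using add_M[OF assms(1) mult_M[OF base_M[of "- 1"] assms(2)]] by simp
  moreover have "act (m - m') w = 0"
    using act_lincomb[of "{False, True}" "\<lambda>i. if i then m else m'" "\<lambda>i. if i then 1 else - 1" w] assms
    unfolding eq by simp
  ultimately show ?thesis using act_inj[of "m - m'" w] assms by simp
qed

lemma act_surj:
  assumes w: "w \<in> W"
  obtains m where "m \<in> M" "w = act m w0"
proof -
  obtain f g where nz: "\<exists>e\<in>P. f e \<noteq> 0 \<or> g e \<noteq> 0" and
    sum: "(\<Sum>e\<in>P. f e *s word (fst e) (snd e) w0) + (\<Sum>e\<in>P. g e *s word (fst e) (snd e) w) = 0"
    using rank_one[OF w] unfolding word_def by blast
  define mf where "mf = (\<Sum>e\<in>P. to_ac (f e) * mono e)"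
  define mg where "mg = (\<Sum>e\<in>P. to_ac (g e) * mono e)"
  have M: "mf \<in> M" "mg \<in> M" unfolding mf_def mg_def by (rule mono_comb_M)+
  have "act mf w0 = (\<Sum>e\<in>P. f e *s word (fst e) (snd e) w0)" "act mg w = (\<Sum>e\<in>P. g e *s word (fst e) (snd e) w)"
    unfolding act_def by (intro sum.cong refl; simp add: coord_unique[OF mf_def] coord_unique[OF mg_def])+
  then have eq: "act mf w0 + act mg w = 0" using sum by simp
  have "mg \<noteq> 0"
  proof
    assume 0: "mg = 0"
    then have g0: "\<forall>e\<in>P. g e = 0" using mono_independent[of g] unfolding mg_def by blast
    have "act mg w = 0" unfolding 0 by (rule act_zero_left)
    then have "act mf w0 = 0" using eq by simp
    then have "mf = 0" by (rule act_inj[OF M(1) w0])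
    then have "\<forall>e\<in>P. f e = 0" using mono_independent[of f] unfolding mf_def by blast
    then show False using g0 nz by blast
  qed
  have "act mg w = - act mf w0" using eq by (simp add: eq_neg_iff_add_eq_0 add.commute)
  also have "\<dots> = act (to_ac (- 1) * mf) w0" unfolding act_scale[OF M(1)] by simp
  finally have "act mg w = act (to_ac (- 1) * mf) w0" .
  then have "act (inverse mg) (act mg w) = act (inverse mg) (act (to_ac (- 1) * mf) w0)" by simp
  then have "act (inverse mg * mg) w = act (inverse mg * (to_ac (- 1) * mf)) w0"
    using act_mult[OF inverse_M[OF M(2)] M(2) w] act_mult[OF inverse_M[OF M(2)] mult_M[OF base_M M(1)] w0(1)] by metis
  then have "w = act (inverse mg * (to_ac (- 1) * mf)) w0" using \<open>mg \<noteq> 0\<close> act_one[OF w] by simp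
  then show ?thesis using that mult_M[OF inverse_M[OF M(2)] mult_M[OF base_M M(1)]] by blast
qed

text \<open>
  Since \<open>j i = \<zeta> i j\<close>, the operator \<open>opi\<close> is semilinear: it twists the scalars by \<open>s\<close>, which multiplies
  \<open>\<beta>\<close> by the inverse of \<open>\<zeta>\<close>.
\<close>

lemma opi_act:
  assumes m: "m \<in> M" and w: "w \<in> W"
  shows "opi (act m w) = act (s m) (opi w)"
proof -
  have "s m = (\<Sum>e\<in>P. s (to_ac (coord m e) * mono e))"
    using flinearD(5)[OF fspace_M flinear_s, of P "\<lambda>e. to_ac (coord m e) * mono e"] coord_sum[OF m]
    by (simp add: mult_M base_M mono_M)
  also have "\<dots> = (\<Sum>e\<in>P. to_ac (coord m e * inverse \<zeta> ^ fst e) * mono e)"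
    by (intro sum.cong refl) (simp add: s_mult base_M mono_M s_base s_mono)
  finally have "act (s m) (opi w) = (\<Sum>e\<in>P. (coord m e * inverse \<zeta> ^ fst e) *s act (mono e) (opi w))"
    by (simp only: act_lincomb[OF mono_M])
  also have "\<dots> = opi (act m w)"
    unfolding act_def[of m] mono_def
    by (simp add: ops_sum ops_scale opi_word w act_mono ops_W)
  finally show ?thesis by simp
qed

lemma opI_act:
  assumes m: "m \<in> M" and w: "w \<in> W"
  shows "opI (act m w) = act (t m) (opI w)"
proof -
  have "t m = (\<Sum>e\<in>P. t (to_ac (coord m e) * mono e))"
    using flinearD(5)[OF fspace_M flinear_t, of P "\<lambda>e. to_ac (coord m e) * mono e"] coord_sum[OF m]
    by (simp add: mult_M base_M mono_M)
  also have "\<dots> = (\<Sum>e\<in>P. to_ac (coord m e * \<zeta> ^ snd e) * mono e)"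
    by (intro sum.cong refl) (simp add: t_mult base_M mono_M t_base t_mono)
  finally have "act (t m) (opI w) = (\<Sum>e\<in>P. (coord m e * \<zeta> ^ snd e) *s act (mono e) (opI w))"
    by (simp only: act_lincomb[OF mono_M])
  also have "\<dots> = opI (act m w)"
    unfolding act_def[of m] mono_def
    by (simp add: ops_sum ops_scale opI_word w act_mono ops_W)
  finally show ?thesis by simp
qed

text \<open>
  Write \<open>i w0 = x w0\<close> and \<open>I w0 = y w0\<close>. By semilinearity, \<open>i\<^sup>p w0\<close> is the norm of \<open>x\<close> times \<open>w0\<close>, which
  must be \<open>a w0\<close>; likewise for \<open>I\<close>; and \<open>i I w0 = I i w0\<close> is the third equation.
\<close>

theorem solution_exists:
  "\<exists>x\<in>M. \<exists>y\<in>M. (\<Prod>k<p. (s ^^ k) x) = to_ac a \<and> (\<Prod>k<p. (t ^^ k) y) = to_ac c \<and> x * s y = y * t x"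
proof -
  obtain x where x: "x \<in> M" "opi w0 = act x w0" using act_surj[OF ops_W(1)[OF w0(1)]] by blast
  obtain y where y: "y \<in> M" "opI w0 = act y w0" using act_surj[OF ops_W(3)[OF w0(1)]] by blast
  have st: "(s ^^ k) m \<in> M" "(t ^^ k) m \<in> M" if "m \<in> M" for k m using that by (induction k) (auto simp: s_M t_M)
  have prod_M: "(\<Prod>q<(k::nat). f q) \<in> M" if "\<And>q. f q \<in> M" for f k
    using that by (induction k) (auto simp: one_M mult_M)
  have s_prod: "s (\<Prod>q<k. (s ^^ q) x) = (\<Prod>q<k. (s ^^ Suc q) x)" for k
    using s_base[of 1] by (induction k) (auto simp: s_mult prod_M st x)
  have t_prod: "t (\<Prod>q<k. (t ^^ q) y) = (\<Prod>q<k. (t ^^ Suc q) y)" for k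
    using t_base[of 1] by (induction k) (auto simp: t_mult prod_M st y)
  have 1: "(opi ^^ k) w0 = act (\<Prod>q<k. (s ^^ q) x) w0" for k
  proof (induction k)
    case (Suc k)
    have "(opi ^^ Suc k) w0 = act (s (\<Prod>q<k. (s ^^ q) x)) (act x w0)"
      using Suc opi_act[OF prod_M[of "\<lambda>q. (s ^^ q) x", OF st(1)[OF x(1)]] w0(1)] x(2) by simp
    also have "\<dots> = act (s (\<Prod>q<k. (s ^^ q) x) * x) w0"
      by (rule act_mult[symmetric, OF s_M[OF prod_M] x(1) w0(1)]) (rule st(1)[OF x(1)])
    also have "s (\<Prod>q<k. (s ^^ q) x) * x = (\<Prod>q<Suc k. (s ^^ q) x)"
      unfolding s_prod by (simp only: prod.lessThan_Suc_shift funpow_0 mult.commute)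
    finally show ?case .
  qed (simp add: act_one w0)
  have 2: "(opI ^^ k) w0 = act (\<Prod>q<k. (t ^^ q) y) w0" for k
  proof (induction k)
    case (Suc k)
    have "(opI ^^ Suc k) w0 = act (t (\<Prod>q<k. (t ^^ q) y)) (act y w0)"
      using Suc opI_act[OF prod_M[of "\<lambda>q. (t ^^ q) y", OF st(2)[OF y(1)]] w0(1)] y(2) by simp
    also have "\<dots> = act (t (\<Prod>q<k. (t ^^ q) y) * y) w0"
      by (rule act_mult[symmetric, OF t_M[OF prod_M] y(1) w0(1)]) (rule st(2)[OF y(1)])
    also have "t (\<Prod>q<k. (t ^^ q) y) * y = (\<Prod>q<Suc k. (t ^^ q) y)"
      unfolding t_prod by (simp only: prod.lessThan_Suc_shift funpow_0 mult.commute)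
    finally show ?case .
  qed (simp add: act_one w0)
  have const: "act (to_ac k) w0 = k *s w0" for k using act_scale[OF one_M, of k w0] act_one[OF w0(1)] by simp
  have "(\<Prod>k<p. (s ^^ k) x) = to_ac a"
    by (rule act_inj_eq[OF prod_M[OF st(1)[OF x(1)]] base_M w0]) (simp add: const opi_order w0 flip: 1)
  moreover have "(\<Prod>k<p. (t ^^ k) y) = to_ac c"
    by (rule act_inj_eq[OF prod_M[OF st(2)[OF y(1)]] base_M w0]) (simp add: const opI_order w0 flip: 2)
  moreover have "x * s y = y * t x"
  proof (rule act_inj_eq[OF _ _ w0])
    show "x * s y \<in> M" "y * t x \<in> M" by (simp_all add: mult_M s_M t_M x y)
    have "act (s y * x) w0 = opi (opI w0)"
      using act_mult[OF s_M[OF y(1)] x(1) w0(1)] opi_act[OF y(1) w0(1)] x(2) y(2) by simp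
    also have "\<dots> = act (t x * y) w0"
      using act_mult[OF t_M[OF x(1)] y(1) w0(1)] opI_act[OF x(1) w0(1)] x(2) y(2) iI[OF w0(1)] by simp
    finally show "act (x * s y) w0 = act (y * t x) w0" by (simp add: mult.commute)
  qed
  ultimately show ?thesis using x(1) y(1) by blast
qed

end

section \<open>Brauer equivalence and matrix algebras\<close>

lemma matrix_algebra_simps [simp]:
  "carrier (matrix_algebra n A) = ({..<n} \<times> {..<n}) \<rightarrow>\<^sub>E carrier A"
  "Y \<otimes>\<^bsub>matrix_algebra n A\<^esub> Z = (\<lambda>(i, j)\<in>{..<n} \<times> {..<n}. \<Oplus>\<^bsub>A\<^esub>k\<in>{..<n}. Y (i, k) \<otimes>\<^bsub>A\<^esub> Z (k, j))"
  "\<one>\<^bsub>matrix_algebra n A\<^esub> = (\<lambda>(i, j)\<in>{..<n} \<times> {..<n}. if i = j then \<one>\<^bsub>A\<^esub> else \<zero>\<^bsub>A\<^esub>)"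
  "\<zero>\<^bsub>matrix_algebra n A\<^esub> = (\<lambda>_\<in>{..<n} \<times> {..<n}. \<zero>\<^bsub>A\<^esub>)"
  "Y \<oplus>\<^bsub>matrix_algebra n A\<^esub> Z = (\<lambda>e\<in>{..<n} \<times> {..<n}. Y e \<oplus>\<^bsub>A\<^esub> Z e)"
  "k \<odot>\<^bsub>matrix_algebra n A\<^esub> Y = (\<lambda>e\<in>{..<n} \<times> {..<n}. k \<odot>\<^bsub>A\<^esub> Y e)"
  by (simp_all add: matrix_algebra_def)

lemma algebra_iso_matrix:
  assumes "ring A" "ring B" and \<theta>: "\<theta> \<in> algebra_iso F A B"
  shows "(\<lambda>Y. \<lambda>e\<in>{..<n} \<times> {..<n}. \<theta> (Y e)) \<in> algebra_iso F (matrix_algebra n A) (matrix_algebra n B)"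
proof -
  let ?N = "{..<n} \<times> {..<n}"
  have hom: "\<theta> \<in> ring_hom A B" and bij: "bij_betw \<theta> (carrier A) (carrier B)"
    and scal: "\<And>k x. k \<in> carrier F \<Longrightarrow> x \<in> carrier A \<Longrightarrow> \<theta> (k \<odot>\<^bsub>A\<^esub> x) = k \<odot>\<^bsub>B\<^esub> \<theta> x"
    using \<theta> by (auto simp: algebra_iso_def ring_iso_def)
  interpret A: ring A by fact
  interpret B: ring B by fact
  interpret ring_hom_ring A B \<theta> by (rule ring_hom_ringI2[OF assms(1,2) hom])
  define \<Theta> where "\<Theta> Y = (\<lambda>e\<in>?N. \<theta> (Y e))" for Y
  have ent: "Y e \<in> carrier A" if "Y \<in> ?N \<rightarrow>\<^sub>E carrier A" "e \<in> ?N" for Y e using that by auto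
  have \<Theta>_closed: "\<Theta> Y \<in> carrier (matrix_algebra n B)" if "Y \<in> ?N \<rightarrow>\<^sub>E carrier A" for Y
    unfolding \<Theta>_def matrix_algebra_simps restrict_PiE_iff using ent[OF that] hom_closed by blast
  have "\<Theta> \<in> ring_hom (matrix_algebra n A) (matrix_algebra n B)"
  proof (rule ring_hom_memI)
    fix Y Z assume Y: "Y \<in> carrier (matrix_algebra n A)" and Z: "Z \<in> carrier (matrix_algebra n A)"
    then have Y': "Y \<in> ?N \<rightarrow>\<^sub>E carrier A" and Z': "Z \<in> ?N \<rightarrow>\<^sub>E carrier A" by simp_all
    show "\<Theta> Y \<in> carrier (matrix_algebra n B)" by (rule \<Theta>_closed[OF Y'])
    show "\<Theta> (Y \<otimes>\<^bsub>matrix_algebra n A\<^esub> Z) = \<Theta> Y \<otimes>\<^bsub>matrix_algebra n B\<^esub> \<Theta> Z"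
    proof (rule extensionalityI[where A = ?N])
      fix e assume e: "e \<in> ?N"
      obtain i j where ij: "e = (i, j)" "i < n" "j < n" using e by auto
      have cl: "(\<lambda>k. Y (i, k) \<otimes>\<^bsub>A\<^esub> Z (k, j)) \<in> {..<n} \<rightarrow> carrier A"
        using ent[OF Y'] ent[OF Z'] ij by auto
      have "\<theta> (\<Oplus>\<^bsub>A\<^esub>k\<in>{..<n}. Y (i, k) \<otimes>\<^bsub>A\<^esub> Z (k, j)) = (\<Oplus>\<^bsub>B\<^esub>k\<in>{..<n}. \<theta> (Y (i, k) \<otimes>\<^bsub>A\<^esub> Z (k, j)))"
        using hom_finsum[OF cl] by (simp add: o_def)
      also have "\<dots> = (\<Oplus>\<^bsub>B\<^esub>k\<in>{..<n}. \<Theta> Y (i, k) \<otimes>\<^bsub>B\<^esub> \<Theta> Z (k, j))"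
        using ij ent[OF Y'] ent[OF Z'] by (intro B.finsum_cong') (auto simp: \<Theta>_def)
      finally show "\<Theta> (Y \<otimes>\<^bsub>matrix_algebra n A\<^esub> Z) e = (\<Theta> Y \<otimes>\<^bsub>matrix_algebra n B\<^esub> \<Theta> Z) e"
        using ij by (simp add: \<Theta>_def)
    qed (simp_all add: \<Theta>_def)
    show "\<Theta> (Y \<oplus>\<^bsub>matrix_algebra n A\<^esub> Z) = \<Theta> Y \<oplus>\<^bsub>matrix_algebra n B\<^esub> \<Theta> Z"
      using ent[OF Y'] ent[OF Z'] by (intro extensionalityI[where A = ?N]) (simp_all add: \<Theta>_def)
  next
    show "\<Theta> \<one>\<^bsub>matrix_algebra n A\<^esub> = \<one>\<^bsub>matrix_algebra n B\<^esub>"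
      by (intro extensionalityI[where A = ?N]) (auto simp: \<Theta>_def)
  qed
  moreover have "bij_betw \<Theta> (carrier (matrix_algebra n A)) (carrier (matrix_algebra n B))"
  proof (rule bij_betw_byWitness[where f' = "\<lambda>Y. \<lambda>e\<in>?N. inv_into (carrier A) \<theta> (Y e)"])
    have I: "inv_into (carrier A) \<theta> x \<in> carrier A" if "x \<in> carrier B" for x
      using bij_betw_apply[OF bij_betw_inv_into[OF bij] that] .
    show "\<forall>Y\<in>carrier (matrix_algebra n A). (\<lambda>e\<in>?N. inv_into (carrier A) \<theta> (\<Theta> Y e)) = Y"
    proof
      fix Y assume "Y \<in> carrier (matrix_algebra n A)"
      then have Y: "Y \<in> ?N \<rightarrow>\<^sub>E carrier A" by simp
      then show "(\<lambda>e\<in>?N. inv_into (carrier A) \<theta> (\<Theta> Y e)) = Y"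
        by (intro extensionalityI[where A = ?N])
           (simp_all add: \<Theta>_def bij_betw_inv_into_left[OF bij ent[OF Y]] PiE_def)
    qed
    show "\<forall>Y\<in>carrier (matrix_algebra n B). \<Theta> (\<lambda>e\<in>?N. inv_into (carrier A) \<theta> (Y e)) = Y"
    proof
      fix Y assume "Y \<in> carrier (matrix_algebra n B)"
      then have Y: "Y \<in> ?N \<rightarrow>\<^sub>E carrier B" by simp
      then have "Y e \<in> carrier B" if "e \<in> ?N" for e using that by (rule PiE_mem)
      then show "\<Theta> (\<lambda>e\<in>?N. inv_into (carrier A) \<theta> (Y e)) = Y"
        using Y by (intro extensionalityI[where A = ?N])
           (simp_all add: \<Theta>_def bij_betw_inv_into_right[OF bij] PiE_def)
    qed
    show "\<Theta> ` carrier (matrix_algebra n A) \<subseteq> carrier (matrix_algebra n B)"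
      by (rule image_subsetI, rule \<Theta>_closed) (simp only: matrix_algebra_simps)
    show "(\<lambda>Y. \<lambda>e\<in>?N. inv_into (carrier A) \<theta> (Y e)) ` carrier (matrix_algebra n B) \<subseteq> carrier (matrix_algebra n A)"
      unfolding matrix_algebra_simps image_subset_iff restrict_PiE_iff
    proof (intro ballI)
      fix Y e assume "Y \<in> ?N \<rightarrow>\<^sub>E carrier B" "e \<in> ?N"
      then show "inv_into (carrier A) \<theta> (Y e) \<in> carrier A" by (intro I) (rule PiE_mem)
    qed
  qed
  moreover have "\<Theta> (k \<odot>\<^bsub>matrix_algebra n A\<^esub> Y) = k \<odot>\<^bsub>matrix_algebra n B\<^esub> \<Theta> Y"
    if k: "k \<in> carrier F" and "Y \<in> carrier (matrix_algebra n A)" for k Y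
  proof -
    have Y: "Y \<in> ?N \<rightarrow>\<^sub>E carrier A" using that by simp
    show ?thesis by (rule extensionalityI[where A = ?N]) (simp_all add: \<Theta>_def scal[OF k ent[OF Y]])
  qed
  ultimately have "\<Theta> \<in> algebra_iso F (matrix_algebra n A) (matrix_algebra n B)"
    unfolding algebra_iso_def ring_iso_def by blast
  then show ?thesis unfolding \<Theta>_def[abs_def] .
qed

lemma algebra_iso_trans:
  "f \<in> algebra_iso F A B \<Longrightarrow> g \<in> algebra_iso F B C \<Longrightarrow> g \<circ> f \<in> algebra_iso F A C"
  unfolding algebra_iso_def using ring_iso_set_trans[of f A B g C]
  by (auto simp: ring_iso_def ring_hom_def Pi_iff)

lemma algebra_iso_sym:
  assumes A: "assoc_algebra F A" and h: "h \<in> algebra_iso F A B"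
  shows "inv_into (carrier A) h \<in> algebra_iso F B A"
proof -
  have ring: "ring A" and mod: "module F A" using A by (auto simp: assoc_algebra_def)
  have iso: "h \<in> ring_iso A B" and scal: "\<And>k x. k \<in> carrier F \<Longrightarrow> x \<in> carrier A \<Longrightarrow> h (k \<odot>\<^bsub>A\<^esub> x) = k \<odot>\<^bsub>B\<^esub> h x"
    using h by (auto simp: algebra_iso_def)
  have bij: "bij_betw h (carrier A) (carrier B)" using iso by (simp add: ring_iso_def)
  have "inv_into (carrier A) h (k \<odot>\<^bsub>B\<^esub> y) = k \<odot>\<^bsub>A\<^esub> inv_into (carrier A) h y"
    if k: "k \<in> carrier F" and y: "y \<in> carrier B" for k y
  proof -
    define x where "x = inv_into (carrier A) h y"
    have x: "x \<in> carrier A" "h x = y"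
      using bij_betw_inv_into_right[OF bij y] bij_betwE[OF bij_betw_inv_into[OF bij]] y by (auto simp: x_def)
    have "inv_into (carrier A) h (h (k \<odot>\<^bsub>A\<^esub> x)) = k \<odot>\<^bsub>A\<^esub> x"
      by (rule bij_betw_inv_into_left[OF bij module.smult_closed[OF mod k x(1)]])
    then show ?thesis using scal[OF k x(1)] x by (simp add: x_def)
  qed
  then show ?thesis unfolding algebra_iso_def using ring_iso_set_sym[OF ring iso] by blast
qed

text \<open>
  An isomorphism \<open>A \<cong> B\<close> induces isomorphisms of matrix algebras, and composing with these transports
  every equivalence of \<open>A\<close> with a third algebra to \<open>B\<close>.
\<close>

lemma brauer_class_eqI:
  assumes A: "central_simple_algebra F A" and B: "central_simple_algebra F B"
    and \<theta>: "\<theta> \<in> algebra_iso F A B"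
  shows "brauer_class F A = brauer_class F B"
proof -
  have aA: "assoc_algebra F A" and aB: "assoc_algebra F B" using A B by (auto simp: central_simple_algebra_def)
  then have r: "ring A" "ring B" by (auto simp: assoc_algebra_def)
  have sub: "brauer_class F A \<subseteq> brauer_class F B"
    if A: "central_simple_algebra F A" and B: "central_simple_algebra F B" and r: "ring A" "ring B"
      and \<theta>: "\<theta> \<in> algebra_iso F B A" for A B :: "('a, 'b) module" and \<theta>
  proof
    fix C assume "C \<in> brauer_class F A"
    then obtain m n f where mn: "m \<ge> 1" "n \<ge> 1" "f \<in> algebra_iso F (matrix_algebra m A) (matrix_algebra n C)"
      and C: "central_simple_algebra F C"
      unfolding brauer_class_def brauer_rel_def by auto
    have "f \<circ> (\<lambda>Y. \<lambda>e\<in>{..<m} \<times> {..<m}. \<theta> (Y e)) \<in> algebra_iso F (matrix_algebra m B) (matrix_algebra n C)"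
      by (rule algebra_iso_trans[OF algebra_iso_matrix[OF r(2,1) \<theta>] mn(3)])
    then show "C \<in> brauer_class F B"
      unfolding brauer_class_def brauer_rel_def using mn B C by blast
  qed
  show ?thesis
    using sub[OF A B r algebra_iso_sym[OF aA \<theta>]] sub[OF B A r(2,1) \<theta>] by blast
qed

lemma brauer_class_eqD:
  assumes B: "central_simple_algebra F B" and eq: "brauer_class F A = brauer_class F B"
  obtains m n h where "m \<ge> 1" "n \<ge> 1" "h \<in> algebra_iso F (matrix_algebra m A) (matrix_algebra n B)"
proof -
  have "id \<in> ring_iso R R" for R :: "(nat \<times> nat \<Rightarrow> 'b, 'c) ring_scheme"
    by (simp add: ring_iso_def ring_hom_def bij_betw_def)
  then have "id \<in> algebra_iso F (matrix_algebra 1 B) (matrix_algebra 1 B)"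
    unfolding algebra_iso_def by (simp del: matrix_algebra_simps)
  then have "B \<in> brauer_class F B" unfolding brauer_class_def brauer_rel_def using B by blast
  then have "B \<in> brauer_class F A" using eq by simp
  then have "\<exists>m\<ge>1. \<exists>n\<ge>1. algebra_iso F (matrix_algebra m A) (matrix_algebra n B) \<noteq> {}"
    unfolding brauer_class_def brauer_rel_def by blast
  then show ?thesis using that by blast
qed

section \<open>Matrices over a symbol algebra\<close>

lemma symbol_mult_zero:
  "symbol_mult p \<zeta> u v (\<lambda>e. 0) g e = 0" "symbol_mult p \<zeta> u v g (\<lambda>e. 0) e = 0"
  using symbol_mult_scale(1)[where c = 0] symbol_mult_scale(2)[where c = 0] by simp_all

lemma symbol_mult_sum:
  "symbol_mult p \<zeta> u v (\<lambda>e. \<Sum>l\<in>S. f l e) g e = (\<Sum>l\<in>S. symbol_mult p \<zeta> u v (f l) g e)"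
  "symbol_mult p \<zeta> u v g (\<lambda>e. \<Sum>l\<in>S. f l e) e = (\<Sum>l\<in>S. symbol_mult p \<zeta> u v g (f l) e)"
  by (induction S rule: infinite_finite_induct; simp add: symbol_mult_zero symbol_mult_add)+

type_synonym 'a smat = "nat \<times> nat \<Rightarrow> nat \<times> nat \<Rightarrow> 'a"

text \<open>
  Matrices over a symbol algebra, given by all their coefficients and extended by zero outside the
  index range. In contrast to the extensional functions of \<open>matrix_algebra\<close>, these form a vector space
  under the pointwise operations of the function type.
\<close>

definition smat :: "nat \<Rightarrow> nat \<Rightarrow> 'a::field smat set" where
  "smat p n = {Y. \<forall>ij e. Y ij e \<noteq> 0 \<longrightarrow> ij \<in> {..<n} \<times> {..<n} \<and> e \<in> {..<p} \<times> {..<p}}"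

definition smat_mult :: "nat \<Rightarrow> 'a::field \<Rightarrow> 'a \<Rightarrow> 'a \<Rightarrow> nat \<Rightarrow> 'a smat \<Rightarrow> 'a smat \<Rightarrow> 'a smat" where
  "smat_mult p \<zeta> u v n Y Z = (\<lambda>ij e. if ij \<in> {..<n} \<times> {..<n} \<and> e \<in> {..<p} \<times> {..<p}
     then \<Sum>k<n. symbol_mult p \<zeta> u v (Y (fst ij, k)) (Z (k, snd ij)) e else 0)"

definition smat_unit :: "nat \<Rightarrow> nat \<Rightarrow> nat \<Rightarrow> (nat \<times> nat \<Rightarrow> 'a::field) \<Rightarrow> 'a smat" where
  "smat_unit p k l f = (\<lambda>ij e. if ij = (k, l) \<and> e \<in> {..<p} \<times> {..<p} then f e else 0)"

definition smat_scale :: "'a::field \<Rightarrow> 'a smat \<Rightarrow> 'a smat" where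
  "smat_scale c Y = (\<lambda>ij e. c * Y ij e)"

definition smat_one :: "nat \<Rightarrow> nat \<Rightarrow> 'a::field smat" where
  "smat_one p n = (\<lambda>ij e. if ij \<in> {..<n} \<times> {..<n} \<and> fst ij = snd ij \<and> e = (0, 0) then 1 else 0)"

lemma sum_fun2: "(\<Sum>i\<in>S. f i) x y = (\<Sum>i\<in>S. f i x y)" for f :: "'i \<Rightarrow> 'a::field smat"
  by (induction S rule: infinite_finite_induct) auto

lemma vector_space_smat: "vector_space (smat_scale :: 'a::field \<Rightarrow> _)"
  by unfold_locales (auto simp: smat_scale_def fun_eq_iff algebra_simps)

lemma smat_mult_add:
  "smat_mult p \<zeta> u v n (Y + Y') Z = smat_mult p \<zeta> u v n Y Z + smat_mult p \<zeta> u v n Y' Z"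
  "smat_mult p \<zeta> u v n Z (Y + Y') = smat_mult p \<zeta> u v n Z Y + smat_mult p \<zeta> u v n Z Y'"
  by (auto simp: smat_mult_def fun_eq_iff plus_fun_def symbol_mult_add sum.distrib)

lemma smat_mult_scale:
  "smat_mult p \<zeta> u v n (smat_scale c Y) Z = smat_scale c (smat_mult p \<zeta> u v n Y Z)"
  "smat_mult p \<zeta> u v n Y (smat_scale c Z) = smat_scale c (smat_mult p \<zeta> u v n Y Z)"
  by (auto simp: smat_mult_def smat_scale_def fun_eq_iff symbol_mult_scale sum_distrib_left)

lemma smat_mult_closed: "smat_mult p \<zeta> u v n Y Z \<in> smat p n"
  by (auto simp: smat_def smat_mult_def split: if_splits)

lemma smat_outside:
  "Y \<in> smat p n \<Longrightarrow> \<not> (ij \<in> {..<n} \<times> {..<n} \<and> e \<in> {..<p} \<times> {..<p}) \<Longrightarrow> Y ij e = 0"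
  unfolding smat_def by blast

lemma smat_mult_assoc:
  assumes "p > 0" "\<zeta> ^ p = (1::'a::field)"
  shows "smat_mult p \<zeta> u v n (smat_mult p \<zeta> u v n Y Z) T = smat_mult p \<zeta> u v n Y (smat_mult p \<zeta> u v n Z T)"
proof (intro ext)
  fix ij e
  show "smat_mult p \<zeta> u v n (smat_mult p \<zeta> u v n Y Z) T ij e = smat_mult p \<zeta> u v n Y (smat_mult p \<zeta> u v n Z T) ij e"
  proof (cases "ij \<in> {..<n} \<times> {..<n} \<and> e \<in> {..<p} \<times> {..<p}")
    case True
    then obtain i j where ij: "ij = (i, j)" "i < n" "j < n" by auto
    have "smat_mult p \<zeta> u v n (smat_mult p \<zeta> u v n Y Z) T ij e
      = (\<Sum>k<n. symbol_mult p \<zeta> u v (smat_mult p \<zeta> u v n Y Z (i, k)) (T (k, j)) e)"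
      using True ij by (simp add: smat_mult_def[of _ _ _ _ _ _ T])
    also have "\<dots> = (\<Sum>k<n. symbol_mult p \<zeta> u v (\<lambda>e. \<Sum>l<n. symbol_mult p \<zeta> u v (Y (i, l)) (Z (l, k)) e) (T (k, j)) e)"
    proof (intro sum.cong refl)
      fix k assume "k \<in> {..<n}"
      have "symbol_mult p \<zeta> u v (smat_mult p \<zeta> u v n Y Z (i, k)) (T (k, j))
        = symbol_mult p \<zeta> u v (\<lambda>e. \<Sum>l<n. symbol_mult p \<zeta> u v (Y (i, l)) (Z (l, k)) e) (T (k, j))"
        using \<open>k \<in> {..<n}\<close> ij by (intro symbol_mult_cong) (auto simp: smat_mult_def)
      then show "symbol_mult p \<zeta> u v (smat_mult p \<zeta> u v n Y Z (i, k)) (T (k, j)) e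
        = symbol_mult p \<zeta> u v (\<lambda>e. \<Sum>l<n. symbol_mult p \<zeta> u v (Y (i, l)) (Z (l, k)) e) (T (k, j)) e" by simp
    qed
    also have "\<dots> = (\<Sum>l<n. \<Sum>k<n. symbol_mult p \<zeta> u v (Y (i, l)) (symbol_mult p \<zeta> u v (Z (l, k)) (T (k, j))) e)"
      unfolding symbol_mult_sum symbol_mult_assoc[OF assms] by (rule sum.swap)
    also have "\<dots> = (\<Sum>l<n. symbol_mult p \<zeta> u v (Y (i, l)) (\<lambda>e. \<Sum>k<n. symbol_mult p \<zeta> u v (Z (l, k)) (T (k, j)) e) e)"
      unfolding symbol_mult_sum ..
    also have "\<dots> = (\<Sum>l<n. symbol_mult p \<zeta> u v (Y (i, l)) (smat_mult p \<zeta> u v n Z T (l, j)) e)"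
    proof (intro sum.cong refl)
      fix l assume "l \<in> {..<n}"
      have "symbol_mult p \<zeta> u v (Y (i, l)) (\<lambda>e. \<Sum>k<n. symbol_mult p \<zeta> u v (Z (l, k)) (T (k, j)) e)
        = symbol_mult p \<zeta> u v (Y (i, l)) (smat_mult p \<zeta> u v n Z T (l, j))"
        using \<open>l \<in> {..<n}\<close> ij by (intro symbol_mult_cong) (auto simp: smat_mult_def)
      then show "symbol_mult p \<zeta> u v (Y (i, l)) (\<lambda>e. \<Sum>k<n. symbol_mult p \<zeta> u v (Z (l, k)) (T (k, j)) e) e
        = symbol_mult p \<zeta> u v (Y (i, l)) (smat_mult p \<zeta> u v n Z T (l, j)) e" by simp
    qed
    also have "\<dots> = smat_mult p \<zeta> u v n Y (smat_mult p \<zeta> u v n Z T) ij e"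
      using True ij by (simp add: smat_mult_def[of _ _ _ _ _ Y])
    finally show ?thesis .
  next
    case False
    show ?thesis by (simp only: smat_outside[OF smat_mult_closed False])
  qed
qed

lemma smat_one_mult:
  assumes p: "p > 0" and Y: "Y \<in> smat p n"
  shows "smat_mult p \<zeta> u v n (smat_one p n) Y = Y" "smat_mult p \<zeta> u v n Y (smat_one p n) = Y"
proof -
  have one: "symbol_mult p \<zeta> u v (smat_one p n (i, k)) f e = (if i = k then f e else 0)"
     "symbol_mult p \<zeta> u v f (smat_one p n (i, k)) e = (if i = k then f e else 0)"
    if "i < n" "k < n" "e \<in> {..<p} \<times> {..<p}" for i k f e
  proof -
    have "symbol_mult p \<zeta> u v (smat_one p n (i, k)) f e = symbol_mult p \<zeta> u v (\<lambda>e. (if i = k then 1 else 0) * symbol_basis p (0, 0) e) f e"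
      by (rule fun_cong[OF symbol_mult_cong]) (use that in \<open>auto simp: smat_one_def symbol_basis_def\<close>)
    then show "symbol_mult p \<zeta> u v (smat_one p n (i, k)) f e = (if i = k then f e else 0)"
      unfolding symbol_mult_scale symbol_mult_one[OF p that(3)] by simp
    have "symbol_mult p \<zeta> u v f (smat_one p n (i, k)) e = symbol_mult p \<zeta> u v f (\<lambda>e. (if i = k then 1 else 0) * symbol_basis p (0, 0) e) e"
      by (rule fun_cong[OF symbol_mult_cong]) (use that in \<open>auto simp: smat_one_def symbol_basis_def\<close>)
    then show "symbol_mult p \<zeta> u v f (smat_one p n (i, k)) e = (if i = k then f e else 0)"
      unfolding symbol_mult_scale symbol_mult_one[OF p that(3)] by simp
  qed
  have out: "Y ij e = 0" if "\<not> (ij \<in> {..<n} \<times> {..<n} \<and> e \<in> {..<p} \<times> {..<p})" for ij e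
    using Y that unfolding smat_def by blast
  show "smat_mult p \<zeta> u v n (smat_one p n) Y = Y"
  proof (intro ext)
    fix ij e
    show "smat_mult p \<zeta> u v n (smat_one p n) Y ij e = Y ij e"
      using out[of ij e] by (cases ij) (auto simp: smat_mult_def one sum.delta)
  qed
  show "smat_mult p \<zeta> u v n Y (smat_one p n) = Y"
  proof (intro ext)
    fix ij e
    show "smat_mult p \<zeta> u v n Y (smat_one p n) ij e = Y ij e"
      using out[of ij e] by (cases ij) (auto simp: smat_mult_def one sum.delta)
  qed
qed

lemma smat_unit_mult:
  assumes "k < n" "l < n" "l' < n" "m < n"
  shows "smat_mult p \<zeta> u v n (smat_unit p k l f) (smat_unit p l' m g)
     = (if l = l' then smat_unit p k m (symbol_mult p \<zeta> u v f g) else 0)"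
proof (intro ext)
  fix ij e :: "nat \<times> nat"
  note 0 = symbol_mult_zero
  obtain i j where ij: "ij = (i, j)" by (cases ij)
  have u: "symbol_mult p \<zeta> u v (smat_unit p k l f (i, q)) (smat_unit p l' m g (q, j)) e
     = (if i = k \<and> q = l \<and> q = l' \<and> j = m then symbol_mult p \<zeta> u v f g e else 0)" for q
  proof (cases "i = k \<and> q = l \<and> q = l' \<and> j = m")
    case True
    then have "symbol_mult p \<zeta> u v (smat_unit p k l f (i, q)) (smat_unit p l' m g (q, j)) = symbol_mult p \<zeta> u v f g"
      by (intro symbol_mult_cong) (auto simp: smat_unit_def)
    then show ?thesis using True by simp
  next
    case False
    then have "smat_unit p k l f (i, q) = (\<lambda>e. 0) \<or> smat_unit p l' m g (q, j) = (\<lambda>e. 0)"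
      by (auto simp: smat_unit_def fun_eq_iff)
    then show ?thesis using False by (auto simp: 0)
  qed
  have "(\<Sum>q<n. if i = k \<and> q = l \<and> q = l' \<and> j = m then symbol_mult p \<zeta> u v f g e else 0)
     = (\<Sum>q<n. if q = l then (if i = k \<and> l = l' \<and> j = m then symbol_mult p \<zeta> u v f g e else 0) else 0)"
    by (intro sum.cong) auto
  also have "\<dots> = (if i = k \<and> l = l' \<and> j = m then symbol_mult p \<zeta> u v f g e else 0)"
    using assms by (simp add: sum.delta)
  finally have "smat_mult p \<zeta> u v n (smat_unit p k l f) (smat_unit p l' m g) ij e
     = (if ij \<in> {..<n} \<times> {..<n} \<and> e \<in> {..<p} \<times> {..<p}
        then if i = k \<and> l = l' \<and> j = m then symbol_mult p \<zeta> u v f g e else 0 else 0)"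
    unfolding smat_mult_def ij fst_conv snd_conv u by (rule if_cong[OF refl _ refl])
  then show "smat_mult p \<zeta> u v n (smat_unit p k l f) (smat_unit p l' m g) ij e
     = (if l = l' then smat_unit p k m (symbol_mult p \<zeta> u v f g) else 0) ij e"
    using assms by (auto simp: ij smat_unit_def zero_fun_def)
qed

lemma smat_unit_closed: "k < n \<Longrightarrow> l < n \<Longrightarrow> smat_unit p k l f \<in> smat p n"
  by (auto simp: smat_def smat_unit_def split: if_splits)

lemma smat_one_sum:
  assumes "p > 0"
  shows "smat_one p n = (\<Sum>k<n. smat_unit p k k (symbol_basis p (0, 0)))"
proof (intro ext)
  fix ij e
  have "(\<Sum>k<n. smat_unit p k k (symbol_basis p (0, 0))) ij e
     = (\<Sum>k<n. if k = fst ij then (if fst ij = snd ij \<and> e = (0, 0) then 1 else 0) else 0)"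
    unfolding sum_fun2 using assms
    by (intro sum.cong refl) (cases ij, auto simp: smat_unit_def symbol_basis_def)
  also have "\<dots> = smat_one p n ij e"
    by (auto simp: sum.delta smat_one_def mem_Times_iff)
  finally show "smat_one p n ij e = (\<Sum>k<n. smat_unit p k k (symbol_basis p (0, 0))) ij e" by (rule sym)
qed

text \<open>
  The translations between the two representations of matrices over a symbol algebra.
\<close>

definition to_smat :: "nat \<Rightarrow> nat \<Rightarrow> 'a::field smat \<Rightarrow> 'a smat" where
  "to_smat p n Y = (\<lambda>ij e. if ij \<in> {..<n} \<times> {..<n} \<and> e \<in> {..<p} \<times> {..<p} then Y ij e else 0)"

definition of_smat :: "nat \<Rightarrow> nat \<Rightarrow> 'a::field smat \<Rightarrow> 'a smat" where
  "of_smat p n Y = (\<lambda>ij\<in>{..<n} \<times> {..<n}. \<lambda>e\<in>{..<p} \<times> {..<p}. Y ij e)"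

lemma of_smat_carrier: "of_smat p n Y \<in> carrier (matrix_algebra n (symbol_algebra p \<zeta> u v))"
  by (auto simp: of_smat_def)

lemma to_of_smat: "Y \<in> smat p n \<Longrightarrow> to_smat p n (of_smat p n Y) = Y"
  unfolding to_smat_def of_smat_def smat_def by (intro ext) auto

lemma of_to_smat:
  assumes "Y \<in> carrier (matrix_algebra n (symbol_algebra p \<zeta> u v))"
  shows "of_smat p n (to_smat p n Y) = Y"
proof (rule extensionalityI[where A = "{..<n} \<times> {..<n}"])
  fix ij assume ij: "ij \<in> {..<n} \<times> {..<n}"
  then have "Y ij \<in> {..<p} \<times> {..<p} \<rightarrow>\<^sub>E UNIV" using assms by (auto dest: PiE_mem)
  then show "of_smat p n (to_smat p n Y) ij = Y ij"
    using ij by (intro PiE_UNIV_eqI[where S = "{..<p} \<times> {..<p}"]) (auto simp: of_smat_def to_smat_def)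
qed (use assms in \<open>auto simp: of_smat_def PiE_def\<close>)

lemma to_smat_closed: "to_smat p n Y \<in> smat p n"
  by (auto simp: smat_def to_smat_def split: if_splits)

lemma of_smat_mult:
  assumes "p > 0" "\<zeta> ^ p = 1"
  shows "of_smat p n (smat_mult p \<zeta> u v n Y Z)
    = of_smat p n Y \<otimes>\<^bsub>matrix_algebra n (symbol_algebra p \<zeta> u v)\<^esub> of_smat p n Z"
proof (rule extensionalityI[where A = "{..<n} \<times> {..<n}"])
  let ?A = "symbol_algebra p \<zeta> u v"
  fix ij assume "ij \<in> {..<n} \<times> {..<n}"
  then obtain i j where ij: "ij = (i, j)" "i < n" "j < n" by auto
  interpret ring ?A using assoc_algebra_symbol[OF assms] by (simp add: assoc_algebra_def)
  have cl: "(\<lambda>k. of_smat p n Y (i, k) \<otimes>\<^bsub>?A\<^esub> of_smat p n Z (k, j)) \<in> {..<n} \<rightarrow> carrier ?A" by auto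
  have "(\<Oplus>\<^bsub>?A\<^esub>k\<in>{..<n}. of_smat p n Y (i, k) \<otimes>\<^bsub>?A\<^esub> of_smat p n Z (k, j))
     = (\<lambda>e\<in>{..<p} \<times> {..<p}. smat_mult p \<zeta> u v n Y Z (i, j) e)"
  proof (rule PiE_UNIV_eqI[where S = "{..<p} \<times> {..<p}"])
    show "(\<Oplus>\<^bsub>?A\<^esub>k\<in>{..<n}. of_smat p n Y (i, k) \<otimes>\<^bsub>?A\<^esub> of_smat p n Z (k, j)) \<in> {..<p} \<times> {..<p} \<rightarrow>\<^sub>E UNIV"
      using finsum_closed[OF cl] by simp
    fix e assume e: "e \<in> {..<p} \<times> {..<p}"
    show "(\<Oplus>\<^bsub>?A\<^esub>k\<in>{..<n}. of_smat p n Y (i, k) \<otimes>\<^bsub>?A\<^esub> of_smat p n Z (k, j)) e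
       = (\<lambda>e\<in>{..<p} \<times> {..<p}. smat_mult p \<zeta> u v n Y Z (i, j) e) e"
    proof -
      have "(\<Oplus>\<^bsub>?A\<^esub>k\<in>{..<n}. of_smat p n Y (i, k) \<otimes>\<^bsub>?A\<^esub> of_smat p n Z (k, j)) e
        = (\<Sum>k<n. (of_smat p n Y (i, k) \<otimes>\<^bsub>?A\<^esub> of_smat p n Z (k, j)) e)"
        by (rule symbol_finsum[OF assms _ cl e]) simp
      also have "\<dots> = (\<Sum>k<n. symbol_mult p \<zeta> u v (Y (i, k)) (Z (k, j)) e)"
        using e ij by (intro sum.cong) (simp_all add: of_smat_def symbol_mult_restrict)
      finally show ?thesis using e ij by (simp add: smat_mult_def)
    qed
  qed simp
  then show "of_smat p n (smat_mult p \<zeta> u v n Y Z) ij = (of_smat p n Y \<otimes>\<^bsub>matrix_algebra n ?A\<^esub> of_smat p n Z) ij"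
    using ij by (simp add: of_smat_def[of _ _ "smat_mult p \<zeta> u v n Y Z"])
qed (simp_all add: of_smat_def)

lemma of_smat_linear:
  "of_smat p n (Y + Z) = of_smat p n Y \<oplus>\<^bsub>matrix_algebra n (symbol_algebra p \<zeta> u v)\<^esub> of_smat p n Z"
  "of_smat p n (smat_scale c Y) = c \<odot>\<^bsub>matrix_algebra n (symbol_algebra p \<zeta> u v)\<^esub> of_smat p n Y"
  "of_smat p n (smat_one p n) = \<one>\<^bsub>matrix_algebra n (symbol_algebra p \<zeta> u v)\<^esub>"
proof -
  note I = extensionalityI[where A = "{..<n} \<times> {..<n}"]
  show "of_smat p n (Y + Z) = of_smat p n Y \<oplus>\<^bsub>matrix_algebra n (symbol_algebra p \<zeta> u v)\<^esub> of_smat p n Z"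
    by (rule I) (simp_all add: of_smat_def cong: restrict_cong)
  show "of_smat p n (smat_scale c Y) = c \<odot>\<^bsub>matrix_algebra n (symbol_algebra p \<zeta> u v)\<^esub> of_smat p n Y"
    by (rule I) (simp_all add: of_smat_def smat_scale_def cong: restrict_cong)
  show "of_smat p n (smat_one p n) = \<one>\<^bsub>matrix_algebra n (symbol_algebra p \<zeta> u v)\<^esub>"
  proof (rule I)
    fix ij assume "ij \<in> {..<n} \<times> {..<n}"
    then show "of_smat p n (smat_one p n) ij = \<one>\<^bsub>matrix_algebra n (symbol_algebra p \<zeta> u v)\<^esub> ij"
      by (cases "fst ij = snd ij") (simp_all add: of_smat_def smat_one_def symbol_basis_def case_prod_unfold cong: restrict_cong)
  qed (simp_all add: of_smat_def case_prod_unfold)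
qed

text \<open>
  Sums of matrices are handled as sums in the function type and are not to be unfolded pointwise.
\<close>

declare plus_fun_apply [simp del] zero_fun_apply [simp del]

lemma symbol_basis_mult:
  fixes \<zeta> u v :: "'a::field"
  assumes "k < p" "l < p" "m < p" "n < p" and e: "e \<in> {..<p} \<times> {..<p}"
  shows "symbol_mult p \<zeta> u v (symbol_basis p (m, n)) (symbol_basis p (k, l)) e
    = \<zeta> ^ (n * k) * u ^ ((k + m) div p) * v ^ ((l + n) div p) * symbol_basis p ((k + m) mod p, (l + n) mod p) e"
proof -
  obtain k' l' where e': "k' < p" "l' < p" "e = ((k' + m) mod p, (l' + n) mod p)"
    using shift_index_cases[OF e assms(3,4)] .
  have "symbol_mult p \<zeta> u v (symbol_basis p (m, n)) (symbol_basis p (k, l)) e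
    = symbol_basis p (k, l) (k', l') * \<zeta> ^ (n * k') * u ^ ((k' + m) div p) * v ^ ((l' + n) div p)"
    unfolding e'(3) by (rule symbol_mult_basis(2)[OF e'(1,2) assms(3,4)])
  moreover have "symbol_basis p ((k + m) mod p, (l + n) mod p) e = (if (k', l') = (k, l) then 1 else 0 :: 'a)"
    using e e' assms by (auto simp: symbol_basis_def dest: mod_add_left_cancel)
  moreover have "symbol_basis p (k, l) (k', l') = (if (k', l') = (k, l) then 1 else 0 :: 'a)"
    using e' by (simp add: symbol_basis_def)
  ultimately show ?thesis by (cases "(k', l') = (k, l)") simp_all
qed

context bicyclic
begin

text \<open>
  Let \<open>B\<close> be the algebra of \<open>n \<times> n\<close> matrices over \<open>(c, d)_p\<close>. It contains the standard matrix units \<open>V\<close>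
  and the images \<open>U\<close> of the matrix units over \<open>(a, b)_p\<close>. Comparing dimensions gives \<open>m = n\<close>. The corner
  \<open>W\<close> of \<open>B\<close> cut out by the idempotents \<open>U 0 0\<close> on the left and \<open>V 0 0\<close> on the right is a bimodule over the
  two symbol algebras, and \<open>B\<close> is the direct sum of \<open>m n\<close> copies of it. So \<open>W\<close> has dimension \<open>p\<^sup>2\<close> over
  \<open>F\<close>, that is, dimension one over \<open>M\<close>.
\<close>

lemma solution_of_matrix_iso:
  assumes ac: "a \<noteq> 0" "c \<noteq> 0" and mn: "m \<ge> 1" "n \<ge> 1"
    and h: "h \<in> algebra_iso fld (matrix_algebra m (symbol_algebra p \<zeta> a b)) (matrix_algebra n (symbol_algebra p \<zeta> c d))"
  shows "\<exists>x\<in>M. \<exists>y\<in>M. (\<Prod>k<p. (s ^^ k) x) = to_ac a \<and> (\<Prod>k<p. (t ^^ k) y) = to_ac c \<and> x * s y = y * t x"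
proof -
  let ?P = "{..<p} \<times> {..<p}"
  let ?A = "matrix_algebra m (symbol_algebra p \<zeta> a b)" and ?B = "matrix_algebra n (symbol_algebra p \<zeta> c d)"
  define mA where "mA = smat_mult p \<zeta> a b m"
  define mB where "mB = smat_mult p \<zeta> c d n"
  interpret S: vector_space "smat_scale :: 'a \<Rightarrow> _" by (rule vector_space_smat)
  have assocB: "mB (mB Y Z) T = mB Y (mB Z T)" for Y Z T
    unfolding mB_def by (rule smat_mult_assoc[OF p_pos \<zeta>_pow])
  have addB: "mB (Y + Y') Z = mB Y Z + mB Y' Z" "mB Z (Y + Y') = mB Z Y + mB Z Y'" for Y Y' Z
    unfolding mB_def by (rule smat_mult_add)+
  have scaleB: "mB (smat_scale k Y) Z = smat_scale k (mB Y Z)" "mB Y (smat_scale k Z) = smat_scale k (mB Y Z)" for k Y Z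
    unfolding mB_def by (rule smat_mult_scale)+
  have zeroB: "mB 0 Z = 0" "mB Z 0 = 0" for Z
    using scaleB[of 0 0 Z] scaleB(2)[of Z 0 0] by simp_all
  have sumB: "mB (\<Sum>i\<in>I. f i) Z = (\<Sum>i\<in>I. mB (f i) Z)" "mB Z (\<Sum>i\<in>I. f i) = (\<Sum>i\<in>I. mB Z (f i))"
    for f :: "'i \<Rightarrow> _" and I Z
  proof -
    show "mB (\<Sum>i\<in>I. f i) Z = (\<Sum>i\<in>I. mB (f i) Z)"
      by (induction I rule: infinite_finite_induct) (simp_all only: sum.infinite sum.empty sum.insert not_False_eq_True zeroB addB)
    show "mB Z (\<Sum>i\<in>I. f i) = (\<Sum>i\<in>I. mB Z (f i))"
      by (induction I rule: infinite_finite_induct) (simp_all only: sum.infinite sum.empty sum.insert not_False_eq_True zeroB addB)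
  qed
  have closedB: "mB Y Z \<in> smat p n" for Y Z unfolding mB_def by (rule smat_mult_closed)
  define H where "H Y = to_smat p n (h (of_smat p m Y))" for Y
  have hom: "h \<in> ring_hom ?A ?B" and bij: "bij_betw h (carrier ?A) (carrier ?B)"
    and scal: "\<And>k Y. Y \<in> carrier ?A \<Longrightarrow> h (k \<odot>\<^bsub>?A\<^esub> Y) = k \<odot>\<^bsub>?B\<^esub> h Y"
    using h unfolding algebra_iso_def ring_iso_def by auto
  note oA = of_smat_carrier[of p m _ \<zeta> a b]
  have hB: "h (of_smat p m Y) \<in> carrier ?B" for Y by (rule ring_hom_closed[OF hom oA])
  have ofH: "of_smat p n (H Y) = h (of_smat p m Y)" for Y
    unfolding H_def by (rule of_to_smat[OF hB])
  have HI: "H Y = Z" if "h (of_smat p m Y) = of_smat p n Z" "Z \<in> smat p n" for Y Z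
    unfolding H_def that(1) by (rule to_of_smat[OF that(2)])
  have H_closed: "H Y \<in> smat p n" for Y unfolding H_def by (rule to_smat_closed)
  have plus_closed: "Y + Z \<in> smat p n" if "Y \<in> smat p n" "Z \<in> smat p n" for Y Z :: "'a smat" and n
    unfolding smat_def mem_Collect_eq
  proof (intro allI impI)
    fix ij e assume "(Y + Z) ij e \<noteq> 0"
    then have "Y ij e \<noteq> 0 \<or> Z ij e \<noteq> 0" by (auto simp: plus_fun_apply)
    then show "ij \<in> {..<n} \<times> {..<n} \<and> e \<in> ?P" using that unfolding smat_def by blast
  qed
  have scale_closed: "smat_scale k Y \<in> smat p n" if "Y \<in> smat p n" for Y k n
    using that unfolding smat_def smat_scale_def by auto
  have H_add: "H (Y + Z) = H Y + H Z" for Y Z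
  proof (rule HI)
    show "h (of_smat p m (Y + Z)) = of_smat p n (H Y + H Z)"
      unfolding of_smat_linear(1)[of p m _ _ \<zeta> a b] of_smat_linear(1)[of p n _ _ \<zeta> c d] ofH
      by (rule ring_hom_add[OF hom oA oA])
  qed (intro plus_closed H_closed)
  have H_scale: "H (smat_scale k Y) = smat_scale k (H Y)" for k Y
  proof (rule HI)
    show "h (of_smat p m (smat_scale k Y)) = of_smat p n (smat_scale k (H Y))"
      unfolding of_smat_linear(2)[of p m _ _ \<zeta> a b] of_smat_linear(2)[of p n _ _ \<zeta> c d] ofH
      by (rule scal[OF oA])
  qed (intro scale_closed H_closed)
  have H_mult: "H (mA Y Z) = mB (H Y) (H Z)" for Y Z
  proof (rule HI)
    show "h (of_smat p m (mA Y Z)) = of_smat p n (mB (H Y) (H Z))"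
      unfolding mA_def mB_def of_smat_mult[OF p_pos \<zeta>_pow] ofH
      by (rule ring_hom_mult[OF hom oA oA])
  qed (rule closedB)
  have one_closed: "smat_one p k \<in> smat p k" for k
    using p_pos by (auto simp: smat_def smat_one_def split: if_splits)
  have H_one: "H (smat_one p m) = smat_one p n"
    by (rule HI) (simp_all only: of_smat_linear(3)[of p m \<zeta> a b] of_smat_linear(3)[of p n \<zeta> c d] ring_hom_one[OF hom] one_closed)
  have H_zero: "H 0 = 0" using H_scale[of 0 0] by simp
  have H_sum: "H (\<Sum>i\<in>I. f i) = (\<Sum>i\<in>I. H (f i))" for f :: "'i \<Rightarrow> _" and I
    by (induction I rule: infinite_finite_induct) (simp_all only: sum.infinite sum.empty sum.insert not_False_eq_True H_zero H_add)
  have H_inj: "Y = 0" if "H Y = 0" "Y \<in> smat p m" for Y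
  proof -
    have "h (of_smat p m Y) = h (of_smat p m 0)" using ofH[of Y] ofH[of 0] that(1) H_zero by simp
    then have "of_smat p m Y = of_smat p m 0" by (rule inj_onD[OF bij_betw_imp_inj_on[OF bij] _ oA oA])
    then have "to_smat p m (of_smat p m Y) = to_smat p m (of_smat p m 0)" by simp
    moreover have "0 \<in> smat p m" by (simp add: smat_def zero_fun_apply)
    ultimately show ?thesis using to_of_smat that(2) by metis
  qed
  have H_surj: "\<exists>Y\<in>smat p m. H Y = Z" if "Z \<in> smat p n" for Z
  proof -
    have "of_smat p n Z \<in> h ` carrier ?A"
      unfolding bij_betw_imp_surj_on[OF bij] by (rule of_smat_carrier)
    then obtain Y where Y: "Y \<in> carrier ?A" "h Y = of_smat p n Z" by (elim imageE) (rule that, simp_all only:)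
    have "H (to_smat p m Y) = Z" using Y(2) by (intro HI[OF _ that]) (simp only: of_to_smat[OF Y(1)])
    then show ?thesis using to_smat_closed by blast
  qed
  \<comment> \<open>The matrices \<open>\<Delta> x\<close> with a single coefficient equal to one form bases of both algebras, of
     cardinalities \<open>m\<^sup>2 p\<^sup>2\<close> and \<open>n\<^sup>2 p\<^sup>2\<close>, and \<open>H\<close> preserves linear independence both ways; so \<open>m = n\<close>.\<close>
  define \<Delta> where "\<Delta> x = (smat_unit p (fst (fst x)) (snd (fst x)) (symbol_basis p (snd x)) :: 'a smat)"
    for x :: "(nat \<times> nat) \<times> (nat \<times> nat)"
  define I where "I k = ({..<k} \<times> {..<k}) \<times> ?P" for k :: nat
  have \<Delta>: "\<Delta> x ij e = (if x = (ij, e) then 1 else 0)" if "x \<in> I k" for x ij e k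
    using that by (cases x) (auto simp: \<Delta>_def smat_unit_def symbol_basis_def I_def)
  have \<Delta>_closed: "\<Delta> x \<in> smat p k" if "x \<in> I k" for x k
    using that by (auto simp: \<Delta>_def I_def intro: smat_unit_closed)
  have finI: "finite (I k)" for k by (simp add: I_def)
  have cardI: "card (I k) = k * k * (p * p)" for k by (simp add: I_def card_cartesian_product)
  have \<Delta>_sum: "(\<Sum>x\<in>I k. smat_scale (g x) (\<Delta> x)) ij e = (if (ij, e) \<in> I k then g (ij, e) else 0)" for g k ij e
  proof -
    have "(\<Sum>x\<in>I k. smat_scale (g x) (\<Delta> x)) ij e = (\<Sum>x\<in>I k. if x = (ij, e) then g x else 0)"
      unfolding sum_fun2 by (intro sum.cong refl) (auto simp: smat_scale_def \<Delta>)
    then show ?thesis using finI by (simp add: sum.delta)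
  qed
  have sum_closed: "(\<Sum>x\<in>J. smat_scale (g x) (Y x)) \<in> smat p k" if "\<And>x. x \<in> J \<Longrightarrow> Y x \<in> smat p k"
    for J :: "'j set" and g and Y :: "'j \<Rightarrow> 'a smat" and k
    using that
  proof (induction J rule: infinite_finite_induct)
    case (insert x F)
    then show ?case using plus_closed[of "smat_scale (g x) (Y x)" k] scale_closed[of "Y x" k] by simp
  qed (simp_all add: smat_def zero_fun_apply)
  have eq0: "Y = 0" if "Y \<in> smat p k" "\<And>x. x \<in> I k \<Longrightarrow> Y (fst x) (snd x) = 0" for Y :: "'a smat" and k
  proof (intro ext)
    fix ij e
    show "Y ij e = 0 ij e" using that(2)[of "(ij, e)"] smat_outside[OF that(1), of ij e]
      by (cases "(ij, e) \<in> I k") (auto simp: I_def zero_fun_def)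
  qed
  have "m = n"
  proof (rule ccontr)
    assume "m \<noteq> n"
    then consider "card (I n) < card (I m)" | "card (I m) < card (I n)"
      unfolding cardI using p_pos by (metis linorder_neqE_nat mult_less_cancel2 mult_strict_mono' nat_0_less_mult_iff zero_le)
    then show False
    proof cases
      case 1
      obtain g where g: "\<exists>x\<in>I m. g x \<noteq> 0" "\<And>y. y \<in> I n \<Longrightarrow> (\<Sum>x\<in>I m. g x * H (\<Delta> x) (fst y) (snd y)) = 0"
        using linear_dependence[OF finI finI 1, of "\<lambda>x y. H (\<Delta> x) (fst y) (snd y)"] by blast
      have "H (\<Sum>x\<in>I m. smat_scale (g x) (\<Delta> x)) = 0"
      proof (rule eq0[OF H_closed])
        fix y assume "y \<in> I n"
        then show "H (\<Sum>x\<in>I m. smat_scale (g x) (\<Delta> x)) (fst y) (snd y) = 0"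
          using g(2) by (simp add: H_sum H_scale sum_fun2) (simp add: smat_scale_def)
      qed
      then have 0: "(\<Sum>x\<in>I m. smat_scale (g x) (\<Delta> x)) = 0" by (rule H_inj) (rule sum_closed[OF \<Delta>_closed])
      obtain x where x: "x \<in> I m" "g x \<noteq> 0" using g(1) by blast
      then show False using fun_cong[OF fun_cong[OF 0], of "fst x" "snd x"] by (simp add: \<Delta>_sum zero_fun_def)
    next
      case 2
      obtain Y where Y: "\<And>x. x \<in> I n \<Longrightarrow> Y x \<in> smat p m \<and> H (Y x) = \<Delta> x"
        using H_surj[OF \<Delta>_closed] by metis
      obtain g where g: "\<exists>x\<in>I n. g x \<noteq> 0" "\<And>y. y \<in> I m \<Longrightarrow> (\<Sum>x\<in>I n. g x * Y x (fst y) (snd y)) = 0"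
        using linear_dependence[OF finI finI 2, of "\<lambda>x y. Y x (fst y) (snd y)"] by blast
      have "(\<Sum>x\<in>I n. smat_scale (g x) (Y x)) = 0"
      proof (rule eq0[of _ m])
        show "(\<Sum>x\<in>I n. smat_scale (g x) (Y x)) \<in> smat p m" using Y by (intro sum_closed) blast
        fix y assume "y \<in> I m"
        then show "(\<Sum>x\<in>I n. smat_scale (g x) (Y x)) (fst y) (snd y) = 0"
          using g(2) unfolding sum_fun2 by (simp add: smat_scale_def)
      qed
      then have "H (\<Sum>x\<in>I n. smat_scale (g x) (Y x)) = 0" using H_zero by simp
      then have 0: "(\<Sum>x\<in>I n. smat_scale (g x) (\<Delta> x)) = 0" using Y by (simp add: H_sum H_scale)
      obtain x where x: "x \<in> I n" "g x \<noteq> 0" using g(1) by blast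
      then show False using fun_cong[OF fun_cong[OF 0], of "fst x" "snd x"] by (simp add: \<Delta>_sum zero_fun_def)
    qed
  qed
  \<comment> \<open>In the corner \<open>W\<close> the idempotents are identities, so left multiplication by \<open>U 0 0 f\<close> and right
     multiplication by \<open>V 0 0 g\<close> define actions of the two symbol algebras.\<close>
  define U where "U k l f = H (smat_unit p k l f)" for k l f
  define V where "V k l f = (smat_unit p k l f :: 'a smat)" for k l f
  define \<epsilon> where "\<epsilon> = (symbol_basis p :: nat \<times> nat \<Rightarrow> nat \<times> nat \<Rightarrow> 'a)"
  have UU: "mB (U k l f) (U l' q g) = (if l = l' then U k q (symbol_mult p \<zeta> a b f g) else 0)"
    if "k < m" "l < m" "l' < m" "q < m" for k l l' q f g
    unfolding U_def H_mult[symmetric] unfolding mA_def smat_unit_mult[OF that] by (simp add: H_zero)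
  have VV: "mB (V k l f) (V l' q g) = (if l = l' then V k q (symbol_mult p \<zeta> c d f g) else 0)"
    if "k < n" "l < n" "l' < n" "q < n" for k l l' q f g
    unfolding V_def mB_def by (rule smat_unit_mult[OF that])
  have unit_cong: "smat_unit p k l f = smat_unit p k l g" if "\<And>e. e \<in> ?P \<Longrightarrow> f e = g e" for k l f g
    using that by (auto simp: smat_unit_def fun_eq_iff)
  have unit_scale: "smat_unit p k l (\<lambda>e. x * f e) = smat_scale x (smat_unit p k l f)" for k l x f
    by (auto simp: smat_unit_def smat_scale_def fun_eq_iff)
  have U_cong: "U k l f = U k l g" and V_cong: "V k l f = V k l g" if "\<And>e. e \<in> ?P \<Longrightarrow> f e = g e" for k l f g
    unfolding U_def V_def using unit_cong[OF that] by auto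
  have U_scale: "U k l (\<lambda>e. x * f e) = smat_scale x (U k l f)" and V_scale: "V k l (\<lambda>e. x * f e) = smat_scale x (V k l f)" for k l x f
    unfolding U_def V_def unit_scale H_scale by auto
  have U1: "mB (U k l (\<epsilon> (0, 0))) (U l q f) = U k q f" "mB (U k l f) (U l q (\<epsilon> (0, 0))) = U k q f"
    if "k < m" "l < m" "q < m" for k l q f
    unfolding UU[OF that(1,2,2,3)] \<epsilon>_def
    by (simp only: simp_thms if_True, rule U_cong, rule symbol_mult_one[OF p_pos], assumption)+
  have V1: "mB (V k l (\<epsilon> (0, 0))) (V l q f) = V k q f" "mB (V k l f) (V l q (\<epsilon> (0, 0))) = V k q f"
    if "k < n" "l < n" "q < n" for k l q f
    unfolding VV[OF that(1,2,2,3)] \<epsilon>_def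
    by (simp only: simp_thms if_True, rule V_cong, rule symbol_mult_one[OF p_pos], assumption)+
  have m0: "0 < m" and n0: "0 < n" using mn by auto
  define W where "W = {Y \<in> smat p n. mB (U 0 0 (\<epsilon> (0, 0))) Y = Y \<and> mB Y (V 0 0 (\<epsilon> (0, 0))) = Y}"
  define opi where "opi Y = mB (U 0 0 (\<epsilon> (1, 0))) Y" for Y
  define opj where "opj Y = mB (U 0 0 (\<epsilon> (0, 1))) Y" for Y
  define opI where "opI Y = mB Y (V 0 0 (\<epsilon> (1, 0)))" for Y
  define opJ where "opJ Y = mB Y (V 0 0 (\<epsilon> (0, 1)))" for Y
  note op_defs = opi_def opj_def opI_def opJ_def
  have UW: "mB (U 0 0 f) Y \<in> W" if "Y \<in> W" for f Y
    using that unfolding W_def by (simp add: closedB U1 m0 flip: assocB) (simp add: assocB)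
  have VW: "mB Y (V 0 0 f) \<in> W" if "Y \<in> W" for f Y
    using that unfolding W_def by (simp add: closedB V1 n0 assocB) (simp flip: assocB)
  have ops_W: "opi Y \<in> W" "opj Y \<in> W" "opI Y \<in> W" "opJ Y \<in> W" if "Y \<in> W" for Y
    unfolding op_defs using UW[OF that] VW[OF that] by auto
  have powL: "((\<lambda>Y. mB (U 0 0 f) Y) ^^ k) Y = mB (U 0 0 (g k)) Y"
    if Y: "Y \<in> W" and g0: "g 0 = \<epsilon> (0, 0)"
      and gS: "\<And>k e. e \<in> ?P \<Longrightarrow> symbol_mult p \<zeta> a b f (g k) e = g (Suc k) e" for Y k f g
  proof (induction k)
    case 0
    show ?case using Y by (simp add: g0 W_def)
  next
    case (Suc k)
    then show ?case using gS by (simp add: UU m0 assocB[symmetric]) (metis (mono_tags, lifting) U_cong)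
  qed
  have powR: "((\<lambda>Y. mB Y (V 0 0 f)) ^^ k) Y = mB Y (V 0 0 (g k))"
    if Y: "Y \<in> W" and g0: "g 0 = \<epsilon> (0, 0)"
      and gS: "\<And>k e. e \<in> ?P \<Longrightarrow> symbol_mult p \<zeta> c d (g k) f e = g (Suc k) e" for Y k f g
  proof (induction k)
    case 0
    show ?case using Y by (simp add: g0 W_def)
  next
    case (Suc k)
    then show ?case using gS by (simp add: VV n0 assocB) (metis (mono_tags, lifting) V_cong)
  qed
  have divSuc: "Suc k div p = k div p + Suc (k mod p) div p" "Suc k mod p = Suc (k mod p) mod p" for k
  proof -
    have "Suc k = p * (k div p) + Suc (k mod p)" by simp
    then show "Suc k div p = k div p + Suc (k mod p) div p" using p_pos
      by (metis div_mult_self4 mult.commute not_less0 add.commute)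
    show "Suc k mod p = Suc (k mod p) mod p" by (simp add: mod_Suc_eq)
  qed
  have kp: "k mod p < p" for k using p_pos by simp
  define ip where "ip x k = (\<lambda>e. x ^ (k div p) * \<epsilon> (k mod p, 0) e)" for x :: 'a and k
  define jp where "jp x k = (\<lambda>e. x ^ (k div p) * \<epsilon> (0, k mod p) e)" for x :: 'a and k
  have ip_Suc: "ip x (Suc k) e = x ^ (k div p) * (x ^ (Suc (k mod p) div p) * \<epsilon> (Suc (k mod p) mod p, 0) e)"
    and jp_Suc: "jp x (Suc k) e = x ^ (k div p) * (x ^ (Suc (k mod p) div p) * \<epsilon> (0, Suc (k mod p) mod p) e)" for x k e
    by (simp_all only: ip_def jp_def divSuc(1)[of k] divSuc(2)[of k] power_add mult.assoc)
  have ipS: "symbol_mult p \<zeta> u v (\<epsilon> (1, 0)) (ip u k) e = ip u (Suc k) e"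
      "symbol_mult p \<zeta> u v (ip u k) (\<epsilon> (1, 0)) e = ip u (Suc k) e"
    and jpS: "symbol_mult p \<zeta> u v (\<epsilon> (0, 1)) (jp v k) e = jp v (Suc k) e"
      "symbol_mult p \<zeta> u v (jp v k) (\<epsilon> (0, 1)) e = jp v (Suc k) e" if e: "e \<in> ?P" for k e u v
  proof -
    show "symbol_mult p \<zeta> u v (\<epsilon> (1, 0)) (ip u k) e = ip u (Suc k) e"
      unfolding ip_Suc unfolding ip_def symbol_mult_scale \<epsilon>_def
        symbol_basis_mult[OF kp[of k] p_pos p_gt_1 p_pos e] by simp
    show "symbol_mult p \<zeta> u v (ip u k) (\<epsilon> (1, 0)) e = ip u (Suc k) e"
      unfolding ip_Suc unfolding ip_def symbol_mult_scale \<epsilon>_def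
        symbol_basis_mult[OF p_gt_1 p_pos kp[of k] p_pos e] by simp
    show "symbol_mult p \<zeta> u v (\<epsilon> (0, 1)) (jp v k) e = jp v (Suc k) e"
      unfolding jp_Suc unfolding jp_def symbol_mult_scale \<epsilon>_def
        symbol_basis_mult[OF p_pos kp[of k] p_pos p_gt_1 e] by simp
    show "symbol_mult p \<zeta> u v (jp v k) (\<epsilon> (0, 1)) e = jp v (Suc k) e"
      unfolding jp_Suc unfolding jp_def symbol_mult_scale \<epsilon>_def
        symbol_basis_mult[OF p_pos p_gt_1 p_pos kp[of k] e] by simp
  qed
  have ip0: "ip x 0 = \<epsilon> (0, 0)" "jp x 0 = \<epsilon> (0, 0)" for x by (simp_all add: ip_def jp_def)
  have ipp: "ip x p = (\<lambda>e. x * \<epsilon> (0, 0) e)" "jp x p = (\<lambda>e. x * \<epsilon> (0, 0) e)" for x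
    using p_pos by (simp_all add: ip_def jp_def)
  have orders: "(opi ^^ p) Y = smat_scale a Y" "(opj ^^ p) Y = smat_scale b Y"
    "(opI ^^ p) Y = smat_scale c Y" "(opJ ^^ p) Y = smat_scale d Y" if Y: "Y \<in> W" for Y
  proof -
    have W1: "mB (U 0 0 (\<epsilon> (0, 0))) Y = Y" "mB Y (V 0 0 (\<epsilon> (0, 0))) = Y" using Y by (auto simp: W_def)
    show "(opi ^^ p) Y = smat_scale a Y"
    proof -
      have "(opi ^^ p) Y = mB (U 0 0 (ip a p)) Y"
        unfolding opi_def[abs_def] by (rule powL[OF Y ip0(1) ipS(1)])
      then show ?thesis unfolding ipp U_scale scaleB W1 .
    qed
    show "(opj ^^ p) Y = smat_scale b Y"
    proof -
      have "(opj ^^ p) Y = mB (U 0 0 (jp b p)) Y"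
        unfolding opj_def[abs_def] by (rule powL[OF Y ip0(2) jpS(1)])
      then show ?thesis unfolding ipp U_scale scaleB W1 .
    qed
    show "(opI ^^ p) Y = smat_scale c Y"
    proof -
      have "(opI ^^ p) Y = mB Y (V 0 0 (ip c p))"
        unfolding opI_def[abs_def] by (rule powR[OF Y ip0(1) ipS(2)])
      then show ?thesis unfolding ipp V_scale scaleB W1 .
    qed
    show "(opJ ^^ p) Y = smat_scale d Y"
    proof -
      have "(opJ ^^ p) Y = mB Y (V 0 0 (jp d p))"
        unfolding opJ_def[abs_def] by (rule powR[OF Y ip0(2) jpS(2)])
      then show ?thesis unfolding ipp V_scale scaleB W1 .
    qed
  qed
  have ji: "symbol_mult p \<zeta> u v (\<epsilon> (0, 1)) (\<epsilon> (1, 0)) e = \<zeta> * symbol_mult p \<zeta> u v (\<epsilon> (1, 0)) (\<epsilon> (0, 1)) e"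
    if e: "e \<in> ?P" for u v e
    unfolding \<epsilon>_def symbol_basis_mult[OF p_gt_1 p_pos p_pos p_gt_1 e] symbol_basis_mult[OF p_pos p_gt_1 p_gt_1 p_pos e]
    using p_gt_1 by simp
  have jiU: "opj (opi Y) = smat_scale \<zeta> (opi (opj Y))" for Y
  proof -
    have "mB (U 0 0 (\<epsilon> (0, 1))) (U 0 0 (\<epsilon> (1, 0))) = smat_scale \<zeta> (mB (U 0 0 (\<epsilon> (1, 0))) (U 0 0 (\<epsilon> (0, 1))))"
      unfolding UU[OF m0 m0 m0 m0] simp_thms if_True U_scale[symmetric] by (rule U_cong, rule ji)
    then show ?thesis by (simp add: op_defs scaleB flip: assocB)
  qed
  have IJV: "opI (opJ Y) = smat_scale \<zeta> (opJ (opI Y))" for Y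
  proof -
    have "mB (V 0 0 (\<epsilon> (0, 1))) (V 0 0 (\<epsilon> (1, 0))) = smat_scale \<zeta> (mB (V 0 0 (\<epsilon> (1, 0))) (V 0 0 (\<epsilon> (0, 1))))"
      unfolding VV[OF n0 n0 n0 n0] simp_thms if_True V_scale[symmetric] by (rule V_cong, rule ji)
    then show ?thesis by (simp add: op_defs scaleB assocB)
  qed
  have zero_closed: "0 \<in> smat p n" by (simp add: smat_def zero_fun_apply)
  have subW: "S.subspace W"
    unfolding S.subspace_def W_def
    by (simp add: addB scaleB zeroB zero_closed plus_closed scale_closed)
  have lin: "module_hom smat_scale smat_scale opi" "module_hom smat_scale smat_scale opj"
    "module_hom smat_scale smat_scale opI" "module_hom smat_scale smat_scale opJ"
    by (intro module_hom.intro module_hom_axioms.intro S.module_axioms; simp add: op_defs addB scaleB)+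
  \<comment> \<open>If all the products \<open>U 0 k V l 0\<close> vanished, then so would the unit matrix, which is the sum of the
     products \<open>U k 0 U 0 k V l 0 V 0 l\<close>.\<close>
  have "\<exists>k<m. \<exists>l<n. mB (U 0 k (\<epsilon> (0, 0))) (V l 0 (\<epsilon> (0, 0))) \<noteq> 0"
  proof (rule ccontr)
    assume "\<not> ?thesis"
    then have 0: "mB (U 0 k (\<epsilon> (0, 0))) (V l 0 (\<epsilon> (0, 0))) = 0" if "k < m" "l < n" for k l using that by blast
    have oneU: "smat_one p n = (\<Sum>k<m. mB (U k 0 (\<epsilon> (0, 0))) (U 0 k (\<epsilon> (0, 0))))"
    proof -
      have "smat_one p n = H (smat_one p m)" by (rule H_one[symmetric])
      also have "\<dots> = (\<Sum>k<m. U k k (\<epsilon> (0, 0)))"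
        by (simp only: smat_one_sum[OF p_pos] H_sum U_def \<epsilon>_def)
      finally have "smat_one p n = (\<Sum>k<m. U k k (\<epsilon> (0, 0)))" .
      then show ?thesis using m0 by (simp add: U1)
    qed
    have oneV: "smat_one p n = (\<Sum>l<n. mB (V l 0 (\<epsilon> (0, 0))) (V 0 l (\<epsilon> (0, 0))))"
    proof -
      have "smat_one p n = (\<Sum>l<n. V l l (\<epsilon> (0, 0)))"
        by (simp only: smat_one_sum[OF p_pos] V_def \<epsilon>_def)
      then show ?thesis using n0 by (simp add: V1)
    qed
    have "smat_one p n = mB (smat_one p n) (smat_one p n)"
      unfolding mB_def by (simp only: smat_one_mult(1)[OF p_pos one_closed])
    also have "\<dots> = (\<Sum>k<m. \<Sum>l<n. mB (mB (U k 0 (\<epsilon> (0, 0))) (U 0 k (\<epsilon> (0, 0)))) (mB (V l 0 (\<epsilon> (0, 0))) (V 0 l (\<epsilon> (0, 0)))))"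
      by (subst oneU, subst oneV) (simp only: sumB, rule sum.swap)
    also have "\<dots> = 0"
    proof (intro sum.neutral ballI)
      fix k l assume "k \<in> {..<m}" "l \<in> {..<n}"
      have "mB (mB (U k 0 (\<epsilon> (0, 0))) (U 0 k (\<epsilon> (0, 0)))) (mB (V l 0 (\<epsilon> (0, 0))) (V 0 l (\<epsilon> (0, 0))))
        = mB (U k 0 (\<epsilon> (0, 0))) (mB (mB (U 0 k (\<epsilon> (0, 0))) (V l 0 (\<epsilon> (0, 0)))) (V 0 l (\<epsilon> (0, 0))))"
        by (simp only: assocB)
      then show "mB (mB (U k 0 (\<epsilon> (0, 0))) (U 0 k (\<epsilon> (0, 0)))) (mB (V l 0 (\<epsilon> (0, 0))) (V 0 l (\<epsilon> (0, 0)))) = 0"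
        using 0 \<open>k \<in> {..<m}\<close> \<open>l \<in> {..<n}\<close> by (simp add: zeroB)
    qed
    finally have "smat_one p n (0, 0) (0, 0) = (0 :: 'a smat) (0, 0) (0, 0)" by simp
    then show False using n0 by (simp add: smat_one_def zero_fun_def)
  qed
  then obtain k1 l1 where kl1: "k1 < m" "l1 < n" "mB (U 0 k1 (\<epsilon> (0, 0))) (V l1 0 (\<epsilon> (0, 0))) \<noteq> 0" by blast
  define w0 where "w0 = mB (U 0 k1 (\<epsilon> (0, 0))) (V l1 0 (\<epsilon> (0, 0)))"
  have w0: "w0 \<in> W" "w0 \<noteq> 0"
  proof -
    have "mB (U 0 0 (\<epsilon> (0, 0))) w0 = w0" unfolding w0_def assocB[symmetric] U1[OF m0 m0 kl1(1)] ..
    moreover have "mB w0 (V 0 0 (\<epsilon> (0, 0))) = w0" unfolding w0_def assocB V1[OF kl1(2) n0 n0] ..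
    ultimately show "w0 \<in> W" unfolding W_def w0_def using closedB by blast
    show "w0 \<noteq> 0" unfolding w0_def by (rule kl1(3))
  qed
  \<comment> \<open>Two vectors \<open>w0\<close>, \<open>w\<close> of \<open>W\<close> span at most \<open>2 p\<^sup>2\<close> words in \<open>opj\<close> and \<open>opJ\<close>. Translating these words to all
     \<open>m n\<close> corners gives twice as many elements as \<open>dim B\<close>, so they are dependent; multiplying the
     relation back into the corner \<open>W\<close> gives a relation among the words themselves.\<close>
  have rank: "\<exists>f g. (\<exists>e\<in>?P. f e \<noteq> 0 \<or> g e \<noteq> 0) \<and>
       (\<Sum>e\<in>?P. smat_scale (f e) ((opj ^^ fst e) ((opJ ^^ snd e) w0)))
       + (\<Sum>e\<in>?P. smat_scale (g e) ((opj ^^ fst e) ((opJ ^^ snd e) w))) = 0" if w: "w \<in> W" for w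
  proof -
    define r where "r \<epsilon>' e = (opj ^^ fst e) ((opJ ^^ snd e) (if \<epsilon>' then w0 else w))" for \<epsilon>' and e :: "nat \<times> nat"
    have powW: "(opj ^^ k) Y \<in> W" "(opJ ^^ k) Y \<in> W" if "Y \<in> W" for k Y
      using that by (induction k) (auto simp: ops_W)
    have rW: "r \<epsilon>' e \<in> W" for \<epsilon>' e unfolding r_def using w0(1) w by (intro powW) simp
    define J where "J = ({..<m} \<times> {..<n}) \<times> (?P \<times> (UNIV :: bool set))"
    define T where "T x = mB (mB (U (fst (fst x)) 0 (\<epsilon> (0, 0))) (r (snd (snd x)) (fst (snd x)))) (V 0 (snd (fst x)) (\<epsilon> (0, 0)))"
      for x :: "(nat \<times> nat) \<times> (nat \<times> nat) \<times> bool"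
    have finJ: "finite J" by (simp add: J_def)
    have "card J = 2 * card (I n)" unfolding cardI J_def by (simp add: card_cartesian_product \<open>m = n\<close>)
    then have card: "card (I n) < card J" using p_pos n0 by (simp add: cardI)
    obtain q where q: "\<exists>x\<in>J. q x \<noteq> 0" "\<And>y. y \<in> I n \<Longrightarrow> (\<Sum>x\<in>J. q x * T x (fst y) (snd y)) = 0"
      using linear_dependence[OF finI finJ card, of "\<lambda>x y. T x (fst y) (snd y)"] by blast
    have 0: "(\<Sum>x\<in>J. smat_scale (q x) (T x)) = 0"
    proof (rule eq0[of _ n])
      show "(\<Sum>x\<in>J. smat_scale (q x) (T x)) \<in> smat p n" by (intro sum_closed) (simp add: T_def closedB)
      fix y assume "y \<in> I n"
      then show "(\<Sum>x\<in>J. smat_scale (q x) (T x)) (fst y) (snd y) = 0"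
        using q(2) unfolding sum_fun2 by (simp add: smat_scale_def)
    qed
    obtain k0 l0 e0 \<epsilon>0 where x0: "((k0, l0), (e0, \<epsilon>0)) \<in> J" "q ((k0, l0), (e0, \<epsilon>0)) \<noteq> 0"
      using q(1) by (metis prod.collapse)
    then have kl0: "k0 < m" "l0 < n" "e0 \<in> ?P" by (auto simp: J_def)
    have proj: "mB (mB (U 0 k0 (\<epsilon> (0, 0))) (T x)) (V l0 0 (\<epsilon> (0, 0)))
       = (if fst x = (k0, l0) then r (snd (snd x)) (fst (snd x)) else 0)" if "x \<in> J" for x
    proof -
      obtain k l e \<epsilon>' where x: "x = ((k, l), (e, \<epsilon>'))" by (metis prod.collapse)
      have kl: "k < m" "l < n" using that x by (auto simp: J_def)
      have "mB (mB (U 0 k0 (\<epsilon> (0, 0))) (T x)) (V l0 0 (\<epsilon> (0, 0)))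
        = mB (mB (mB (U 0 k0 (\<epsilon> (0, 0))) (U k 0 (\<epsilon> (0, 0)))) (r \<epsilon>' e)) (mB (V 0 l (\<epsilon> (0, 0))) (V l0 0 (\<epsilon> (0, 0))))"
        unfolding T_def x by (simp add: assocB)
      also have "mB (U 0 k0 (\<epsilon> (0, 0))) (U k 0 (\<epsilon> (0, 0))) = (if k = k0 then U 0 0 (\<epsilon> (0, 0)) else 0)"
        using kl kl0 m0 U1(1)[of 0 k0 0] by (simp add: UU)
      also have "mB (V 0 l (\<epsilon> (0, 0))) (V l0 0 (\<epsilon> (0, 0))) = (if l = l0 then V 0 0 (\<epsilon> (0, 0)) else 0)"
        using kl kl0 n0 V1(1)[of 0 l0 0] by (simp add: VV)
      finally show ?thesis using rW[of \<epsilon>' e] by (auto simp: x W_def zeroB)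
    qed
    have "0 = mB (mB (U 0 k0 (\<epsilon> (0, 0))) (\<Sum>x\<in>J. smat_scale (q x) (T x))) (V l0 0 (\<epsilon> (0, 0)))"
      by (simp only: 0 zeroB)
    also have "\<dots> = (\<Sum>x\<in>J. smat_scale (q x) (mB (mB (U 0 k0 (\<epsilon> (0, 0))) (T x)) (V l0 0 (\<epsilon> (0, 0)))))"
      by (simp only: sumB scaleB)
    also have "\<dots> = (\<Sum>x\<in>J. if fst x = (k0, l0) then smat_scale (q x) (r (snd (snd x)) (fst (snd x))) else 0)"
      by (intro sum.cong refl) (simp add: proj)
    also have "\<dots> = (\<Sum>kl\<in>{..<m} \<times> {..<n}. \<Sum>y\<in>?P \<times> UNIV. if kl = (k0, l0) then smat_scale (q (kl, y)) (r (snd y) (fst y)) else 0)"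
      unfolding J_def sum.cartesian_product by (intro sum.cong) auto
    also have "\<dots> = (\<Sum>kl\<in>{..<m} \<times> {..<n}. if kl = (k0, l0) then \<Sum>y\<in>?P \<times> UNIV. smat_scale (q (kl, y)) (r (snd y) (fst y)) else 0)"
      by (intro sum.cong) auto
    also have "\<dots> = (\<Sum>y\<in>?P \<times> UNIV. smat_scale (q ((k0, l0), y)) (r (snd y) (fst y)))"
      using kl0 by (simp add: sum.delta)
    also have "\<dots> = (\<Sum>e\<in>?P. \<Sum>\<epsilon>'\<in>UNIV. smat_scale (q ((k0, l0), (e, \<epsilon>'))) (r \<epsilon>' e))"
      unfolding sum.cartesian_product by (intro sum.cong) auto
    also have "\<dots> = (\<Sum>e\<in>?P. smat_scale (q ((k0, l0), (e, True))) (r True e)) + (\<Sum>e\<in>?P. smat_scale (q ((k0, l0), (e, False))) (r False e))"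
      by (simp add: UNIV_bool sum.distrib add.commute)
    finally have "(\<Sum>e\<in>?P. smat_scale (q ((k0, l0), (e, True))) (r True e)) + (\<Sum>e\<in>?P. smat_scale (q ((k0, l0), (e, False))) (r False e)) = 0" by simp
    moreover have "\<exists>e\<in>?P. q ((k0, l0), (e, True)) \<noteq> 0 \<or> q ((k0, l0), (e, False)) \<noteq> 0"
      using x0(2) kl0(3) by (intro bexI[of _ e0]) (cases \<epsilon>0; simp)
    ultimately show ?thesis
      unfolding r_def
      by (intro exI[of _ "\<lambda>e. q ((k0, l0), (e, True))"] exI[of _ "\<lambda>e. q ((k0, l0), (e, False))"] conjI) simp_all
  qed
  have comm: "opi (opI Y) = opI (opi Y)" "opi (opJ Y) = opJ (opi Y)" "opj (opI Y) = opI (opj Y)" "opj (opJ Y) = opJ (opj Y)" for Y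
    unfolding op_defs by (simp_all only: assocB)
  interpret bicyclic_bimodule p \<zeta> b d \<beta> \<delta> M s t smat_scale W opi opj opI opJ a c w0
    by (rule bicyclic_bimodule.intro[OF bicyclic_axioms vector_space_smat], rule bicyclic_bimodule_axioms.intro)
       (rule subW lin w0 | erule ops_W orders rank | rule jiU IJV comm)+
  show ?thesis by (rule solution_exists)
qed

end

section \<open>Automorphisms of the Kummer extension\<close>

lemma fld_a_inv [simp]: "\<ominus>\<^bsub>fld\<^esub> x = - (x :: 'b::field)"
proof -
  interpret field "fld :: 'b ring" by (rule field_from_type_algebra)
  show ?thesis by (rule minus_equality) simp_all
qed

lemma fld_m_inv: "x \<noteq> 0 \<Longrightarrow> inv\<^bsub>fld\<^esub> x = inverse (x :: 'b::field)"
proof -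
  assume x: "x \<noteq> 0"
  interpret field "fld :: 'b ring" by (rule field_from_type_algebra)
  show ?thesis by (rule inv_unique'[symmetric]) (use x in simp_all)
qed

lemma subfield_fldD:
  fixes E :: "'b::field set"
  assumes "subfield E fld"
  shows "0 \<in> E" "1 \<in> E" "x \<in> E \<Longrightarrow> y \<in> E \<Longrightarrow> x + y \<in> E" "x \<in> E \<Longrightarrow> y \<in> E \<Longrightarrow> x * y \<in> E"
    "x \<in> E \<Longrightarrow> - x \<in> E" "x \<in> E \<Longrightarrow> inverse x \<in> E"
proof -
  interpret field "fld :: 'b ring" by (rule field_from_type_algebra)
  have sr: "subring E fld" by (rule subfieldE(1)[OF assms])
  show 0: "0 \<in> E" and "1 \<in> E" using subringE(2,3)[OF sr] by simp_all
  show "x \<in> E \<Longrightarrow> y \<in> E \<Longrightarrow> x + y \<in> E" using subringE(7)[OF sr, of x y] by simp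
  show "x \<in> E \<Longrightarrow> y \<in> E \<Longrightarrow> x * y \<in> E" using subringE(6)[OF sr, of x y] by simp
  show "x \<in> E \<Longrightarrow> - x \<in> E" using subringE(5)[OF sr, of x] by simp
  show "inverse x \<in> E" if "x \<in> E"
    using subfield_m_inv(1)[OF assms, of x] that 0 by (cases "x = 0") (simp_all add: fld_m_inv)
qed

lemma subfield_fldI:
  fixes E :: "'b::field set"
  assumes "1 \<in> E" "\<And>x y. x \<in> E \<Longrightarrow> y \<in> E \<Longrightarrow> x + y \<in> E" "\<And>x y. x \<in> E \<Longrightarrow> y \<in> E \<Longrightarrow> x * y \<in> E"
    "\<And>x. x \<in> E \<Longrightarrow> - x \<in> E" "\<And>x. x \<in> E \<Longrightarrow> x \<noteq> 0 \<Longrightarrow> inverse x \<in> E"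
  shows "subfield E fld"
proof -
  interpret field "fld :: 'b ring" by (rule field_from_type_algebra)
  show ?thesis
  proof (rule subfieldI')
    show "subring E fld" by (rule subringI) (use assms in simp_all)
    show "inv\<^bsub>fld\<^esub> k \<in> E" if "k \<in> E - {\<zero>\<^bsub>fld\<^esub>}" for k
      using assms(5)[of k] that by (simp add: fld_m_inv)
  qed
qed

lemma Gal_carrier_iff:
  "\<sigma> \<in> carrier (Gal E k) \<longleftrightarrow> \<sigma> \<in> extensional E \<and> bij_betw \<sigma> E E \<and>
     (\<forall>x\<in>E. \<forall>y\<in>E. \<sigma> (x + y) = \<sigma> x + \<sigma> y \<and> \<sigma> (x * y) = \<sigma> x * \<sigma> y) \<and> \<sigma> 1 = 1 \<and> (\<forall>x\<in>k. \<sigma> x = x)"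
  unfolding Gal_def Bij_def ring_hom_def by (auto simp: bij_betw_def)

lemma Gal_mult: "\<sigma> \<in> carrier (Gal E k) \<Longrightarrow> \<tau> \<in> carrier (Gal E k) \<Longrightarrow> \<sigma> \<otimes>\<^bsub>Gal E k\<^esub> \<tau> = compose E \<sigma> \<tau>"
  unfolding Gal_def BijGroup_def by auto

lemma Gal_one: "\<one>\<^bsub>Gal E k\<^esub> = (\<lambda>x\<in>E. x)"
  unfolding Gal_def BijGroup_def by auto

lemma Gal_in: "\<sigma> \<in> carrier (Gal E k) \<Longrightarrow> x \<in> E \<Longrightarrow> \<sigma> x \<in> E"
  by (auto simp: Gal_carrier_iff bij_betw_def)

lemma Gal_eqI:
  assumes "\<sigma> \<in> carrier (Gal E k)" "\<tau> \<in> carrier (Gal E k)" "\<And>x. x \<in> E \<Longrightarrow> \<sigma> x = \<tau> x"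
  shows "\<sigma> = \<tau>"
  using assms by (intro extensionalityI[where A = E]) (auto simp: Gal_carrier_iff)

lemma group_Gal:
  fixes E :: "'b::field set"
  assumes E: "subfield E fld" and k: "k \<subseteq> E"
  shows "group (Gal E k)"
proof -
  note F = subfield_fldD[OF E]
  let ?C = "carrier (Gal E k)"
  have sub: "?C \<subseteq> carrier (BijGroup E)" by (auto simp: Gal_def BijGroup_def)
  have "subgroup ?C (BijGroup E)"
  proof (rule group.subgroupI[OF group_BijGroup sub])
    have "(\<lambda>x\<in>E. x) \<in> ?C" using F k by (auto simp: Gal_carrier_iff bij_betw_def inj_on_def)
    then show "?C \<noteq> {}" by blast
  next
    fix \<sigma> assume \<sigma>: "\<sigma> \<in> ?C"
    then have B: "\<sigma> \<in> Bij E" by (auto simp: Gal_def)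
    have bij: "bij_betw \<sigma> E E" using \<sigma> by (simp add: Gal_carrier_iff)
    define \<tau> where "\<tau> = (\<lambda>x\<in>E. inv_into E \<sigma> x)"
    have inv: "inv\<^bsub>BijGroup E\<^esub> \<sigma> = \<tau>" unfolding \<tau>_def by (rule inv_BijGroup[OF B])
    have \<tau>E: "\<tau> x \<in> E" "\<sigma> (\<tau> x) = x" if "x \<in> E" for x
      using bij_betw_inv_into_right[OF bij that] bij_betw_apply[OF bij_betw_inv_into[OF bij] that] that
      by (auto simp: \<tau>_def)
    have \<tau>I: "\<tau> y = x" if "x \<in> E" "\<sigma> x = y" for x y
      using bij_betw_inv_into_left[OF bij that(1)] that Gal_in[OF \<sigma> that(1)] by (auto simp: \<tau>_def)
    have "\<tau> \<in> ?C"
      unfolding Gal_carrier_iff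
    proof (intro conjI ballI)
      show "\<tau> \<in> extensional E" by (simp add: \<tau>_def)
      show "bij_betw \<tau> E E" using bij_betw_inv_into[OF bij] by (auto simp: \<tau>_def cong: bij_betw_cong)
      fix x y assume "x \<in> E" "y \<in> E"
      then show "\<tau> (x + y) = \<tau> x + \<tau> y" "\<tau> (x * y) = \<tau> x * \<tau> y"
        using \<sigma> by (intro \<tau>I; simp add: Gal_carrier_iff F \<tau>E)+
    next
      show "\<tau> 1 = 1" using \<sigma> F by (intro \<tau>I) (simp_all add: Gal_carrier_iff)
      fix x assume "x \<in> k"
      then show "\<tau> x = x" using \<sigma> k by (intro \<tau>I) (auto simp: Gal_carrier_iff)
    qed
    then show "inv\<^bsub>BijGroup E\<^esub> \<sigma> \<in> ?C" using inv by simp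
  next
    fix \<sigma> \<tau> assume \<sigma>: "\<sigma> \<in> ?C" and \<tau>: "\<tau> \<in> ?C"
    then have "\<sigma> \<in> Bij E" "\<tau> \<in> Bij E" by (auto simp: Gal_def)
    then have eq: "\<sigma> \<otimes>\<^bsub>BijGroup E\<^esub> \<tau> = compose E \<sigma> \<tau>" by (simp add: BijGroup_def)
    have "compose E \<sigma> \<tau> \<in> ?C"
      unfolding Gal_carrier_iff
    proof (intro conjI ballI)
      show "bij_betw (compose E \<sigma> \<tau>) E E"
        using \<sigma> \<tau> by (auto simp: Gal_carrier_iff intro: bij_betw_compose)
    qed (use \<sigma> \<tau> F k Gal_in[OF \<tau>] in \<open>auto simp: Gal_carrier_iff compose_def\<close>)
    then show "\<sigma> \<otimes>\<^bsub>BijGroup E\<^esub> \<tau> \<in> ?C" using eq by simp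
  qed
  from subgroup.subgroup_is_group[OF this group_BijGroup] show ?thesis
    by (simp add: Gal_def)
qed

lemma Gal_pow_apply:
  assumes "subfield E fld" "k \<subseteq> E" "\<sigma> \<in> carrier (Gal E k)" "x \<in> E"
  shows "(\<sigma> [^]\<^bsub>Gal E k\<^esub> (n::nat)) x = (\<sigma> ^^ n) x"
proof -
  interpret group "Gal E k" by (rule group_Gal[OF assms(1,2)])
  have "(\<sigma> [^]\<^bsub>Gal E k\<^esub> n) x = (\<sigma> ^^ n) x" if "x \<in> E" for x
    using that
  proof (induction n arbitrary: x)
    case (Suc n)
    have "(\<sigma> [^]\<^bsub>Gal E k\<^esub> Suc n) x = (\<sigma> [^]\<^bsub>Gal E k\<^esub> n) (\<sigma> x)"
      using Suc.prems assms(3) by (simp add: Gal_mult compose_def)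
    then show ?case using Suc Gal_in[OF assms(3)] by (simp add: funpow_swap1)
  qed (simp add: Gal_one)
  then show ?thesis using assms(4) .
qed

text \<open>
  Field endomorphisms over the base field as total functions with unspecified values outside \<open>E\<close>.
  Elements of \<open>Gal E base_field\<close>, their restrictions, composites and iterates are all of this form.
\<close>

definition base_endo :: "'a::field alg_closure set \<Rightarrow> ('a alg_closure \<Rightarrow> 'a alg_closure) \<Rightarrow> bool" where
  "base_endo E f \<longleftrightarrow> (\<forall>x\<in>E. f x \<in> E) \<and> (\<forall>x\<in>E. \<forall>y\<in>E. f (x + y) = f x + f y \<and> f (x * y) = f x * f y) \<and>
     (\<forall>k. f (to_ac k) = to_ac k)"

lemma base_endoD:
  assumes "base_endo E f"
  shows "x \<in> E \<Longrightarrow> f x \<in> E" "x \<in> E \<Longrightarrow> y \<in> E \<Longrightarrow> f (x + y) = f x + f y"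
    "x \<in> E \<Longrightarrow> y \<in> E \<Longrightarrow> f (x * y) = f x * f y" "f (to_ac k) = to_ac k" "f 0 = 0" "f 1 = 1"
  using assms unfolding base_endo_def by (auto, (metis to_ac_0 to_ac_1)+)

lemma base_endo_power: "base_endo E f \<Longrightarrow> subfield E fld \<Longrightarrow> x \<in> E \<Longrightarrow> f (x ^ n) = f x ^ n \<and> x ^ n \<in> E"
  by (induction n) (auto simp: base_endoD subfield_fldD)

lemma base_endo_comp: "base_endo E f \<Longrightarrow> base_endo E g \<Longrightarrow> base_endo E (f \<circ> g)"
  unfolding base_endo_def by auto

lemma base_endo_id: "base_endo E (\<lambda>x. x)"
  unfolding base_endo_def by auto

lemma base_endo_funpow: "base_endo E f \<Longrightarrow> base_endo E (f ^^ n)"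
proof (induction n)
  case 0
  show ?case unfolding funpow.simps id_def by (rule base_endo_id)
next
  case (Suc n)
  show ?case unfolding funpow.simps by (rule base_endo_comp[OF Suc.prems Suc.IH[OF Suc.prems]])
qed

lemma Gal_base_endo:
  assumes "base_field \<subseteq> E" "\<sigma> \<in> carrier (Gal E base_field)"
  shows "base_endo E \<sigma>"
  unfolding base_endo_def
proof (intro conjI ballI allI)
  show "\<sigma> x \<in> E" if "x \<in> E" for x by (rule Gal_in[OF assms(2) that])
  show "\<sigma> (to_ac k) = to_ac k" for k using assms(2) by (simp add: Gal_carrier_iff)
qed (use assms(2) in \<open>simp_all add: Gal_carrier_iff\<close>)

lemma base_endo_nonzero:
  assumes "base_endo E f" "subfield E fld" "x \<in> E" "x \<noteq> 0"
  shows "f x \<noteq> 0" "f (inverse x) = inverse (f x)"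
proof -
  have "f x * f (inverse x) = f (x * inverse x)"
    using base_endoD(3)[OF assms(1,3)] subfield_fldD(6)[OF assms(2,3)] by simp
  also have "\<dots> = 1" using assms(4) base_endoD(6)[OF assms(1)] by simp
  finally have 1: "f x * f (inverse x) = 1" .
  then show "f x \<noteq> 0" by auto
  show "f (inverse x) = inverse (f x)" using 1 by (metis inverse_unique)
qed

lemma base_endo_uminus:
  assumes "base_endo E f" "subfield E fld" "x \<in> E"
  shows "f (- x) = - f x"
proof -
  have "f x + f (- x) = f (x + - x)"
    by (rule base_endoD(2)[OF assms(1,3) subfield_fldD(5)[OF assms(2,3)], symmetric])
  also have "\<dots> = 0" using base_endoD(5)[OF assms(1)] by simp
  finally show ?thesis by (simp add: eq_neg_iff_add_eq_0 add.commute)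
qed

lemma base_endo_eqI:
  assumes E: "subfield E fld" and f: "base_endo E f" and g: "base_endo E g"
    and S: "S \<subseteq> E" "\<And>x. x \<in> S \<Longrightarrow> f x = g x" and x: "x \<in> generate_field fld (base_field \<union> S)"
    and base: "base_field \<subseteq> E"
  shows "f x = g x"
proof -
  have "x \<in> E \<and> f x = g x"
    using x
  proof (induction rule: generate_field.induct)
    case one
    then show ?case using base_endoD(6)[OF f] base_endoD(6)[OF g] subfield_fldD(2)[OF E] by simp
  next
    case (incl h)
    then show ?case using S base base_endoD(4)[OF f] base_endoD(4)[OF g] by auto
  next
    case (a_inv h)
    then show ?case using base_endo_uminus[OF f E] base_endo_uminus[OF g E] subfield_fldD(5)[OF E] by simp
  next
    case (m_inv h)
    then show ?case using base_endo_nonzero(2)[OF f E] base_endo_nonzero(2)[OF g E] subfield_fldD(6)[OF E]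
      by (simp add: fld_m_inv)
  next
    case (eng_add h1 h2)
    then show ?case using subfield_fldD(3)[OF E] base_endoD(2)[OF f] base_endoD(2)[OF g] by simp
  next
    case (eng_mult h1 h2)
    then show ?case using subfield_fldD(4)[OF E] base_endoD(3)[OF f] base_endoD(3)[OF g] by simp
  qed
  then show ?thesis by simp
qed

lemma endo_on_scaled:
  assumes "base_endo E f" "x \<in> E" "base_field \<subseteq> E"
  shows "f (to_ac k * x) = to_ac k * f x"
proof -
  have "to_ac k \<in> E" using assms(3) by auto
  from base_endoD(3)[OF assms(1) this assms(2)] show ?thesis by (simp only: base_endoD(4)[OF assms(1)])
qed

lemma base_endo_flinear:
  assumes "base_endo E f" "base_field \<subseteq> E"
  shows "flinear E f"
  by (rule flinearI) (use assms in \<open>auto simp: base_endoD endo_on_scaled\<close>)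

text \<open>
  The quotient of the image by the radical is a \<open>p\<close>-th root of unity.
\<close>

lemma root_image:
  fixes \<zeta> :: "'a::field"
  assumes f: "base_endo E f" and E: "subfield E fld" and r: "r \<in> E" "r ^ p = to_ac k" "k \<noteq> 0"
    and z: "primitive_root_of_unity p \<zeta>"
  obtains n where "n < p" "f r = to_ac \<zeta> ^ n * r"
proof -
  have r0: "r \<noteq> 0" using r z by (auto simp: zero_power primitive_root_of_unity_def)
  have "f r ^ p = to_ac k" using base_endo_power[OF f E r(1), of p] r(2) base_endoD(4)[OF f] by simp
  then have "(f r / r) ^ p = 1" using r by (simp add: power_divide)
  from roots_of_unity_are_powers[OF prim_root_to_ac[OF z] this] obtain n where
    n: "n < p" "f r / r = to_ac \<zeta> ^ n" .
  then show ?thesis using r0 that by (simp add: field_simps)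
qed

text \<open>
  The situation of the theorem. The condition \<open>p \<noteq> CHAR('a)\<close> appears in the form in which it is used.
\<close>

locale kummer4 =
  fixes p :: nat and \<zeta> a b c d :: "'a::field" and \<alpha> \<beta> \<gamma> \<delta> :: "'a alg_closure" and K :: "'a alg_closure set"
  assumes prime_p: "Factorial_Ring.prime p" and p_nz: "of_nat p \<noteq> (0 :: 'a)"
    and root: "primitive_root_of_unity p \<zeta>"
    and nz: "a \<noteq> 0" "b \<noteq> 0" "c \<noteq> 0" "d \<noteq> 0"
    and pow: "\<alpha> ^ p = to_ac a" "\<beta> ^ p = to_ac b" "\<gamma> ^ p = to_ac c" "\<delta> ^ p = to_ac d"
    and K_eq: "K = generate_field fld (base_field \<union> {\<alpha>, \<beta>, \<gamma>, \<delta>})"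
    and galois_K: "galois_extension K base_field"
    and Gal_K: "Gal K base_field \<cong> integer_mod_group p \<times>\<times> integer_mod_group p
           \<times>\<times> integer_mod_group p \<times>\<times> integer_mod_group p"
begin

lemma p_pos: "p > 0" and p_gt_1: "p > 1"
  using prime_gt_1_nat[OF prime_p] by auto

lemma subfield_K: "subfield K fld" and base_K: "base_field \<subseteq> K"
  using galois_K by (auto simp: galois_extension_def)

lemma gens_K: "\<alpha> \<in> K" "\<beta> \<in> K" "\<gamma> \<in> K" "\<delta> \<in> K"
  unfolding K_eq by (auto intro: generate_field.incl)

lemma gens_nz: "\<alpha> \<noteq> 0" "\<beta> \<noteq> 0" "\<gamma> \<noteq> 0" "\<delta> \<noteq> 0"
  using pow nz p_pos by (auto simp: zero_power)

lemma \<zeta>_nz: "\<zeta> \<noteq> 0" and \<zeta>_pow: "\<zeta> ^ p = 1"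
  using prim_root_nonzero[OF root] prim_root_power[OF root] by auto

lemma endo_eq:
  assumes "base_endo E f" "base_endo E g" "subfield E fld" "K \<subseteq> E"
    "f \<alpha> = g \<alpha>" "f \<beta> = g \<beta>" "f \<gamma> = g \<gamma>" "f \<delta> = g \<delta>" "x \<in> K"
  shows "f x = g x"
  using base_endo_eqI[OF assms(3,1,2), of "{\<alpha>, \<beta>, \<gamma>, \<delta>}" x] assms(4-) gens_K base_K K_eq by auto

text \<open>
  The exponents by which \<open>f\<close> multiplies the four radicals with powers of \<open>\<zeta>\<close>.
\<close>

definition acts :: "('a alg_closure \<Rightarrow> 'a alg_closure) \<Rightarrow> nat \<times> nat \<times> nat \<times> nat \<Rightarrow> bool" where
  "acts f e \<longleftrightarrow> (case e of (i, j, k, l) \<Rightarrow> f \<alpha> = to_ac \<zeta> ^ i * \<alpha> \<and> f \<beta> = to_ac \<zeta> ^ j * \<beta> \<and>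
     f \<gamma> = to_ac \<zeta> ^ k * \<gamma> \<and> f \<delta> = to_ac \<zeta> ^ l * \<delta>)"

lemma acts_exists:
  assumes f: "base_endo E f" and E: "subfield E fld" "K \<subseteq> E"
  shows "\<exists>e\<in>{..<p} \<times> {..<p} \<times> {..<p} \<times> {..<p}. acts f e"
proof -
  have g: "\<alpha> \<in> E" "\<beta> \<in> E" "\<gamma> \<in> E" "\<delta> \<in> E" using gens_K E by auto
  obtain i where "i < p" "f \<alpha> = to_ac \<zeta> ^ i * \<alpha>" using root_image[OF f E(1) g(1) pow(1) nz(1) root] .
  moreover obtain j where "j < p" "f \<beta> = to_ac \<zeta> ^ j * \<beta>" using root_image[OF f E(1) g(2) pow(2) nz(2) root] .
  moreover obtain k where "k < p" "f \<gamma> = to_ac \<zeta> ^ k * \<gamma>" using root_image[OF f E(1) g(3) pow(3) nz(3) root] .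
  moreover obtain l where "l < p" "f \<delta> = to_ac \<zeta> ^ l * \<delta>" using root_image[OF f E(1) g(4) pow(4) nz(4) root] .
  ultimately show ?thesis by (intro bexI[of _ "(i, j, k, l)"]) (auto simp: acts_def)
qed

lemma Gal_K_endo: "\<sigma> \<in> carrier (Gal K base_field) \<Longrightarrow> base_endo K \<sigma>"
  by (rule Gal_base_endo[OF base_K])

text \<open>
  An automorphism is determined by its exponents, and the group has order \<open>p\<^sup>4\<close>, which is the number of
  possible exponents.
\<close>

lemma Gal_K_acts:
  assumes e: "e \<in> {..<p} \<times> {..<p} \<times> {..<p} \<times> {..<p}"
  shows "\<exists>\<sigma>\<in>carrier (Gal K base_field). acts \<sigma> e"
proof -
  let ?E = "{..<p} \<times> {..<p} \<times> {..<p} \<times> {..<p}" and ?G = "carrier (Gal K base_field)"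
  have "\<forall>\<sigma>\<in>?G. \<exists>e. e \<in> ?E \<and> acts \<sigma> e" using acts_exists[OF Gal_K_endo subfield_K] by blast
  then obtain ev where ev: "\<And>\<sigma>. \<sigma> \<in> ?G \<Longrightarrow> ev \<sigma> \<in> ?E" "\<And>\<sigma>. \<sigma> \<in> ?G \<Longrightarrow> acts \<sigma> (ev \<sigma>)" by metis
  have inj: "inj_on ev ?G"
  proof (rule inj_onI)
    fix \<sigma> \<tau> assume \<sigma>: "\<sigma> \<in> ?G" and \<tau>: "\<tau> \<in> ?G" and eq: "ev \<sigma> = ev \<tau>"
    have "acts \<sigma> (ev \<sigma>)" "acts \<tau> (ev \<sigma>)" using ev(2)[OF \<sigma>] ev(2)[OF \<tau>] eq by auto
    then have "\<sigma> \<alpha> = \<tau> \<alpha>" "\<sigma> \<beta> = \<tau> \<beta>" "\<sigma> \<gamma> = \<tau> \<gamma>" "\<sigma> \<delta> = \<tau> \<delta>"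
      by (auto simp: acts_def case_prod_unfold)
    then show "\<sigma> = \<tau>" using endo_eq[OF Gal_K_endo[OF \<sigma>] Gal_K_endo[OF \<tau>] subfield_K]
      by (intro Gal_eqI[OF \<sigma> \<tau>]) auto
  qed
  have "card (ev ` ?G) = card ?G" by (rule card_image[OF inj])
  also have "\<dots> = card ({0..<int p} \<times> {0..<int p} \<times> {0..<int p} \<times> {0..<int p})"
    using iso_same_card[OF Gal_K] p_pos by (simp add: carrier_integer_mod_group)
  also have "\<dots> = card ?E" by (simp add: card_cartesian_product)
  finally have "ev ` ?G = ?E" by (intro card_subset_eq image_subsetI ev(1)) auto
  then have "e \<in> ev ` ?G" using e by simp
  then obtain \<sigma> where \<sigma>: "e = ev \<sigma>" "\<sigma> \<in> ?G" ..
  show ?thesis by (rule bexI[OF _ \<sigma>(2)]) (use ev(2)[OF \<sigma>(2)] \<sigma>(1) in simp)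
qed

definition \<sigma>_of :: "nat \<times> nat \<times> nat \<times> nat \<Rightarrow> 'a alg_closure \<Rightarrow> 'a alg_closure" where
  "\<sigma>_of e = (SOME \<sigma>. \<sigma> \<in> carrier (Gal K base_field) \<and> acts \<sigma> e)"

lemma \<sigma>_of:
  assumes "e \<in> {..<p} \<times> {..<p} \<times> {..<p} \<times> {..<p}"
  shows "\<sigma>_of e \<in> carrier (Gal K base_field)" "acts (\<sigma>_of e) e" "base_endo K (\<sigma>_of e)"
proof -
  have "\<sigma>_of e \<in> carrier (Gal K base_field) \<and> acts (\<sigma>_of e) e"
    unfolding \<sigma>_of_def by (rule someI_ex[OF Gal_K_acts[OF assms, unfolded Bex_def]])
  then show "\<sigma>_of e \<in> carrier (Gal K base_field)" "acts (\<sigma>_of e) e" by blast+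
  then show "base_endo K (\<sigma>_of e)" by (intro Gal_K_endo)
qed

text \<open>
  The exponent \<open>p - 1\<close> makes \<open>\<sigma>b'\<close> the inverse of the Kummer generator at \<open>\<beta>\<close>.
\<close>

definition "\<sigma>a = \<sigma>_of (1, 0, 0, 0)"
definition "\<sigma>b' = \<sigma>_of (0, p - 1, 0, 0)"
definition "\<sigma>c = \<sigma>_of (0, 0, 1, 0)"
definition "\<sigma>d = \<sigma>_of (0, 0, 0, 1)"

lemma \<sigma>_Gal: "\<sigma>a \<in> carrier (Gal K base_field)" "\<sigma>b' \<in> carrier (Gal K base_field)"
    "\<sigma>c \<in> carrier (Gal K base_field)" "\<sigma>d \<in> carrier (Gal K base_field)"
  unfolding \<sigma>a_def \<sigma>b'_def \<sigma>c_def \<sigma>d_def by (rule \<sigma>_of, use p_gt_1 in simp)+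

lemmas \<sigma>_endo = \<sigma>_Gal[THEN Gal_K_endo]

lemma inverse_\<zeta>: "to_ac \<zeta> ^ (p - 1) = to_ac (inverse \<zeta>)"
proof -
  have "\<zeta> ^ (p - 1) * \<zeta> = 1" using \<zeta>_pow p_pos by (metis power_minus_mult)
  then have "\<zeta> ^ (p - 1) = inverse \<zeta>" by (metis inverse_unique mult.commute)
  then show ?thesis by (metis to_ac_power)
qed

lemma \<sigma>_acts:
  "\<sigma>a \<alpha> = to_ac \<zeta> * \<alpha>" "\<sigma>a \<beta> = \<beta>" "\<sigma>a \<gamma> = \<gamma>" "\<sigma>a \<delta> = \<delta>"
  "\<sigma>b' \<alpha> = \<alpha>" "\<sigma>b' \<beta> = to_ac (inverse \<zeta>) * \<beta>" "\<sigma>b' \<gamma> = \<gamma>" "\<sigma>b' \<delta> = \<delta>"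
  "\<sigma>c \<alpha> = \<alpha>" "\<sigma>c \<beta> = \<beta>" "\<sigma>c \<gamma> = to_ac \<zeta> * \<gamma>" "\<sigma>c \<delta> = \<delta>"
  "\<sigma>d \<alpha> = \<alpha>" "\<sigma>d \<beta> = \<beta>" "\<sigma>d \<gamma> = \<gamma>" "\<sigma>d \<delta> = to_ac \<zeta> * \<delta>"
proof -
  have "acts \<sigma>a (1, 0, 0, 0)" "acts \<sigma>b' (0, p - 1, 0, 0)" "acts \<sigma>c (0, 0, 1, 0)" "acts \<sigma>d (0, 0, 0, 1)"
    unfolding \<sigma>a_def \<sigma>b'_def \<sigma>c_def \<sigma>d_def by (rule \<sigma>_of, use p_gt_1 in simp)+
  then show
    "\<sigma>a \<alpha> = to_ac \<zeta> * \<alpha>" "\<sigma>a \<beta> = \<beta>" "\<sigma>a \<gamma> = \<gamma>" "\<sigma>a \<delta> = \<delta>"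
    "\<sigma>b' \<alpha> = \<alpha>" "\<sigma>b' \<beta> = to_ac (inverse \<zeta>) * \<beta>" "\<sigma>b' \<gamma> = \<gamma>" "\<sigma>b' \<delta> = \<delta>"
    "\<sigma>c \<alpha> = \<alpha>" "\<sigma>c \<beta> = \<beta>" "\<sigma>c \<gamma> = to_ac \<zeta> * \<gamma>" "\<sigma>c \<delta> = \<delta>"
    "\<sigma>d \<alpha> = \<alpha>" "\<sigma>d \<beta> = \<beta>" "\<sigma>d \<gamma> = \<gamma>" "\<sigma>d \<delta> = to_ac \<zeta> * \<delta>"
    unfolding acts_def by (simp_all add: inverse_\<zeta>[unfolded One_nat_def] del: to_ac_inverse)
qed

lemma funpow_scaled:
  assumes f: "base_endo E f" and x: "x \<in> E" and base: "base_field \<subseteq> E" and "f x = to_ac k * x"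
  shows "(f ^^ n) x = to_ac (k ^ n) * x"
proof (induction n)
  case (Suc n)
  have "f ((f ^^ n) x) = to_ac (k ^ n) * (to_ac k * x)"
    unfolding Suc endo_on_scaled[OF f x base] assms(4) ..
  then show ?case by (simp add: mult_ac)
qed simp

lemma \<sigma>_order:
  assumes \<sigma>: "\<sigma> \<in> carrier (Gal K base_field)" and x: "x \<in> K"
  shows "(\<sigma> ^^ p) x = x"
proof -
  obtain e where e: "acts \<sigma> e" using acts_exists[OF Gal_K_endo[OF \<sigma>] subfield_K] by blast
  have *: "(\<sigma> ^^ p) y = y" if "y \<in> K" "\<sigma> y = to_ac \<zeta> ^ n * y" for y n
  proof -
    have "(\<sigma> ^^ p) y = to_ac ((\<zeta> ^ n) ^ p) * y"
      using that by (intro funpow_scaled[OF Gal_K_endo[OF \<sigma>] _ base_K]) simp_all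
    also have "(\<zeta> ^ n) ^ p = 1" by (metis \<zeta>_pow mult.commute power_mult power_one)
    finally show ?thesis by simp
  qed
  show ?thesis
    by (rule endo_eq[OF base_endo_funpow[OF Gal_K_endo[OF \<sigma>]] base_endo_id subfield_K order_refl _ _ _ _ x])
       (use e * gens_K in \<open>auto simp: acts_def case_prod_unfold\<close>)
qed

lemma \<sigma>_commute:
  assumes \<sigma>: "\<sigma> \<in> carrier (Gal K base_field)" and \<tau>: "\<tau> \<in> carrier (Gal K base_field)" and x: "x \<in> K"
  shows "\<sigma> (\<tau> x) = \<tau> (\<sigma> x)"
proof -
  obtain e where e: "acts \<sigma> e" using acts_exists[OF Gal_K_endo[OF \<sigma>] subfield_K] by blast
  obtain e' where e': "acts \<tau> e'" using acts_exists[OF Gal_K_endo[OF \<tau>] subfield_K] by blast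
  have *: "\<sigma> (\<tau> y) = \<tau> (\<sigma> y)" if "y \<in> K" "\<sigma> y = to_ac \<zeta> ^ n * y" "\<tau> y = to_ac \<zeta> ^ n' * y" for y n n'
    using that endo_on_scaled[OF Gal_K_endo[OF \<sigma>] that(1) base_K, of "\<zeta> ^ n'"]
      endo_on_scaled[OF Gal_K_endo[OF \<tau>] that(1) base_K, of "\<zeta> ^ n"] by (simp add: mult_ac)
  have "(\<sigma> \<circ> \<tau>) x = (\<tau> \<circ> \<sigma>) x"
    by (rule endo_eq[OF base_endo_comp[OF Gal_K_endo[OF \<sigma>] Gal_K_endo[OF \<tau>]]
         base_endo_comp[OF Gal_K_endo[OF \<tau>] Gal_K_endo[OF \<sigma>]] subfield_K order_refl _ _ _ _ x])
       (use e e' * gens_K in \<open>auto simp: acts_def case_prod_unfold\<close>)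
  then show ?thesis by simp
qed

text \<open>
  The four automorphisms generate the Galois group.
\<close>

lemma fixed_base:
  assumes x: "x \<in> K" and fixd: "\<sigma>a x = x" "\<sigma>b' x = x" "\<sigma>c x = x" "\<sigma>d x = x"
  shows "x \<in> base_field"
proof -
  have "\<sigma> x = x" if \<sigma>: "\<sigma> \<in> carrier (Gal K base_field)" for \<sigma>
  proof -
    obtain i j k l where e: "acts \<sigma> (i, j, k, l)" "j < p"
      using acts_exists[OF Gal_K_endo[OF \<sigma>] subfield_K order_refl] by auto
    define \<tau> where "\<tau> = (\<sigma>a ^^ i) \<circ> (\<sigma>b' ^^ (p - j)) \<circ> (\<sigma>c ^^ k) \<circ> (\<sigma>d ^^ l)"
    have endo: "base_endo K \<tau>"
      unfolding \<tau>_def by (intro base_endo_comp base_endo_funpow \<sigma>_endo)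
    note S = \<sigma>_endo[THEN base_endo_funpow, THEN endo_on_scaled, OF _ base_K]
    have fx: "(f ^^ n) y = y" if "f y = y" for f :: "'a alg_closure \<Rightarrow> 'a alg_closure" and n y
      using that by (induction n) auto
    have z: "inverse \<zeta> ^ (p - j) = \<zeta> ^ j"
    proof -
      have "inverse \<zeta> ^ (p - j) * (\<zeta> ^ (p - j) * \<zeta> ^ j) = \<zeta> ^ j"
        using \<zeta>_nz by (simp add: power_inverse)
      also have "\<zeta> ^ (p - j) * \<zeta> ^ j = 1" using e(2) \<zeta>_pow by (simp flip: power_add)
      finally show ?thesis by simp
    qed
    have "\<tau> \<alpha> = \<sigma> \<alpha>" "\<tau> \<beta> = \<sigma> \<beta>" "\<tau> \<gamma> = \<sigma> \<gamma>" "\<tau> \<delta> = \<sigma> \<delta>"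
      using e(1) z gens_K funpow_scaled[OF \<sigma>_endo(1) gens_K(1) base_K \<sigma>_acts(1), of i]
        funpow_scaled[OF \<sigma>_endo(2) gens_K(2) base_K \<sigma>_acts(6), of "p - j"]
        funpow_scaled[OF \<sigma>_endo(3) gens_K(3) base_K \<sigma>_acts(11), of k]
        funpow_scaled[OF \<sigma>_endo(4) gens_K(4) base_K \<sigma>_acts(16), of l]
      unfolding \<tau>_def acts_def by (simp_all add: fx \<sigma>_acts S del: to_ac_power to_ac_inverse) (simp_all add: S fx \<sigma>_acts)
    then have "\<tau> x = \<sigma> x" using endo_eq[OF endo Gal_K_endo[OF \<sigma>] subfield_K order_refl] x by blast
    then show ?thesis by (simp add: \<tau>_def fx fixd)
  qed
  then have "x \<in> {x \<in> K. \<forall>\<sigma>\<in>carrier (Gal K base_field). \<sigma> x = x}" using x by blast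
  then show ?thesis using galois_K unfolding galois_extension_def by blast
qed

text \<open>
  By Galois theory this is \<open>F(\<beta>, \<delta>)\<close>; describing it as a fixed field makes the closure properties
  immediate.
\<close>

definition "M = {x \<in> K. \<sigma>a x = x \<and> \<sigma>c x = x}"

lemma M_K: "m \<in> M \<Longrightarrow> m \<in> K" and M_fixed: "m \<in> M \<Longrightarrow> \<sigma>a m = m" "m \<in> M \<Longrightarrow> \<sigma>c m = m"
  by (auto simp: M_def)

lemma bicyclic_M: "bicyclic p \<zeta> b d \<beta> \<delta> M \<sigma>b' \<sigma>d"
proof (rule bicyclic.intro)
  note F = subfield_fldD[OF subfield_K] and A = base_endoD[OF \<sigma>_endo(1)] and B = base_endoD[OF \<sigma>_endo(2)]
    and C = base_endoD[OF \<sigma>_endo(3)] and D = base_endoD[OF \<sigma>_endo(4)]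
  have stable: "\<sigma> m \<in> M" if \<sigma>: "\<sigma> \<in> carrier (Gal K base_field)" and m: "m \<in> M" for \<sigma> m
    using \<sigma>_commute[OF \<sigma>_Gal(1) \<sigma> M_K[OF m]] \<sigma>_commute[OF \<sigma>_Gal(3) \<sigma> M_K[OF m]] Gal_in[OF \<sigma> M_K[OF m]]
      M_fixed[OF m] by (simp add: M_def)
  show "to_ac k \<in> M" for k using base_K by (auto simp: M_def A C)
  show "m + m' \<in> M" "m * m' \<in> M" if "m \<in> M" "m' \<in> M" for m m'
    using that by (auto simp: M_def A C F)
  show "inverse m \<in> M" if "m \<in> M" for m
    using that base_endo_nonzero(2)[OF \<sigma>_endo(1) subfield_K, of m] base_endo_nonzero(2)[OF \<sigma>_endo(3) subfield_K, of m] F(6)[of m]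
    by (cases "m = 0") (auto simp: M_def A C)
  show "\<beta> \<in> M" "\<delta> \<in> M" using gens_K by (auto simp: M_def \<sigma>_acts)
  show "\<sigma>b' m \<in> M" "\<sigma>d m \<in> M" if "m \<in> M" for m using stable \<sigma>_Gal that by auto
  show "\<sigma>b' (m + m') = \<sigma>b' m + \<sigma>b' m'" "\<sigma>d (m + m') = \<sigma>d m + \<sigma>d m'"
    "\<sigma>b' (m * m') = \<sigma>b' m * \<sigma>b' m'" "\<sigma>d (m * m') = \<sigma>d m * \<sigma>d m'" if "m \<in> M" "m' \<in> M" for m m'
    using that M_K B D by auto
  show "\<sigma>b' (to_ac k) = to_ac k" "\<sigma>d (to_ac k) = to_ac k" for k by (simp_all add: B D)
  show "\<sigma>b' (\<sigma>d m) = \<sigma>d (\<sigma>b' m)" if "m \<in> M" for m by (rule \<sigma>_commute[OF \<sigma>_Gal(2,4) M_K[OF that]])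
  show "(\<sigma>b' ^^ p) m = m" "(\<sigma>d ^^ p) m = m" if "m \<in> M" for m by (rule \<sigma>_order[OF _ M_K[OF that]], rule \<sigma>_Gal)+
  show "m \<in> base_field" if "m \<in> M" "\<sigma>b' m = m" "\<sigma>d m = m" for m
    using fixed_base[OF M_K[OF that(1)]] M_fixed[OF that(1)] that by blast
qed (rule prime_p root p_nz nz pow \<sigma>_acts)+

lemma symbol_classes_equal_iff:
  "symbol_class p \<zeta> a b = symbol_class p \<zeta> c d \<longleftrightarrow>
   (\<exists>x\<in>M. \<exists>y\<in>M. (\<Prod>k<p. (\<sigma>b' ^^ k) x) = to_ac a \<and> (\<Prod>k<p. (\<sigma>d ^^ k) y) = to_ac c \<and> x * \<sigma>b' y = y * \<sigma>d x)"
proof -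
  note csa = central_simple_symbol_algebra[OF prime_p root]
  interpret bicyclic p \<zeta> b d \<beta> \<delta> M \<sigma>b' \<sigma>d by (rule bicyclic_M)
  show ?thesis
  proof
    assume "symbol_class p \<zeta> a b = symbol_class p \<zeta> c d"
    then show "\<exists>x\<in>M. \<exists>y\<in>M. (\<Prod>k<p. (\<sigma>b' ^^ k) x) = to_ac a \<and> (\<Prod>k<p. (\<sigma>d ^^ k) y) = to_ac c \<and> x * \<sigma>b' y = y * \<sigma>d x"
      unfolding symbol_class_def
      by (rule brauer_class_eqD[OF csa[OF nz(3,4)]]) (rule solution_of_matrix_iso[OF nz(1,3)])
  next
    assume "\<exists>x\<in>M. \<exists>y\<in>M. (\<Prod>k<p. (\<sigma>b' ^^ k) x) = to_ac a \<and> (\<Prod>k<p. (\<sigma>d ^^ k) y) = to_ac c \<and> x * \<sigma>b' y = y * \<sigma>d x"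
    then obtain x y where xy: "x \<in> M" "y \<in> M" "(\<Prod>k<p. (\<sigma>b' ^^ k) x) = to_ac a" "(\<Prod>k<p. (\<sigma>d ^^ k) y) = to_ac c"
      "x * \<sigma>b' y = y * \<sigma>d x" by blast
    interpret bicyclic_solution p \<zeta> b d \<beta> \<delta> M \<sigma>b' \<sigma>d x y a c
      by (rule bicyclic_solution.intro[OF bicyclic_M], rule bicyclic_solution_axioms.intro) (rule nz xy)+
    obtain \<theta> where "\<theta> \<in> algebra_iso fld (symbol_algebra p \<zeta> c d) (symbol_algebra p \<zeta> a b)"
      using symbol_algebras_isomorphic by blast
    from brauer_class_eqI[OF csa[OF nz(3,4)] csa[OF nz(1,2)] this]
    show "symbol_class p \<zeta> a b = symbol_class p \<zeta> c d" unfolding symbol_class_def by simp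
  qed
qed

end

section \<open>The Heisenberg group and its central product\<close>

lemma (in group) central_subgroup_normal:
  assumes N: "subgroup N G" and comm: "\<And>n x. n \<in> N \<Longrightarrow> x \<in> carrier G \<Longrightarrow> n \<otimes> x = x \<otimes> n"
  shows "N \<lhd> G"
  by (rule normalI[OF N]) (simp add: r_coset_def l_coset_def comm)

lemma quotient_iso:
  assumes h: "h \<in> hom G H" and G: "group G" and H: "group H" and N: "N \<lhd> G"
    and ker: "\<And>x. x \<in> carrier G \<Longrightarrow> h x = \<one>\<^bsub>H\<^esub> \<longleftrightarrow> x \<in> N"
    and surj: "\<And>y. y \<in> carrier H \<Longrightarrow> \<exists>x\<in>carrier G. h x = y"
  obtains \<theta> where "\<theta> \<in> iso (G Mod N) H" "\<And>x. x \<in> carrier G \<Longrightarrow> \<theta> (N #>\<^bsub>G\<^esub> x) = h x"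
proof -
  interpret group_hom G H h using h G H by (simp add: group_hom_def group_hom_axioms_def)
  interpret N: normal N G by (rule N)
  have sub: "N \<subseteq> kernel G H h" using ker N.subset by (auto simp: kernel_def)
  obtain \<theta> where \<theta>: "\<theta> \<in> hom (G Mod N) H" "\<And>x. x \<in> carrier G \<Longrightarrow> \<theta> (N #>\<^bsub>G\<^esub> x) = h x"
    by (rule FactGroup_universal_kernel[OF N sub], rule that)
  have carr: "carrier (G Mod N) = (\<lambda>x. N #>\<^bsub>G\<^esub> x) ` carrier G" by (rule carrier_FactGroup)
  have "inj_on \<theta> (carrier (G Mod N))"
  proof (rule inj_onI)
    fix A B assume "A \<in> carrier (G Mod N)" "B \<in> carrier (G Mod N)" and eq: "\<theta> A = \<theta> B"
    then obtain x y where x: "x \<in> carrier G" "A = N #>\<^bsub>G\<^esub> x" and y: "y \<in> carrier G" "B = N #>\<^bsub>G\<^esub> y"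
      unfolding carr by blast
    have "x \<otimes>\<^bsub>G\<^esub> inv\<^bsub>G\<^esub> y \<in> carrier G" using x y by simp
    moreover have "h (x \<otimes>\<^bsub>G\<^esub> inv\<^bsub>G\<^esub> y) = \<one>\<^bsub>H\<^esub>" using eq x y \<theta>(2) by simp
    ultimately have "x \<otimes>\<^bsub>G\<^esub> inv\<^bsub>G\<^esub> y \<in> N" using ker by blast
    from G.rcosI[OF this N.subset y(1)] have "x \<in> N #>\<^bsub>G\<^esub> y" using x y by (simp add: G.m_assoc)
    then show "A = B" using G.repr_independence[OF _ y(1) N.subgroup_axioms] x y by simp
  qed
  moreover have "\<theta> ` carrier (G Mod N) = carrier H"
  proof
    show "\<theta> ` carrier (G Mod N) \<subseteq> carrier H" using hom_closed \<theta>(2) by (auto simp: carr)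
    show "carrier H \<subseteq> \<theta> ` carrier (G Mod N)"
    proof
      fix y assume "y \<in> carrier H"
      from surj[OF this] obtain x where "x \<in> carrier G" "h x = y" by blast
      then show "y \<in> \<theta> ` carrier (G Mod N)" using \<theta>(2)[of x] unfolding carr by force
    qed
  qed
  ultimately have "\<theta> \<in> iso (G Mod N) H" using \<theta>(1) by (simp add: iso_def bij_betw_def)
  then show ?thesis by (rule that) (rule \<theta>(2))
qed

lemma heis_carrier: "carrier (heis p) = {0..<int p} \<times> {0..<int p} \<times> {0..<int p}"
  and heis_one: "\<one>\<^bsub>heis p\<^esub> = (0, 0, 0)"
  and heis_mult: "(x, y, z) \<otimes>\<^bsub>heis p\<^esub> (x', y', z') =
    ((x + x') mod int p, (y + y') mod int p, (z + z' + x * y') mod int p)"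
  by (simp_all add: heis_def)

lemma group_heis:
  assumes "p > 0"
  shows "group (heis p)"
proof (rule groupI)
  show "\<one>\<^bsub>heis p\<^esub> \<in> carrier (heis p)" using assms by (simp add: heis_carrier heis_one)
next
  fix g h assume "g \<in> carrier (heis p)" "h \<in> carrier (heis p)"
  then show "g \<otimes>\<^bsub>heis p\<^esub> h \<in> carrier (heis p)"
    using assms by (cases g; cases h) (simp add: heis_carrier heis_mult)
next
  fix g h k :: "int \<times> int \<times> int"
  obtain x y z where g: "g = (x, y, z)" by (cases g)
  obtain x' y' z' where h: "h = (x', y', z')" by (cases h)
  obtain x'' y'' z'' where k: "k = (x'', y'', z'')" by (cases k)
  show "g \<otimes>\<^bsub>heis p\<^esub> h \<otimes>\<^bsub>heis p\<^esub> k = g \<otimes>\<^bsub>heis p\<^esub> (h \<otimes>\<^bsub>heis p\<^esub> k)"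
  proof -
    have 1: "(r mod int p + z'' + (q mod int p) * y'') mod int p = (r + z'' + q * y'') mod int p" for q r
      by (intro mod_add_cong mod_mult_cong) simp_all
    have 2: "(z + r mod int p + x * (q mod int p)) mod int p = (z + r + x * q) mod int p" for q r
      by (intro mod_add_cong mod_mult_cong) simp_all
    show ?thesis unfolding g h k heis_mult 1 2 by (simp add: mod_simps algebra_simps)
  qed
next
  fix g assume "g \<in> carrier (heis p)"
  then show "\<one>\<^bsub>heis p\<^esub> \<otimes>\<^bsub>heis p\<^esub> g = g" by (cases g) (simp add: heis_one heis_mult heis_carrier)
next
  fix g assume g: "g \<in> carrier (heis p)"
  obtain x y z where xyz: "g = (x, y, z)" by (cases g)
  have "((- x) mod int p, (- y) mod int p, (x * y - z) mod int p) \<in> carrier (heis p)"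
    using assms by (simp add: heis_carrier)
  moreover have "((x * y - z) mod int p + z + ((- x) mod int p) * y) mod int p = (x * y - z + z + (- x) * y) mod int p"
    by (intro mod_add_cong mod_mult_cong) simp_all
  then have "((- x) mod int p, (- y) mod int p, (x * y - z) mod int p) \<otimes>\<^bsub>heis p\<^esub> g = \<one>\<^bsub>heis p\<^esub>"
    unfolding xyz heis_mult heis_one by (simp add: mod_simps)
  ultimately show "\<exists>h\<in>carrier (heis p). h \<otimes>\<^bsub>heis p\<^esub> g = \<one>\<^bsub>heis p\<^esub>" by blast
qed

context group
begin

lemma commute_pow:
  assumes "A \<in> carrier G" "B \<in> carrier G" "A \<otimes> B = B \<otimes> A"
  shows "A \<otimes> B [^] (m::nat) = B [^] m \<otimes> A"
  using assms group_commutes_pow[of B A m] by simp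

lemma commute_pow_pow:
  assumes "A \<in> carrier G" "B \<in> carrier G" "A \<otimes> B = B \<otimes> A"
  shows "A [^] (n::nat) \<otimes> B [^] (m::nat) = B [^] m \<otimes> A [^] n"
  using commute_pow[of "B [^] m" A n] commute_pow[OF assms, of m] assms by simp

text \<open>
  Each transposition of an \<open>A\<close> with a \<open>B\<close> produces one factor \<open>T\<close>.
\<close>

lemma heis_pow_commute:
  assumes c: "A \<in> carrier G" "B \<in> carrier G" "T \<in> carrier G"
    and TA: "T \<otimes> A = A \<otimes> T" and TB: "T \<otimes> B = B \<otimes> T" and AB: "A \<otimes> B = B \<otimes> A \<otimes> T"
  shows "A [^] (n::nat) \<otimes> B [^] (m::nat) = B [^] m \<otimes> A [^] n \<otimes> T [^] (n * m)"
proof -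
  have 1: "A \<otimes> B [^] m = B [^] m \<otimes> A \<otimes> T [^] m" for m :: nat
  proof (induction m)
    case (Suc m)
    have "A \<otimes> B [^] Suc m = (A \<otimes> B [^] m) \<otimes> B" using c by (simp add: m_assoc)
    also have "\<dots> = B [^] m \<otimes> A \<otimes> (T [^] m \<otimes> B)" unfolding Suc using c by (simp add: m_assoc)
    also have "T [^] m \<otimes> B = B \<otimes> T [^] m" using commute_pow[OF c(2,3) TB[symmetric]] by simp
    also have "B [^] m \<otimes> A \<otimes> (B \<otimes> T [^] m) = B [^] m \<otimes> (A \<otimes> B) \<otimes> T [^] m" using c by (simp add: m_assoc)
    also have "\<dots> = B [^] m \<otimes> B \<otimes> A \<otimes> (T \<otimes> T [^] m)" unfolding AB using c by (simp add: m_assoc)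
    also have "T \<otimes> T [^] m = T [^] Suc m" by (rule nat_pow_Suc2[OF c(3), symmetric])
    finally show ?case using c by simp
  qed (use c in simp)
  show ?thesis
  proof (induction n)
    case (Suc n)
    have "A [^] Suc n \<otimes> B [^] m = A [^] n \<otimes> (A \<otimes> B [^] m)" using c by (simp add: m_assoc)
    also have "\<dots> = (A [^] n \<otimes> B [^] m) \<otimes> A \<otimes> T [^] m" unfolding 1 using c by (simp add: m_assoc)
    also have "\<dots> = B [^] m \<otimes> A [^] n \<otimes> (T [^] (n * m) \<otimes> A) \<otimes> T [^] m" unfolding Suc using c by (simp add: m_assoc)
    also have "T [^] (n * m) \<otimes> A = A \<otimes> T [^] (n * m)" using commute_pow[OF c(1,3) TA[symmetric]] by simp
    also have "B [^] m \<otimes> A [^] n \<otimes> (A \<otimes> T [^] (n * m)) \<otimes> T [^] m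
      = B [^] m \<otimes> (A [^] n \<otimes> A) \<otimes> (T [^] (n * m) \<otimes> T [^] m)" using c by (simp add: m_assoc)
    also have "T [^] (n * m) \<otimes> T [^] m = T [^] (Suc n * m)" using c by (simp add: nat_pow_mult add.commute)
    finally show ?case using c by simp
  qed (use c in simp)
qed

lemma pow_mod_cong:
  assumes "A \<in> carrier G" "A [^] p = \<one>" "n mod p = m mod p"
  shows "A [^] (n::nat) = A [^] m"
proof -
  have "A [^] k = A [^] (k mod p)" for k
  proof -
    have "A [^] k = A [^] (p * (k div p) + k mod p)" by simp
    also have "\<dots> = A [^] (p * (k div p)) \<otimes> A [^] (k mod p)" using assms(1) by (simp add: nat_pow_mult)
    also have "A [^] (p * (k div p)) = (A [^] p) [^] (k div p)" using assms(1) by (simp add: nat_pow_pow)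
    finally show ?thesis using assms by simp
  qed
  then show ?thesis using assms(3) by metis
qed

lemma subgroup_pow_closed: "subgroup S G \<Longrightarrow> g \<in> S \<Longrightarrow> g [^] (n::nat) \<in> S"
  by (induction n) (auto simp: subgroup.one_closed subgroup.m_closed)

text \<open>
  With \<open>B\<close> in front of \<open>A\<close> no power of \<open>T\<close> has to be inserted: the matrix \<open>(x, y, z)\<close> equals \<open>(0, 1, 0)\<^sup>y (1, 0, 0)\<^sup>x
  (0, 0, 1)\<^sup>z\<close>.
\<close>

definition heis_word :: "'a \<Rightarrow> 'a \<Rightarrow> 'a \<Rightarrow> int \<times> int \<times> int \<Rightarrow> 'a" where
  "heis_word A B T = (\<lambda>(x, y, z). B [^] nat y \<otimes> A [^] nat x \<otimes> T [^] nat z)"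

lemma heis_word_closed:
  "A \<in> carrier G \<Longrightarrow> B \<in> carrier G \<Longrightarrow> T \<in> carrier G \<Longrightarrow> heis_word A B T g \<in> carrier G"
  by (simp add: heis_word_def case_prod_unfold)

lemma commute_mult:
  assumes "a \<in> carrier G" "b \<in> carrier G" "c \<in> carrier G" "a \<otimes> b = b \<otimes> a" "a \<otimes> c = c \<otimes> a"
  shows "a \<otimes> (b \<otimes> c) = b \<otimes> c \<otimes> a"
proof -
  have "a \<otimes> (b \<otimes> c) = b \<otimes> a \<otimes> c" using assms(1-3) by (simp add: m_assoc[symmetric] assms(4))
  then show ?thesis using assms(1-3) by (simp add: m_assoc assms(5))
qed

lemma heis_word_commute:
  assumes "a \<in> carrier G" "A \<in> carrier G" "B \<in> carrier G" "T \<in> carrier G"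
    and "a \<otimes> A = A \<otimes> a" "a \<otimes> B = B \<otimes> a" "a \<otimes> T = T \<otimes> a"
  shows "a \<otimes> heis_word A B T g = heis_word A B T g \<otimes> a"
  unfolding heis_word_def case_prod_unfold using assms by (intro commute_mult commute_pow) auto

text \<open>
  The Heisenberg group is presented by these relations.
\<close>

lemma heis_word_hom:
  assumes c: "A \<in> carrier G" "B \<in> carrier G" "T \<in> carrier G"
    and ord: "A [^] p = \<one>" "B [^] p = \<one>" "T [^] p = \<one>" and p: "p > 0"
    and TA: "T \<otimes> A = A \<otimes> T" and TB: "T \<otimes> B = B \<otimes> T" and AB: "A \<otimes> B = B \<otimes> A \<otimes> T"
  shows "heis_word A B T \<in> hom (heis p) G"
proof (rule homI)
  show "heis_word A B T g \<in> carrier G" for g by (rule heis_word_closed[OF c])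
next
  fix g h assume g: "g \<in> carrier (heis p)" and h: "h \<in> carrier (heis p)"
  obtain x y z where xyz: "g = (int x, int y, int z)"
    using g by (cases g) (auto simp: heis_carrier elim!: nonneg_int_cases)
  obtain x' y' z' where xyz': "h = (int x', int y', int z')"
    using h by (cases h) (auto simp: heis_carrier elim!: nonneg_int_cases)
  have gh: "g \<otimes>\<^bsub>heis p\<^esub> h = (int ((x + x') mod p), int ((y + y') mod p), int ((z + z' + x * y') mod p))"
    unfolding xyz xyz' heis_mult by (simp add: of_nat_mod)
  have "heis_word A B T g \<otimes> heis_word A B T h = B [^] y \<otimes> A [^] x \<otimes> (T [^] z \<otimes> B [^] y') \<otimes> A [^] x' \<otimes> T [^] z'"
    unfolding xyz xyz' heis_word_def using c by (simp add: m_assoc)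
  also have "T [^] z \<otimes> B [^] y' = B [^] y' \<otimes> T [^] z" by (rule commute_pow_pow[OF c(3,2) TB])
  also have "B [^] y \<otimes> A [^] x \<otimes> (B [^] y' \<otimes> T [^] z) \<otimes> A [^] x' \<otimes> T [^] z'
    = B [^] y \<otimes> (A [^] x \<otimes> B [^] y') \<otimes> (T [^] z \<otimes> A [^] x') \<otimes> T [^] z'" using c by (simp add: m_assoc)
  also have "A [^] x \<otimes> B [^] y' = B [^] y' \<otimes> A [^] x \<otimes> T [^] (x * y')" by (rule heis_pow_commute[OF c TA TB AB])
  also have "T [^] z \<otimes> A [^] x' = A [^] x' \<otimes> T [^] z" by (rule commute_pow_pow[OF c(3,1) TA])
  also have "B [^] y \<otimes> (B [^] y' \<otimes> A [^] x \<otimes> T [^] (x * y')) \<otimes> (A [^] x' \<otimes> T [^] z) \<otimes> T [^] z'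
    = B [^] y \<otimes> B [^] y' \<otimes> A [^] x \<otimes> (T [^] (x * y') \<otimes> A [^] x') \<otimes> (T [^] z \<otimes> T [^] z')" using c by (simp add: m_assoc)
  also have "T [^] (x * y') \<otimes> A [^] x' = A [^] x' \<otimes> T [^] (x * y')" by (rule commute_pow_pow[OF c(3,1) TA])
  also have "B [^] y \<otimes> B [^] y' \<otimes> A [^] x \<otimes> (A [^] x' \<otimes> T [^] (x * y')) \<otimes> (T [^] z \<otimes> T [^] z')
    = (B [^] y \<otimes> B [^] y') \<otimes> (A [^] x \<otimes> A [^] x') \<otimes> (T [^] (x * y') \<otimes> (T [^] z \<otimes> T [^] z'))" using c by (simp add: m_assoc)
  also have "\<dots> = B [^] (y + y') \<otimes> A [^] (x + x') \<otimes> T [^] (z + z' + x * y')"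
    using c by (simp add: nat_pow_mult add_ac)
  also have "\<dots> = heis_word A B T (g \<otimes>\<^bsub>heis p\<^esub> h)"
    unfolding gh heis_word_def case_prod_conv nat_int
    using pow_mod_cong[OF c(1) ord(1), OF mod_mod_trivial] pow_mod_cong[OF c(2) ord(2), OF mod_mod_trivial]
      pow_mod_cong[OF c(3) ord(3), OF mod_mod_trivial] by (simp only:)
  finally show "heis_word A B T (g \<otimes>\<^bsub>heis p\<^esub> h) = heis_word A B T g \<otimes> heis_word A B T h" by simp
qed

end

lemma hom_DirProd_commuting:
  fixes G (structure)
  assumes G: "group G" and f: "f \<in> hom H G" and g: "g \<in> hom K G"
    and comm: "\<And>x y. x \<in> carrier H \<Longrightarrow> y \<in> carrier K \<Longrightarrow> f x \<otimes> g y = g y \<otimes> f x"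
  shows "(\<lambda>(x, y). f x \<otimes> g y) \<in> hom (H \<times>\<times> K) G"
proof -
  interpret group G by (rule G)
  have c: "\<And>x. x \<in> carrier H \<Longrightarrow> f x \<in> carrier G" "\<And>x. x \<in> carrier K \<Longrightarrow> g x \<in> carrier G"
    using f g by (auto simp: hom_def)
  show ?thesis
  proof (rule homI)
    fix r assume "r \<in> carrier (H \<times>\<times> K)"
    then show "(case r of (x, y) \<Rightarrow> f x \<otimes> g y) \<in> carrier G" using c by (cases r) simp
  next
    fix r r' assume r: "r \<in> carrier (H \<times>\<times> K)" "r' \<in> carrier (H \<times>\<times> K)"
    obtain x y where xy: "r = (x, y)" by (cases r)
    obtain x' y' where xy': "r' = (x', y')" by (cases r')
    have x: "x \<in> carrier H" "x' \<in> carrier H" and y: "y \<in> carrier K" "y' \<in> carrier K" using r xy xy' by auto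
    have "f x \<otimes> f x' \<otimes> (g y \<otimes> g y') = f x \<otimes> (f x' \<otimes> g y) \<otimes> g y'"
      using c x y by (simp add: m_assoc)
    also have "\<dots> = f x \<otimes> g y \<otimes> (f x' \<otimes> g y')"
      unfolding comm[OF x(2) y(1)] using c x y by (simp add: m_assoc)
    finally show "(case r \<otimes>\<^bsub>H \<times>\<times> K\<^esub> r' of (x, y) \<Rightarrow> f x \<otimes> g y) =
        (case r of (x, y) \<Rightarrow> f x \<otimes> g y) \<otimes> (case r' of (x, y) \<Rightarrow> f x \<otimes> g y)"
      by (simp only: xy xy' mult_DirProd case_prod_conv hom_mult[OF f x] hom_mult[OF g y])
  qed
qed

locale central_product =
  fixes p :: nat
  assumes p1: "p > 1"
begin

abbreviation "HH \<equiv> heis p \<times>\<times> heis p"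

lemma group_HH: "group HH"
  using p1 by (intro DirProd_group group_heis) auto

lemma diag_normal: "central_diag p \<lhd> HH"
proof -
  interpret group HH by (rule group_HH)
  have car: "((0, 0, z), (0, 0, z)) \<in> carrier HH" if "z \<in> {0..<int p}" for z
    using that by (simp add: heis_carrier)
  have mod: "z mod int p \<in> {0..<int p}" for z using p1 by simp
  show ?thesis
  proof (rule central_subgroup_normal)
    show "subgroup (central_diag p) HH"
    proof (rule subgroupI)
      show "central_diag p \<subseteq> carrier HH" using car by (auto simp: central_diag_def simp del: carrier_DirProd)
      show "central_diag p \<noteq> {}" using p1 by (auto simp: central_diag_def)
    next
      fix g assume "g \<in> central_diag p"
      then obtain z where z: "z \<in> {0..<int p}" "g = ((0, 0, z), (0, 0, z))" by (auto simp: central_diag_def)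
      have "inv\<^bsub>HH\<^esub> g = ((0, 0, (- z) mod int p), (0, 0, (- z) mod int p))"
        by (rule inv_equality) (use car[OF z(1)] car[OF mod, of "- z"] z(2) in \<open>simp_all add: heis_mult heis_one mod_simps del: carrier_DirProd\<close>)
      then show "inv\<^bsub>HH\<^esub> g \<in> central_diag p" using mod by (auto simp: central_diag_def)
    next
      fix g h assume "g \<in> central_diag p" "h \<in> central_diag p"
      then show "g \<otimes>\<^bsub>HH\<^esub> h \<in> central_diag p" using mod by (auto simp: central_diag_def heis_mult)
    qed
    show "n \<otimes>\<^bsub>HH\<^esub> g = g \<otimes>\<^bsub>HH\<^esub> n" if "n \<in> central_diag p" for n g
      using that by (cases g) (auto simp: central_diag_def heis_mult add.commute)
  qed
qed

sublocale Ep: group "Ep p"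
  unfolding Ep_def by (rule normal.factorgroup_is_group[OF diag_normal])

lemma Ep_mk_closed: "g \<in> carrier (heis p) \<Longrightarrow> h \<in> carrier (heis p) \<Longrightarrow> Ep_mk p g h \<in> carrier (Ep p)"
  unfolding Ep_mk_def Ep_def carrier_FactGroup by (rule imageI) simp

lemma Ep_cases:
  assumes "e \<in> carrier (Ep p)"
  obtains g h where "g \<in> carrier (heis p)" "h \<in> carrier (heis p)" "e = Ep_mk p g h"
  using assms unfolding Ep_mk_def Ep_def carrier_FactGroup by auto

lemma Ep_mk_mult:
  assumes "g \<in> carrier (heis p)" "h \<in> carrier (heis p)" "g' \<in> carrier (heis p)" "h' \<in> carrier (heis p)"
  shows "Ep_mk p g h \<otimes>\<^bsub>Ep p\<^esub> Ep_mk p g' h' = Ep_mk p (g \<otimes>\<^bsub>heis p\<^esub> g') (h \<otimes>\<^bsub>heis p\<^esub> h')"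
  using normal.rcos_sum[OF diag_normal, of "(g, h)" "(g', h')"] assms
  unfolding Ep_mk_def Ep_def by (simp add: FactGroup_def)

lemma Ep_one: "\<one>\<^bsub>Ep p\<^esub> = Ep_mk p (0, 0, 0) (0, 0, 0)"
proof -
  interpret group HH by (rule group_HH)
  have "central_diag p \<subseteq> carrier HH" by (rule subgroup.subset[OF normal_imp_subgroup[OF diag_normal]])
  from coset_mult_one[OF this] show ?thesis unfolding Ep_mk_def Ep_def by (simp add: heis_one FactGroup_def)
qed

lemma Ep_mk_eqD:
  assumes "Ep_mk p g h = Ep_mk p g' h'" "g' \<in> carrier (heis p)" "h' \<in> carrier (heis p)"
  shows "(g', h') \<in> central_diag p #>\<^bsub>HH\<^esub> (g, h)"
  using group.repr_independenceD[OF group_HH normal_imp_subgroup[OF diag_normal], of "(g', h')" "(g, h)"] assms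
  unfolding Ep_mk_def by simp

text \<open>
  A central element of the second factor is the inverse of the same element of the first.
\<close>

lemma Ep_mk_absorb:
  assumes "(x, y, z) \<in> carrier (heis p)" "(x', y', z') \<in> carrier (heis p)" "k \<in> {0..<int p}"
  shows "Ep_mk p (x, y, (z + k) mod int p) (x', y', (z' + k) mod int p) = Ep_mk p (x, y, z) (x', y', z')"
proof -
  have "((x, y, (z + k) mod int p), (x', y', (z' + k) mod int p)) \<in> central_diag p #>\<^bsub>HH\<^esub> ((x, y, z), (x', y', z'))"
    unfolding r_coset_def central_diag_def
    using assms by (auto simp: heis_mult heis_carrier add.commute intro!: bexI[of _ k])
  from group.repr_independence[OF group_HH this _ normal_imp_subgroup[OF diag_normal]] assms
  show ?thesis unfolding Ep_mk_def by simp
qed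

lemma heis_memI: "x \<in> {0..<int p} \<Longrightarrow> y \<in> {0..<int p} \<Longrightarrow> z \<in> {0..<int p} \<Longrightarrow> (x, y, z) \<in> carrier (heis p)"
  by (simp add: heis_carrier)

lemma mem_range: "0 \<in> {0..<int p}" "1 \<in> {0..<int p}" "k mod int p \<in> {0..<int p}"
  using p1 by auto

lemmas Ep_defs = s_a_def s_b_def s_c_def s_d_def Ep_tau_def

lemma Ep_gens_closed: "s_a p \<in> carrier (Ep p)" "s_b p \<in> carrier (Ep p)" "s_c p \<in> carrier (Ep p)"
    "s_d p \<in> carrier (Ep p)" "Ep_tau p \<in> carrier (Ep p)"
  unfolding Ep_defs by (intro Ep_mk_closed heis_memI mem_range)+

lemma Ep_gen_pow:
  "s_a p [^]\<^bsub>Ep p\<^esub> (n::nat) = Ep_mk p (int n mod int p, 0, 0) (0, 0, 0)"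
  "s_b p [^]\<^bsub>Ep p\<^esub> (n::nat) = Ep_mk p (0, int n mod int p, 0) (0, 0, 0)"
  "s_c p [^]\<^bsub>Ep p\<^esub> (n::nat) = Ep_mk p (0, 0, 0) (int n mod int p, 0, 0)"
  "s_d p [^]\<^bsub>Ep p\<^esub> (n::nat) = Ep_mk p (0, 0, 0) (0, int n mod int p, 0)"
  "Ep_tau p [^]\<^bsub>Ep p\<^esub> (n::nat) = Ep_mk p (0, 0, int n mod int p) (0, 0, 0)"
  by (induction n; simp add: Ep_one Ep_defs Ep_mk_mult heis_memI mem_range heis_mult mod_simps add.commute
      del: atLeastLessThan_iff)+

lemma Ep_gen_order:
  "s_a p [^]\<^bsub>Ep p\<^esub> p = \<one>\<^bsub>Ep p\<^esub>" "s_b p [^]\<^bsub>Ep p\<^esub> p = \<one>\<^bsub>Ep p\<^esub>" "s_c p [^]\<^bsub>Ep p\<^esub> p = \<one>\<^bsub>Ep p\<^esub>"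
  "s_d p [^]\<^bsub>Ep p\<^esub> p = \<one>\<^bsub>Ep p\<^esub>" "Ep_tau p [^]\<^bsub>Ep p\<^esub> p = \<one>\<^bsub>Ep p\<^esub>"
  unfolding Ep_gen_pow Ep_one by simp_all

lemma Ep_relations:
  "s_a p \<otimes>\<^bsub>Ep p\<^esub> s_b p = s_b p \<otimes>\<^bsub>Ep p\<^esub> s_a p \<otimes>\<^bsub>Ep p\<^esub> Ep_tau p"
  "s_d p \<otimes>\<^bsub>Ep p\<^esub> s_c p = s_c p \<otimes>\<^bsub>Ep p\<^esub> s_d p \<otimes>\<^bsub>Ep p\<^esub> Ep_tau p"
  "s_a p \<otimes>\<^bsub>Ep p\<^esub> s_c p = s_c p \<otimes>\<^bsub>Ep p\<^esub> s_a p" "s_a p \<otimes>\<^bsub>Ep p\<^esub> s_d p = s_d p \<otimes>\<^bsub>Ep p\<^esub> s_a p"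
  "s_b p \<otimes>\<^bsub>Ep p\<^esub> s_c p = s_c p \<otimes>\<^bsub>Ep p\<^esub> s_b p" "s_b p \<otimes>\<^bsub>Ep p\<^esub> s_d p = s_d p \<otimes>\<^bsub>Ep p\<^esub> s_b p"
proof -
  have *: "1 mod int p = 1" using p1 by simp
  note simps = Ep_defs Ep_mk_mult heis_memI mem_range heis_mult *
  show "s_a p \<otimes>\<^bsub>Ep p\<^esub> s_b p = s_b p \<otimes>\<^bsub>Ep p\<^esub> s_a p \<otimes>\<^bsub>Ep p\<^esub> Ep_tau p"
    "s_a p \<otimes>\<^bsub>Ep p\<^esub> s_c p = s_c p \<otimes>\<^bsub>Ep p\<^esub> s_a p" "s_a p \<otimes>\<^bsub>Ep p\<^esub> s_d p = s_d p \<otimes>\<^bsub>Ep p\<^esub> s_a p"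
    "s_b p \<otimes>\<^bsub>Ep p\<^esub> s_c p = s_c p \<otimes>\<^bsub>Ep p\<^esub> s_b p" "s_b p \<otimes>\<^bsub>Ep p\<^esub> s_d p = s_d p \<otimes>\<^bsub>Ep p\<^esub> s_b p"
    by (simp_all add: simps del: atLeastLessThan_iff)
  have "Ep_mk p (0, 0, (0 + 1) mod int p) (1, 1, (0 + 1) mod int p) = Ep_mk p (0, 0, 0) (1, 1, 0)"
    by (intro Ep_mk_absorb heis_memI mem_range)
  then show "s_d p \<otimes>\<^bsub>Ep p\<^esub> s_c p = s_c p \<otimes>\<^bsub>Ep p\<^esub> s_d p \<otimes>\<^bsub>Ep p\<^esub> Ep_tau p"
    by (simp add: simps del: atLeastLessThan_iff)
qed

lemma Ep_tau_central: "e \<in> carrier (Ep p) \<Longrightarrow> Ep_tau p \<otimes>\<^bsub>Ep p\<^esub> e = e \<otimes>\<^bsub>Ep p\<^esub> Ep_tau p"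
  by (erule Ep_cases)
     (auto simp: Ep_tau_def Ep_mk_mult heis_memI mem_range heis_mult add.commute simp del: atLeastLessThan_iff)

lemma Ep_tau_nontrivial: "Ep_tau p \<noteq> \<one>\<^bsub>Ep p\<^esub>"
proof
  assume "Ep_tau p = \<one>\<^bsub>Ep p\<^esub>"
  then have "Ep_mk p (0, 0, 0) (0, 0, 0) = Ep_mk p (0, 0, 1) (0, 0, 0)" by (simp add: Ep_tau_def Ep_one)
  from Ep_mk_eqD[OF this] show False
    using p1 by (auto simp: heis_memI mem_range r_coset_def central_diag_def heis_mult simp del: atLeastLessThan_iff)
qed

text \<open>
  The central coordinate of the second factor is moved into the first one, where it becomes a
  power of \<open>\<tau>\<close>.
\<close>

lemma Ep_normal_form:
  assumes "e \<in> carrier (Ep p)"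
  shows "\<exists>x<p. \<exists>y<p. \<exists>z<p. \<exists>u<p. \<exists>v<p. e = s_b p [^]\<^bsub>Ep p\<^esub> y \<otimes>\<^bsub>Ep p\<^esub> s_a p [^]\<^bsub>Ep p\<^esub> x \<otimes>\<^bsub>Ep p\<^esub>
    Ep_tau p [^]\<^bsub>Ep p\<^esub> z \<otimes>\<^bsub>Ep p\<^esub> s_d p [^]\<^bsub>Ep p\<^esub> v \<otimes>\<^bsub>Ep p\<^esub> s_c p [^]\<^bsub>Ep p\<^esub> u"
proof -
  obtain g h where gh: "g \<in> carrier (heis p)" "h \<in> carrier (heis p)" "e = Ep_mk p g h" by (rule Ep_cases[OF assms])
  obtain x y z where g: "g = (int x, int y, z)" "x < p" "y < p" "z \<in> {0..<int p}"
    using gh(1) by (cases g) (auto simp: heis_carrier elim!: nonneg_int_cases)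
  obtain u v w where h: "h = (int u, int v, w)" "u < p" "v < p" "w \<in> {0..<int p}"
    using gh(2) by (cases h) (auto simp: heis_carrier elim!: nonneg_int_cases)
  define k where "k = nat ((z - w) mod int p)"
  have k: "int k = (z - w) mod int p" "k < p" using p1 by (auto simp: k_def nat_less_iff)
  have "Ep_mk p (int x, int y, (int k + w) mod int p) (int u, int v, (0 + w) mod int p)
      = Ep_mk p (int x, int y, int k) (int u, int v, 0)"
    by (rule Ep_mk_absorb) (use g h k p1 in \<open>simp_all add: heis_carrier\<close>)
  moreover have "(int k + w) mod int p = z" "(0 + w) mod int p = w" using g(4) h(4) by (simp_all add: k mod_simps)
  ultimately have "e = Ep_mk p (int x, int y, int k) (int u, int v, 0)" by (simp only: gh(3) g(1) h(1))
  also have "\<dots> = s_b p [^]\<^bsub>Ep p\<^esub> y \<otimes>\<^bsub>Ep p\<^esub> s_a p [^]\<^bsub>Ep p\<^esub> x \<otimes>\<^bsub>Ep p\<^esub>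
    Ep_tau p [^]\<^bsub>Ep p\<^esub> k \<otimes>\<^bsub>Ep p\<^esub> s_d p [^]\<^bsub>Ep p\<^esub> v \<otimes>\<^bsub>Ep p\<^esub> s_c p [^]\<^bsub>Ep p\<^esub> u"
    unfolding Ep_gen_pow using g(2,3) h(2,3) k(2) by (simp add: Ep_mk_mult heis_carrier heis_mult)
  finally show ?thesis using g(2,3) h(2,3) k(2) by blast
qed

lemma Ep_kernel_subgroup: "subgroup (Ep_kernel p) (Ep p)"
  unfolding Ep_kernel_def using Ep_gens_closed(5) by (intro Ep.generate_is_subgroup) simp

lemma Ep_tau_pow_kernel: "Ep_tau p [^]\<^bsub>Ep p\<^esub> (n::nat) \<in> Ep_kernel p"
proof -
  have "Ep_tau p \<in> Ep_kernel p" unfolding Ep_kernel_def by (rule generate.incl) simp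
  then show ?thesis by (rule Ep.subgroup_pow_closed[OF Ep_kernel_subgroup])
qed

lemma Ep_kernel_normal: "Ep_kernel p \<lhd> Ep p"
proof (rule Ep.central_subgroup_normal[OF Ep_kernel_subgroup])
  fix n e assume n: "n \<in> Ep_kernel p" and e: "e \<in> carrier (Ep p)"
  from n obtain k :: int where k: "n = Ep_tau p [^]\<^bsub>Ep p\<^esub> k"
    unfolding Ep_kernel_def Ep.generate_pow[OF Ep_gens_closed(5)] by blast
  have "Ep_tau p [^]\<^bsub>Ep p\<^esub> k = Ep_tau p [^]\<^bsub>Ep p\<^esub> (nat (k mod int p))"
  proof -
    have "k = int p * (k div int p) + k mod int p" by simp
    then have "Ep_tau p [^]\<^bsub>Ep p\<^esub> k = Ep_tau p [^]\<^bsub>Ep p\<^esub> (int p * (k div int p)) \<otimes>\<^bsub>Ep p\<^esub> Ep_tau p [^]\<^bsub>Ep p\<^esub> (k mod int p)"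
      using Ep.int_pow_mult[OF Ep_gens_closed(5)] by metis
    also have "Ep_tau p [^]\<^bsub>Ep p\<^esub> (int p * (k div int p)) = (Ep_tau p [^]\<^bsub>Ep p\<^esub> p) [^]\<^bsub>Ep p\<^esub> (k div int p)"
      by (simp add: Ep.int_pow_pow[OF Ep_gens_closed(5), symmetric] int_pow_int)
    also have "Ep_tau p [^]\<^bsub>Ep p\<^esub> (k mod int p) = Ep_tau p [^]\<^bsub>Ep p\<^esub> (nat (k mod int p))"
      using p1 by (simp add: int_pow_int[symmetric])
    finally show ?thesis using Ep_gens_closed(5) by (simp add: Ep_gen_order)
  qed
  then show "n \<otimes>\<^bsub>Ep p\<^esub> e = e \<otimes>\<^bsub>Ep p\<^esub> n"
    using Ep.commute_pow[OF e Ep_gens_closed(5) Ep_tau_central[OF e, symmetric]] k by simp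
qed

lemma Ep_generated:
  assumes "subgroup S (Ep p)" "s_a p \<in> S" "s_b p \<in> S" "s_c p \<in> S" "s_d p \<in> S" "Ep_tau p \<in> S"
    and "e \<in> carrier (Ep p)"
  shows "e \<in> S"
proof -
  note pow = Ep.subgroup_pow_closed[OF assms(1)]
  from Ep_normal_form[OF assms(7)] obtain x y z u v :: nat where
    "e = s_b p [^]\<^bsub>Ep p\<^esub> y \<otimes>\<^bsub>Ep p\<^esub> s_a p [^]\<^bsub>Ep p\<^esub> x \<otimes>\<^bsub>Ep p\<^esub>
    Ep_tau p [^]\<^bsub>Ep p\<^esub> z \<otimes>\<^bsub>Ep p\<^esub> s_d p [^]\<^bsub>Ep p\<^esub> v \<otimes>\<^bsub>Ep p\<^esub> s_c p [^]\<^bsub>Ep p\<^esub> u" by blast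
  then show ?thesis by (simp only:) (intro subgroup.m_closed[OF assms(1)] pow assms(2-6))
qed

text \<open>
  The presentation of \<open>\<E>_p\<close>, as a criterion for recognising it. The words in \<open>A, B, T\<close> and those in
  \<open>C, D, T\<inverse>\<close> define commuting homomorphisms from two Heisenberg groups; together they map onto \<open>G\<close> with
  kernel the diagonal of the centre. The inverse of \<open>T\<close> is written as \<open>T\<close> to the power \<open>p - 1\<close> in order to
  stay with natural exponents.
\<close>

lemma Ep_iso:
  fixes G (structure)
  assumes G: "group G" and c: "A \<in> carrier G" "B \<in> carrier G" "C \<in> carrier G" "D \<in> carrier G" "T \<in> carrier G"
    and ord: "A [^] p = \<one>" "B [^] p = \<one>" "C [^] p = \<one>" "D [^] p = \<one>" "T [^] p = \<one>"
    and T: "T \<otimes> A = A \<otimes> T" "T \<otimes> B = B \<otimes> T" "T \<otimes> C = C \<otimes> T" "T \<otimes> D = D \<otimes> T"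
    and AB: "A \<otimes> B = B \<otimes> A \<otimes> T" and DC: "D \<otimes> C = C \<otimes> D \<otimes> T"
    and comm: "A \<otimes> C = C \<otimes> A" "A \<otimes> D = D \<otimes> A" "B \<otimes> C = C \<otimes> B" "B \<otimes> D = D \<otimes> B"
    and inj: "\<And>x y z u v :: nat. x < p \<Longrightarrow> y < p \<Longrightarrow> u < p \<Longrightarrow> v < p \<Longrightarrow>
      B [^] y \<otimes> A [^] x \<otimes> T [^] z \<otimes> D [^] v \<otimes> C [^] u = \<one> \<Longrightarrow>
      x = 0 \<and> y = 0 \<and> u = 0 \<and> v = 0 \<and> p dvd z"
    and surj: "\<And>g. g \<in> carrier G \<Longrightarrow> \<exists>x<p. \<exists>y<p. \<exists>z<p. \<exists>u<p. \<exists>v<p.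
      g = B [^] y \<otimes> A [^] x \<otimes> T [^] z \<otimes> D [^] v \<otimes> C [^] u"
  obtains \<theta> where "\<theta> \<in> iso (Ep p) G" "\<theta> (s_a p) = A" "\<theta> (s_b p) = B" "\<theta> (s_c p) = C" "\<theta> (s_d p) = D" "\<theta> (Ep_tau p) = T"
proof -
  interpret group G by (rule G)
  define T' where "T' = T [^] (p - 1)"
  have p0: "p > 0" using p1 by simp
  have T'c: "T' \<in> carrier G" using c by (simp add: T'_def)
  have T'1: "T \<otimes> T' = \<one>" using ord(5) p0 nat_pow_Suc2[OF c(5), of "p - 1"] by (simp add: T'_def)
  have T'ord: "T' [^] p = \<one>"
    unfolding T'_def nat_pow_pow[OF c(5)] mult.commute[of "p - 1"] nat_pow_pow[OF c(5), symmetric] ord(5) by simp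
  have T'comm: "T' \<otimes> C = C \<otimes> T'" "T' \<otimes> D = D \<otimes> T'"
    unfolding T'_def using commute_pow[OF c(3,5) T(3)[symmetric]] commute_pow[OF c(4,5) T(4)[symmetric]] by simp_all
  have "D \<otimes> C \<otimes> T' = C \<otimes> D \<otimes> (T \<otimes> T')" unfolding DC using c T'c by (simp add: m_assoc)
  then have CD: "C \<otimes> D = D \<otimes> C \<otimes> T'" using c by (simp add: T'1)
  define \<Phi> where "\<Phi> = (\<lambda>(g, h). heis_word A B T g \<otimes> heis_word C D T' h)"
  have hom: "\<Phi> \<in> hom HH G"
    unfolding \<Phi>_def
  proof (rule hom_DirProd_commuting[OF G])
    show "heis_word A B T \<in> hom (heis p) G" by (rule heis_word_hom) fact+
    show "heis_word C D T' \<in> hom (heis p) G" by (rule heis_word_hom) fact+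
    fix g h :: "int \<times> int \<times> int"
    have T'T: "T' \<otimes> a = a \<otimes> T'" if "a \<in> carrier G" "T \<otimes> a = a \<otimes> T" for a
      unfolding T'_def using commute_pow[OF that(1) c(5) that(2)[symmetric]] by simp
    have W: "a \<otimes> heis_word A B T g = heis_word A B T g \<otimes> a"
      if "a \<in> carrier G" "A \<otimes> a = a \<otimes> A" "B \<otimes> a = a \<otimes> B" "T \<otimes> a = a \<otimes> T" for a
      by (rule heis_word_commute) (use that c in simp_all)
    show "heis_word A B T g \<otimes> heis_word C D T' h = heis_word C D T' h \<otimes> heis_word A B T g"
    proof (rule heis_word_commute[OF heis_word_closed[OF c(1,2,5)] c(3,4) T'c])
      show "heis_word A B T g \<otimes> C = C \<otimes> heis_word A B T g" by (rule W[symmetric]) fact+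
      show "heis_word A B T g \<otimes> D = D \<otimes> heis_word A B T g" by (rule W[symmetric]) fact+
      show "heis_word A B T g \<otimes> T' = T' \<otimes> heis_word A B T g"
        by (rule W[symmetric, OF T'c T'T[OF c(1) T(1), symmetric] T'T[OF c(2) T(2), symmetric] T'T[OF c(5) refl, symmetric]])
    qed
  qed
  have word: "\<Phi> ((int x, int y, int z), (int u, int v, int w)) =
      B [^] y \<otimes> A [^] x \<otimes> T [^] (z + (p - 1) * w) \<otimes> D [^] v \<otimes> C [^] u" for x y z u v w
  proof -
    have T'w: "T' [^] w = T [^] ((p - 1) * w)" unfolding T'_def by (simp add: nat_pow_pow[OF c(5)])
    let ?t = "T [^] ((p - 1) * w)"
    have "\<Phi> ((int x, int y, int z), (int u, int v, int w)) =
      B [^] y \<otimes> A [^] x \<otimes> T [^] z \<otimes> D [^] v \<otimes> (C [^] u \<otimes> ?t)"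
      unfolding \<Phi>_def heis_word_def using c T'c by (simp add: m_assoc T'w)
    also have "C [^] u \<otimes> ?t = ?t \<otimes> C [^] u" by (rule commute_pow_pow[OF c(3,5) T(3)[symmetric]])
    also have "B [^] y \<otimes> A [^] x \<otimes> T [^] z \<otimes> D [^] v \<otimes> (?t \<otimes> C [^] u)
      = B [^] y \<otimes> A [^] x \<otimes> T [^] z \<otimes> (D [^] v \<otimes> ?t) \<otimes> C [^] u" using c by (simp add: m_assoc)
    also have "D [^] v \<otimes> ?t = ?t \<otimes> D [^] v" by (rule commute_pow_pow[OF c(4,5) T(4)[symmetric]])
    also have "B [^] y \<otimes> A [^] x \<otimes> T [^] z \<otimes> (?t \<otimes> D [^] v) \<otimes> C [^] u
      = B [^] y \<otimes> A [^] x \<otimes> (T [^] z \<otimes> ?t) \<otimes> D [^] v \<otimes> C [^] u" using c by (simp add: m_assoc)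
    finally show ?thesis using c by (simp add: nat_pow_mult)
  qed
  obtain \<theta> where \<theta>: "\<theta> \<in> iso (HH Mod central_diag p) G"
    "\<And>e. e \<in> carrier HH \<Longrightarrow> \<theta> (central_diag p #>\<^bsub>HH\<^esub> e) = \<Phi> e"
  proof (rule quotient_iso[OF hom group_HH G diag_normal])
    fix e assume e: "e \<in> carrier HH"
    obtain x y z u v w where e_eq: "e = ((int x, int y, int z), (int u, int v, int w))"
      and lt: "x < p" "y < p" "z < p" "u < p" "v < p" "w < p"
      using e by (cases e) (auto simp: heis_carrier elim!: nonneg_int_cases)
    have dvd: "p dvd z + (p - 1) * w \<longleftrightarrow> z = w"
    proof -
      have eq: "z + (p - 1) * w + w = z + p * w" using p0 by (cases p) auto
      show ?thesis
      proof
        assume "p dvd z + (p - 1) * w"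
        then have "(z + (p - 1) * w + w) mod p = w mod p" by (metis dvd_eq_mod_eq_0 mod_add_left_eq add_0)
        then show "z = w" unfolding eq using lt by simp
      next
        assume "z = w"
        then have "z + (p - 1) * w = p * w" using p0 by (cases p) auto
        then show "p dvd z + (p - 1) * w" by simp
      qed
    qed
    show "\<Phi> e = \<one> \<longleftrightarrow> e \<in> central_diag p"
    proof
      assume "\<Phi> e = \<one>"
      then have "x = 0 \<and> y = 0 \<and> u = 0 \<and> v = 0 \<and> p dvd z + (p - 1) * w"
        unfolding e_eq word by (rule inj[OF lt(1,2,4,5)])
      then show "e \<in> central_diag p" using lt by (auto simp: e_eq dvd central_diag_def simp del: One_nat_def)
    next
      assume "e \<in> central_diag p"
      then have z: "x = 0" "y = 0" "u = 0" "v = 0" "z = w" by (auto simp: e_eq central_diag_def)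
      then have "(z + (p - 1) * w) mod p = 0 mod p" using dvd by (simp add: dvd_eq_mod_eq_0)
      then have "T [^] (z + (p - 1) * w) = T [^] (0::nat)" by (rule pow_mod_cong[OF c(5) ord(5)])
      then show "\<Phi> e = \<one>" unfolding e_eq word z(1-4) by (simp del: One_nat_def)
    qed
  next
    fix g assume "g \<in> carrier G"
    from surj[OF this] obtain x y z u v where lt: "x < p" "y < p" "z < p" "u < p" "v < p"
      and g: "g = B [^] y \<otimes> A [^] x \<otimes> T [^] z \<otimes> D [^] v \<otimes> C [^] u" by blast
    have "g = \<Phi> ((int x, int y, int z), (int u, int v, int 0))" unfolding word g by simp
    moreover have "((int x, int y, int z), (int u, int v, int 0)) \<in> carrier HH" using lt by (simp add: heis_carrier)
    ultimately show "\<exists>e\<in>carrier HH. \<Phi> e = g" by (intro bexI) (rule sym)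
  qed (rule that)
  have \<theta>mk: "\<theta> (Ep_mk p g h) = \<Phi> (g, h)" if "g \<in> carrier (heis p)" "h \<in> carrier (heis p)" for g h
    unfolding Ep_mk_def using \<theta>(2)[of "(g, h)"] that by simp
  show ?thesis
  proof (rule that)
    show "\<theta> \<in> iso (Ep p) G" using \<theta>(1) unfolding Ep_def .
    show "\<theta> (s_a p) = A" "\<theta> (s_b p) = B" "\<theta> (s_c p) = C" "\<theta> (s_d p) = D" "\<theta> (Ep_tau p) = T"
      unfolding Ep_defs using c T'c
      by (simp_all add: \<theta>mk heis_memI mem_range \<Phi>_def heis_word_def del: atLeastLessThan_iff)
  qed
qed

end

section \<open>From an extension to a solution of the equations\<close>

lemma obtain_power_inverse_mod:
  fixes p k :: nat
  assumes "Factorial_Ring.prime p" "0 < k" "k < p"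
  obtains e q where "k * e = p * q + 1"
proof -
  have "\<not> p dvd k" using assms(2,3) by (auto dest: dvd_imp_le)
  then have "gcd k p = 1" using prime_imp_coprime[OF assms(1)] by (simp add: coprime_iff_gcd_eq_1 gcd.commute)
  then show ?thesis using bezout_nat[of k p] assms(2) that by auto
qed

sublocale kummer4 \<subseteq> M: bicyclic p \<zeta> b d \<beta> \<delta> M \<sigma>b' \<sigma>d
  by (rule bicyclic_M)

text \<open>
  Operators on \<open>L\<close> that lift \<open>\<sigma>a\<close>, \<open>\<sigma>b'\<close>, \<open>\<sigma>c\<close>, \<open>\<sigma>d\<close> and the identity, with the relations of \<open>\<E>_p\<close>. The
  relation \<open>ba\<close> is \<open>[s_a, s_b] = \<tau>\<close> rewritten for the inverse \<open>gb\<close> of the lift of \<open>\<sigma>_b\<close>, and \<open>dc\<close> is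
  \<open>[s_c, s_d] = \<tau>\<inverse>\<close>. That both take the same form is the effect of the opposite orientations.
\<close>

locale kummer4_lift = kummer4 +
  fixes L :: "'a alg_closure set" and ga gb gc gd gt :: "'a alg_closure \<Rightarrow> 'a alg_closure"
  assumes subfield_L: "subfield L fld" and KL: "K \<subseteq> L"
    and endo: "base_endo L ga" "base_endo L gb" "base_endo L gc" "base_endo L gd" "base_endo L gt"
    and order: "x \<in> L \<Longrightarrow> (ga ^^ p) x = x" "x \<in> L \<Longrightarrow> (gb ^^ p) x = x" "x \<in> L \<Longrightarrow> (gc ^^ p) x = x"
      "x \<in> L \<Longrightarrow> (gd ^^ p) x = x" "x \<in> L \<Longrightarrow> (gt ^^ p) x = x"
    and on_K: "x \<in> K \<Longrightarrow> ga x = \<sigma>a x" "x \<in> K \<Longrightarrow> gb x = \<sigma>b' x" "x \<in> K \<Longrightarrow> gc x = \<sigma>c x" "x \<in> K \<Longrightarrow> gd x = \<sigma>d x"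
      "x \<in> K \<Longrightarrow> gt x = x"
    and ba: "x \<in> L \<Longrightarrow> gb (ga x) = ga (gb (gt x))" and dc: "x \<in> L \<Longrightarrow> gd (gc x) = gc (gd (gt x))"
    and comm: "x \<in> L \<Longrightarrow> ga (gc x) = gc (ga x)" "x \<in> L \<Longrightarrow> ga (gd x) = gd (ga x)" "x \<in> L \<Longrightarrow> gb (gc x) = gc (gb x)"
      "x \<in> L \<Longrightarrow> gb (gd x) = gd (gb x)"
    and central: "x \<in> L \<Longrightarrow> gt (ga x) = ga (gt x)" "x \<in> L \<Longrightarrow> gt (gb x) = gb (gt x)" "x \<in> L \<Longrightarrow> gt (gc x) = gc (gt x)"
      "x \<in> L \<Longrightarrow> gt (gd x) = gd (gt x)"
    and moved: "\<exists>x\<in>L. gt x \<noteq> x"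
    and fixed: "x \<in> L \<Longrightarrow> ga x = x \<Longrightarrow> gb x = x \<Longrightarrow> gc x = x \<Longrightarrow> gd x = x \<Longrightarrow> gt x = x \<Longrightarrow> x \<in> base_field"
begin

lemma base_L: "base_field \<subseteq> L" and gens_L: "\<alpha> \<in> L" "\<beta> \<in> L" "\<gamma> \<in> L" "\<delta> \<in> L"
  using base_K gens_K KL by auto

lemma to_ac_L: "to_ac k \<in> L"
  using base_L by auto

lemmas L = subfield_fldD[OF subfield_L] to_ac_L
lemmas A = base_endoD[OF endo(1)] and B = base_endoD[OF endo(2)] and C = base_endoD[OF endo(3)]
  and D = base_endoD[OF endo(4)] and T = base_endoD[OF endo(5)]

lemma power_L: "x \<in> L \<Longrightarrow> x ^ n \<in> L"
  by (induction n) (simp_all add: L)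

lemma scaled: "base_endo L g \<Longrightarrow> x \<in> L \<Longrightarrow> g (to_ac k * x) = to_ac k * g x"
  using endo_on_scaled base_L by blast

lemma g_power: "base_endo L g \<Longrightarrow> x \<in> L \<Longrightarrow> g (x ^ n) = g x ^ n"
  using base_endo_power[OF _ subfield_L] by blast

lemma gens_image:
  "ga \<alpha> = to_ac \<zeta> * \<alpha>" "ga \<gamma> = \<gamma>" "gc \<alpha> = \<alpha>" "gc \<gamma> = to_ac \<zeta> * \<gamma>" "gt \<alpha> = \<alpha>" "gt \<gamma> = \<gamma>"
  "ga \<beta> = \<beta>" "ga \<delta> = \<delta>" "gc \<beta> = \<beta>" "gc \<delta> = \<delta>" "gt \<beta> = \<beta>" "gt \<delta> = \<delta>"
  "gb \<alpha> = \<alpha>" "gb \<gamma> = \<gamma>" "gb \<beta> = to_ac (inverse \<zeta>) * \<beta>" "gb \<delta> = \<delta>"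
  "gd \<alpha> = \<alpha>" "gd \<gamma> = \<gamma>" "gd \<beta> = \<beta>" "gd \<delta> = to_ac \<zeta> * \<delta>"
  using gens_K by (simp_all only: on_K \<sigma>_acts)

lemma \<zeta>_cancel: "to_ac (inverse \<zeta>) * (to_ac \<zeta> * x) = x" "to_ac \<zeta> * (to_ac (inverse \<zeta>) * x) = x"
proof -
  have "to_ac (inverse \<zeta>) * to_ac \<zeta> = (1 :: 'a alg_closure)" using \<zeta>_nz by (simp flip: to_ac_mult del: to_ac_inverse)
  then show "to_ac (inverse \<zeta>) * (to_ac \<zeta> * x) = x" "to_ac \<zeta> * (to_ac (inverse \<zeta>) * x) = x"
    by (simp_all add: mult.assoc[symmetric] mult.commute[of "to_ac \<zeta>"] del: to_ac_inverse)
qed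

text \<open>
  Some eigenvalue \<open>\<zeta>\<^sup>k\<close> other than \<open>1\<close> occurs. Raising the eigenvector to a power inverse to \<open>k\<close> modulo
  \<open>p\<close> turns the eigenvalue into \<open>\<zeta>\<close>.
\<close>

lemma \<zeta>_vector: "\<exists>x\<in>L. x \<noteq> 0 \<and> gt x = to_ac \<zeta> * x"
proof -
  obtain y where y: "y \<in> L" "gt y \<noteq> y" using moved by blast
  have V: "fspace L" by (rule fspaceI) (simp_all add: L)
  have G: "flinear L gt" by (rule base_endo_flinear[OF endo(5) base_L])
  obtain Y where Y: "\<And>k. Y k \<in> L" "\<And>k. gt (Y k) = to_ac \<zeta> ^ k * Y k" "y = (\<Sum>k<p. Y k)"
    by (rule eigen_decomp[OF V G order(5) root p_nz y(1)], assumption, rule that)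
  have "\<exists>k<p. k \<noteq> 0 \<and> Y k \<noteq> 0"
  proof (rule ccontr)
    assume "\<not> (\<exists>k<p. k \<noteq> 0 \<and> Y k \<noteq> 0)"
    then have z: "Y k = 0" if "k < p" "k \<noteq> 0" for k using that by blast
    have "(\<Sum>k<p. Y k) = Y 0"
      using z p_pos by (subst sum.remove[of _ 0]) auto
    then show False using y(2) Y(2)[of 0] Y(3) by simp
  qed
  then obtain k where k: "k < p" "k > 0" "Y k \<noteq> 0" by blast
  obtain e q where e: "k * e = p * q + 1" by (rule obtain_power_inverse_mod[OF prime_p k(2,1)])
  have "gt (Y k ^ e) = to_ac \<zeta> ^ (k * e) * Y k ^ e"
    using g_power[OF endo(5) Y(1)] by (simp add: Y(2) power_mult_distrib power_mult)
  also have "to_ac \<zeta> ^ (k * e) = (to_ac \<zeta> :: 'a alg_closure)"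
    unfolding e using prim_root_power[OF prim_root_to_ac[OF root]] by (simp add: power_add power_mult)
  finally show ?thesis using k(3) power_L[OF Y(1)] by (intro bexI[of _ "Y k ^ e"]) auto
qed

text \<open>
  Multiplication by \<open>\<alpha>\<close> shifts the eigenvalues of \<open>ga\<close> on the \<open>\<zeta>\<close>-eigenspace of \<open>gt\<close>, and \<open>\<gamma>\<close> those of \<open>gc\<close> on
  the part fixed by \<open>ga\<close>; so \<open>fixed_vector\<close> applies twice.
\<close>

lemma stable_vector: "\<exists>x\<in>L. x \<noteq> 0 \<and> gt x = to_ac \<zeta> * x \<and> ga x = x \<and> gc x = x"
proof -
  define V where "V = {x \<in> L. gt x = to_ac \<zeta> * x}"
  have V: "fspace V"
    by (rule fspaceI) (auto simp: V_def L T scaled[OF endo(5)] algebra_simps)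
  have inv: "primitive_root_of_unity p (inverse \<zeta>)" by (rule prim_root_inverse[OF root])
  have GA: "flinear V ga"
    by (rule flinearI) (auto simp: V_def A central scaled[OF endo(1)])
  obtain x where x: "x \<in> V" "x \<noteq> 0" using \<zeta>_vector by (auto simp: V_def)
  obtain y where y: "y \<in> V" "y \<noteq> 0" "ga y = y"
  proof (rule fixed_vector[OF V GA _ inv p_nz gens_nz(1) _ _ x])
    show "(ga ^^ p) v = v" if "v \<in> V" for v using that order(1) by (simp add: V_def)
    show "\<alpha> * v \<in> V" if "v \<in> V" for v using that by (simp add: V_def L gens_L T gens_image mult_ac)
    show "to_ac (inverse \<zeta>) * ga (\<alpha> * v) = \<alpha> * ga v" if "v \<in> V" for v
      using that by (simp add: V_def gens_L A gens_image \<zeta>_cancel mult.assoc del: to_ac_inverse)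
  qed
  define W where "W = {x \<in> V. ga x = x}"
  have W: "fspace W"
    by (rule fspaceI) (auto simp: W_def V_def L T A scaled[OF endo(5)] scaled[OF endo(1)] algebra_simps)
  have GC: "flinear W gc"
    by (rule flinearI) (auto simp: W_def V_def C central comm scaled[OF endo(3)])
  have yW: "y \<in> W" using y by (simp add: W_def)
  obtain z where z: "z \<in> W" "z \<noteq> 0" "gc z = z"
  proof (rule fixed_vector[OF W GC _ inv p_nz gens_nz(3) _ _ yW y(2)])
    show "(gc ^^ p) v = v" if "v \<in> W" for v using that order(3) by (simp add: V_def W_def)
    show "\<gamma> * v \<in> W" if "v \<in> W" for v using that by (simp add: V_def W_def L gens_L A T gens_image mult_ac)
    show "to_ac (inverse \<zeta>) * gc (\<gamma> * v) = \<gamma> * gc v" if "v \<in> W" for v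
      using that by (simp add: V_def W_def gens_L C gens_image \<zeta>_cancel mult.assoc del: to_ac_inverse)
  qed
  then show ?thesis by (auto simp: W_def V_def)
qed

text \<open>
  The subspace fixed by \<open>ga\<close>, \<open>gc\<close> and \<open>gt\<close> is stable under \<open>gb\<close> and \<open>gd\<close>. Common eigenvectors of these two,
  divided by monomials in \<open>\<beta>\<close> and \<open>\<delta>\<close>, are fixed by all five operators and therefore scalars. This is
  the Galois correspondence for this one subgroup.
\<close>

lemma fixed_in_M:
  assumes x: "x \<in> L" "ga x = x" "gc x = x" "gt x = x"
  shows "x \<in> M"
proof -
  define V where "V = {x \<in> L. ga x = x \<and> gc x = x \<and> gt x = x}"
  have V: "fspace V"
    by (rule fspaceI) (auto simp: V_def L A C T scaled[OF endo(1)] scaled[OF endo(3)] scaled[OF endo(5)])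
  have GB: "flinear V gb"
  proof (rule flinearI)
    show "gb v \<in> V" if v: "v \<in> V" for v
      using v ba[of v] comm(3)[of v] central(2)[of v] by (simp add: V_def B)
  qed (auto simp: V_def B scaled[OF endo(2)])
  have GD: "gd v \<in> V" if v: "v \<in> V" for v
    using v dc[of v] comm(2)[of v] central(4)[of v] by (simp add: V_def D)
  have xV: "x \<in> V" using x by (simp add: V_def)
  have Bp: "(gb ^^ p) v = v" if "v \<in> V" for v using that order(2) by (simp add: V_def)
  obtain Y where Y: "\<And>k. Y k \<in> V" "\<And>k. gb (Y k) = to_ac \<zeta> ^ k * Y k" "x = (\<Sum>k<p. Y k)"
    by (rule eigen_decomp[OF V GB Bp root p_nz xV], assumption, rule that)
  have "Y k \<in> M" for k
  proof -
    define W where "W = {v \<in> V. gb v = to_ac (\<zeta> ^ k) * v}"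
    have W: "fspace W"
      by (rule fspaceI) (auto simp: W_def fspaceD[OF V] flinearD[OF V GB] distrib_left mult.left_commute simp del: to_ac_power)
    have VL: "v \<in> L" if "v \<in> V" for v using that by (simp add: V_def)
    have GW: "flinear W gd"
    proof (rule flinearI)
      show "gd v \<in> W" if v: "v \<in> W" for v
        using v GD[of v] comm(4)[of v] VL[of v] scaled[OF endo(4), of v] by (simp add: W_def del: to_ac_power)
    qed (auto simp: W_def VL D scaled[OF endo(4)])
    have YW: "Y k \<in> W" using Y by (simp add: W_def)
    have Dp: "(gd ^^ p) v = v" if "v \<in> W" for v using that order(4) VL by (simp add: W_def)
    obtain Z where Z: "\<And>l. Z l \<in> W" "\<And>l. gd (Z l) = to_ac \<zeta> ^ l * Z l" "Y k = (\<Sum>l<p. Z l)"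
      by (rule eigen_decomp[OF W GW Dp root p_nz YW], assumption, rule that)
    have "Z l \<in> M" for l
    proof -
      have ZL: "Z l \<in> L" "ga (Z l) = Z l" "gc (Z l) = Z l" "gt (Z l) = Z l" "gb (Z l) = to_ac \<zeta> ^ k * Z l"
        using Z(1)[of l] by (auto simp: W_def V_def)
      have bd: "\<beta> ^ k \<in> L" "inverse \<delta> ^ l \<in> L" by (simp_all add: power_L L gens_L)
      have inv: "g (inverse \<delta>) = inverse (g \<delta>)" if "base_endo L g" for g
        by (rule base_endo_nonzero(2)[OF that subfield_L gens_L(4) gens_nz(4)])
      define u where "u = \<beta> ^ k * inverse \<delta> ^ l * Z l"
      have uL: "u \<in> L" by (simp add: u_def L bd ZL)
      have g_u: "g u = g \<beta> ^ k * inverse (g \<delta>) ^ l * g (Z l)" if g: "base_endo L g" for g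
        unfolding u_def using g
        by (simp add: base_endoD(3)[OF g] L bd ZL g_power[OF g] gens_L inv)
      have zk: "(to_ac (inverse \<zeta>) :: 'a alg_closure) ^ k * to_ac \<zeta> ^ k = 1"
        "inverse (to_ac \<zeta> :: 'a alg_closure) ^ l * to_ac \<zeta> ^ l = 1"
        using \<zeta>_nz by (simp_all flip: power_mult_distrib)
      have "gb u = (to_ac (inverse \<zeta>) ^ k * to_ac \<zeta> ^ k) * u"
        unfolding g_u[OF endo(2)] unfolding gens_image ZL u_def power_mult_distrib by (simp only: mult_ac)
      moreover have "gd u = (inverse (to_ac \<zeta>) ^ l * to_ac \<zeta> ^ l) * u"
        unfolding g_u[OF endo(4)] unfolding gens_image Z(2) u_def power_mult_distrib inverse_mult_distrib by (simp only: mult_ac)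
      moreover have "ga u = u" "gc u = u" "gt u = u"
        unfolding g_u[OF endo(1)] g_u[OF endo(3)] g_u[OF endo(5)] unfolding gens_image ZL u_def by simp_all
      ultimately have "u \<in> base_field" using fixed[OF uL] unfolding zk by simp
      then have "u \<in> M" using M.base_M by auto
      moreover have "Z l = inverse \<beta> ^ k * \<delta> ^ l * u"
        using gens_nz by (simp add: u_def field_simps)
      ultimately show ?thesis using M.mult_M M.power_M M.inverse_M M.\<beta>_M M.\<delta>_M by simp
    qed
    then show "Y k \<in> M" unfolding Z(3) by (intro fspaceD(4)[OF M.fspace_M])
  qed
  then show ?thesis unfolding Y(3) by (intro fspaceD(4)[OF M.fspace_M])
qed

text \<open>
  For \<open>v\<close> as in \<open>stable_vector\<close>, \<open>ba\<close> makes \<open>ga\<close> multiply \<open>gb v\<close> by the inverse of \<open>\<zeta>\<close>, which cancels against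
  \<open>\<alpha>\<close>; hence \<open>x = \<alpha> (gb v) / v\<close> lies in \<open>M\<close>, and similarly \<open>y\<close>. The norms telescope because \<open>gb\<close> and \<open>gd\<close>
  have order \<open>p\<close>, and \<open>x s(y) = y t(x)\<close> holds because they commute.
\<close>

lemma solution_from_lift:
  "\<exists>x\<in>M. \<exists>y\<in>M. (\<Prod>k<p. (\<sigma>b' ^^ k) x) = to_ac a \<and> (\<Prod>k<p. (\<sigma>d ^^ k) y) = to_ac c \<and> x * \<sigma>b' y = y * \<sigma>d x"
proof -
  obtain v where v: "v \<in> L" "v \<noteq> 0" "gt v = to_ac \<zeta> * v" "ga v = v" "gc v = v" using stable_vector by blast
  have inv: "g (inverse r) = inverse (g r)" "g r \<noteq> 0" if "base_endo L g" "r \<in> L" "r \<noteq> 0" for g r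
    using base_endo_nonzero[OF that(1) subfield_L that(2,3)] by auto
  define x where "x = \<alpha> * (gb v * inverse v)"
  define y where "y = \<gamma> * (gd v * inverse v)"
  note in_L = v(1) B(1)[OF v(1)] D(1)[OF v(1)] L(6)[OF v(1)]
  have gab: "ga (gb v) = to_ac (inverse \<zeta>) * gb v"
  proof -
    have "gb v = to_ac \<zeta> * ga (gb v)"
      using ba[OF v(1)] v by (simp add: scaled endo in_L)
    then show ?thesis using \<zeta>_cancel(1) by metis
  qed
  have gcd: "gc (gd v) = to_ac (inverse \<zeta>) * gd v"
  proof -
    have "gd v = to_ac \<zeta> * gc (gd v)"
      using dc[OF v(1)] v by (simp add: scaled endo in_L)
    then show ?thesis using \<zeta>_cancel(1) by metis
  qed
  have other: "gc (gb v) = gb v" "ga (gd v) = gd v" "gt (gb v) = to_ac \<zeta> * gb v" "gt (gd v) = to_ac \<zeta> * gd v"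
    using comm(3)[OF v(1)] comm(2)[OF v(1)] central(2)[OF v(1)] central(4)[OF v(1)] v by (simp_all add: scaled endo)
  have ix: "g x = g \<alpha> * (g (gb v) * inverse (g v))" and iy: "g y = g \<gamma> * (g (gd v) * inverse (g v))"
    if g: "base_endo L g" for g
    unfolding x_def y_def using g by (simp_all add: base_endoD(3)[OF g] in_L gens_L L inv v(2))
  have z0: "(to_ac \<zeta> :: 'a alg_closure) \<noteq> 0" using \<zeta>_nz by simp
  have xM: "x \<in> M"
  proof (rule fixed_in_M)
    show "x \<in> L" by (simp add: x_def L gens_L in_L)
    show "ga x = x" unfolding ix[OF endo(1)] unfolding gab gens_image v unfolding x_def using z0 by (simp add: field_simps)
    show "gc x = x" unfolding ix[OF endo(3)] unfolding other gens_image v unfolding x_def ..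
    show "gt x = x" unfolding ix[OF endo(5)] unfolding other gens_image v unfolding x_def using z0 by (simp add: field_simps)
  qed
  have yM: "y \<in> M"
  proof (rule fixed_in_M)
    show "y \<in> L" by (simp add: y_def L gens_L in_L)
    show "ga y = y" unfolding iy[OF endo(1)] unfolding other gens_image v unfolding y_def ..
    show "gc y = y" unfolding iy[OF endo(3)] unfolding gcd gens_image v unfolding y_def using z0 by (simp add: field_simps)
    show "gt y = y" unfolding iy[OF endo(5)] unfolding other gens_image v unfolding y_def using z0 by (simp add: field_simps)
  qed
  have sb: "(\<sigma>b' ^^ k) m = (gb ^^ k) m \<and> (\<sigma>b' ^^ k) m \<in> M" if "m \<in> M" for k m
    using that by (induction k) (auto simp: on_K(2)[OF M_K] M.s_M)
  have sd: "(\<sigma>d ^^ k) m = (gd ^^ k) m \<and> (\<sigma>d ^^ k) m \<in> M" if "m \<in> M" for k m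
    using that by (induction k) (auto simp: on_K(4)[OF M_K] M.t_M)
  have gens_pow: "(gb ^^ k) \<alpha> = \<alpha>" "(gd ^^ k) \<gamma> = \<gamma>" for k
    by (induction k) (simp_all add: gens_image)
  have nz: "(g ^^ k) v \<noteq> 0" if "base_endo L g" for g k
    by (rule inv(2)[OF base_endo_funpow[OF that] v(1,2)])
  have telescope: "(\<Prod>k<n. e * ((g ^^ Suc k) v * inverse ((g ^^ k) v))) = e ^ n * ((g ^^ n) v * inverse v)"
    if "base_endo L g" for g e n
    using v(2) nz[OF that] by (induction n) (simp_all add: field_simps)
  have "(\<Prod>k<p. (\<sigma>b' ^^ k) x) = (\<Prod>k<p. \<alpha> * ((gb ^^ Suc k) v * inverse ((gb ^^ k) v)))"
    using sb[OF xM] by (intro prod.cong refl) (simp add: ix[OF base_endo_funpow[OF endo(2)]] gens_pow funpow_swap1)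
  also have "\<dots> = to_ac a" unfolding telescope[OF endo(2)] order(2)[OF v(1)] pow(1) using v(2) by simp
  finally have 1: "(\<Prod>k<p. (\<sigma>b' ^^ k) x) = to_ac a" .
  have "(\<Prod>k<p. (\<sigma>d ^^ k) y) = (\<Prod>k<p. \<gamma> * ((gd ^^ Suc k) v * inverse ((gd ^^ k) v)))"
    using sd[OF yM] by (intro prod.cong refl) (simp add: iy[OF base_endo_funpow[OF endo(4)]] gens_pow funpow_swap1)
  also have "\<dots> = to_ac c" unfolding telescope[OF endo(4)] order(4)[OF v(1)] pow(3) using v(2) by simp
  finally have 2: "(\<Prod>k<p. (\<sigma>d ^^ k) y) = to_ac c" .
  have nzs: "gb v \<noteq> 0" "gd v \<noteq> 0" using inv(2) endo v by auto
  have "x * gb y = y * gd x"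
    unfolding iy[OF endo(2)] ix[OF endo(4)] unfolding gens_image comm(4)[OF v(1)] x_def y_def
    using nzs v(2) by (simp add: field_simps)
  then have "x * \<sigma>b' y = y * \<sigma>d x" using on_K(2)[OF M_K[OF yM]] on_K(4)[OF M_K[OF xM]] by simp
  then show ?thesis using xM yM 1 2 by blast
qed

end

lemma Gal_mult_apply:
  "\<sigma> \<in> carrier (Gal E k) \<Longrightarrow> \<tau> \<in> carrier (Gal E k) \<Longrightarrow> x \<in> E \<Longrightarrow> (\<sigma> \<otimes>\<^bsub>Gal E k\<^esub> \<tau>) x = \<sigma> (\<tau> x)"
  by (simp add: Gal_mult compose_def)

context group
begin

lemma commute_inv:
  assumes "A \<in> carrier G" "B \<in> carrier G" "A \<otimes> B = B \<otimes> A"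
  shows "A \<otimes> inv B = inv B \<otimes> A"
proof -
  have "inv B \<otimes> (A \<otimes> B) \<otimes> inv B = A \<otimes> inv B"
    unfolding assms(3) using assms(1,2) by (simp add: m_assoc[symmetric])
  moreover have "inv B \<otimes> (A \<otimes> B) \<otimes> inv B = inv B \<otimes> A" using assms(1,2) by (simp add: m_assoc)
  ultimately show ?thesis by simp
qed

lemma heis_relation_inv:
  assumes c: "A \<in> carrier G" "B \<in> carrier G" "T \<in> carrier G" and T: "T \<otimes> B = B \<otimes> T"
  shows "A \<otimes> B = B \<otimes> A \<otimes> T \<longleftrightarrow> inv B \<otimes> A = A \<otimes> inv B \<otimes> T"
proof -
  have cancel: "inv B \<otimes> (B \<otimes> Z) = Z" if "Z \<in> carrier G" for Z
    using c(2) that by (simp add: m_assoc[symmetric])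
  have Ti: "T \<otimes> inv B = inv B \<otimes> T" by (rule commute_inv[OF c(3,2) T])
  show ?thesis
  proof
    assume "A \<otimes> B = B \<otimes> A \<otimes> T"
    then have "inv B \<otimes> (A \<otimes> B) \<otimes> inv B = inv B \<otimes> (B \<otimes> A \<otimes> T) \<otimes> inv B" by simp
    also have "\<dots> = A \<otimes> (T \<otimes> inv B)" using c by (simp add: m_assoc[symmetric])
    also have "\<dots> = A \<otimes> inv B \<otimes> T" unfolding Ti using c by (simp add: m_assoc)
    finally show "inv B \<otimes> A = A \<otimes> inv B \<otimes> T" using c by (simp add: m_assoc)
  next
    assume "inv B \<otimes> A = A \<otimes> inv B \<otimes> T"
    then have "B \<otimes> (inv B \<otimes> A) \<otimes> B = B \<otimes> (A \<otimes> inv B \<otimes> T) \<otimes> B" by simp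
    also have "\<dots> = B \<otimes> A \<otimes> inv B \<otimes> (T \<otimes> B)" using c by (simp add: m_assoc)
    also have "\<dots> = B \<otimes> A \<otimes> T" unfolding T using c cancel[OF c(3)] by (simp add: m_assoc)
    finally show "A \<otimes> B = B \<otimes> A \<otimes> T" using c by (simp add: m_assoc[symmetric])
  qed
qed

end

text \<open>
  The preimages under \<open>\<phi>\<close> of the generators of \<open>\<E>_p\<close>, with that of \<open>s_b\<close> inverted, are operators as in
  \<open>kummer4_lift\<close>. The stabiliser of an element fixed by all of them is a subgroup that contains the
  generators, so the element is fixed by the whole Galois group. The operator \<open>\<tau>\<close> acts trivially on
  \<open>K\<close> because it lies in the kernel of the projection, and nontrivially on \<open>L\<close> because \<open>\<phi>\<close> is injective.
\<close>

lemma (in kummer4) solution_of_extension: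
  assumes gL: "galois_extension L base_field" and KL: "K \<subseteq> L"
    and \<phi>: "\<phi> \<in> iso (Gal L base_field) (Ep p)"
    and \<iota>: "kummer_identification p \<zeta> \<alpha> \<beta> \<gamma> \<delta> K \<iota>"
    and res: "\<forall>g\<in>carrier (Gal L base_field). restrict g K = \<iota> (Ep_proj p (\<phi> g))"
  shows "\<exists>x\<in>M. \<exists>y\<in>M. (\<Prod>k<p. (\<sigma>b' ^^ k) x) = to_ac a \<and> (\<Prod>k<p. (\<sigma>d ^^ k) y) = to_ac c \<and> x * \<sigma>b' y = y * \<sigma>d x"
proof -
  interpret central_product p by unfold_locales (rule p_gt_1)
  define G where "G = Gal L base_field"
  have sL: "subfield L fld" and bL: "base_field \<subseteq> L" using gL by (auto simp: galois_extension_def)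
  have grpG: "group G" unfolding G_def by (rule group_Gal[OF sL bL])
  interpret G: group G by (rule grpG)
  interpret GK: group "Gal K base_field" by (rule group_Gal[OF subfield_K base_K])
  define \<psi> where "\<psi> = inv_into (carrier G) \<phi>"
  have \<phi>G: "\<phi> \<in> iso G (Ep p)" using \<phi> by (simp add: G_def)
  have \<psi>: "\<psi> \<in> iso (Ep p) G" unfolding \<psi>_def by (rule G.iso_set_sym[OF \<phi>G])
  then have \<psi>h: "\<psi> \<in> hom (Ep p) G" by (simp add: iso_def)
  have \<phi>b: "bij_betw \<phi> (carrier G) (carrier (Ep p))" using \<phi>G by (simp add: iso_def)
  have \<phi>\<psi>: "\<phi> (\<psi> e) = e" if "e \<in> carrier (Ep p)" for e
    unfolding \<psi>_def by (rule bij_betw_inv_into_right[OF \<phi>b that])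
  have \<psi>\<phi>: "\<psi> (\<phi> g) = g" "\<phi> g \<in> carrier (Ep p)" if "g \<in> carrier G" for g
    unfolding \<psi>_def using bij_betw_inv_into_left[OF \<phi>b that] bij_betw_apply[OF \<phi>b that] by auto
  interpret H: group_hom "Ep p" G \<psi> using \<psi>h grpG Ep.group_axioms by (simp add: group_hom_def group_hom_axioms_def)
  note gens = Ep_gens_closed
  define ga hb gc gd gt where "ga = \<psi> (s_a p)" "hb = \<psi> (s_b p)" "gc = \<psi> (s_c p)" "gd = \<psi> (s_d p)" "gt = \<psi> (Ep_tau p)"
  note g_defs = this
  define gb where "gb = inv\<^bsub>G\<^esub> hb"
  have c: "ga \<in> carrier G" "hb \<in> carrier G" "gc \<in> carrier G" "gd \<in> carrier G" "gt \<in> carrier G" "gb \<in> carrier G"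
    unfolding g_defs gb_def using gens by simp_all
  have \<phi>g: "\<phi> ga = s_a p" "\<phi> hb = s_b p" "\<phi> gc = s_c p" "\<phi> gd = s_d p" "\<phi> gt = Ep_tau p"
    unfolding g_defs using gens \<phi>\<psi> by simp_all
  have pw: "g [^]\<^bsub>G\<^esub> p = \<one>\<^bsub>G\<^esub> \<Longrightarrow> g \<in> carrier G \<Longrightarrow> x \<in> L \<Longrightarrow> (g ^^ p) x = x" for g x
    using Gal_pow_apply[OF sL bL, of g x p] by (simp add: G_def Gal_one)
  have ord: "ga [^]\<^bsub>G\<^esub> p = \<one>\<^bsub>G\<^esub>" "hb [^]\<^bsub>G\<^esub> p = \<one>\<^bsub>G\<^esub>" "gc [^]\<^bsub>G\<^esub> p = \<one>\<^bsub>G\<^esub>" "gd [^]\<^bsub>G\<^esub> p = \<one>\<^bsub>G\<^esub>" "gt [^]\<^bsub>G\<^esub> p = \<one>\<^bsub>G\<^esub>"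
    unfolding g_defs using gens by (simp_all add: H.hom_nat_pow[symmetric] Ep_gen_order)
  have ordb: "gb [^]\<^bsub>G\<^esub> p = \<one>\<^bsub>G\<^esub>" unfolding gb_def using G.nat_pow_inv[OF c(2)] ord(2) by simp
  have rel: "ga \<otimes>\<^bsub>G\<^esub> hb = hb \<otimes>\<^bsub>G\<^esub> ga \<otimes>\<^bsub>G\<^esub> gt" "gd \<otimes>\<^bsub>G\<^esub> gc = gc \<otimes>\<^bsub>G\<^esub> gd \<otimes>\<^bsub>G\<^esub> gt" "ga \<otimes>\<^bsub>G\<^esub> gc = gc \<otimes>\<^bsub>G\<^esub> ga"
    "ga \<otimes>\<^bsub>G\<^esub> gd = gd \<otimes>\<^bsub>G\<^esub> ga" "gc \<otimes>\<^bsub>G\<^esub> hb = hb \<otimes>\<^bsub>G\<^esub> gc" "gd \<otimes>\<^bsub>G\<^esub> hb = hb \<otimes>\<^bsub>G\<^esub> gd"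
    unfolding g_defs using gens Ep_relations by (simp_all flip: H.hom_mult)
  have cen: "gt \<otimes>\<^bsub>G\<^esub> \<psi> e = \<psi> e \<otimes>\<^bsub>G\<^esub> gt" if "e \<in> carrier (Ep p)" for e
    unfolding g_defs using gens(5) that Ep_tau_central[OF that] by (simp flip: H.hom_mult)
  have tb: "gt \<otimes>\<^bsub>G\<^esub> hb = hb \<otimes>\<^bsub>G\<^esub> gt" using cen[OF gens(2)] by (simp add: g_defs)
  have relb: "gb \<otimes>\<^bsub>G\<^esub> ga = ga \<otimes>\<^bsub>G\<^esub> gb \<otimes>\<^bsub>G\<^esub> gt" "gb \<otimes>\<^bsub>G\<^esub> gc = gc \<otimes>\<^bsub>G\<^esub> gb" "gb \<otimes>\<^bsub>G\<^esub> gd = gd \<otimes>\<^bsub>G\<^esub> gb"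
    "gt \<otimes>\<^bsub>G\<^esub> gb = gb \<otimes>\<^bsub>G\<^esub> gt"
    unfolding gb_def using G.heis_relation_inv[OF c(1,2,5) tb] rel G.commute_inv[OF c(3,2) rel(5)] G.commute_inv[OF c(4,2) rel(6)]
      G.commute_inv[OF c(5,2) tb] by simp_all
  have app: "g (h x) = (g \<otimes>\<^bsub>G\<^esub> h) x" if "g \<in> carrier G" "h \<in> carrier G" "x \<in> L" for g h x
    using that by (simp add: G_def Gal_mult_apply[of _ L base_field])
  have inL: "g x \<in> L" if "g \<in> carrier G" "x \<in> L" for g x using Gal_in that by (auto simp: G_def)
  have eqK: "g x = \<sigma> x" if "g \<in> carrier G" "\<sigma> \<in> carrier (Gal K base_field)" "x \<in> K" "\<iota> (Ep_proj p (\<phi> g)) = \<tau>"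
    "\<tau> \<in> carrier (Gal K base_field)" "\<tau> \<alpha> = \<sigma> \<alpha>" "\<tau> \<beta> = \<sigma> \<beta>" "\<tau> \<gamma> = \<sigma> \<gamma>" "\<tau> \<delta> = \<sigma> \<delta>" for g \<sigma> \<tau> x
  proof -
    have "\<tau> x = \<sigma> x"
      by (rule endo_eq[OF Gal_K_endo[OF that(5)] Gal_K_endo[OF that(2)] subfield_K order_refl that(6-9,3)])
    moreover have "restrict g K = \<tau>" using res that(1,4) by (simp add: G_def)
    ultimately show ?thesis using that(3) by (metis restrict_apply')
  qed
  have \<iota>iso: "\<iota> \<in> iso (Ep p Mod Ep_kernel p) (Gal K base_field)" and
    kg: "kummer_generator \<zeta> \<alpha> {\<beta>, \<gamma>, \<delta>} (\<iota> (Ep_proj p (s_a p)))" "kummer_generator \<zeta> \<beta> {\<alpha>, \<gamma>, \<delta>} (\<iota> (Ep_proj p (s_b p)))"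
    "kummer_generator \<zeta> \<gamma> {\<alpha>, \<beta>, \<delta>} (\<iota> (Ep_proj p (s_c p)))" "kummer_generator \<zeta> \<delta> {\<alpha>, \<beta>, \<gamma>} (\<iota> (Ep_proj p (s_d p)))"
    using \<iota> by (auto simp: kummer_identification_def)
  have \<iota>car: "\<iota> (Ep_proj p e) \<in> carrier (Gal K base_field)" if "e \<in> carrier (Ep p)" for e
  proof -
    have "Ep_proj p e \<in> carrier (Ep p Mod Ep_kernel p)" unfolding carrier_FactGroup Ep_proj_def using that by blast
    then show ?thesis using \<iota>iso by (auto simp: iso_def hom_def)
  qed
  have onK: "ga x = \<sigma>a x" "gc x = \<sigma>c x" "gd x = \<sigma>d x" if "x \<in> K" for x
    using eqK[OF c(1) \<sigma>_Gal(1) that refl] eqK[OF c(3) \<sigma>_Gal(3) that refl] eqK[OF c(4) \<sigma>_Gal(4) that refl] kg \<iota>car gens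
    by (simp_all add: \<phi>g kummer_generator_def \<sigma>_acts)
  have onK_t: "gt x = x" if x: "x \<in> K" for x
  proof -
    have "Ep_proj p (Ep_tau p) = \<one>\<^bsub>Ep p Mod Ep_kernel p\<^esub>"
      using Ep.coset_join2[OF gens(5) Ep_kernel_subgroup] Ep_tau_pow_kernel[of 1] gens(5)
      by (simp add: Ep_proj_def FactGroup_def del: One_nat_def)
    moreover have "\<iota> \<one>\<^bsub>Ep p Mod Ep_kernel p\<^esub> = \<one>\<^bsub>Gal K base_field\<^esub>"
      using \<iota>iso by (intro hom_one normal.factorgroup_is_group[OF Ep_kernel_normal] GK.group_axioms) (simp add: iso_def)
    ultimately have "restrict gt K = (\<lambda>x\<in>K. x)" using res c(5) \<phi>g(5) by (simp add: G_def Gal_one)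
    from fun_cong[OF this, of x] show ?thesis using x by simp
  qed
  have gg: "gb \<otimes>\<^bsub>G\<^esub> hb = \<one>\<^bsub>G\<^esub>" "hb \<otimes>\<^bsub>G\<^esub> gb = \<one>\<^bsub>G\<^esub>" unfolding gb_def using c(2) by simp_all
  have one_app: "\<one>\<^bsub>G\<^esub> x = x" if "x \<in> L" for x using that by (simp add: G_def Gal_one)
  have bb: "gb (hb x) = x" "hb (gb x) = x" if "x \<in> L" for x
    unfolding app[OF c(6,2) that] app[OF c(2,6) that] gg by (rule one_app[OF that])+
  have onK_b: "gb x = \<sigma>b' x" if x: "x \<in> K" for x
  proof -
    define \<tau> where "\<tau> = \<iota> (Ep_proj p (s_b p))"
    have \<tau>c: "\<tau> \<in> carrier (Gal K base_field)" unfolding \<tau>_def by (rule \<iota>car[OF gens(2)])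
    note e\<tau> = Gal_K_endo[OF \<tau>c]
    have \<tau>: "\<tau> \<alpha> = \<alpha>" "\<tau> \<beta> = to_ac \<zeta> * \<beta>" "\<tau> \<gamma> = \<gamma>" "\<tau> \<delta> = \<delta>" using kg(2) by (auto simp: \<tau>_def kummer_generator_def)
    have z: "to_ac (inverse \<zeta>) * (to_ac \<zeta> * \<beta>) = \<beta>"
      using \<zeta>_nz by (simp add: mult.assoc[symmetric] flip: to_ac_mult del: to_ac_inverse)
    have "(\<tau> \<circ> \<sigma>b') x = (\<lambda>x. x) x"
      by (rule endo_eq[OF base_endo_comp[OF e\<tau> \<sigma>_endo(2)] base_endo_id subfield_K order_refl _ _ _ _ x])
         (use \<tau> gens_K z in \<open>simp_all add: \<sigma>_acts endo_on_scaled[OF e\<tau> _ base_K] del: to_ac_inverse\<close>)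
    moreover have sx: "\<sigma>b' x \<in> K" by (rule Gal_in[OF \<sigma>_Gal(2) x])
    moreover have "hb (\<sigma>b' x) = \<tau> (\<sigma>b' x)" by (rule eqK[OF c(2) \<tau>c sx _ \<tau>c]) (simp_all add: \<phi>g \<tau>_def)
    ultimately have "hb (\<sigma>b' x) = x" by simp
    then show ?thesis using bb(1)[of "\<sigma>b' x"] sx KL by auto
  qed
  have "kummer4_lift p \<zeta> a b c d \<alpha> \<beta> \<gamma> \<delta> K L ga gb gc gd gt"
  proof (rule kummer4_lift.intro[OF kummer4_axioms], rule kummer4_lift_axioms.intro)
    show "base_endo L ga" "base_endo L gb" "base_endo L gc" "base_endo L gd" "base_endo L gt"
      using c by (auto simp: G_def intro: Gal_base_endo[OF bL])
    show "\<exists>x\<in>L. gt x \<noteq> x"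
    proof (rule ccontr)
      assume "\<not> (\<exists>x\<in>L. gt x \<noteq> x)"
      then have "gt = \<one>\<^bsub>G\<^esub>"
        using c(5) G.one_closed unfolding G_def by (intro Gal_eqI) (auto simp: Gal_one)
      then have "Ep_tau p = \<phi> \<one>\<^bsub>G\<^esub>" using \<phi>g(5) by simp
      also have "\<dots> = \<one>\<^bsub>Ep p\<^esub>"
        by (rule hom_one[OF _ grpG Ep.group_axioms]) (use \<phi>G in \<open>simp add: iso_def\<close>)
      finally show False using Ep_tau_nontrivial by simp
    qed
    fix x assume x: "x \<in> L"
    show "(ga ^^ p) x = x" "(gb ^^ p) x = x" "(gc ^^ p) x = x" "(gd ^^ p) x = x" "(gt ^^ p) x = x"
      using pw ord ordb c x by auto
    note mul = Gal_mult_apply[where E = L and k = base_field, folded G_def]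
    show "gb (ga x) = ga (gb (gt x))" using arg_cong[OF relb(1), of "\<lambda>g. g x"] x c by (simp add: mul inL)
    show "gd (gc x) = gc (gd (gt x))" using arg_cong[OF rel(2), of "\<lambda>g. g x"] x c by (simp add: mul inL)
    show "ga (gc x) = gc (ga x)" using arg_cong[OF rel(3), of "\<lambda>g. g x"] x c by (simp add: mul inL)
    show "ga (gd x) = gd (ga x)" using arg_cong[OF rel(4), of "\<lambda>g. g x"] x c by (simp add: mul inL)
    show "gb (gc x) = gc (gb x)" using arg_cong[OF relb(2), of "\<lambda>g. g x"] x c by (simp add: mul inL)
    show "gb (gd x) = gd (gb x)" using arg_cong[OF relb(3), of "\<lambda>g. g x"] x c by (simp add: mul inL)
    have cenx: "gt (g x) = g (gt x)" if "gt \<otimes>\<^bsub>G\<^esub> g = g \<otimes>\<^bsub>G\<^esub> gt" "g \<in> carrier G" for g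
      using arg_cong[OF that(1), of "\<lambda>g. g x"] x c that(2) by (simp add: mul inL)
    show "gt (ga x) = ga (gt x)" by (rule cenx[OF _ c(1)]) (use cen[OF gens(1)] in \<open>simp add: g_defs\<close>)
    show "gt (gb x) = gb (gt x)" by (rule cenx[OF relb(4) c(6)])
    show "gt (gc x) = gc (gt x)" by (rule cenx[OF _ c(3)]) (use cen[OF gens(3)] in \<open>simp add: g_defs\<close>)
    show "gt (gd x) = gd (gt x)" by (rule cenx[OF _ c(4)]) (use cen[OF gens(4)] in \<open>simp add: g_defs\<close>)
    assume fx: "ga x = x" "gb x = x" "gc x = x" "gd x = x" "gt x = x"
    define S where "S = {e \<in> carrier (Ep p). \<psi> e x = x}"
    have "subgroup S (Ep p)"
    proof (rule Ep.subgroupI)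
      show "S \<subseteq> carrier (Ep p)" by (auto simp: S_def)
      have "\<one>\<^bsub>Ep p\<^esub> \<in> S" using x by (simp add: S_def G_def Gal_one)
      then show "S \<noteq> {}" by blast
    next
      fix e assume e: "e \<in> S"
      then have ec: "e \<in> carrier (Ep p)" "\<psi> e x = x" by (auto simp: S_def)
      have "\<psi> (inv\<^bsub>Ep p\<^esub> e) (\<psi> e x) = (\<psi> (inv\<^bsub>Ep p\<^esub> e) \<otimes>\<^bsub>G\<^esub> \<psi> e) x" using ec x by (intro app) simp_all
      also have "\<psi> (inv\<^bsub>Ep p\<^esub> e) \<otimes>\<^bsub>G\<^esub> \<psi> e = \<one>\<^bsub>G\<^esub>" using ec(1) by simp
      finally show "inv\<^bsub>Ep p\<^esub> e \<in> S" using ec x by (simp add: S_def G_def Gal_one)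
    next
      fix e f assume "e \<in> S" "f \<in> S"
      then show "e \<otimes>\<^bsub>Ep p\<^esub> f \<in> S" using x by (auto simp: S_def app[symmetric])
    qed
    moreover have "s_a p \<in> S" "s_c p \<in> S" "s_d p \<in> S" "Ep_tau p \<in> S" "s_b p \<in> S"
      using fx gens bb(2)[OF x] by (simp_all add: S_def g_defs[symmetric])
    ultimately have all: "e \<in> S" if "e \<in> carrier (Ep p)" for e using Ep_generated that by blast
    have "\<sigma> x = x" if "\<sigma> \<in> carrier (Gal L base_field)" for \<sigma>
      using all[OF \<psi>\<phi>(2), of \<sigma>] \<psi>\<phi>(1)[of \<sigma>] that by (simp add: S_def G_def)
    then have "x \<in> {x \<in> L. \<forall>\<sigma>\<in>carrier (Gal L base_field). \<sigma> x = x}" using x by blast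
    then show "x \<in> base_field" using gL unfolding galois_extension_def by blast
  qed (use sL KL onK onK_b onK_t in auto)
  then interpret kummer4_lift p \<zeta> a b c d \<alpha> \<beta> \<gamma> \<delta> K L ga gb gc gd gt .
  show ?thesis by (rule solution_from_lift)
qed

section \<open>Radicals over a subfield\<close>

definition polys_over :: "'b::field set \<Rightarrow> 'b poly set" where
  "polys_over K = {q. \<forall>i. coeff q i \<in> K}"

lemma sum_in_subfield:
  "subfield K fld \<Longrightarrow> (\<And>i. i \<in> I \<Longrightarrow> f i \<in> K) \<Longrightarrow> sum f I \<in> K"
  by (induction I rule: infinite_finite_induct) (auto simp: subfield_fldD)

lemma polys_over_closed:
  assumes K: "subfield K fld"
  shows "0 \<in> polys_over K" "q \<in> polys_over K \<Longrightarrow> r \<in> polys_over K \<Longrightarrow> q + r \<in> polys_over K"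
    "q \<in> polys_over K \<Longrightarrow> r \<in> polys_over K \<Longrightarrow> q - r \<in> polys_over K"
    "q \<in> polys_over K \<Longrightarrow> r \<in> polys_over K \<Longrightarrow> q * r \<in> polys_over K"
    "c \<in> K \<Longrightarrow> monom c n \<in> polys_over K"
    "c \<in> K \<Longrightarrow> q \<in> polys_over K \<Longrightarrow> smult c q \<in> polys_over K"
  using subfield_fldD[OF K] subfield_fldD(3)[OF K, of x "- y" for x y]
  by (auto simp: polys_over_def coeff_mult intro!: sum_in_subfield[OF K])

lemma monic_division_over:
  fixes q P :: "'b::field poly"
  assumes K: "subfield K fld" and q: "q \<in> polys_over K" "lead_coeff q = 1" and P: "P \<in> polys_over K"
  shows "\<exists>s\<in>polys_over K. \<exists>r\<in>polys_over K. P = q * s + r \<and> (r = 0 \<or> degree r < degree q)"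
proof -
  note cl = polys_over_closed[OF K]
  show ?thesis
    using P
  proof (induction "degree P" arbitrary: P rule: less_induct)
    case less
    show ?case
    proof (cases "P = 0 \<or> degree P < degree q")
      case True
      then show ?thesis using less.prems cl(1) by (intro bexI[of _ 0] bexI[of _ P]) auto
    next
      case False
      define m where "m = monom (lead_coeff P) (degree P - degree q)"
      have m: "m \<in> polys_over K" unfolding m_def using less.prems by (intro cl(5)) (simp add: polys_over_def)
      have P0: "P \<noteq> 0" and q0: "q \<noteq> 0" using q(2) False by auto
      then have m0: "m \<noteq> 0" by (simp add: m_def)
      have dmon: "degree m = degree P - degree q"
        unfolding m_def by (rule degree_monom_eq) (use P0 in simp)
      have dm: "degree (q * m) = degree P" "coeff (q * m) (degree P) = lead_coeff P"
      proof -
        show d: "degree (q * m) = degree P"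
          using False q0 m0 by (simp add: degree_mult_eq dmon)
        have "lead_coeff m = lead_coeff P" unfolding dmon by (simp add: m_def)
        then have "lead_coeff (q * m) = lead_coeff P" using q(2) by (simp add: lead_coeff_mult)
        then show "coeff (q * m) (degree P) = lead_coeff P" using d by simp
      qed
      define P' where "P' = P - q * m"
      have P': "P' \<in> polys_over K" unfolding P'_def by (intro cl less.prems q m)
      have "P' = 0 \<or> degree P' < degree P"
      proof (cases "P' = 0")
        case nz: False
        have "degree P' \<le> degree P" unfolding P'_def by (rule degree_diff_le) (simp_all add: dm)
        moreover have "coeff P' (degree P) = 0" by (simp add: P'_def dm)
        ultimately show ?thesis using nz by (metis le_neq_implies_less leading_coeff_neq_0)
      qed simp
      then show ?thesis
      proof
        assume "P' = 0"
        then show ?thesis using m cl(1) by (intro bexI[of _ m] bexI[of _ 0]) (simp_all add: P'_def)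
      next
        assume "degree P' < degree P"
        from less.hyps[OF this P'] obtain s r where s: "s \<in> polys_over K" "r \<in> polys_over K"
          "P' = q * s + r" "r = 0 \<or> degree r < degree q" by blast
        have "P = q * (m + s) + r" using s(3) by (simp add: P'_def algebra_simps)
        then show ?thesis using s cl(2)[OF m s(1)] by blast
      qed
    qed
  qed
qed

text \<open>
  The radical \<open>\<xi>\<close> has degree \<open>p\<close> over \<open>K\<close>. If a monic \<open>q\<close> over \<open>K\<close> of smaller degree \<open>n > 0\<close> is minimal for \<open>\<xi>\<close>, it
  divides \<open>T\<^sup>p - \<omega>\<close>, so all its roots are multiples of \<open>\<xi>\<close> by roots of unity, and its constant term is
  \<open>\<xi>\<^sup>n\<close> up to a unit of \<open>K\<close>. As \<open>n\<close> is prime to \<open>p\<close>, this puts \<open>\<xi>\<close> itself into \<open>K\<close>.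
\<close>

lemma kummer_independent:
  fixes \<xi> z :: "'b::alg_closed_field"
  assumes K: "subfield K fld" and p: "Factorial_Ring.prime p" and z: "primitive_root_of_unity p z" "z \<in> K"
    and \<omega>: "\<xi> ^ p = \<omega>" "\<omega> \<in> K" and \<xi>: "\<xi> \<notin> K"
    and c: "\<And>k. c k \<in> K" and rel: "(\<Sum>k<p. c k * \<xi> ^ k) = 0"
  shows "k < p \<Longrightarrow> c k = 0"
proof (rule ccontr)
  note cl = polys_over_closed[OF K] and F = subfield_fldD[OF K]
  have \<xi>0: "\<xi> \<noteq> 0" using \<xi> F(1) by auto
  have p0: "p > 0" using p by (simp add: prime_gt_0_nat)
  have powK: "x ^ n \<in> K" if "x \<in> K" for x n using that by (induction n) (simp_all add: F)
  assume k: "k < p" "c k \<noteq> 0"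
  define q0 where "q0 = (\<Sum>k<p. monom (c k) k)"
  have co: "coeff q0 i = (if i < p then c i else 0)" for i
    by (simp add: q0_def coeff_sum)
  have q0: "q0 \<in> polys_over K" "q0 \<noteq> 0" "poly q0 \<xi> = 0" "degree q0 < p"
  proof -
    show "q0 \<in> polys_over K" using c F(1) by (simp add: polys_over_def co)
    show "q0 \<noteq> 0" using co[of k] k by auto
    show "poly q0 \<xi> = 0" using rel by (simp add: q0_def poly_sum poly_monom)
    have "degree q0 \<le> p - 1" by (rule degree_le) (auto simp: co)
    then show "degree q0 < p" using p0 by simp
  qed
  define Q where "Q n \<longleftrightarrow> (\<exists>q\<in>polys_over K. q \<noteq> 0 \<and> poly q \<xi> = 0 \<and> degree q = n)" for n
  define n where "n = (LEAST n. Q n)"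
  have "Q (degree q0)" unfolding Q_def using q0 by blast
  then have Qn: "Q n" and nle: "n \<le> degree q0" unfolding n_def by (auto intro: LeastI Least_le)
  have min: "n \<le> degree r" if "r \<in> polys_over K" "r \<noteq> 0" "poly r \<xi> = 0" for r
    unfolding n_def by (rule Least_le) (use that in \<open>auto simp: Q_def\<close>)
  obtain q1 where q1: "q1 \<in> polys_over K" "q1 \<noteq> 0" "poly q1 \<xi> = 0" "degree q1 = n" using Qn unfolding Q_def by blast
  define q where "q = smult (inverse (lead_coeff q1)) q1"
  have q: "q \<in> polys_over K" "lead_coeff q = 1" "poly q \<xi> = 0" "degree q = n" "q \<noteq> 0"
    unfolding q_def using q1 F(6) by (auto simp: polys_over_def F)
  have n0: "n > 0"
  proof (rule ccontr)
    assume "\<not> n > 0"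
    then obtain e where "q = [:e:]" using degree_eq_zeroE[of q] q(4) by auto
    then show False using q(2,3) by simp
  qed
  have np: "n < p" using nle q0(4) by simp
  define P where "P = monom 1 p - [:\<omega>:]"
  have "P \<in> polys_over K" unfolding P_def
    using F(2) \<omega>(2) cl(5)[of \<omega> 0] by (intro cl) (simp_all add: monom_0)
  from monic_division_over[OF K q(1,2) this] obtain s r where sr: "r \<in> polys_over K" "P = q * s + r"
    "r = 0 \<or> degree r < n" unfolding q(4) by blast
  have "poly P \<xi> = 0" using \<omega>(1) by (simp add: P_def poly_monom)
  then have "poly r \<xi> = 0" using sr(2) q(3) by simp
  then have "r = 0" using min[OF sr(1)] sr(3) by fastforce
  then have P_eq: "P = q * s" using sr(2) by simp
  obtain A where A: "size A = n" "q = (\<Prod>x\<in>#A. [:-x, 1:])"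
    using alg_closed_imp_factorization[OF q(5)] q(2,4) by auto
  have roots: "\<exists>k. x = z ^ k * \<xi>" if "x \<in># A" for x
  proof -
    have "poly q x = 0" unfolding A(2) poly_prod_mset using that by (auto simp: prod_mset_zero_iff)
    then have "poly P x = 0" by (simp add: P_eq)
    then have "(x / \<xi>) ^ p = 1" using \<omega>(1) \<xi>0 by (auto simp: P_def poly_monom power_divide)
    then obtain k where "x / \<xi> = z ^ k" by (rule roots_of_unity_are_powers[OF z(1)])
    then show ?thesis using \<xi>0 by (intro exI[of _ k]) (simp add: field_simps)
  qed
  have "\<exists>k. (\<Prod>x\<in>#A. - x) = (- 1) ^ size A * z ^ k * \<xi> ^ size A"
    using roots
  proof (induction A)
    case empty
    show ?case by (intro exI[of _ 0]) simp
  next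
    case (add x A)
    obtain k where k: "(\<Prod>x\<in>#A. - x) = (- 1) ^ size A * z ^ k * \<xi> ^ size A" using add by auto
    obtain l where l: "x = z ^ l * \<xi>" using add.prems[of x] by auto
    show ?case by (intro exI[of _ "k + l"]) (simp add: k l power_add mult_ac)
  qed
  then obtain k where k: "(\<Prod>x\<in>#A. - x) = (- 1) ^ n * z ^ k * \<xi> ^ n" using A(1) by auto
  have coeff0: "coeff q 0 = (\<Prod>x\<in>#A. - x)"
    unfolding poly_0_coeff_0[symmetric] A(2) poly_prod_mset by (simp add: image_mset.compositionality o_def)
  have "coeff q 0 \<in> K" using q(1) by (simp add: polys_over_def)
  then have c0: "(- 1) ^ n * z ^ k * \<xi> ^ n \<in> K" unfolding coeff0 k .
  have u: "(- 1) ^ n * z ^ k \<in> K" by (intro F(4) powK F(5) F(2) z(2))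
  have u0: "(- 1) ^ n * z ^ k \<noteq> 0" using prim_root_nonzero[OF z(1)] by simp
  have aux: "w = inverse U * (U * w)" if "U \<noteq> 0" for U w :: 'b
    using that by (simp add: field_simps)
  have "\<xi> ^ n = inverse ((- 1) ^ n * z ^ k) * ((- 1) ^ n * z ^ k * \<xi> ^ n)"
    by (rule aux[OF u0])
  also have "\<dots> \<in> K" by (intro F(4) F(6) u c0)
  finally have \<xi>n: "\<xi> ^ n \<in> K" .
  obtain e m where e: "n * e = p * m + 1" by (rule obtain_power_inverse_mod[OF p n0 np])
  have "(\<xi> ^ n) ^ e = \<omega> ^ m * \<xi>" unfolding power_mult[symmetric] e by (simp add: power_add power_mult \<omega>(1))
  then have "\<xi> = inverse (\<omega> ^ m) * (\<xi> ^ n) ^ e" using \<omega>(1) \<xi>0 by (auto simp: field_simps)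
  also have "\<dots> \<in> K" by (intro F(4) F(6) powK \<omega>(2) \<xi>n)
  finally show False using \<xi> by simp
qed

lemma poly_in_subring:
  fixes x :: "'a::field alg_closure"
  assumes "base_field \<subseteq> R" "\<And>x y. x \<in> R \<Longrightarrow> y \<in> R \<Longrightarrow> x + y \<in> R" "\<And>x y. x \<in> R \<Longrightarrow> y \<in> R \<Longrightarrow> x * y \<in> R" "x \<in> R"
  shows "poly (map_poly to_ac f) x \<in> R"
proof -
  have b: "to_ac k \<in> R" for k using assms(1) by auto
  show ?thesis
  proof (induction f)
    case 0
    show ?case using b[of 0] by simp
  next
    case (pCons k f)
    then show ?case using assms b by (simp add: map_poly_pCons)
  qed
qed

text \<open>
  Every element of the algebraic closure satisfies a polynomial equation over the base field. After
  cancelling powers of \<open>x\<close> the constant term is nonzero, and the equation expresses the inverse of \<open>x\<close>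
  as a polynomial in \<open>x\<close>.
\<close>

lemma subring_over_base_inverse:
  fixes x :: "'a::field alg_closure"
  assumes R: "base_field \<subseteq> R" "\<And>x y. x \<in> R \<Longrightarrow> y \<in> R \<Longrightarrow> x + y \<in> R" "\<And>x y. x \<in> R \<Longrightarrow> y \<in> R \<Longrightarrow> x * y \<in> R"
    and x: "x \<in> R" "x \<noteq> 0"
  shows "inverse x \<in> R"
proof -
  have b: "to_ac k \<in> R" for k using R(1) by auto
  have "inverse x \<in> R" if "f \<noteq> 0" "poly (map_poly to_ac f) x = 0" for f :: "'a poly"
    using that
  proof (induction f)
    case (pCons k f)
    let ?y = "poly (map_poly to_ac f) x"
    have eq: "to_ac k + x * ?y = 0" using pCons.prems by (simp add: map_poly_pCons)
    show ?case
    proof (cases "k = 0")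
      case True
      then show ?thesis using eq x(2) pCons by auto
    next
      case False
      have "x * (to_ac (- inverse k) * ?y) = to_ac (- inverse k) * (x * ?y)" by simp
      also have "x * ?y = to_ac (- k)" using eq by (simp add: eq_neg_iff_add_eq_0 add.commute)
      also have "to_ac (- inverse k) * to_ac (- k) = (1 :: 'a alg_closure)"
        by (simp only: to_ac_mult[symmetric] minus_mult_minus left_inverse[OF False] to_ac_1)
      finally have "inverse x = to_ac (- inverse k) * ?y" by (rule inverse_unique)
      then show ?thesis by (simp only: R(3)[OF b poly_in_subring[OF R x(1)]])
    qed
  qed simp
  then show ?thesis using alg_closure_algebraic[of x] by blast
qed

text \<open>
  Here \<open>eval\<close> takes lists of coefficients with the leading one first, hence the reversals.
\<close>

lemma not_transcendental:
  fixes x :: "'a::field alg_closure"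
  shows "\<not> ring.transcendental fld base_field x"
proof -
  interpret field "fld :: 'a alg_closure ring" by (rule field_from_type_algebra)
  obtain f :: "'a poly" where f: "f \<noteq> 0" "poly (map_poly to_ac f) x = 0" by (rule alg_closure_algebraic)
  define q where "q = map_poly to_ac f"
  have q0: "q \<noteq> 0" using f(1) by (simp add: q_def map_poly_eq_0_iff)
  have ev: "eval (rev (coeffs r)) x = poly r x" for r :: "'a alg_closure poly"
  proof (induction r)
    case 0
    show ?case by simp
  next
    case (pCons k r)
    have "eval (rev (coeffs r) @ [k]) x = eval (rev (coeffs r)) x \<otimes>\<^bsub>fld\<^esub> x [^]\<^bsub>fld\<^esub> length [k] \<oplus>\<^bsub>fld\<^esub> eval [k] x"
      by (rule eval_append) simp_all
    then show ?case using pCons by (simp add: cCons_def mult.commute add.commute)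
  qed
  have "rev (coeffs q) \<in> carrier (base_field[X]\<^bsub>fld\<^esub>)"
  proof -
    have "set (coeffs q) \<subseteq> base_field" by (auto simp: q_def coeffs_def coeff_map_poly)
    moreover have "hd (rev (coeffs q)) \<noteq> 0" using last_coeffs_eq_coeff_degree[OF q0] q0 by (simp add: hd_rev)
    ultimately show ?thesis by (simp add: univ_poly_def polynomial_def)
  qed
  moreover have "rev (coeffs q) \<noteq> []" using q0 by simp
  moreover have "eval (rev (coeffs q)) x = \<zero>\<^bsub>fld\<^esub>" using ev f(2) by (simp add: q_def)
  ultimately show ?thesis using algebraicI by (auto simp: over_def)
qed

section \<open>Construction of the extension from a solution\<close>

lemma base_endo_sum:
  assumes f: "base_endo E f" and E: "subfield E fld" and g: "\<And>i. i \<in> I \<Longrightarrow> g i \<in> E"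
  shows "f (\<Sum>i\<in>I. g i) = (\<Sum>i\<in>I. f (g i))"
proof -
  have "(\<Sum>i\<in>I. g i) \<in> E \<and> f (\<Sum>i\<in>I. g i) = (\<Sum>i\<in>I. f (g i))"
    using g by (induction I rule: infinite_finite_induct) (auto simp: base_endoD[OF f] subfield_fldD[OF E])
  then show ?thesis by simp
qed

lemma base_endo_prod:
  assumes f: "base_endo E f" and E: "subfield E fld" and g: "\<And>i. i \<in> I \<Longrightarrow> g i \<in> E"
  shows "(\<Prod>i\<in>I. g i) \<in> E \<and> f (\<Prod>i\<in>I. g i) = (\<Prod>i\<in>I. f (g i))"
  using g by (induction I rule: infinite_finite_induct) (auto simp: base_endoD[OF f] subfield_fldD[OF E])

text \<open>
  The iterates of a twisted operator collect a partial norm of the twisting factor.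
\<close>

lemma funpow_twist:
  assumes f: "base_endo E f" and E: "subfield E fld" and q: "q \<in> E" and m: "m \<in> E"
  shows "((\<lambda>m. q * f m) ^^ n) m = (\<Prod>k<n. (f ^^ k) q) * (f ^^ n) m"
proof (induction n)
  case (Suc n)
  have fk: "(f ^^ k) r \<in> E" if "r \<in> E" for k r by (rule base_endoD(1)[OF base_endo_funpow[OF f] that])
  have P: "(\<Prod>k<n. (f ^^ k) q) \<in> E" "f (\<Prod>k<n. (f ^^ k) q) = (\<Prod>k<n. (f ^^ Suc k) q)"
    using base_endo_prod[OF f E, of "{..<n}" "\<lambda>k. (f ^^ k) q"] fk[OF q] by simp_all
  have "((\<lambda>m. q * f m) ^^ Suc n) m = q * f ((\<Prod>k<n. (f ^^ k) q) * (f ^^ n) m)" by (simp add: Suc)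
  also have "\<dots> = (q * (\<Prod>k<n. (f ^^ Suc k) q)) * (f ^^ Suc n) m"
    unfolding base_endoD(3)[OF f P(1) fk[OF m]] P(2) by (simp add: mult.assoc)
  also have "q * (\<Prod>k<n. (f ^^ Suc k) q) = (\<Prod>k<Suc n. (f ^^ k) q)"
    unfolding prod.lessThan_Suc_shift by simp
  finally show ?case .
qed simp

lemma restrict_endo_Gal:
  assumes E: "subfield E fld" "base_field \<subseteq> E" and f: "base_endo E f" and ord: "\<And>v. v \<in> E \<Longrightarrow> (f ^^ n) v = v" and n: "n > 0"
  shows "restrict f E \<in> carrier (Gal E base_field)"
  unfolding Gal_carrier_iff
proof (intro conjI ballI)
  have fn: "(f ^^ (n - 1)) v \<in> E" if "v \<in> E" for v by (rule base_endoD(1)[OF base_endo_funpow[OF f] that])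
  have 1: "f ((f ^^ (n - 1)) v) = v" "(f ^^ (n - 1)) (f v) = v" if "v \<in> E" for v
    using ord[OF that] n by (cases n; simp add: funpow_swap1)+
  have "bij_betw f E E"
    by (rule bij_betw_byWitness[where f' = "f ^^ (n - 1)"]) (use 1 fn base_endoD(1)[OF f] in auto)
  then show "bij_betw (restrict f E) E E" by (simp cong: bij_betw_cong)
qed (use base_endoD[OF f] subfield_fldD[OF E(1)] E(2) in auto)

lemma sum_lessThan_pred:
  assumes "p > (0::nat)"
  shows "(\<Sum>k<p. g k) = (\<Sum>k<p - 1. g k) + g (p - 1)" "(\<Sum>k<p. g k) = g 0 + (\<Sum>k<p - 1. g (Suc k))"
proof -
  obtain n where "p = Suc n" using assms by (cases p) auto
  then show "(\<Sum>k<p. g k) = (\<Sum>k<p - 1. g k) + g (p - 1)" "(\<Sum>k<p. g k) = g 0 + (\<Sum>k<p - 1. g (Suc k))"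
    by (simp only: sum.lessThan_Suc diff_Suc_1, simp only: sum.lessThan_Suc_shift diff_Suc_1)
qed

locale kummer4_solution = kummer4 +
  fixes x y
  assumes x_M: "x \<in> M" and y_M: "y \<in> M"
    and x_norm: "(\<Prod>k<p. (\<sigma>b' ^^ k) x) = to_ac a" and y_norm: "(\<Prod>k<p. (\<sigma>d ^^ k) y) = to_ac c"
    and xy: "x * \<sigma>b' y = y * \<sigma>d x"
begin

lemma x_nz: "x \<noteq> 0" and y_nz: "y \<noteq> 0"
proof -
  show "x \<noteq> 0"
  proof
    assume 0: "x = 0"
    have "(\<Prod>k<p. (\<sigma>b' ^^ k) x) = 0" by (rule prod_zero[OF finite_lessThan bexI[of _ 0]]) (use 0 p_pos in simp_all)
    then show False using x_norm nz(1) by simp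
  qed
  show "y \<noteq> 0"
  proof
    assume 0: "y = 0"
    have "(\<Prod>k<p. (\<sigma>d ^^ k) y) = 0" by (rule prod_zero[OF finite_lessThan bexI[of _ 0]]) (use 0 p_pos in simp_all)
    then show False using y_norm nz(3) by simp
  qed
qed

lemma x_K: "x \<in> K" and y_K: "y \<in> K"
  using x_M y_M M_K by auto

lemmas F = subfield_fldD[OF subfield_K]

lemma to_ac_K: "to_ac k \<in> K"
  using base_K by auto

lemma power_K: "m \<in> K \<Longrightarrow> m ^ n \<in> K"
  by (induction n) (simp_all add: F)

lemma twist_order:
  assumes e: "base_endo K \<sigma>" and u: "u \<in> K" "u \<noteq> 0" and k: "k \<noteq> 0" and n: "(\<Prod>i<p. (\<sigma> ^^ i) u) = to_ac k"
    and ord: "\<And>v. v \<in> K \<Longrightarrow> (\<sigma> ^^ p) v = v" and v: "v \<in> K"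
  shows "((\<lambda>m. (to_ac k * inverse u ^ p) * \<sigma> m) ^^ p) v = v"
proof -
  have iu: "inverse u \<in> K" "inverse u ^ p \<in> K" using u by (simp_all add: F power_K)
  have "(\<sigma> ^^ i) (to_ac k * inverse u ^ p) = to_ac k * inverse ((\<sigma> ^^ i) u) ^ p" for i
  proof -
    note ei = base_endo_funpow[OF e, of i]
    show ?thesis
      unfolding endo_on_scaled[OF ei iu(2) base_K] using base_endo_power[OF ei subfield_K iu(1), of p]
        base_endo_nonzero(2)[OF ei subfield_K u] by simp
  qed
  then have "(\<Prod>i<p. (\<sigma> ^^ i) (to_ac k * inverse u ^ p)) = to_ac k ^ p * (\<Prod>i<p. inverse ((\<sigma> ^^ i) u)) ^ p"
    by (simp add: prod.distrib prod_power_distrib)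
  also have "(\<Prod>i<p. inverse ((\<sigma> ^^ i) u)) = inverse (to_ac k)"
    unfolding n[symmetric] using prod_inversef[of "\<lambda>i. (\<sigma> ^^ i) u" "{..<p}"] by (simp add: o_def)
  also have "to_ac k ^ p * inverse (to_ac k) ^ p = (1 :: 'a alg_closure)"
    using k by (simp flip: power_mult_distrib)
  finally show ?thesis
    using funpow_twist[OF e subfield_K _ v, of "to_ac k * inverse u ^ p" p] ord[OF v] iu to_ac_K by (simp add: F)
qed

text \<open>
  The operators that send \<open>m\<close> to \<open>a x\<close> to the power \<open>-p\<close> times \<open>\<sigma>b' m\<close>, and to \<open>c y\<close> to the power \<open>-p\<close> times \<open>\<sigma>d m\<close>, have order
  \<open>p\<close> by the norm equations and commute by the third equation. Multiplication by \<open>\<beta>\<close> and by \<open>\<delta>\<close>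
  shifts their eigenvalues, so a common nonzero fixed vector exists.
\<close>

lemma \<omega>_exists: "\<exists>w\<in>M. w \<noteq> 0 \<and> \<sigma>b' w = x ^ p * inverse (to_ac a) * w \<and> \<sigma>d w = y ^ p * inverse (to_ac c) * w"
proof -
  define q where "q = to_ac a * inverse x ^ p"
  define r where "r = to_ac c * inverse y ^ p"
  have qM: "q \<in> M" "r \<in> M" unfolding q_def r_def using x_M y_M by (simp_all add: M.mult_M M.base_M M.power_M M.inverse_M)
  define Gb where "Gb m = q * \<sigma>b' m" for m
  define Gd where "Gd m = r * \<sigma>d m" for m
  have inv: "primitive_root_of_unity p (inverse \<zeta>)" by (rule prim_root_inverse[OF root])
  have z: "to_ac \<zeta> * (to_ac (inverse \<zeta>) * m) = m" "to_ac (inverse \<zeta>) * (to_ac \<zeta> * m) = m" for m :: "'a alg_closure"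
    using \<zeta>_nz by (simp_all add: mult.assoc[symmetric] flip: to_ac_mult del: to_ac_inverse)
  have GbL: "flinear M Gb"
    by (rule flinearI) (auto simp: Gb_def qM M.mult_M M.s_M M.s_add M.s_mult M.base_M M.s_base algebra_simps)
  have Gbp: "(Gb ^^ p) v = v" if "v \<in> M" for v
    unfolding Gb_def q_def
    by (rule twist_order[OF \<sigma>_endo(2) x_K x_nz nz(1) x_norm \<sigma>_order[OF \<sigma>_Gal(2)] M_K[OF that]])
  obtain w1 where w1: "w1 \<in> M" "w1 \<noteq> 0" "Gb w1 = w1"
  proof (rule fixed_vector[OF M.fspace_M GbL Gbp root p_nz gens_nz(2), of 1])
    show "\<beta> * v \<in> M" if "v \<in> M" for v using that by (simp add: M.mult_M M.\<beta>_M)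
    show "to_ac \<zeta> * Gb (\<beta> * v) = \<beta> * Gb v" if "v \<in> M" for v
    proof -
      have "to_ac \<zeta> * Gb (\<beta> * v) = to_ac \<zeta> * (to_ac (inverse \<zeta>) * (\<beta> * (q * \<sigma>b' v)))"
        unfolding Gb_def M.s_mult[OF M.\<beta>_M that] M.s_\<beta> by (simp only: mult_ac)
      then show ?thesis unfolding z by (simp add: Gb_def)
    qed
  qed (simp_all add: M.one_M)
  define V where "V = {m \<in> M. Gb m = m}"
  have V: "fspace V"
    by (rule fspaceI) (auto simp: V_def fspaceD[OF M.fspace_M] flinearD[OF M.fspace_M GbL])
  have qr: "q * \<sigma>b' r = r * \<sigma>d q"
  proof -
    have "\<sigma>b' r = to_ac c * inverse (\<sigma>b' y) ^ p"
      unfolding r_def endo_on_scaled[OF \<sigma>_endo(2) power_K[OF F(6)[OF y_K]] base_K]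
      using base_endo_power[OF \<sigma>_endo(2) subfield_K F(6)[OF y_K], of p] base_endo_nonzero(2)[OF \<sigma>_endo(2) subfield_K y_K y_nz] by simp
    moreover have "\<sigma>d q = to_ac a * inverse (\<sigma>d x) ^ p"
      unfolding q_def endo_on_scaled[OF \<sigma>_endo(4) power_K[OF F(6)[OF x_K]] base_K]
      using base_endo_power[OF \<sigma>_endo(4) subfield_K F(6)[OF x_K], of p] base_endo_nonzero(2)[OF \<sigma>_endo(4) subfield_K x_K x_nz] by simp
    moreover have "(inverse x * inverse (\<sigma>b' y)) ^ p = (inverse y * inverse (\<sigma>d x)) ^ p"
      using xy by (simp flip: inverse_mult_distrib)
    ultimately show ?thesis unfolding q_def r_def by (simp add: power_mult_distrib mult_ac)
  qed
  have GdV: "Gd m \<in> V" if "m \<in> V" for m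
  proof -
    have m: "m \<in> M" "q * \<sigma>b' m = m" using that by (auto simp: V_def Gb_def)
    have "Gb (Gd m) = (q * \<sigma>b' r) * \<sigma>d (\<sigma>b' m)"
      unfolding Gb_def Gd_def M.s_mult[OF qM(2) M.t_M[OF m(1)]] M.st_commute[OF m(1)] by (simp only: mult_ac)
    also have "\<dots> = r * \<sigma>d (q * \<sigma>b' m)" unfolding qr M.t_mult[OF qM(1) M.s_M[OF m(1)]] by (simp only: mult_ac)
    finally show ?thesis using m qM by (simp add: V_def Gd_def M.mult_M M.t_M)
  qed
  have GdL: "flinear V Gd"
  proof (rule flinearI)
    show "Gd v \<in> V" if "v \<in> V" for v by (rule GdV[OF that])
  qed (auto simp: V_def Gd_def M.t_add M.t_mult M.base_M M.t_base algebra_simps)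
  have Gdp: "(Gd ^^ p) v = v" if "v \<in> V" for v
    unfolding Gd_def r_def
    by (rule twist_order[OF \<sigma>_endo(4) y_K y_nz nz(3) y_norm \<sigma>_order[OF \<sigma>_Gal(4)]]) (use that M_K in \<open>auto simp: V_def\<close>)
  have w1V: "w1 \<in> V" using w1 by (simp add: V_def)
  obtain w where w: "w \<in> V" "w \<noteq> 0" "Gd w = w"
  proof (rule fixed_vector[OF V GdL Gdp inv p_nz gens_nz(4) _ _ w1V w1(2)])
    show "\<delta> * v \<in> V" if "v \<in> V" for v
      using that by (auto simp: V_def Gb_def M.mult_M M.\<delta>_M M.s_mult M.s_\<delta> mult.left_commute)
    show "to_ac (inverse \<zeta>) * Gd (\<delta> * v) = \<delta> * Gd v" if "v \<in> V" for v
    proof -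
      have vM: "v \<in> M" using that by (simp add: V_def)
      have "to_ac (inverse \<zeta>) * Gd (\<delta> * v) = to_ac (inverse \<zeta>) * (to_ac \<zeta> * (\<delta> * (r * \<sigma>d v)))"
        unfolding Gd_def M.t_mult[OF M.\<delta>_M vM] M.t_\<delta> by (simp only: mult_ac)
      then show ?thesis unfolding z by (simp add: Gd_def)
    qed
  qed
  have "to_ac a * (\<sigma>b' w) = x ^ p * w" "to_ac c * (\<sigma>d w) = y ^ p * w"
    using w x_nz y_nz by (auto simp: V_def Gb_def Gd_def q_def r_def field_simps)
  then have "\<sigma>b' w = x ^ p * inverse (to_ac a) * w" "\<sigma>d w = y ^ p * inverse (to_ac c) * w"
    using nz by (auto simp: field_simps)
  then show ?thesis using w by (auto simp: V_def)
qed

definition "\<omega> = (SOME w. w \<in> M \<and> w \<noteq> 0 \<and> \<sigma>b' w = x ^ p * inverse (to_ac a) * w \<and> \<sigma>d w = y ^ p * inverse (to_ac c) * w)"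
definition "\<xi> = (SOME r. r ^ p = \<omega>)"
text \<open>
  The factors by which the lifts of \<open>\<sigma>b'\<close> and \<open>\<sigma>d\<close> are going to multiply \<open>\<xi>\<close>.
\<close>

definition "fb = x * inverse \<alpha>"
definition "fd = y * inverse \<gamma>"

lemma \<omega>: "\<omega> \<in> M" "\<omega> \<noteq> 0" "\<sigma>b' \<omega> = fb ^ p * \<omega>" "\<sigma>d \<omega> = fd ^ p * \<omega>" "\<sigma>a \<omega> = \<omega>" "\<sigma>c \<omega> = \<omega>" "\<omega> \<in> K"
proof -
  have "\<omega> \<in> M \<and> \<omega> \<noteq> 0 \<and> \<sigma>b' \<omega> = x ^ p * inverse (to_ac a) * \<omega> \<and> \<sigma>d \<omega> = y ^ p * inverse (to_ac c) * \<omega>"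
    unfolding \<omega>_def by (rule someI_ex[OF \<omega>_exists[unfolded Bex_def]])
  moreover have "fb ^ p = x ^ p * inverse (to_ac a)" "fd ^ p = y ^ p * inverse (to_ac c)"
    by (simp_all add: fb_def fd_def power_mult_distrib power_inverse pow del: to_ac_inverse)
  ultimately show "\<omega> \<in> M" "\<omega> \<noteq> 0" "\<sigma>b' \<omega> = fb ^ p * \<omega>" "\<sigma>d \<omega> = fd ^ p * \<omega>" by simp_all
  then show "\<sigma>a \<omega> = \<omega>" "\<sigma>c \<omega> = \<omega>" "\<omega> \<in> K" using M_fixed M_K by auto
qed

lemma \<xi>: "\<xi> ^ p = \<omega>" "\<xi> \<noteq> 0"
proof -
  show 1: "\<xi> ^ p = \<omega>" unfolding \<xi>_def by (rule someI_ex[OF nth_root_exists[OF p_pos]])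
  show "\<xi> \<noteq> 0" using 1 \<omega>(2) p_pos by (auto simp: zero_power)
qed

lemma cocycle_K: "fb \<in> K" "fd \<in> K" "fb \<noteq> 0" "fd \<noteq> 0"
  unfolding fb_def fd_def using x_K y_K gens_K x_nz y_nz gens_nz by (simp_all add: F)

lemma cocycle_image:
  "to_ac \<zeta> * \<sigma>a fb = fb" "\<sigma>c fb = fb" "\<sigma>a fd = fd" "to_ac \<zeta> * \<sigma>c fd = fd" "fb * \<sigma>b' fd = fd * \<sigma>d fb"
proof -
  have im: "\<sigma> (m * inverse r) = \<sigma> m * inverse (\<sigma> r)" if "base_endo K \<sigma>" "m \<in> K" "r \<in> K" "r \<noteq> 0" for \<sigma> m r
    using base_endoD(3)[OF that(1,2) F(6)[OF that(3)]] base_endo_nonzero(2)[OF that(1) subfield_K that(3,4)] by simp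
  note b = im[OF _ x_K gens_K(1) gens_nz(1)] and d = im[OF _ y_K gens_K(3) gens_nz(3)]
  have z0: "(to_ac \<zeta> :: 'a alg_closure) \<noteq> 0" using \<zeta>_nz by simp
  note fixed = M_fixed[OF x_M] M_fixed[OF y_M]
  show "to_ac \<zeta> * \<sigma>a fb = fb" "\<sigma>c fb = fb" unfolding fb_def b[OF \<sigma>_endo(1)] b[OF \<sigma>_endo(3)] \<sigma>_acts fixed
    using z0 by (simp_all add: field_simps)
  show "\<sigma>a fd = fd" "to_ac \<zeta> * \<sigma>c fd = fd" unfolding fd_def d[OF \<sigma>_endo(1)] d[OF \<sigma>_endo(3)] \<sigma>_acts fixed
    using z0 by (simp_all add: field_simps)
  have "(x * \<sigma>b' y) * (inverse \<alpha> * inverse \<gamma>) = (y * \<sigma>d x) * (inverse \<alpha> * inverse \<gamma>)" by (simp only: xy)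
  then show "fb * \<sigma>b' fd = fd * \<sigma>d fb" unfolding fb_def fd_def b[OF \<sigma>_endo(4)] d[OF \<sigma>_endo(2)] \<sigma>_acts by (simp only: mult_ac)
qed

lemma \<xi>_root: "r ^ p = (u * \<xi>) ^ p \<Longrightarrow> u \<noteq> 0 \<Longrightarrow> \<exists>n<p. r = to_ac \<zeta> ^ n * (u * \<xi>)"
proof -
  assume r: "r ^ p = (u * \<xi>) ^ p" and u: "u \<noteq> 0"
  have nz: "u * \<xi> \<noteq> 0" using u \<xi>(2) by simp
  have "(r / (u * \<xi>)) ^ p = 1" using nz unfolding power_divide r by simp
  from roots_of_unity_are_powers[OF prim_root_to_ac[OF root] this] obtain n where "n < p" "r / (u * \<xi>) = to_ac \<zeta> ^ n" .
  then show ?thesis using nz by (intro exI[of _ n]) (simp add: field_simps)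
qed

text \<open>
  Otherwise \<open>\<sigma>a\<close> and \<open>\<sigma>b'\<close> would act on \<open>\<xi>\<close> by the factors \<open>1\<close> and \<open>fb\<close> up to roots of unity. As they commute
  on \<open>K\<close>, \<open>fb\<close> would be fixed by \<open>\<sigma>a\<close>, but \<open>\<sigma>a\<close> moves \<open>\<alpha>\<close> and therefore \<open>fb\<close>.
\<close>

lemma \<xi>_notin_K: "\<xi> \<notin> K"
proof
  assume K: "\<xi> \<in> K"
  note A = base_endoD[OF \<sigma>_endo(1)] and B = base_endoD[OF \<sigma>_endo(2)]
  have "\<sigma>a \<xi> ^ p = (1 * \<xi>) ^ p"
    using base_endo_power[OF \<sigma>_endo(1) subfield_K K, of p] by (simp add: \<xi> \<omega>)
  then obtain n where n: "\<sigma>a \<xi> = to_ac \<zeta> ^ n * \<xi>" using \<xi>_root[of "\<sigma>a \<xi>" 1] by auto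
  have "\<sigma>b' \<xi> ^ p = (fb * \<xi>) ^ p"
    using base_endo_power[OF \<sigma>_endo(2) subfield_K K, of p] by (simp add: \<xi> \<omega> power_mult_distrib)
  then obtain m where m: "\<sigma>b' \<xi> = to_ac \<zeta> ^ m * (fb * \<xi>)" using \<xi>_root cocycle_K(3) by blast
  note S = endo_on_scaled[OF _ _ base_K, of _ _ "\<zeta> ^ _", unfolded to_ac_power]
  have "\<sigma>a (\<sigma>b' \<xi>) = to_ac \<zeta> ^ m * (\<sigma>a fb * (to_ac \<zeta> ^ n * \<xi>))"
    unfolding m using K cocycle_K by (simp add: S \<sigma>_endo F A n)
  moreover have "\<sigma>b' (\<sigma>a \<xi>) = to_ac \<zeta> ^ n * (to_ac \<zeta> ^ m * (fb * \<xi>))"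
    unfolding n using K by (simp add: S \<sigma>_endo m)
  moreover have "\<sigma>a (\<sigma>b' \<xi>) = \<sigma>b' (\<sigma>a \<xi>)" by (rule \<sigma>_commute[OF \<sigma>_Gal(1,2) K])
  ultimately have "\<sigma>a fb = fb" using \<zeta>_nz \<xi>(2) by (simp add: mult_ac)
  then have "to_ac \<zeta> * fb = 1 * fb" using cocycle_image(1) by simp
  then have "\<zeta> = 1" using cocycle_K(3) by (metis mult_right_cancel to_ac_1 to_ac_eq_iff)
  then show False using prim_root_power_inj[OF root, of 1 0] p_gt_1 by simp
qed

definition S :: "(nat \<Rightarrow> 'a alg_closure) \<Rightarrow> 'a alg_closure" where
  "S e = (\<Sum>k<p. e k * \<xi> ^ k)"

definition L :: "'a alg_closure set" where
  "L = {S e | e. \<forall>k. e k \<in> K}"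

lemma S_L: "(\<And>k. e k \<in> K) \<Longrightarrow> S e \<in> L"
  by (auto simp: L_def)

lemma L_cases:
  assumes "v \<in> L"
  obtains e where "v = S e" "\<And>k. e k \<in> K"
  using assms by (auto simp: L_def)

lemma S_inj:
  assumes "\<And>k. e k \<in> K" "\<And>k. e' k \<in> K" "S e = S e'" "k < p"
  shows "e k = e' k"
proof -
  have z: "to_ac \<zeta> \<in> K" by (rule to_ac_K)
  have "e i - e' i \<in> K" for i using F(3)[OF assms(1) F(5)[OF assms(2)], of i i] by simp
  moreover have "(\<Sum>k<p. (e k - e' k) * \<xi> ^ k) = 0" using assms(3) by (simp add: S_def left_diff_distrib sum_subtractf)
  ultimately have "e k - e' k = 0"
    by (rule kummer_independent[OF subfield_K prime_p prim_root_to_ac[OF root] z \<xi>(1) \<omega>(7) \<xi>_notin_K _ _ assms(4)])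
  then show ?thesis by simp
qed

lemma S_add: "S e + S e' = S (\<lambda>k. e k + e' k)" and S_scale: "u * S e = S (\<lambda>k. u * e k)"
  by (simp_all add: S_def algebra_simps sum.distrib sum_distrib_left)

lemma S_shift: "\<xi> * S e = S (\<lambda>k. if k = 0 then e (p - 1) * \<omega> else e (k - 1))"
proof -
  have "\<xi> * S e = (\<Sum>k<p - 1. e k * \<xi> ^ Suc k) + e (p - 1) * (\<xi> * \<xi> ^ (p - 1))"
    unfolding S_def sum_lessThan_pred(1)[OF p_pos] by (simp add: sum_distrib_left algebra_simps)
  moreover have "\<xi> * \<xi> ^ (p - 1) = \<omega>" using p_pos \<xi>(1) by (simp add: power_eq_if[of \<xi> p])
  moreover have "S (\<lambda>k. if k = 0 then e (p - 1) * \<omega> else e (k - 1)) = e (p - 1) * \<omega> + (\<Sum>k<p - 1. e k * \<xi> ^ Suc k)"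
    unfolding S_def sum_lessThan_pred(2)[OF p_pos] by simp
  ultimately show ?thesis by simp
qed

lemma S_const: "S (\<lambda>k. if k = 0 then u else 0) = u"
  unfolding S_def using p_pos by (subst sum.remove[of _ 0]) auto

lemma K_L: "K \<subseteq> L"
  using S_L[of "\<lambda>k. if k = 0 then u else 0" for u] by (auto simp: S_const F)

lemma L_add:
  assumes "u \<in> L" "v \<in> L"
  shows "u + v \<in> L"
proof -
  obtain e where e: "u = S e" "\<And>k. e k \<in> K" by (rule L_cases[OF assms(1)], rule that)
  obtain e' where e': "v = S e'" "\<And>k. e' k \<in> K" by (rule L_cases[OF assms(2)], rule that)
  show ?thesis unfolding e(1) e'(1) S_add by (intro S_L F(3) e e')
qed

lemma L_scale:
  assumes "u \<in> K" "v \<in> L"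
  shows "u * v \<in> L"
proof -
  obtain e where e: "v = S e" "\<And>k. e k \<in> K" by (rule L_cases[OF assms(2)], rule that)
  show ?thesis unfolding e(1) S_scale by (intro S_L F(4) e assms)
qed

lemma L_shift: "v \<in> L \<Longrightarrow> \<xi> ^ n * v \<in> L"
proof (induction n)
  case (Suc n)
  then have "\<xi> ^ n * v \<in> L" by simp
  obtain e where e: "\<xi> ^ n * v = S e" "\<And>k. e k \<in> K" by (rule L_cases[OF \<open>\<xi> ^ n * v \<in> L\<close>], rule that)
  have "\<xi> * (\<xi> ^ n * v) \<in> L" unfolding e(1) S_shift by (rule S_L) (use e(2) \<omega>(7) F(4) in auto)
  then show ?case by (simp add: mult.assoc)
qed simp

lemma L_sum: "(\<And>i. i \<in> I \<Longrightarrow> f i \<in> L) \<Longrightarrow> sum f I \<in> L"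
  by (induction I rule: infinite_finite_induct) (use K_L F(1) in \<open>auto intro: L_add\<close>)

lemma L_mult:
  assumes "u \<in> L" "v \<in> L"
  shows "u * v \<in> L"
proof -
  obtain e where e: "u = S e" "\<And>k. e k \<in> K" by (rule L_cases[OF assms(1)], rule that)
  have "u * v = (\<Sum>k<p. e k * (\<xi> ^ k * v))" by (simp add: e(1) S_def sum_distrib_right mult.assoc)
  also have "\<dots> \<in> L" by (intro L_sum L_scale L_shift e assms)
  finally show ?thesis .
qed

lemma base_L: "base_field \<subseteq> L"
  using base_K K_L by auto

lemma subfield_L: "subfield L fld"
proof (rule subfield_fldI)
  show "1 \<in> L" using K_L F(2) by auto
  show "- v \<in> L" if "v \<in> L" for v using L_scale[OF F(5)[OF F(2)] that] by simp
  show "inverse v \<in> L" if "v \<in> L" "v \<noteq> 0" for v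
    by (rule subring_over_base_inverse[OF base_L L_add L_mult that])
qed (rule L_add L_mult; assumption)+

lemma \<xi>_L: "\<xi> \<in> L"
  using L_shift[of 1 1] K_L F(2) by auto

definition coeffs_of :: "'a alg_closure \<Rightarrow> nat \<Rightarrow> 'a alg_closure" where
  "coeffs_of v = (SOME c. (\<forall>k. c k \<in> K) \<and> v = S c)"

text \<open>
  The lift of \<open>\<sigma>\<close> to \<open>L\<close> that multiplies \<open>\<xi>\<close> by \<open>f\<close>; it is multiplicative when \<open>\<sigma> \<omega> = f\<^sup>p \<omega>\<close>.
\<close>

definition ext :: "('a alg_closure \<Rightarrow> 'a alg_closure) \<Rightarrow> 'a alg_closure \<Rightarrow> 'a alg_closure \<Rightarrow> 'a alg_closure" where
  "ext \<sigma> f v = (\<Sum>k<p. \<sigma> (coeffs_of v k) * (f * \<xi>) ^ k)"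

lemma ext_S:
  assumes "\<And>k. e k \<in> K"
  shows "ext \<sigma> f (S e) = (\<Sum>k<p. \<sigma> (e k) * (f * \<xi>) ^ k)"
proof -
  have "\<exists>e'. (\<forall>k. e' k \<in> K) \<and> S e = S e'" using assms by blast
  from someI_ex[OF this] have "\<And>k. coeffs_of (S e) k \<in> K" "S e = S (coeffs_of (S e))"
    unfolding coeffs_of_def by auto
  from S_inj[OF assms this] show ?thesis by (simp add: ext_def)
qed

text \<open>
  The crucial case of multiplicativity is the product with \<open>\<xi>\<close>: the top term overflows through
  \<open>\<xi>\<^sup>p = \<omega>\<close>, and the condition on \<open>f\<close> is what makes it match. The general product follows by linearity.
\<close>

lemma ext_endo:
  assumes \<sigma>: "base_endo K \<sigma>" and f: "f \<in> K" and \<omega>f: "\<sigma> \<omega> = f ^ p * \<omega>"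
  shows "base_endo L (ext \<sigma> f)" "u \<in> K \<Longrightarrow> ext \<sigma> f u = \<sigma> u" "ext \<sigma> f \<xi> = f * \<xi>"
proof -
  note E = base_endoD[OF \<sigma>]
  define T where "T = ext \<sigma> f"
  have const: "T u = \<sigma> u" if "u \<in> K" for u
  proof -
    have "T (S (\<lambda>k. if k = 0 then u else 0)) = (\<Sum>k<p. \<sigma> (if k = 0 then u else 0) * (f * \<xi>) ^ k)"
      unfolding T_def by (rule ext_S) (simp add: that F)
    also have "\<dots> = \<sigma> u" using p_pos E(5) by (subst sum.remove[of _ 0]) auto
    finally show ?thesis unfolding S_const .
  qed
  have add: "T (u + v) = T u + T v" if uv: "u \<in> L" "v \<in> L" for u v
  proof -
    obtain c where c: "u = S c" "\<And>k. c k \<in> K" by (rule L_cases[OF uv(1)], rule that)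
    obtain c' where c': "v = S c'" "\<And>k. c' k \<in> K" by (rule L_cases[OF uv(2)], rule that)
    have "c k + c' k \<in> K" for k by (intro F c c')
    then show ?thesis unfolding c(1) c'(1) S_add T_def
      by (simp add: ext_S c(2) c'(2) E algebra_simps sum.distrib)
  qed
  have scale: "T (u * v) = \<sigma> u * T v" if uv: "u \<in> K" "v \<in> L" for u v
  proof -
    obtain c where c: "v = S c" "\<And>k. c k \<in> K" by (rule L_cases[OF uv(2)], rule that)
    have "u * c k \<in> K" for k by (intro F c that)
    then show ?thesis unfolding c(1) S_scale T_def
      by (simp add: ext_S c(2) E that(1) sum_distrib_left mult.assoc)
  qed
  have shift: "T (\<xi> * v) = f * \<xi> * T v" if uv: "v \<in> L" for v
  proof -
    obtain c where c: "v = S c" "\<And>k. c k \<in> K" by (rule L_cases[OF uv], rule that)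
    have cl: "(if k = 0 then c (p - 1) * \<omega> else c (k - 1)) \<in> K" for k using c(2) \<omega>(7) F(4) by simp
    have "T (\<xi> * v) = \<sigma> (c (p - 1) * \<omega>) + (\<Sum>k<p - 1. \<sigma> (c k) * (f * \<xi>) ^ Suc k)"
      unfolding c(1) S_shift T_def ext_S[OF cl] unfolding sum_lessThan_pred(2)[OF p_pos] by simp
    also have "\<sigma> (c (p - 1) * \<omega>) = \<sigma> (c (p - 1)) * (f * \<xi>) ^ p"
      unfolding E(3)[OF c(2) \<omega>(7)] \<omega>f power_mult_distrib \<xi>(1) by simp
    also have "(f * \<xi>) ^ p = f * \<xi> * (f * \<xi>) ^ (p - 1)" using p_pos by (simp add: power_eq_if[of _ p])
    also have "\<sigma> (c (p - 1)) * (f * \<xi> * (f * \<xi>) ^ (p - 1)) + (\<Sum>k<p - 1. \<sigma> (c k) * (f * \<xi>) ^ Suc k) = f * \<xi> * T v"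
      unfolding c(1) T_def ext_S[OF c(2)] sum_lessThan_pred(1)[OF p_pos]
      by (simp add: sum_distrib_left distrib_left mult_ac del: power_mult_distrib)
    finally show ?thesis .
  qed
  have pow: "T (\<xi> ^ n * v) = (f * \<xi>) ^ n * T v" if "v \<in> L" for n v
  proof (induction n)
    case (Suc n)
    have "T (\<xi> ^ Suc n * v) = f * \<xi> * T (\<xi> ^ n * v)"
      using shift[OF L_shift[OF that, of n]] by (simp add: mult.assoc)
    then show ?case unfolding Suc by (simp add: mult.assoc)
  qed simp
  have sum: "T (sum g I) = (\<Sum>i\<in>I. T (g i))" if "\<And>i. i \<in> I \<Longrightarrow> g i \<in> L" for g and I :: "nat set"
    using that
  proof (induction I rule: infinite_finite_induct)
    case (insert i I)
    then show ?case using add[OF _ L_sum, of "g i" I g] by auto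
  qed (use const[OF F(1)] E(5) in auto)
  have mult: "T (u * v) = T u * T v" if uv: "u \<in> L" "v \<in> L" for u v
  proof -
    obtain c where c: "u = S c" "\<And>k. c k \<in> K" by (rule L_cases[OF uv(1)], rule that)
    have "u * v = (\<Sum>k<p. c k * (\<xi> ^ k * v))" by (simp add: c(1) S_def sum_distrib_right mult.assoc)
    then have "T (u * v) = (\<Sum>k<p. T (c k * (\<xi> ^ k * v)))"
      using sum[of "{..<p}" "\<lambda>k. c k * (\<xi> ^ k * v)"] c(2) that by (simp add: L_scale L_shift)
    also have "\<dots> = (\<Sum>k<p. \<sigma> (c k) * (f * \<xi>) ^ k * T v)"
      using scale[OF c(2) L_shift[OF that(2)]] pow[OF that(2)] by (simp add: mult.assoc)
    also have "\<dots> = T u * T v" unfolding c(1) T_def ext_S[OF c(2)] by (simp add: sum_distrib_right)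
    finally show ?thesis .
  qed
  have closed: "T v \<in> L" if uv: "v \<in> L" for v
  proof -
    obtain c where c: "v = S c" "\<And>k. c k \<in> K" by (rule L_cases[OF uv], rule that)
    have "T v = S (\<lambda>k. \<sigma> (c k) * f ^ k)"
      unfolding c(1) T_def unfolding ext_S[OF c(2)] unfolding S_def by (simp add: power_mult_distrib mult.assoc)
    then show ?thesis using c(2) E(1) f by (auto intro!: S_L F(4) power_K)
  qed
  show "base_endo L (ext \<sigma> f)" unfolding base_endo_def T_def[symmetric]
    using closed add mult const[OF to_ac_K] E(4) by simp
  show "u \<in> K \<Longrightarrow> ext \<sigma> f u = \<sigma> u" using const unfolding T_def .
  show "ext \<sigma> f \<xi> = f * \<xi>"
    using pow[of 1 1] K_L F(2) const[OF F(2)] E(6) unfolding T_def by auto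
qed

lemma L_endo_eq:
  assumes "base_endo L f" "base_endo L g" "\<And>u. u \<in> K \<Longrightarrow> f u = g u" "f \<xi> = g \<xi>" "v \<in> L"
  shows "f v = g v"
proof -
  obtain c where c: "v = S c" "\<And>k. c k \<in> K" by (rule L_cases[OF assms(5)], rule that)
  have *: "h v = (\<Sum>k<p. h (c k) * h \<xi> ^ k)" if h: "base_endo L h" for h
  proof -
    have cL: "c k \<in> L" "\<xi> ^ k \<in> L" for k
      using c(2) K_L base_endo_power[OF h subfield_L \<xi>_L] by auto
    have "h v = (\<Sum>k<p. h (c k * \<xi> ^ k))"
      unfolding c(1) S_def by (rule base_endo_sum[OF h subfield_L]) (intro L_mult cL)
    then show ?thesis using base_endoD(3)[OF h cL] base_endo_power[OF h subfield_L \<xi>_L] by simp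
  qed
  show ?thesis unfolding *[OF assms(1)] *[OF assms(2)] using assms(3)[OF c(2)] assms(4) by simp
qed

end

context kummer4_solution
begin

lemma ext_pow_\<xi>:
  assumes \<sigma>: "base_endo K \<sigma>" and f: "f \<in> K" and \<omega>f: "\<sigma> \<omega> = f ^ p * \<omega>"
  shows "(ext \<sigma> f ^^ n) \<xi> = (\<Prod>k<n. (\<sigma> ^^ k) f) * \<xi>"
proof -
  note e = ext_endo[OF \<sigma> f \<omega>f]
  have tw: "((\<lambda>m. f * \<sigma> m) ^^ n) 1 \<in> K \<and> (ext \<sigma> f ^^ n) \<xi> = ((\<lambda>m. f * \<sigma> m) ^^ n) 1 * \<xi>"
  proof (induction n)
    case (Suc n)
    define w where "w = ((\<lambda>m. f * \<sigma> m) ^^ n) 1"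
    have w: "w \<in> K" "(ext \<sigma> f ^^ n) \<xi> = w * \<xi>" using Suc by (auto simp: w_def)
    have wL: "w \<in> L" using w(1) K_L by auto
    have "(ext \<sigma> f ^^ Suc n) \<xi> = f * \<sigma> w * \<xi>"
      using base_endoD(3)[OF e(1) wL \<xi>_L] e(2)[OF w(1)] e(3) by (simp add: w(2) mult_ac)
    moreover have "f * \<sigma> w \<in> K" using f base_endoD(1)[OF \<sigma> w(1)] by (simp add: F)
    ultimately show ?case by (simp add: w_def)
  qed (simp add: F)
  have "(\<sigma> ^^ n) 1 = 1" by (rule base_endoD(6)[OF base_endo_funpow[OF \<sigma>]])
  with tw show ?thesis using funpow_twist[OF \<sigma> subfield_K f F(2), of n] by simp
qed

lemma ext_order:
  assumes \<sigma>: "base_endo K \<sigma>" and f: "f \<in> K" and \<omega>f: "\<sigma> \<omega> = f ^ p * \<omega>"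
    and ord: "\<And>u. u \<in> K \<Longrightarrow> (\<sigma> ^^ p) u = u" and norm: "(\<Prod>k<p. (\<sigma> ^^ k) f) = 1" and v: "v \<in> L"
  shows "(ext \<sigma> f ^^ p) v = v"
proof (rule L_endo_eq[OF base_endo_funpow[OF ext_endo(1)[OF \<sigma> f \<omega>f]] base_endo_id _ _ v])
  fix u assume u: "u \<in> K"
  have "(ext \<sigma> f ^^ n) u = (\<sigma> ^^ n) u \<and> (\<sigma> ^^ n) u \<in> K" for n
    by (induction n) (use u ext_endo(2)[OF \<sigma> f \<omega>f] base_endoD(1)[OF \<sigma>] in auto)
  then show "(ext \<sigma> f ^^ p) u = u" using ord[OF u] by simp
next
  show "(ext \<sigma> f ^^ p) \<xi> = \<xi>" unfolding ext_pow_\<xi>[OF \<sigma> f \<omega>f] norm by simp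
qed

text \<open>
  On \<open>K\<close> the two composites agree since the Galois group of \<open>K\<close> is abelian, so that the commutator of two lifts
  is visible on \<open>\<xi>\<close> alone; \<open>h\<close> is a lift of the identity, with factor \<open>k\<close>.
\<close>

lemma ext_commute:
  assumes \<sigma>: "\<sigma> \<in> carrier (Gal K base_field)" "f \<in> K" "\<sigma> \<omega> = f ^ p * \<omega>"
    and \<tau>: "\<tau> \<in> carrier (Gal K base_field)" "g \<in> K" "\<tau> \<omega> = g ^ p * \<omega>"
    and h: "base_endo L h" "\<And>u. u \<in> K \<Longrightarrow> h u = u" "h \<xi> = to_ac k * \<xi>"
    and eq: "\<sigma> g * f = to_ac k * (\<tau> f * g)" and v: "v \<in> L"
  shows "ext \<sigma> f (ext \<tau> g v) = ext \<tau> g (ext \<sigma> f (h v))"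
proof -
  note e = ext_endo[OF Gal_K_endo[OF \<sigma>(1)] \<sigma>(2,3)] and e' = ext_endo[OF Gal_K_endo[OF \<tau>(1)] \<tau>(2,3)]
  have gL: "g \<in> L" "f \<in> L" using \<sigma>(2) \<tau>(2) K_L by auto
  have "(ext \<sigma> f \<circ> ext \<tau> g) v = (ext \<tau> g \<circ> (ext \<sigma> f \<circ> h)) v"
  proof (rule L_endo_eq[OF base_endo_comp[OF e(1) e'(1)] base_endo_comp[OF e'(1) base_endo_comp[OF e(1) h(1)]] _ _ v])
    show "(ext \<sigma> f \<circ> ext \<tau> g) u = (ext \<tau> g \<circ> (ext \<sigma> f \<circ> h)) u" if "u \<in> K" for u
      using that \<sigma>_commute[OF \<sigma>(1) \<tau>(1) that] Gal_in[OF \<sigma>(1) that] Gal_in[OF \<tau>(1) that] by (simp add: h(2) e(2) e'(2))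
    have 1: "ext \<sigma> f (ext \<tau> g \<xi>) = (\<sigma> g * f) * \<xi>"
      unfolding e'(3) base_endoD(3)[OF e(1) gL(1) \<xi>_L] e(2)[OF \<tau>(2)] e(3) by (simp only: mult_ac)
    have "ext \<sigma> f (h \<xi>) = to_ac k * (f * \<xi>)" unfolding h(3) endo_on_scaled[OF e(1) \<xi>_L base_L] e(3) ..
    then have "ext \<tau> g (ext \<sigma> f (h \<xi>)) = to_ac k * ext \<tau> g (f * \<xi>)"
      using endo_on_scaled[OF e'(1) L_mult[OF gL(2) \<xi>_L] base_L] by simp
    also have "ext \<tau> g (f * \<xi>) = \<tau> f * (g * \<xi>)"
      unfolding base_endoD(3)[OF e'(1) gL(2) \<xi>_L] e'(2)[OF \<sigma>(2)] e'(3) ..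
    also have "to_ac k * (\<tau> f * (g * \<xi>)) = (\<sigma> g * f) * \<xi>" unfolding eq by (simp only: mult_ac)
    finally show "(ext \<sigma> f \<circ> ext \<tau> g) \<xi> = (ext \<tau> g \<circ> (ext \<sigma> f \<circ> h)) \<xi>" using 1 by simp
  qed
  then show ?thesis by simp
qed

text \<open>
  The identity of \<open>K\<close>; its lift with factor \<open>\<zeta>\<close> is the central element \<open>\<tau>\<close>.
\<close>

definition "\<sigma>1 = (\<lambda>u\<in>K. u)"

lemma \<sigma>1: "\<sigma>1 \<in> carrier (Gal K base_field)" "u \<in> K \<Longrightarrow> \<sigma>1 u = u"
proof -
  interpret GK: group "Gal K base_field" by (rule group_Gal[OF subfield_K base_K])
  show "\<sigma>1 \<in> carrier (Gal K base_field)" using GK.one_closed by (simp add: \<sigma>1_def Gal_one)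
qed (simp add: \<sigma>1_def)

lemma one_K: "1 \<in> K"
  by (rule F(2))

lemma valid:
  "\<sigma>a \<omega> = 1 ^ p * \<omega>" "\<sigma>b' \<omega> = fb ^ p * \<omega>" "\<sigma>c \<omega> = 1 ^ p * \<omega>" "\<sigma>d \<omega> = fd ^ p * \<omega>" "\<sigma>1 \<omega> = to_ac \<zeta> ^ p * \<omega>"
  using \<omega> \<sigma>1(2)[OF \<omega>(7)] prim_root_power[OF prim_root_to_ac[OF root]] by simp_all

definition "Fa = ext \<sigma>a 1"
definition "Fb = ext \<sigma>b' fb"
definition "Fc = ext \<sigma>c 1"
definition "Fd = ext \<sigma>d fd"
definition "Ft = ext \<sigma>1 (to_ac \<zeta>)"

lemmas ext_a = ext_endo[OF \<sigma>_endo(1) one_K valid(1), folded Fa_def]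
lemmas ext_b = ext_endo[OF \<sigma>_endo(2) cocycle_K(1) valid(2), folded Fb_def]
lemmas ext_c = ext_endo[OF \<sigma>_endo(3) one_K valid(3), folded Fc_def]
lemmas ext_d = ext_endo[OF \<sigma>_endo(4) cocycle_K(2) valid(4), folded Fd_def]
lemmas ext_t = ext_endo[OF Gal_K_endo[OF \<sigma>1(1)] to_ac_K valid(5), folded Ft_def]

lemma Ft_K: "u \<in> K \<Longrightarrow> Ft u = u"
  using ext_t(2) \<sigma>1(2) by simp

lemma F_order:
  assumes v: "v \<in> L"
  shows "(Fa ^^ p) v = v" "(Fb ^^ p) v = v" "(Fc ^^ p) v = v" "(Fd ^^ p) v = v" "(Ft ^^ p) v = v"
proof -
  have 1: "(\<sigma> ^^ k) 1 = 1" if "base_endo K \<sigma>" for \<sigma> k by (rule base_endoD(6)[OF base_endo_funpow[OF that]])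
  have norm: "(\<Prod>k<p. (\<sigma> ^^ k) (u * inverse r)) = 1" if \<sigma>: "base_endo K \<sigma>" and u: "u \<in> K"
    and r: "r \<in> K" "r \<noteq> 0" "\<sigma> r = r" "r ^ p = to_ac k" and n: "(\<Prod>k<p. (\<sigma> ^^ k) u) = to_ac k" for \<sigma> u r k
  proof -
    have rk: "(\<sigma> ^^ i) r = r" for i using r(3) by (induction i) auto
    have "(\<sigma> ^^ i) (u * inverse r) = (\<sigma> ^^ i) u * inverse r" for i
      using base_endoD(3)[OF base_endo_funpow[OF \<sigma>] u F(6)[OF r(1)], of i]
        base_endo_nonzero(2)[OF base_endo_funpow[OF \<sigma>] subfield_K r(1,2), of i] rk[of i] by simp
    then have "(\<Prod>k<p. (\<sigma> ^^ k) (u * inverse r)) = to_ac k * inverse (to_ac k)"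
      unfolding n[symmetric] by (simp add: prod.distrib n r(4)[symmetric] power_inverse)
    then show ?thesis using r by (metis power_not_zero right_inverse)
  qed
  show "(Fa ^^ p) v = v" unfolding Fa_def
    by (rule ext_order[OF \<sigma>_endo(1) one_K valid(1) \<sigma>_order[OF \<sigma>_Gal(1)] _ v]) (auto simp: 1[OF \<sigma>_endo(1)])
  show "(Fc ^^ p) v = v" unfolding Fc_def
    by (rule ext_order[OF \<sigma>_endo(3) one_K valid(3) \<sigma>_order[OF \<sigma>_Gal(3)] _ v]) (auto simp: 1[OF \<sigma>_endo(3)])
  show "(Fb ^^ p) v = v" unfolding Fb_def
    by (rule ext_order[OF \<sigma>_endo(2) cocycle_K(1) valid(2) \<sigma>_order[OF \<sigma>_Gal(2)] _ v])
       (auto simp: fb_def intro!: norm[OF \<sigma>_endo(2) x_K gens_K(1) gens_nz(1) \<sigma>_acts(5) pow(1) x_norm])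
  show "(Fd ^^ p) v = v" unfolding Fd_def
    by (rule ext_order[OF \<sigma>_endo(4) cocycle_K(2) valid(4) \<sigma>_order[OF \<sigma>_Gal(4)] _ v])
       (auto simp: fd_def intro!: norm[OF \<sigma>_endo(4) y_K gens_K(3) gens_nz(3) \<sigma>_acts(15) pow(3) y_norm])
  have s: "(\<sigma>1 ^^ i) u = u" if "u \<in> K" for i u using that \<sigma>1(2) by (induction i) auto
  show "(Ft ^^ p) v = v" unfolding Ft_def
    by (rule ext_order[OF Gal_K_endo[OF \<sigma>1(1)] to_ac_K valid(5) s _ v])
       (use s[OF to_ac_K] prim_root_power[OF prim_root_to_ac[OF root]] in auto)
qed

lemma F_relations:
  assumes v: "v \<in> L"
  shows "Fb (Fa v) = Fa (Fb (Ft v))" "Fd (Fc v) = Fc (Fd (Ft v))"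
    "Fa (Fc v) = Fc (Fa v)" "Fa (Fd v) = Fd (Fa v)" "Fb (Fc v) = Fc (Fb v)" "Fb (Fd v) = Fd (Fb v)"
    "Ft (Fa v) = Fa (Ft v)" "Ft (Fb v) = Fb (Ft v)" "Ft (Fc v) = Fc (Ft v)" "Ft (Fd v) = Fd (Ft v)"
proof -
  note defs = Fa_def Fb_def Fc_def Fd_def Ft_def
  have t3: "Ft \<xi> = to_ac \<zeta> * \<xi>" by (rule ext_t(3))
  note h = ext_t(1) Ft_K t3
  note i = base_endo_id refl
  have i3: "(\<lambda>v. v) \<xi> = to_ac 1 * \<xi>" by simp
  note one = base_endoD(6)[OF \<sigma>_endo(1)] base_endoD(6)[OF \<sigma>_endo(2)] base_endoD(6)[OF \<sigma>_endo(3)] base_endoD(6)[OF \<sigma>_endo(4)]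
  note ba = base_endoD(4)[OF \<sigma>_endo(1)] base_endoD(4)[OF \<sigma>_endo(2)] base_endoD(4)[OF \<sigma>_endo(3)] base_endoD(4)[OF \<sigma>_endo(4)]
  note a = \<sigma>_Gal(1) one_K valid(1) and b = \<sigma>_Gal(2) cocycle_K(1) valid(2) and c = \<sigma>_Gal(3) one_K valid(3)
    and d = \<sigma>_Gal(4) cocycle_K(2) valid(4) and t = \<sigma>1(1) to_ac_K valid(5)
  note simps = one cocycle_image to_ac_1 mult_1_left mult_1_right
  note simps_t = \<sigma>1(2)[OF one_K] \<sigma>1(2)[OF cocycle_K(1)] \<sigma>1(2)[OF cocycle_K(2)] ba to_ac_1 mult_1_left mult_1_right
  show "Fb (Fa v) = Fa (Fb (Ft v))" unfolding Fa_def Fb_def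
    by (rule ext_commute[OF b a h _ v]) (simp_all only: simps)
  show "Fd (Fc v) = Fc (Fd (Ft v))" unfolding Fc_def Fd_def
    by (rule ext_commute[OF d c h _ v]) (simp_all only: simps)
  show "Fa (Fc v) = Fc (Fa v)" unfolding defs by (rule ext_commute[OF a c i i3 _ v]) (simp only: simps)
  show "Fa (Fd v) = Fd (Fa v)" unfolding defs by (rule ext_commute[OF a d i i3 _ v]) (simp only: simps)
  show "Fb (Fc v) = Fc (Fb v)" unfolding defs by (rule ext_commute[OF b c i i3 _ v]) (simp only: simps)
  show "Fb (Fd v) = Fd (Fb v)" unfolding defs
    by (rule ext_commute[OF b d i i3 _ v]) (use cocycle_image(5) in \<open>simp only: to_ac_1 mult_1_left mult.commute\<close>)
  show "Ft (Fa v) = Fa (Ft v)" unfolding defs by (rule ext_commute[OF t a i i3 _ v]) (simp only: simps_t)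
  show "Ft (Fb v) = Fb (Ft v)" unfolding defs by (rule ext_commute[OF t b i i3 _ v]) (simp only: simps_t mult.commute)
  show "Ft (Fc v) = Fc (Ft v)" unfolding defs by (rule ext_commute[OF t c i i3 _ v]) (simp only: simps_t)
  show "Ft (Fd v) = Fd (Ft v)" unfolding defs by (rule ext_commute[OF t d i i3 _ v]) (simp only: simps_t mult.commute)
qed

text \<open>
  An element fixed by the lift \<open>Ft\<close> of the identity has no component at \<open>\<xi>\<^sup>k\<close> for \<open>0 < k < p\<close>, so it lies
  in \<open>K\<close>, where the other four lifts act through the Galois group of \<open>K\<close>.
\<close>

lemma galois_L: "galois_extension L base_field"
  unfolding galois_extension_def
proof (intro conjI ballI)
  show "subfield base_field (fld :: 'a alg_closure ring)" using galois_K by (simp add: galois_extension_def)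
  show "subfield L fld" by (rule subfield_L)
  show "base_field \<subseteq> L" by (rule base_L)
  show "\<not> ring.transcendental fld base_field v" for v :: "'a alg_closure" by (rule not_transcendental)
  show "{v \<in> L. \<forall>\<sigma>\<in>carrier (Gal L base_field). \<sigma> v = v} = base_field"
  proof
    show "base_field \<subseteq> {v \<in> L. \<forall>\<sigma>\<in>carrier (Gal L base_field). \<sigma> v = v}"
      using base_L by (auto simp: Gal_carrier_iff)
    show "{v \<in> L. \<forall>\<sigma>\<in>carrier (Gal L base_field). \<sigma> v = v} \<subseteq> base_field"
    proof
      fix v assume "v \<in> {v \<in> L. \<forall>\<sigma>\<in>carrier (Gal L base_field). \<sigma> v = v}"
      then have v: "v \<in> L" and fx: "\<And>f. restrict f L \<in> carrier (Gal L base_field) \<Longrightarrow> f v = v" by force+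
      note R = restrict_endo_Gal[OF subfield_L base_L _ _ p_pos]
      have fixed: "Fa v = v" "Fb v = v" "Fc v = v" "Fd v = v" "Ft v = v"
        using fx[OF R[OF ext_a(1) F_order(1)]] fx[OF R[OF ext_b(1) F_order(2)]] fx[OF R[OF ext_c(1) F_order(3)]]
          fx[OF R[OF ext_d(1) F_order(4)]] fx[OF R[OF ext_t(1) F_order(5)]] by auto
      obtain e where e: "v = S e" "\<And>k. e k \<in> K" by (rule L_cases[OF v], rule that)
      have "Ft v = S (\<lambda>k. e k * to_ac \<zeta> ^ k)"
        unfolding e(1) Ft_def unfolding ext_S[OF e(2)] unfolding S_def
        by (simp add: \<sigma>1(2) e(2) power_mult_distrib mult.assoc)
      then have "S e = S (\<lambda>k. e k * to_ac \<zeta> ^ k)" using fixed(5) e(1) by simp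
      moreover have "e k * to_ac \<zeta> ^ k \<in> K" for k by (intro F(4) e(2) power_K to_ac_K)
      ultimately have ek: "e k = e k * to_ac \<zeta> ^ k" if "k < p" for k by (rule S_inj[OF e(2) _ _ that, rotated])
      have "e k = 0" if "k < p" "k \<noteq> 0" for k
      proof (rule ccontr)
        assume "e k \<noteq> 0"
        then have "to_ac \<zeta> ^ k = to_ac \<zeta> ^ (0::nat)" using ek[OF that(1)] by simp
        from prim_root_power_inj[OF prim_root_to_ac[OF root] this that(1) p_pos] that(2) show False by simp
      qed
      then have "v = e 0" unfolding e(1) S_def using p_pos by (subst sum.remove[of _ 0]) auto
      then have vK: "v \<in> K" using e(2) by simp
      show "v \<in> base_field"
        by (rule fixed_base[OF vK]) (use fixed ext_a(2) ext_b(2) ext_c(2) ext_d(2) vK in auto)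
    qed
  qed
qed

end

context kummer4_solution
begin

text \<open>
  The five lifts satisfy the hypotheses of \<open>Ep_iso\<close>. The exponents on the four radicals determine an
  automorphism of \<open>L\<close> up to a power of \<open>\<tau>\<close>, which in turn is determined by its effect on \<open>\<xi>\<close>; this gives
  injectivity and surjectivity. The identification of the quotient with \<open>Gal K base_field\<close> is induced
  by restriction to \<open>K\<close>, whose kernel is generated by \<open>\<tau>\<close>.
\<close>

lemma extension_exists:
  "\<exists>L. galois_extension L base_field \<and> K \<subseteq> L \<and>
     (\<exists>\<phi> \<in> iso (Gal L base_field) (Ep p).
      \<exists>\<iota>. kummer_identification p \<zeta> \<alpha> \<beta> \<gamma> \<delta> K \<iota> \<and>
        (\<forall>g \<in> carrier (Gal L base_field). restrict g K = \<iota> (Ep_proj p (\<phi> g))))"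
proof -
  interpret central_product p by unfold_locales (rule p_gt_1)
  define G where "G = Gal L base_field"
  have grpG: "group G" unfolding G_def by (rule group_Gal[OF subfield_L base_L])
  interpret G: group G by (rule grpG)
  interpret GK: group "Gal K base_field" by (rule group_Gal[OF subfield_K base_K])
  note R = restrict_endo_Gal[OF subfield_L base_L _ _ p_pos, folded G_def]
  have app: "(g \<otimes>\<^bsub>G\<^esub> h) v = g (h v)" if "g \<in> carrier G" "h \<in> carrier G" "v \<in> L" for g h v
    using that by (simp add: G_def Gal_mult_apply[of _ L base_field])
  have inL: "g v \<in> L" if "g \<in> carrier G" "v \<in> L" for g v using Gal_in that by (auto simp: G_def)
  have eqI: "g = h" if "g \<in> carrier G" "h \<in> carrier G" "\<And>v. v \<in> L \<Longrightarrow> g v = h v" for g h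
    using Gal_eqI[of g L base_field h] that by (simp add: G_def)
  have one: "\<one>\<^bsub>G\<^esub> v = v" if "v \<in> L" for v using that by (simp add: G_def Gal_one)
  have endo: "base_endo L g" if "g \<in> carrier G" for g using Gal_base_endo[OF base_L] that by (simp add: G_def)
  have pw: "(g [^]\<^bsub>G\<^esub> (n::nat)) v = (g ^^ n) v" if "g \<in> carrier G" "v \<in> L" for g n v
    using Gal_pow_apply[OF subfield_L base_L, of g v n] that by (simp add: G_def)
  define A Bi C D T where "A = restrict Fa L" "Bi = restrict Fb L" "C = restrict Fc L" "D = restrict Fd L" "T = restrict Ft L"
  note defs = this
  have Fc: "A \<in> carrier G" "Bi \<in> carrier G" "C \<in> carrier G" "D \<in> carrier G" "T \<in> carrier G"
    unfolding defs by (intro R ext_a(1) F_order(1) ext_b(1) F_order(2) ext_c(1) F_order(3) ext_d(1) F_order(4) ext_t(1) F_order(5); assumption)+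
  have FL: "Fa v \<in> L" "Fb v \<in> L" "Fc v \<in> L" "Fd v \<in> L" "Ft v \<in> L" if "v \<in> L" for v
    by (rule base_endoD(1)[OF ext_a(1) that] base_endoD(1)[OF ext_b(1) that] base_endoD(1)[OF ext_c(1) that]
        base_endoD(1)[OF ext_d(1) that] base_endoD(1)[OF ext_t(1) that])+
  have val: "A v = Fa v" "Bi v = Fb v" "C v = Fc v" "D v = Fd v" "T v = Ft v" if "v \<in> L" for v
    using that by (simp_all add: defs)
  have power: "g [^]\<^bsub>G\<^esub> p = \<one>\<^bsub>G\<^esub>" if g: "g \<in> carrier G" and gf: "\<And>v. v \<in> L \<Longrightarrow> g v = f v" and f: "\<And>v. v \<in> L \<Longrightarrow> (f ^^ p) v = v" for g f
  proof (rule eqI)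
    fix v assume v: "v \<in> L"
    have "(g ^^ n) v = (f ^^ n) v \<and> (g ^^ n) v \<in> L" for n
      by (induction n) (use v gf inL[OF g] in auto)
    then show "(g [^]\<^bsub>G\<^esub> p) v = \<one>\<^bsub>G\<^esub> v" using f[OF v] by (simp add: pw[OF g v] one[OF v])
  qed (use g in simp_all)
  have ord: "A [^]\<^bsub>G\<^esub> p = \<one>\<^bsub>G\<^esub>" "Bi [^]\<^bsub>G\<^esub> p = \<one>\<^bsub>G\<^esub>" "C [^]\<^bsub>G\<^esub> p = \<one>\<^bsub>G\<^esub>" "D [^]\<^bsub>G\<^esub> p = \<one>\<^bsub>G\<^esub>" "T [^]\<^bsub>G\<^esub> p = \<one>\<^bsub>G\<^esub>"
    by (rule power[OF Fc(1) val(1) F_order(1)] power[OF Fc(2) val(2) F_order(2)] power[OF Fc(3) val(3) F_order(3)]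
      power[OF Fc(4) val(4) F_order(4)] power[OF Fc(5) val(5) F_order(5)]; assumption)+
  have rel: "Bi \<otimes>\<^bsub>G\<^esub> A = A \<otimes>\<^bsub>G\<^esub> Bi \<otimes>\<^bsub>G\<^esub> T" "D \<otimes>\<^bsub>G\<^esub> C = C \<otimes>\<^bsub>G\<^esub> D \<otimes>\<^bsub>G\<^esub> T"
    "A \<otimes>\<^bsub>G\<^esub> C = C \<otimes>\<^bsub>G\<^esub> A" "A \<otimes>\<^bsub>G\<^esub> D = D \<otimes>\<^bsub>G\<^esub> A" "C \<otimes>\<^bsub>G\<^esub> Bi = Bi \<otimes>\<^bsub>G\<^esub> C" "D \<otimes>\<^bsub>G\<^esub> Bi = Bi \<otimes>\<^bsub>G\<^esub> D"
    "T \<otimes>\<^bsub>G\<^esub> A = A \<otimes>\<^bsub>G\<^esub> T" "T \<otimes>\<^bsub>G\<^esub> Bi = Bi \<otimes>\<^bsub>G\<^esub> T" "T \<otimes>\<^bsub>G\<^esub> C = C \<otimes>\<^bsub>G\<^esub> T" "T \<otimes>\<^bsub>G\<^esub> D = D \<otimes>\<^bsub>G\<^esub> T"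
    by (rule eqI; simp add: Fc app val FL inL F_relations)+
  define B where "B = inv\<^bsub>G\<^esub> Bi"
  have Bc: "B \<in> carrier G" unfolding B_def using Fc(2) by simp
  have Bord: "B [^]\<^bsub>G\<^esub> p = \<one>\<^bsub>G\<^esub>" unfolding B_def using G.nat_pow_inv[OF Fc(2)] ord(2) by simp
  have Bcomm: "T \<otimes>\<^bsub>G\<^esub> B = B \<otimes>\<^bsub>G\<^esub> T" "B \<otimes>\<^bsub>G\<^esub> C = C \<otimes>\<^bsub>G\<^esub> B" "B \<otimes>\<^bsub>G\<^esub> D = D \<otimes>\<^bsub>G\<^esub> B"
    unfolding B_def using G.commute_inv[OF Fc(5,2) rel(8)] G.commute_inv[OF Fc(3,2) rel(5)] G.commute_inv[OF Fc(4,2) rel(6)] by simp_all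
  have AB: "A \<otimes>\<^bsub>G\<^esub> B = B \<otimes>\<^bsub>G\<^esub> A \<otimes>\<^bsub>G\<^esub> T"
    using G.heis_relation_inv[OF Fc(1) Bc Fc(5) Bcomm(1)] rel(1) Fc(2) by (simp add: B_def)
  have BB: "B (Bi v) = v" "Bi (B v) = v" if "v \<in> L" for v
  proof -
    have "B \<otimes>\<^bsub>G\<^esub> Bi = \<one>\<^bsub>G\<^esub>" "Bi \<otimes>\<^bsub>G\<^esub> B = \<one>\<^bsub>G\<^esub>" unfolding B_def using Fc(2) by simp_all
    then show "B (Bi v) = v" "Bi (B v) = v" using app[OF Bc Fc(2) that] app[OF Fc(2) Bc that] one[OF that] by simp_all
  qed
  have gL: "\<alpha> \<in> L" "\<beta> \<in> L" "\<gamma> \<in> L" "\<delta> \<in> L" using gens_K K_L by auto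
  have zK: "g (to_ac \<zeta> ^ n * v) = to_ac \<zeta> ^ n * g v" if "g \<in> carrier G" "v \<in> L" for g n v
    using endo_on_scaled[OF endo[OF that(1)] that(2) base_L, of "\<zeta> ^ n"] by simp
  have acts_mult: "acts (g \<otimes>\<^bsub>G\<^esub> h) (i + i', j + j', k + k', l + l')"
    if "g \<in> carrier G" "h \<in> carrier G" "acts g (i, j, k, l)" "acts h (i', j', k', l')" for g h i j k l i' j' k' l'
    using that gL by (simp add: acts_def app zK) (simp add: power_add mult_ac)
  have acts_one: "acts \<one>\<^bsub>G\<^esub> (0, 0, 0, 0)" using gL by (simp add: acts_def one)
  have acts_pow: "acts (g [^]\<^bsub>G\<^esub> (n::nat)) (n * i, n * j, n * k, n * l)" if g: "g \<in> carrier G" "acts g (i, j, k, l)" for g n i j k l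
  proof (induction n)
    case (Suc n)
    from acts_mult[OF G.nat_pow_closed[OF g(1)] g(1) Suc g(2)] show ?case by (simp add: add.commute)
  qed (simp add: acts_one)
  have actsG: "acts A (1, 0, 0, 0)" "acts B (0, 1, 0, 0)" "acts C (0, 0, 1, 0)" "acts D (0, 0, 0, 1)" "acts T (0, 0, 0, 0)"
  proof -
    show "acts A (1, 0, 0, 0)" "acts C (0, 0, 1, 0)" "acts D (0, 0, 0, 1)" "acts T (0, 0, 0, 0)"
      using gens_K gL by (simp_all add: acts_def val ext_a(2) ext_c(2) ext_d(2) Ft_K \<sigma>_acts)
    have Bi: "Bi \<alpha> = \<alpha>" "Bi \<beta> = to_ac (inverse \<zeta>) * \<beta>" "Bi \<gamma> = \<gamma>" "Bi \<delta> = \<delta>"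
      using gens_K gL by (simp_all add: val ext_b(2) \<sigma>_acts)
    have "\<beta> = B (to_ac (inverse \<zeta>) * \<beta>)" using BB(1)[OF gL(2)] Bi by simp
    also have "\<dots> = to_ac (inverse \<zeta>) * B \<beta>" by (rule endo_on_scaled[OF endo[OF Bc] gL(2) base_L])
    finally have "B \<beta> = to_ac \<zeta> * \<beta>" using \<zeta>_nz by (simp add: field_simps)
    then show "acts B (0, 1, 0, 0)" using BB(1)[OF gL(1)] BB(1)[OF gL(3)] BB(1)[OF gL(4)] Bi by (simp add: acts_def)
  qed
  define W where "W i j z k l = B [^]\<^bsub>G\<^esub> j \<otimes>\<^bsub>G\<^esub> A [^]\<^bsub>G\<^esub> i \<otimes>\<^bsub>G\<^esub> T [^]\<^bsub>G\<^esub> z \<otimes>\<^bsub>G\<^esub> D [^]\<^bsub>G\<^esub> l \<otimes>\<^bsub>G\<^esub> C [^]\<^bsub>G\<^esub> k"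
    for i j z k l :: nat
  have Wc: "W i j z k l \<in> carrier G" for i j z k l using Fc Bc by (simp add: W_def)
  have actsW: "acts (W i j z k l) (i, j, k, l)" for i j z k l
    unfolding W_def
    using acts_mult[OF _ _ acts_mult[OF _ _ acts_mult[OF _ _ acts_mult[OF _ _ acts_pow[OF Bc actsG(2), of j]
      acts_pow[OF Fc(1) actsG(1), of i]] acts_pow[OF Fc(5) actsG(5), of z]] acts_pow[OF Fc(4) actsG(4), of l]]
      acts_pow[OF Fc(3) actsG(3), of k]] Fc Bc by simp
  have acts_zero: "i = 0 \<and> j = 0 \<and> k = 0 \<and> l = 0"
    if "acts g (i, j, k, l)" "acts g (0, 0, 0, 0)" "i < p" "j < p" "k < p" "l < p" for g i j k l
  proof -
    have z: "n = 0" if "to_ac \<zeta> ^ n * u = u" "u \<noteq> 0" "n < p" for n and u :: "'a alg_closure"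
      using prim_root_power_inj[OF prim_root_to_ac[OF root], of n 0] that p_pos by simp
    show ?thesis using that gens_nz by (auto simp: acts_def intro: z)
  qed
  have T\<xi>: "(T [^]\<^bsub>G\<^esub> n) \<xi> = to_ac (\<zeta> ^ n) * \<xi>" for n :: nat
    unfolding pw[OF Fc(5) \<xi>_L] by (rule funpow_scaled[OF endo[OF Fc(5)] \<xi>_L base_L]) (simp add: val \<xi>_L ext_t(3))
  have T_K: "(T [^]\<^bsub>G\<^esub> n) u = u" if u: "u \<in> K" for u and n :: nat
  proof -
    have "(T ^^ n) u = u" using u K_L by (induction n) (auto simp: val Ft_K)
    then show ?thesis using pw[OF Fc(5), of u n] u K_L by auto
  qed
  have inj: "i = 0 \<and> j = 0 \<and> k = 0 \<and> l = 0 \<and> p dvd z"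
    if lt: "i < p" "j < p" "k < p" "l < p" and W1: "W i j z k l = \<one>\<^bsub>G\<^esub>" for i j z k l
  proof -
    have 0: "i = 0 \<and> j = 0 \<and> k = 0 \<and> l = 0"
      using acts_zero[OF actsW[of i j z k l] _ lt] acts_one W1 by simp
    then have "T [^]\<^bsub>G\<^esub> z = \<one>\<^bsub>G\<^esub>" using W1 Fc(5) by (simp add: W_def)
    then have "to_ac (\<zeta> ^ z) * \<xi> = \<xi>" using T\<xi>[of z] one[OF \<xi>_L] by simp
    then have "\<zeta> ^ z = 1" using \<xi>(2) by (metis mult_cancel_right1 to_ac_1 to_ac_eq_iff)
    then show ?thesis using 0 prim_root_pow_eq_1_iff[OF root] by simp
  qed
  have onK: "g u = h u" if "g \<in> carrier G" "h \<in> carrier G" "acts g (i, j, k, l)" "acts h (i, j, k, l)" "u \<in> K" for g h i j k l u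
    by (rule endo_eq[OF endo[OF that(1)] endo[OF that(2)] subfield_L K_L _ _ _ _ that(5)])
       (use that(3,4) in \<open>simp_all add: acts_def\<close>)
  have surj: "\<exists>i<p. \<exists>j<p. \<exists>z<p. \<exists>k<p. \<exists>l<p. g = W i j z k l" if g: "g \<in> carrier G" for g
  proof -
    obtain i j k l where ex: "acts g (i, j, k, l)" "i < p" "j < p" "k < p" "l < p"
      using acts_exists[OF endo[OF g] subfield_L K_L] by auto
    define w where "w = W i j 0 k l"
    have wc: "w \<in> carrier G" and wa: "acts w (i, j, k, l)" unfolding w_def by (rule Wc, rule actsW)
    define h where "h = inv\<^bsub>G\<^esub> w \<otimes>\<^bsub>G\<^esub> g"
    have hc: "h \<in> carrier G" using g wc by (simp add: h_def)
    have hK: "h u = u" if u: "u \<in> K" for u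
    proof -
      have uL: "u \<in> L" using u K_L by auto
      have "h u = (inv\<^bsub>G\<^esub> w) (w u)" unfolding h_def using app[of "inv\<^bsub>G\<^esub> w" g u] onK[OF g wc ex(1) wa u] g wc uL by simp
      also have "\<dots> = u" using app[of "inv\<^bsub>G\<^esub> w" w u] wc uL one by simp
      finally show ?thesis .
    qed
    have "h \<xi> ^ p = (1 * \<xi>) ^ p"
      using base_endo_power[OF endo[OF hc] subfield_L \<xi>_L, of p] hK[OF \<omega>(7)] by (simp add: \<xi>)
    then obtain z where z: "z < p" "h \<xi> = to_ac \<zeta> ^ z * (1 * \<xi>)" using \<xi>_root[of "h \<xi>" 1] by auto
    have Tz: "T [^]\<^bsub>G\<^esub> z \<in> carrier G" using Fc(5) by simp
    have "h = T [^]\<^bsub>G\<^esub> z"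
      by (rule eqI[OF hc Tz], rule L_endo_eq[OF endo[OF hc] endo[OF Tz]])
         (use hK T_K T\<xi>[of z] z(2) in simp_all)
    then have "g = w \<otimes>\<^bsub>G\<^esub> T [^]\<^bsub>G\<^esub> z" using g wc unfolding h_def by (metis G.inv_solve_left G.nat_pow_closed Fc(5) hc h_def)
    also have "\<dots> = B [^]\<^bsub>G\<^esub> j \<otimes>\<^bsub>G\<^esub> A [^]\<^bsub>G\<^esub> i \<otimes>\<^bsub>G\<^esub> ((D [^]\<^bsub>G\<^esub> l \<otimes>\<^bsub>G\<^esub> C [^]\<^bsub>G\<^esub> k) \<otimes>\<^bsub>G\<^esub> T [^]\<^bsub>G\<^esub> z)"
      unfolding w_def W_def using Fc Bc by (simp add: G.m_assoc)
    also have "(D [^]\<^bsub>G\<^esub> l \<otimes>\<^bsub>G\<^esub> C [^]\<^bsub>G\<^esub> k) \<otimes>\<^bsub>G\<^esub> T [^]\<^bsub>G\<^esub> z = T [^]\<^bsub>G\<^esub> z \<otimes>\<^bsub>G\<^esub> (D [^]\<^bsub>G\<^esub> l \<otimes>\<^bsub>G\<^esub> C [^]\<^bsub>G\<^esub> k)"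
      using Fc by (intro G.commute_mult[symmetric] G.commute_pow_pow rel(9,10)) simp_all
    also have "B [^]\<^bsub>G\<^esub> j \<otimes>\<^bsub>G\<^esub> A [^]\<^bsub>G\<^esub> i \<otimes>\<^bsub>G\<^esub> (T [^]\<^bsub>G\<^esub> z \<otimes>\<^bsub>G\<^esub> (D [^]\<^bsub>G\<^esub> l \<otimes>\<^bsub>G\<^esub> C [^]\<^bsub>G\<^esub> k)) = W i j z k l"
      unfolding W_def using Fc Bc by (simp add: G.m_assoc)
    finally show ?thesis using ex z(1) by blast
  qed
  obtain \<theta> where \<theta>: "\<theta> \<in> iso (Ep p) G" "\<theta> (s_a p) = A" "\<theta> (s_b p) = B" "\<theta> (s_c p) = C" "\<theta> (s_d p) = D" "\<theta> (Ep_tau p) = T"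
  proof (rule Ep_iso[OF grpG Fc(1) Bc Fc(3,4,5) ord(1) Bord ord(3,4,5) rel(7) Bcomm(1) rel(9,10) AB rel(2,3,4) Bcomm(2,3)])
    fix i j z k l :: nat
    assume "i < p" "j < p" "k < p" "l < p"
      "B [^]\<^bsub>G\<^esub> j \<otimes>\<^bsub>G\<^esub> A [^]\<^bsub>G\<^esub> i \<otimes>\<^bsub>G\<^esub> T [^]\<^bsub>G\<^esub> z \<otimes>\<^bsub>G\<^esub> D [^]\<^bsub>G\<^esub> l \<otimes>\<^bsub>G\<^esub> C [^]\<^bsub>G\<^esub> k = \<one>\<^bsub>G\<^esub>"
    then show "i = 0 \<and> j = 0 \<and> k = 0 \<and> l = 0 \<and> p dvd z" by (rule inj[unfolded W_def])
  next
    fix g assume "g \<in> carrier G"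
    then show "\<exists>i<p. \<exists>j<p. \<exists>z<p. \<exists>k<p. \<exists>l<p. g = B [^]\<^bsub>G\<^esub> j \<otimes>\<^bsub>G\<^esub> A [^]\<^bsub>G\<^esub> i \<otimes>\<^bsub>G\<^esub> T [^]\<^bsub>G\<^esub> z
      \<otimes>\<^bsub>G\<^esub> D [^]\<^bsub>G\<^esub> l \<otimes>\<^bsub>G\<^esub> C [^]\<^bsub>G\<^esub> k" by (rule surj[unfolded W_def])
  qed (rule that)
  have \<theta>h: "\<theta> \<in> hom (Ep p) G" using \<theta>(1) by (simp add: iso_def)
  interpret H: group_hom "Ep p" G \<theta> using \<theta>h grpG Ep.group_axioms by (simp add: group_hom_def group_hom_axioms_def)
  define w where "w i j z k l = s_b p [^]\<^bsub>Ep p\<^esub> j \<otimes>\<^bsub>Ep p\<^esub> s_a p [^]\<^bsub>Ep p\<^esub> i \<otimes>\<^bsub>Ep p\<^esub>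
    Ep_tau p [^]\<^bsub>Ep p\<^esub> z \<otimes>\<^bsub>Ep p\<^esub> s_d p [^]\<^bsub>Ep p\<^esub> l \<otimes>\<^bsub>Ep p\<^esub> s_c p [^]\<^bsub>Ep p\<^esub> k" for i j z k l :: nat
  have wc: "w i j z k l \<in> carrier (Ep p)" for i j z k l using Ep_gens_closed by (simp add: w_def)
  have \<theta>w: "\<theta> (w i j z k l) = W i j z k l" for i j z k l
    unfolding w_def W_def using Ep_gens_closed by (simp add: H.hom_nat_pow \<theta>)
  have stab_pow: "(g [^]\<^bsub>G\<^esub> (n::nat)) u \<in> K" if g: "g \<in> carrier G" "\<And>u. u \<in> K \<Longrightarrow> g u \<in> K" and u: "u \<in> K" for g n u
  proof -
    have "(g ^^ n) u \<in> K" using u g(2) by (induction n) auto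
    then show ?thesis using pw[OF g(1), of u n] u K_L by auto
  qed
  have stabF: "A u \<in> K" "Bi u \<in> K" "C u \<in> K" "D u \<in> K" "T u \<in> K" if "u \<in> K" for u
    using that K_L Gal_in[OF \<sigma>_Gal(1) that] Gal_in[OF \<sigma>_Gal(2) that] Gal_in[OF \<sigma>_Gal(3) that] Gal_in[OF \<sigma>_Gal(4) that]
    by (auto simp: val ext_a(2) ext_b(2) ext_c(2) ext_d(2) Ft_K)
  have stabB: "B u \<in> K" if u: "u \<in> K" for u
  proof -
    have "Bi [^]\<^bsub>G\<^esub> (p - 1) \<otimes>\<^bsub>G\<^esub> Bi = \<one>\<^bsub>G\<^esub>" using ord(2) p_pos G.nat_pow_Suc[of Bi "p - 1"] by simp
    then have "B = Bi [^]\<^bsub>G\<^esub> (p - 1)" unfolding B_def using G.inv_equality Fc(2) by simp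
    then show ?thesis using stab_pow[OF Fc(2) stabF(2) u, of "p - 1"] by simp
  qed
  have stab: "g u \<in> K" if g: "g \<in> carrier G" and u: "u \<in> K" for g u
  proof -
    obtain i j z k l where "g = W i j z k l" using surj[OF g] by blast
    moreover have "W i j z k l u \<in> K"
    proof -
      have uL: "\<And>u. u \<in> K \<Longrightarrow> u \<in> L" using K_L by auto
      have st: "(g \<otimes>\<^bsub>G\<^esub> h) u \<in> K" if "g \<in> carrier G" "h \<in> carrier G" "\<And>u. u \<in> K \<Longrightarrow> g u \<in> K" "\<And>u. u \<in> K \<Longrightarrow> h u \<in> K" "u \<in> K" for g h u
        using app[OF that(1,2) uL[OF that(5)]] that by simp
      show ?thesis unfolding W_def
        using u Fc Bc by (intro st G.m_closed G.nat_pow_closed stab_pow stabB stabF) simp_all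
    qed
    ultimately show ?thesis by simp
  qed
  have endoK: "base_endo K g" if g: "g \<in> carrier G" for g
    using endo[OF g] stab[OF g] K_L unfolding base_endo_def by blast
  have res: "restrict g K = \<tau>" if g: "g \<in> carrier G" and \<tau>: "\<tau> \<in> carrier (Gal K base_field)" and "acts g (i, j, k, l)" "acts \<tau> (i, j, k, l)" for g \<tau> i j k l
  proof (rule extensionalityI[where A = K])
    show "\<tau> \<in> extensional K" using \<tau> by (simp add: Gal_carrier_iff)
    show "restrict g K u = \<tau> u" if u: "u \<in> K" for u
      using endo_eq[OF endoK[OF g] Gal_K_endo[OF \<tau>] subfield_K order_refl _ _ _ _ u] \<open>acts g (i, j, k, l)\<close> \<open>acts \<tau> (i, j, k, l)\<close> u
      by (simp add: acts_def)
  qed simp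
  define \<rho> where "\<rho> e = restrict (\<theta> e) K" for e
  have \<rho>c: "\<rho> e \<in> carrier (Gal K base_field)" if "e \<in> carrier (Ep p)" for e
  proof -
    have g: "\<theta> e \<in> carrier G" using that by simp
    obtain i j k l where ex: "acts (\<theta> e) (i, j, k, l)" "(i, j, k, l) \<in> {..<p} \<times> {..<p} \<times> {..<p} \<times> {..<p}"
      using acts_exists[OF endo[OF g] subfield_L K_L] by auto
    show ?thesis unfolding \<rho>_def using res[OF g \<sigma>_of(1)[OF ex(2)] ex(1) \<sigma>_of(2)[OF ex(2)]] \<sigma>_of(1)[OF ex(2)] by simp
  qed
  have \<rho>h: "\<rho> \<in> hom (Ep p) (Gal K base_field)"
  proof (rule homI)
    fix e f assume e: "e \<in> carrier (Ep p)" and f: "f \<in> carrier (Ep p)"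
    show "\<rho> (e \<otimes>\<^bsub>Ep p\<^esub> f) = \<rho> e \<otimes>\<^bsub>Gal K base_field\<^esub> \<rho> f"
    proof (rule Gal_eqI[OF \<rho>c GK.m_closed[OF \<rho>c \<rho>c]])
      fix u assume u: "u \<in> K"
      then have uL: "u \<in> L" using K_L by auto
      show "\<rho> (e \<otimes>\<^bsub>Ep p\<^esub> f) u = (\<rho> e \<otimes>\<^bsub>Gal K base_field\<^esub> \<rho> f) u"
        unfolding Gal_mult_apply[OF \<rho>c[OF e] \<rho>c[OF f] u] using e f u uL stab[of "\<theta> f" u] by (simp add: \<rho>_def app)
    qed (use e f in simp_all)
  qed (rule \<rho>c)
  have \<rho>1: "acts (\<theta> e) (0, 0, 0, 0)" if "\<rho> e = \<one>\<^bsub>Gal K base_field\<^esub>" for e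
  proof -
    have "\<theta> e u = u" if u: "u \<in> K" for u using fun_cong[OF \<open>\<rho> e = \<one>\<^bsub>Gal K base_field\<^esub>\<close>, of u] u by (simp add: \<rho>_def Gal_one)
    then show ?thesis using gens_K by (simp add: acts_def)
  qed
  obtain \<iota> where \<iota>: "\<iota> \<in> iso (Ep p Mod Ep_kernel p) (Gal K base_field)"
    "\<And>e. e \<in> carrier (Ep p) \<Longrightarrow> \<iota> (Ep_kernel p #>\<^bsub>Ep p\<^esub> e) = \<rho> e"
  proof (rule quotient_iso[OF \<rho>h Ep.group_axioms GK.group_axioms Ep_kernel_normal])
    fix e assume e: "e \<in> carrier (Ep p)"
    show "\<rho> e = \<one>\<^bsub>Gal K base_field\<^esub> \<longleftrightarrow> e \<in> Ep_kernel p"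
    proof
      assume "\<rho> e = \<one>\<^bsub>Gal K base_field\<^esub>"
      then have a0: "acts (\<theta> e) (0, 0, 0, 0)" by (rule \<rho>1)
      obtain i j z k l where ijkl: "i < p" "j < p" "k < p" "l < p" "e = w i j z k l"
        using Ep_normal_form[OF e] unfolding w_def by blast
      have "acts (\<theta> e) (i, j, k, l)" unfolding ijkl(5) \<theta>w by (rule actsW)
      from acts_zero[OF this a0 ijkl(1-4)] have "e = Ep_tau p [^]\<^bsub>Ep p\<^esub> z"
        using ijkl(5) Ep_gens_closed by (simp add: w_def)
      then show "e \<in> Ep_kernel p" using Ep_tau_pow_kernel by simp
    next
      assume ek: "e \<in> Ep_kernel p"
      interpret R: group_hom "Ep p" "Gal K base_field" \<rho>
        using \<rho>h GK.group_axioms Ep.group_axioms by (simp add: group_hom_def group_hom_axioms_def)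
      have "\<rho> (Ep_tau p) = \<one>\<^bsub>Gal K base_field\<^esub>"
        unfolding \<rho>_def \<theta>(6) Gal_one using T_K[of _ 1] Fc(5) by (intro ext) (simp add: restrict_def)
      then have "{Ep_tau p} \<subseteq> kernel (Ep p) (Gal K base_field) \<rho>" using Ep_gens_closed(5) by (simp add: kernel_def)
      from Ep.generate_subgroup_incl[OF this R.subgroup_kernel] have "Ep_kernel p \<subseteq> kernel (Ep p) (Gal K base_field) \<rho>"
        unfolding Ep_kernel_def .
      then show "\<rho> e = \<one>\<^bsub>Gal K base_field\<^esub>" using ek by (auto simp: kernel_def)
    qed
  next
    fix \<tau> assume \<tau>: "\<tau> \<in> carrier (Gal K base_field)"
    obtain i j k l where ex: "acts \<tau> (i, j, k, l)" using acts_exists[OF Gal_K_endo[OF \<tau>] subfield_K order_refl] by auto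
    have "\<rho> (w i j 0 k l) = \<tau>" unfolding \<rho>_def \<theta>w by (rule res[OF Wc \<tau> actsW ex])
    then show "\<exists>e\<in>carrier (Ep p). \<rho> e = \<tau>" using wc by blast
  qed (rule that)
  have \<iota>': "\<iota> (Ep_proj p e) = restrict (\<theta> e) K" if "e \<in> carrier (Ep p)" for e
    using \<iota>(2)[OF that] by (simp add: Ep_proj_def \<rho>_def)
  have kum: "kummer_identification p \<zeta> \<alpha> \<beta> \<gamma> \<delta> K \<iota>"
    unfolding kummer_identification_def kummer_generator_def
    using \<iota>(1) actsG gens_K Ep_gens_closed by (simp add: \<iota>' \<theta> acts_def)
  define \<phi> where "\<phi> = inv_into (carrier (Ep p)) \<theta>"
  have \<phi>: "\<phi> \<in> iso G (Ep p)" unfolding \<phi>_def by (rule Ep.iso_set_sym[OF \<theta>(1)])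
  have "restrict g K = \<iota> (Ep_proj p (\<phi> g))" if g: "g \<in> carrier G" for g
  proof -
    have "\<theta> (\<phi> g) = g" unfolding \<phi>_def using \<theta>(1) g by (intro bij_betw_inv_into_right) (simp_all add: iso_def)
    moreover have "\<phi> g \<in> carrier (Ep p)" using \<phi> g by (auto simp: iso_def hom_def)
    ultimately show ?thesis by (simp add: \<iota>')
  qed
  then show ?thesis using galois_L K_L \<phi> kum unfolding G_def by blast
qed

end

theorem theorem3p4:
  fixes p :: nat
    and \<zeta> a b c d :: "'a::field"
    and \<alpha> \<beta> \<gamma> \<delta> :: "'a alg_closure"
    and K :: "'a alg_closure set"
  assumes "global_field TYPE('a)"
    and "Factorial_Ring.prime p" and "odd p" and "p \<noteq> CHAR('a)"
    and "{z :: 'a alg_closure. z ^ p = 1} \<subseteq> base_field"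
    and "primitive_root_of_unity p \<zeta>"
    and "a \<noteq> 0" and "b \<noteq> 0" and "c \<noteq> 0" and "d \<noteq> 0"
    and "\<alpha> ^ p = to_ac a" and "\<beta> ^ p = to_ac b" and "\<gamma> ^ p = to_ac c" and "\<delta> ^ p = to_ac d"
    and "K = generate_field fld (base_field \<union> {\<alpha>, \<beta>, \<gamma>, \<delta>})"
    and "galois_extension K base_field"
    and "Gal K base_field \<cong> integer_mod_group p \<times>\<times> integer_mod_group p
           \<times>\<times> integer_mod_group p \<times>\<times> integer_mod_group p"
  shows "(\<exists>L. galois_extension L base_field \<and> K \<subseteq> L \<and>
            (\<exists>\<phi> \<in> iso (Gal L base_field) (Ep p).
             \<exists>\<iota>. kummer_identification p \<zeta> \<alpha> \<beta> \<gamma> \<delta> K \<iota> \<and>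
               (\<forall>g \<in> carrier (Gal L base_field). restrict g K = \<iota> (Ep_proj p (\<phi> g)))))
         \<longleftrightarrow> symbol_class p \<zeta> a b = symbol_class p \<zeta> c d"
proof -
  have "of_nat p \<noteq> (0 :: 'a)"
  proof
    assume "of_nat p = (0 :: 'a)"
    then have "CHAR('a) dvd p" by (simp add: of_nat_eq_0_iff_char_dvd)
    then have "CHAR('a) = 1" using assms(2,4) by (auto simp: prime_nat_iff)
    then show False using of_nat_CHAR[where 'a = 'a] by simp
  qed
  then interpret kummer4 p \<zeta> a b c d \<alpha> \<beta> \<gamma> \<delta> K
    using assms by unfold_locales auto
  show ?thesis
  proof
    assume "symbol_class p \<zeta> a b = symbol_class p \<zeta> c d"
    then obtain x y where xy: "x \<in> M" "y \<in> M" "(\<Prod>k<p. (\<sigma>b' ^^ k) x) = to_ac a" "(\<Prod>k<p. (\<sigma>d ^^ k) y) = to_ac c"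
      "x * \<sigma>b' y = y * \<sigma>d x" unfolding symbol_classes_equal_iff by blast
    interpret kummer4_solution p \<zeta> a b c d \<alpha> \<beta> \<gamma> \<delta> K x y by unfold_locales (rule xy)+
    show "\<exists>L. galois_extension L base_field \<and> K \<subseteq> L \<and>
            (\<exists>\<phi> \<in> iso (Gal L base_field) (Ep p).
             \<exists>\<iota>. kummer_identification p \<zeta> \<alpha> \<beta> \<gamma> \<delta> K \<iota> \<and>
               (\<forall>g \<in> carrier (Gal L base_field). restrict g K = \<iota> (Ep_proj p (\<phi> g))))"
      by (rule extension_exists)
  next
    assume "\<exists>L. galois_extension L base_field \<and> K \<subseteq> L \<and>
            (\<exists>\<phi> \<in> iso (Gal L base_field) (Ep p).
             \<exists>\<iota>. kummer_identification p \<zeta> \<alpha> \<beta> \<gamma> \<delta> K \<iota> \<and>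
               (\<forall>g \<in> carrier (Gal L base_field). restrict g K = \<iota> (Ep_proj p (\<phi> g))))"
    then show "symbol_class p \<zeta> a b = symbol_class p \<zeta> c d"
      unfolding symbol_classes_equal_iff using solution_of_extension by (elim exE conjE bexE)
  qed
qed

end
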